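(* Let $R$ be a field. The simple biset functors defined on the full subcategory of $\mathbb B_R^{1,1}$ whose objects are the posets $2^X$ ($X$ a finite set) are parametrized the same way as the simple functors on the correspondence category $\mathrm{Corresp}$. Specifically, if $S$ is a simple biset functor on $\mathbb B_R^{1,1}$ with $S(2^X)\ne 0$ for some set $X$ of smallest size, then the correspondence functor $\hat S$ obtained from $S$ by composition with the functor $\mathrm{Corresp}\to\mathbb B_R^{1,1}$, $X\mapsto 2^X$, $U\mapsto\Omega_U$, has a unique simple composition factor $T$ with $X$ minimal such that $T(X)\ne 0$. This mapping $S\mapsto T$ is a bijection between (isomorphism types of) simple biset functors on $\mathbb B_R^{1,1}$ that do not vanish on the $2^X$ and (isomorphism types of) simple correspondence functors over $R$.
   Context: All categories are finite and $\mathrm{Set}$ is the category of finite sets. A $(\mathcal C,\mathcal D)$-biset is a functor $\Omega:\mathcal C\times\mathcal D^{\mathrm{op}}\to\mathrm{Set}$. It is birepresentable if the left $\mathcal C$-set $x\mapsto\bigsqcup_{y}\Omega(x,y)$ is isomorphic to a disjoint union of functors $\mathrm{Hom}_{\mathcal C}(x',-)$, and the right $\mathcal D$-set $y\mapsto\bigsqcup_x\Omega(x,y)$ is isomorphic to a disjoint union of functors $\mathrm{Hom}_{\mathcal D}(-,y')$. Bisets compose by $(\Omega\circ\Psi)(x,z)=\left(\bigsqcup_{y}\Omega(x,y)\times\Psi(y,z)\right)/\sim$, with $\sim$ generated by $(u\beta,v)\sim(u,\beta v)$ for morphisms $\beta$ of the middle category. $\mathbb B_R^{1,1}$ is the category whose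 objects are finite categories, with $\mathrm{Hom}(\mathcal D,\mathcal C)$ equal to $R\otimes_{\mathbb Z}$ of the Grothendieck group with respect to disjoint union of finite birepresentable $(\mathcal C,\mathcal D)$-bisets, and composition the $R$-bilinear extension of $\circ$. A biset functor on $\mathbb B_R^{1,1}$ is an $R$-linear functor $\mathbb B_R^{1,1}\to R$-mod. A functor is simple if it is non-zero and has no proper non-zero subfunctors; a simple composition factor is a simple subquotient. A correspondence from a finite set $X$ to a finite set $Y$ is a subset $U\subseteq Y\times X$. For $U\subseteq Z\times Y$ and $V\subseteq Y\times X$, $UV=\{(z,x): \exists\, y\in Y,\ (z,y)\in U,\ (y,x)\in V\}$. $\mathrm{Corresp}$ is the category with objects finite sets and with correspondences as morphisms; a correspondence functor over $R$ is a functor $\mathrm{Corresp}\to R$-mod. $2^X$ is the poset of subsets of $X$ ordered by inclusion, regarded as a category with a unique morphism $A\to A'$ if and only if $A\subseteq A'$. For $U\subseteq Y\times X$ and $A\subseteq X$ put ${}^+U(A)=\{y\in Y:\exists\, x\in A,\ (y,x)\in U\}$; this is an order preserving map $2^X\to2^Y$. $\Omega_U$ is the (birepresentable) $(2^Y,2^X)$-biset $\Omega_U(B,A)=\mathrm{Hom}_{2^Y}({}^+U(A),B)$, $B\subseteq Y$, $A\subseteq X$. The assignment $X\mapsto 2^X$, $U\mapsto\Omega_U$ is a functor $\mathrm{Corresp}\to\mathbb B_R^{1,1}$. *)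

theory Defs
  imports "HOL-Algebra.Module" "HOL-Algebra.AbelCoset"
begin

section \<open>Categories\<close>

text \<open>
  Hom-sets are indexed by their end points and need not be disjoint.  The composite of
  \<open>f : x \<rightarrow> y\<close> and \<open>g : y \<rightarrow> z\<close> is \<open>cmp C x y z g f\<close>.
\<close>

record ('o, 'a) category =
  Ob :: "'o set"
  Arr :: "'o \<Rightarrow> 'o \<Rightarrow> 'a set"
  ident :: "'o \<Rightarrow> 'a"
  cmp :: "'o \<Rightarrow> 'o \<Rightarrow> 'o \<Rightarrow> 'a \<Rightarrow> 'a \<Rightarrow> 'a"

locale category =
  fixes C :: "('o, 'a, 'more) category_scheme"
  assumes ident_in: "x \<in> Ob C \<Longrightarrow> ident C x \<in> Arr C x x"
    and cmp_in: "\<lbrakk>x \<in> Ob C; y \<in> Ob C; z \<in> Ob C; f \<in> Arr C x y; g \<in> Arr C y z\<rbrakk>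
        \<Longrightarrow> cmp C x y z g f \<in> Arr C x z"
    and ident_left: "\<lbrakk>x \<in> Ob C; y \<in> Ob C; f \<in> Arr C x y\<rbrakk> \<Longrightarrow> cmp C x y y (ident C y) f = f"
    and ident_right: "\<lbrakk>x \<in> Ob C; y \<in> Ob C; f \<in> Arr C x y\<rbrakk> \<Longrightarrow> cmp C x x y f (ident C x) = f"
    and cmp_assoc: "\<lbrakk>w \<in> Ob C; x \<in> Ob C; y \<in> Ob C; z \<in> Ob C;
          f \<in> Arr C w x; g \<in> Arr C x y; h \<in> Arr C y z\<rbrakk>
        \<Longrightarrow> cmp C w y z h (cmp C w x y g f) = cmp C w x z (cmp C x y z h g) f"

locale finite_category = category C for C :: "('o, 'a, 'more) category_scheme" +
  assumes finite_Ob: "finite (Ob C)"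
    and finite_Arr: "\<lbrakk>x \<in> Ob C; y \<in> Ob C\<rbrakk> \<Longrightarrow> finite (Arr C x y)"

definition op_cat :: "('o, 'a) category \<Rightarrow> ('o, 'a) category" where
  "op_cat C = \<lparr>Ob = Ob C, Arr = (\<lambda>x y. Arr C y x), ident = ident C,
     cmp = (\<lambda>x y z g f. cmp C z y x f g)\<rparr>"

definition prod_cat ::
  "('o, 'a) category \<Rightarrow> ('p, 'b) category \<Rightarrow> ('o \<times> 'p, 'a \<times> 'b) category" where
  "prod_cat C D = \<lparr>Ob = Ob C \<times> Ob D,
     Arr = (\<lambda>(x, y) (x', y'). Arr C x x' \<times> Arr D y y'),
     ident = (\<lambda>(x, y). (ident C x, ident D y)),
     cmp = (\<lambda>(x, y) (x', y') (x'', y'') (g, h) (g', h'). (cmp C x x' x'' g g', cmp D y y' y'' h h'))\<rparr>"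

definition full_subcat :: "('o, 'a, 'more) category_scheme \<Rightarrow> 'o set \<Rightarrow> ('o, 'a, 'more) category_scheme" where
  "full_subcat C A = C\<lparr>Ob := Ob C \<inter> A\<rparr>"

definition corresp :: "('u set, ('u \<times> 'u) set) category" where
  "corresp = \<lparr>Ob = {X. finite X}, Arr = (\<lambda>X Y. {U. U \<subseteq> Y \<times> X}), ident = Id_on,
     cmp = (\<lambda>X Y Z U V. U O V)\<rparr>"

definition pow_cat :: "'u set \<Rightarrow> ('u set, 'u set \<times> 'u set) category" where
  "pow_cat X = \<lparr>Ob = Pow X, Arr = (\<lambda>A A'. if A \<subseteq> A' then {(A, A')} else {}),
     ident = (\<lambda>A. (A, A)), cmp = (\<lambda>A A' A'' g f. (A, A''))\<rparr>"


section \<open>Set-valued functors\<close>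

record ('o, 'a, 'e) setfun =
  elts :: "'o \<Rightarrow> 'e set"
  act :: "'o \<Rightarrow> 'o \<Rightarrow> 'a \<Rightarrow> 'e \<Rightarrow> 'e"

locale finite_set_functor =
  fixes C :: "('o, 'a) category" and F :: "('o, 'a, 'e) setfun"
  assumes finite_elts: "x \<in> Ob C \<Longrightarrow> finite (elts F x)"
    and act_in: "\<lbrakk>x \<in> Ob C; y \<in> Ob C; f \<in> Arr C x y; u \<in> elts F x\<rbrakk> \<Longrightarrow> act F x y f u \<in> elts F y"
    and act_ident: "\<lbrakk>x \<in> Ob C; u \<in> elts F x\<rbrakk> \<Longrightarrow> act F x x (ident C x) u = u"
    and act_cmp: "\<lbrakk>x \<in> Ob C; y \<in> Ob C; z \<in> Ob C; f \<in> Arr C x y; g \<in> Arr C y z; u \<in> elts F x\<rbrakk>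
        \<Longrightarrow> act F x z (cmp C x y z g f) u = act F y z g (act F x y f u)"

definition setfun_iso ::
  "('o, 'a) category \<Rightarrow> ('o, 'a, 'e) setfun \<Rightarrow> ('o, 'a, 'e') setfun \<Rightarrow> bool" where
  "setfun_iso C F G \<longleftrightarrow> (\<exists>\<eta>. (\<forall>x\<in>Ob C. bij_betw (\<eta> x) (elts F x) (elts G x)) \<and>
     (\<forall>x\<in>Ob C. \<forall>y\<in>Ob C. \<forall>f\<in>Arr C x y. \<forall>u\<in>elts F x. \<eta> y (act F x y f u) = act G x y f (\<eta> x u)))"

definition setfun_coprod ::
  "'i set \<Rightarrow> ('i \<Rightarrow> ('o, 'a, 'e) setfun) \<Rightarrow> ('o, 'a, 'i \<times> 'e) setfun" where
  "setfun_coprod I F = \<lparr>elts = (\<lambda>x. SIGMA i:I. elts (F i) x),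
     act = (\<lambda>x y f (i, u). (i, act (F i) x y f u))\<rparr>"

definition representable :: "('o, 'a) category \<Rightarrow> 'o \<Rightarrow> ('o, 'a, 'a) setfun" where
  "representable C x' = \<lparr>elts = Arr C x', act = (\<lambda>x y f u. cmp C x' x y f u)\<rparr>"

text \<open>All sets being finite, finite index sets suffice in the following definition.\<close>

definition sum_of_representables :: "('o, 'a) category \<Rightarrow> ('o, 'a, 'e) setfun \<Rightarrow> bool" where
  "sum_of_representables C F \<longleftrightarrow> (\<exists>(I :: nat set) c. finite I \<and> c ` I \<subseteq> Ob C \<and>
     setfun_iso C F (setfun_coprod I (\<lambda>i. representable C (c i))))"


section \<open>Bisets\<close>

text \<open>
  A \<open>(C, D)\<close>-biset is a functor on \<open>C \<times> D\<^sup>o\<^sup>p\<close>: for \<open>\<alpha> : x \<rightarrow> x'\<close> in \<open>C\<close>, \<open>\<beta> : y' \<rightarrow> y\<close> in \<open>D\<close> and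
  \<open>u \<in> \<Omega>(x, y)\<close>, the element \<open>\<alpha>u\<beta> \<in> \<Omega>(x', y')\<close> is \<open>act \<Omega> (x, y) (x', y') (\<alpha>, \<beta>) u\<close>.
\<close>

definition biset_dom :: "('o, 'a) category \<Rightarrow> ('p, 'b) category \<Rightarrow> ('o \<times> 'p, 'a \<times> 'b) category" where
  "biset_dom C D = prod_cat C (op_cat D)"

definition left_set ::
  "('p, 'b) category \<Rightarrow> ('o \<times> 'p, 'a \<times> 'b, 'e) setfun \<Rightarrow> ('o, 'a, 'p \<times> 'e) setfun" where
  "left_set D \<Omega> = setfun_coprod (Ob D) (\<lambda>y. \<lparr>elts = (\<lambda>x. elts \<Omega> (x, y)),
     act = (\<lambda>x x' \<alpha>. act \<Omega> (x, y) (x', y) (\<alpha>, ident D y))\<rparr>)"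

definition right_set ::
  "('o, 'a) category \<Rightarrow> ('o \<times> 'p, 'a \<times> 'b, 'e) setfun \<Rightarrow> ('p, 'b, 'o \<times> 'e) setfun" where
  "right_set C \<Omega> = setfun_coprod (Ob C) (\<lambda>x. \<lparr>elts = (\<lambda>y. elts \<Omega> (x, y)),
     act = (\<lambda>y y' \<beta>. act \<Omega> (x, y) (x, y') (ident C x, \<beta>))\<rparr>)"

definition birepresentable ::
  "('o, 'a) category \<Rightarrow> ('p, 'b) category \<Rightarrow> ('o \<times> 'p, 'a \<times> 'b, 'e) setfun \<Rightarrow> bool" where
  "birepresentable C D \<Omega> \<longleftrightarrow> finite_set_functor (biset_dom C D) \<Omega> \<and>
     sum_of_representables C (left_set D \<Omega>) \<and> sum_of_representables (op_cat D) (right_set C \<Omega>)"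

definition biset_sum ::
  "('o, 'a, 'e) setfun \<Rightarrow> ('o, 'a, 'e') setfun \<Rightarrow> ('o, 'a, 'e + 'e') setfun" where
  "biset_sum \<Omega> \<Psi> = \<lparr>elts = (\<lambda>x. Inl ` elts \<Omega> x \<union> Inr ` elts \<Psi> x),
     act = (\<lambda>x y f. map_sum (act \<Omega> x y f) (act \<Psi> x y f))\<rparr>"

definition biset_pairs ::
  "('p, 'b) category \<Rightarrow> ('o \<times> 'p, 'a \<times> 'b, 'e) setfun \<Rightarrow> ('p \<times> 'q, 'b \<times> 'c, 'e') setfun
    \<Rightarrow> 'o \<times> 'q \<Rightarrow> ('p \<times> 'e \<times> 'e') set" where
  "biset_pairs D \<Omega> \<Psi> = (\<lambda>(x, z). SIGMA y:Ob D. elts \<Omega> (x, y) \<times> elts \<Psi> (y, z))"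

text \<open>The equivalence relation generated by \<open>(u\<beta>, v) \<sim> (u, \<beta>v)\<close>, where \<open>\<beta> : y \<rightarrow> y'\<close>.\<close>

definition biset_rel ::
  "('o, 'a) category \<Rightarrow> ('p, 'b) category \<Rightarrow> ('q, 'c) category
    \<Rightarrow> ('o \<times> 'p, 'a \<times> 'b, 'e) setfun \<Rightarrow> ('p \<times> 'q, 'b \<times> 'c, 'e') setfun
    \<Rightarrow> 'o \<times> 'q \<Rightarrow> (('p \<times> 'e \<times> 'e') \<times> ('p \<times> 'e \<times> 'e')) set" where
  "biset_rel C D E \<Omega> \<Psi> = (\<lambda>(x, z). let r =
     {((y, act \<Omega> (x, y') (x, y) (ident C x, \<beta>) u, v), (y', u, act \<Psi> (y, z) (y', z) (\<beta>, ident E z) v)) |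
        y y' \<beta> u v. y \<in> Ob D \<and> y' \<in> Ob D \<and> \<beta> \<in> Arr D y y' \<and> u \<in> elts \<Omega> (x, y') \<and> v \<in> elts \<Psi> (y, z)}
     in (r \<union> r\<inverse>)\<^sup>*)"

definition biset_comp ::
  "('o, 'a) category \<Rightarrow> ('p, 'b) category \<Rightarrow> ('q, 'c) category
    \<Rightarrow> ('o \<times> 'p, 'a \<times> 'b, 'e) setfun \<Rightarrow> ('p \<times> 'q, 'b \<times> 'c, 'e') setfun
    \<Rightarrow> ('o \<times> 'q, 'a \<times> 'c, ('p \<times> 'e \<times> 'e') set) setfun" where
  "biset_comp C D E \<Omega> \<Psi> = \<lparr>
     elts = (\<lambda>p. biset_pairs D \<Omega> \<Psi> p // biset_rel C D E \<Omega> \<Psi> p),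
     act = (\<lambda>(x, z) (x', z') (\<alpha>, \<gamma>) K. biset_rel C D E \<Omega> \<Psi> (x', z') ``
       ((\<lambda>(y, u, v). (y, act \<Omega> (x, y) (x', y) (\<alpha>, ident D y) u, act \<Psi> (y, z) (y, z') (ident D y, \<gamma>) v)) ` K))\<rparr>"

text \<open>
  The \<open>(C, D)\<close>-biset \<open>Hom\<^sub>C(\<phi>(-), -)\<close> of a functor \<open>\<phi> : D \<rightarrow> C\<close> with object part \<open>\<phi>\<^sub>o\<close> and arrow part
  \<open>\<phi>\<^sub>a\<close>.  For the identity functor it is the identity of \<open>C\<close> in the biset category.
\<close>

definition functor_biset ::
  "('o, 'a) category \<Rightarrow> ('p \<Rightarrow> 'o) \<Rightarrow> ('p \<Rightarrow> 'p \<Rightarrow> 'b \<Rightarrow> 'a) \<Rightarrow> ('o \<times> 'p, 'a \<times> 'b, 'a) setfun" where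
  "functor_biset C \<phi>\<^sub>o \<phi>\<^sub>a = \<lparr>elts = (\<lambda>(x, y). Arr C (\<phi>\<^sub>o y) x),
     act = (\<lambda>(x, y) (x', y') (\<alpha>, \<beta>) u.
       cmp C (\<phi>\<^sub>o y') (\<phi>\<^sub>o y) x' (cmp C (\<phi>\<^sub>o y) x x' \<alpha> u) (\<phi>\<^sub>a y' y \<beta>))\<rparr>"

definition id_biset :: "('o, 'a) category \<Rightarrow> ('o \<times> 'o, 'a \<times> 'a, 'a) setfun" where
  "id_biset C = functor_biset C (\<lambda>x. x) (\<lambda>x y f. f)"

definition corresp_image :: "('u \<times> 'u) set \<Rightarrow> 'u set \<Rightarrow> 'u set" where
  "corresp_image U A = {y. \<exists>x\<in>A. (y, x) \<in> U}"

definition corresp_biset ::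
  "'u set \<Rightarrow> ('u \<times> 'u) set
    \<Rightarrow> ('u set \<times> 'u set, ('u set \<times> 'u set) \<times> ('u set \<times> 'u set), 'u set \<times> 'u set) setfun" where
  "corresp_biset Y U = functor_biset (pow_cat Y) (corresp_image U)
     (\<lambda>A A' _. (corresp_image U A, corresp_image U A'))"


section \<open>Modules\<close>

text \<open>The multiplicative components of a module record carry no information.\<close>

definition linear_maps ::
  "('r, 'x) ring_scheme \<Rightarrow> ('r, 'm, 'y) module_scheme \<Rightarrow> ('r, 'n, 'z) module_scheme \<Rightarrow> ('m \<Rightarrow> 'n) set" where
  "linear_maps R M N = {f. f \<in> carrier M \<rightarrow> carrier N \<and>
     (\<forall>a\<in>carrier M. \<forall>b\<in>carrier M. f (a \<oplus>\<^bsub>M\<^esub> b) = f a \<oplus>\<^bsub>N\<^esub> f b) \<and>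
     (\<forall>r\<in>carrier R. \<forall>a\<in>carrier M. f (r \<odot>\<^bsub>M\<^esub> a) = r \<odot>\<^bsub>N\<^esub> f a)}"

definition quot_module :: "('r, 'm) module \<Rightarrow> 'm set \<Rightarrow> ('r, 'm set) module" where
  "quot_module M N = \<lparr>carrier = a_rcosets\<^bsub>M\<^esub> N, mult = undefined, one = undefined,
     zero = N, add = set_add M, smult = (\<lambda>r K. \<Union>k\<in>K. N +>\<^bsub>M\<^esub> (r \<odot>\<^bsub>M\<^esub> k))\<rparr>"

definition free_module :: "('r, 'x) ring_scheme \<Rightarrow> 'i set \<Rightarrow> ('r, 'i \<Rightarrow> 'r) module" where
  "free_module R I = \<lparr>
     carrier = {f. range f \<subseteq> carrier R \<and> finite {i. f i \<noteq> \<zero>\<^bsub>R\<^esub>} \<and> {i. f i \<noteq> \<zero>\<^bsub>R\<^esub>} \<subseteq> I},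
     mult = undefined, one = undefined, zero = (\<lambda>_. \<zero>\<^bsub>R\<^esub>),
     add = (\<lambda>f g i. f i \<oplus>\<^bsub>R\<^esub> g i), smult = (\<lambda>r f i. r \<otimes>\<^bsub>R\<^esub> f i)\<rparr>"

definition free_gen :: "('r, 'x) ring_scheme \<Rightarrow> 'i \<Rightarrow> 'i \<Rightarrow> 'r" where
  "free_gen R i = (\<lambda>j. if j = i then \<one>\<^bsub>R\<^esub> else \<zero>\<^bsub>R\<^esub>)"

definition submodule_span :: "('r, 'x) ring_scheme \<Rightarrow> ('r, 'm) module \<Rightarrow> 'm set \<Rightarrow> 'm set" where
  "submodule_span R M A = \<Inter>{N. submodule N R M \<and> A \<subseteq> N}"


section \<open>The biset category\<close>

text \<open>
  An isomorphism class of finite bisets is represented by its members with elements in \<open>nat\<close>.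
\<close>

type_synonym ('o, 'a, 'p, 'b) biset_class = "('o \<times> 'p, 'a \<times> 'b, nat) setfun set"

definition biset_class ::
  "('o, 'a) category \<Rightarrow> ('p, 'b) category \<Rightarrow> ('o \<times> 'p, 'a \<times> 'b, 'e) setfun
    \<Rightarrow> ('o, 'a, 'p, 'b) biset_class" where
  "biset_class C D \<Omega> = {\<Omega>'. finite_set_functor (biset_dom C D) \<Omega>' \<and> setfun_iso (biset_dom C D) \<Omega>' \<Omega>}"

definition birep_classes ::
  "('o, 'a) category \<Rightarrow> ('p, 'b) category \<Rightarrow> ('o, 'a, 'p, 'b) biset_class set" where
  "birep_classes C D = {biset_class C D \<Omega> | \<Omega> :: ('o \<times> 'p, 'a \<times> 'b, nat) setfun. birepresentable C D \<Omega>}"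

text \<open>
  \<open>R \<otimes> K\<close>, for the Grothendieck group \<open>K\<close> of birepresentable bisets under disjoint union, is
  presented as the \<open>R\<close>-module generated by the isomorphism classes subject to
  \<open>[\<Omega> \<squnion> \<Psi>] = [\<Omega>] + [\<Psi>]\<close>.
\<close>

definition sum_relations ::
  "'r ring \<Rightarrow> ('o, 'a) category \<Rightarrow> ('p, 'b) category \<Rightarrow> (('o, 'a, 'p, 'b) biset_class \<Rightarrow> 'r) set" where
  "sum_relations R C D = submodule_span R (free_module R (birep_classes C D))
     {free_gen R (biset_class C D (biset_sum \<Omega> \<Psi>))
        \<ominus>\<^bsub>free_module R (birep_classes C D)\<^esub>
          (free_gen R (biset_class C D \<Omega>)
             \<oplus>\<^bsub>free_module R (birep_classes C D)\<^esub> free_gen R (biset_class C D \<Psi>)) |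
      (\<Omega> :: ('o \<times> 'p, 'a \<times> 'b, nat) setfun) (\<Psi> :: ('o \<times> 'p, 'a \<times> 'b, nat) setfun). birepresentable C D \<Omega> \<and> birepresentable C D \<Psi>}"

definition biset_module ::
  "'r ring \<Rightarrow> ('o, 'a) category \<Rightarrow> ('p, 'b) category
    \<Rightarrow> ('r, (('o, 'a, 'p, 'b) biset_class \<Rightarrow> 'r) set) module" where
  "biset_module R C D = quot_module (free_module R (birep_classes C D)) (sum_relations R C D)"

definition biset_arrow ::
  "'r ring \<Rightarrow> ('o, 'a) category \<Rightarrow> ('p, 'b) category \<Rightarrow> ('o \<times> 'p, 'a \<times> 'b, 'e) setfun
    \<Rightarrow> (('o, 'a, 'p, 'b) biset_class \<Rightarrow> 'r) set" where
  "biset_arrow R C D \<Omega> =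
     sum_relations R C D +>\<^bsub>free_module R (birep_classes C D)\<^esub> free_gen R (biset_class C D \<Omega>)"

definition class_comp ::
  "('o, 'a) category \<Rightarrow> ('p, 'b) category \<Rightarrow> ('q, 'c) category
    \<Rightarrow> ('o, 'a, 'p, 'b) biset_class \<Rightarrow> ('p, 'b, 'q, 'c) biset_class \<Rightarrow> ('o, 'a, 'q, 'c) biset_class" where
  "class_comp C D E b b' = (\<Union>\<Omega>\<in>b. \<Union>\<Psi>\<in>b'. biset_class C E (biset_comp C D E \<Omega> \<Psi>))"

definition free_comp ::
  "'r ring \<Rightarrow> ('o, 'a) category \<Rightarrow> ('p, 'b) category \<Rightarrow> ('q, 'c) category
    \<Rightarrow> (('o, 'a, 'p, 'b) biset_class \<Rightarrow> 'r) \<Rightarrow> (('p, 'b, 'q, 'c) biset_class \<Rightarrow> 'r)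
    \<Rightarrow> ('o, 'a, 'q, 'c) biset_class \<Rightarrow> 'r" where
  "free_comp R C D E f g =
     (\<Oplus>\<^bsub>free_module R (birep_classes C E)\<^esub> p \<in> {b. f b \<noteq> \<zero>\<^bsub>R\<^esub>} \<times> {b'. g b' \<noteq> \<zero>\<^bsub>R\<^esub>}.
        (f (fst p) \<otimes>\<^bsub>R\<^esub> g (snd p)) \<odot>\<^bsub>free_module R (birep_classes C E)\<^esub>
          free_gen R (class_comp C D E (fst p) (snd p)))"

record ('o, 'a, 'r) linear_category = "('o, 'a) category" +
  ArrM :: "'o \<Rightarrow> 'o \<Rightarrow> ('r, 'a) module"

type_synonym ('o, 'a, 'r) biset_arrow = "(('o, 'a, 'o, 'a) biset_class \<Rightarrow> 'r) set"

text \<open>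
  The category whose arrows \<open>D \<rightarrow> C\<close> are the \<open>R\<close>-linear combinations of birepresentable
  \<open>(C, D)\<close>-bisets.
\<close>

definition biset_category ::
  "'r ring \<Rightarrow> (('o, 'a) category, ('o, 'a, 'r) biset_arrow, 'r) linear_category" where
  "biset_category R = \<lparr>Ob = {C. finite_category C},
     Arr = (\<lambda>D C. carrier (biset_module R C D)),
     ident = (\<lambda>C. biset_arrow R C C (id_biset C)),
     cmp = (\<lambda>E D C K L. \<Union>f\<in>K. \<Union>g\<in>L.
        sum_relations R C E +>\<^bsub>free_module R (birep_classes C E)\<^esub> free_comp R C D E f g),
     ArrM = (\<lambda>D C. biset_module R C D)\<rparr>"


section \<open>Module-valued functors\<close>

record ('o, 'a, 'r, 'm) modfun =
  fob :: "'o \<Rightarrow> ('r, 'm) module"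
  far :: "'o \<Rightarrow> 'o \<Rightarrow> 'a \<Rightarrow> 'm \<Rightarrow> 'm"

locale module_functor =
  fixes R :: "'r ring" and C :: "('o, 'a, 'more) category_scheme" and F :: "('o, 'a, 'r, 'm) modfun"
  assumes fob_module: "x \<in> Ob C \<Longrightarrow> module R (fob F x)"
    and far_linear: "\<lbrakk>x \<in> Ob C; y \<in> Ob C; f \<in> Arr C x y\<rbrakk> \<Longrightarrow> far F x y f \<in> linear_maps R (fob F x) (fob F y)"
    and far_ident: "\<lbrakk>x \<in> Ob C; a \<in> carrier (fob F x)\<rbrakk> \<Longrightarrow> far F x x (ident C x) a = a"
    and far_cmp: "\<lbrakk>x \<in> Ob C; y \<in> Ob C; z \<in> Ob C; f \<in> Arr C x y; g \<in> Arr C y z; a \<in> carrier (fob F x)\<rbrakk>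
        \<Longrightarrow> far F x z (cmp C x y z g f) a = far F y z g (far F x y f a)"

locale linear_module_functor = module_functor R C F
  for R :: "'r ring" and C :: "('o, 'a, 'r) linear_category" and F :: "('o, 'a, 'r, 'm) modfun" +
  assumes far_add: "\<lbrakk>x \<in> Ob C; y \<in> Ob C; f \<in> Arr C x y; g \<in> Arr C x y; a \<in> carrier (fob F x)\<rbrakk>
        \<Longrightarrow> far F x y (f \<oplus>\<^bsub>ArrM C x y\<^esub> g) a = far F x y f a \<oplus>\<^bsub>fob F y\<^esub> far F x y g a"
    and far_smult: "\<lbrakk>x \<in> Ob C; y \<in> Ob C; r \<in> carrier R; f \<in> Arr C x y; a \<in> carrier (fob F x)\<rbrakk>
        \<Longrightarrow> far F x y (r \<odot>\<^bsub>ArrM C x y\<^esub> f) a = r \<odot>\<^bsub>fob F y\<^esub> far F x y f a"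

definition modfun_iso ::
  "'r ring \<Rightarrow> ('o, 'a, 'more) category_scheme
    \<Rightarrow> ('o, 'a, 'r, 'm) modfun \<Rightarrow> ('o, 'a, 'r, 'n) modfun \<Rightarrow> bool" where
  "modfun_iso R C F G \<longleftrightarrow> (\<exists>\<eta>.
     (\<forall>x\<in>Ob C. \<eta> x \<in> linear_maps R (fob F x) (fob G x) \<and> bij_betw (\<eta> x) (carrier (fob F x)) (carrier (fob G x))) \<and>
     (\<forall>x\<in>Ob C. \<forall>y\<in>Ob C. \<forall>f\<in>Arr C x y. \<forall>a\<in>carrier (fob F x).
        \<eta> y (far F x y f a) = far G x y f (\<eta> x a)))"

definition vanishes_at :: "('o, 'a, 'r, 'm) modfun \<Rightarrow> 'o \<Rightarrow> bool" where
  "vanishes_at F x \<longleftrightarrow> carrier (fob F x) = {\<zero>\<^bsub>fob F x\<^esub>}"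

definition subfunctor ::
  "'r ring \<Rightarrow> ('o, 'a, 'more) category_scheme \<Rightarrow> ('o, 'a, 'r, 'm) modfun \<Rightarrow> ('o \<Rightarrow> 'm set) \<Rightarrow> bool" where
  "subfunctor R C F P \<longleftrightarrow> (\<forall>x\<in>Ob C. submodule (P x) R (fob F x)) \<and>
     (\<forall>x\<in>Ob C. \<forall>y\<in>Ob C. \<forall>f\<in>Arr C x y. far F x y f ` P x \<subseteq> P y)"

definition simple_functor ::
  "'r ring \<Rightarrow> ('o, 'a, 'more) category_scheme \<Rightarrow> ('o, 'a, 'r, 'm) modfun \<Rightarrow> bool" where
  "simple_functor R C F \<longleftrightarrow> module_functor R C F \<and> (\<exists>x\<in>Ob C. \<not> vanishes_at F x) \<and>
     (\<forall>P. subfunctor R C F P \<longrightarrow>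
        (\<forall>x\<in>Ob C. P x = {\<zero>\<^bsub>fob F x\<^esub>}) \<or> (\<forall>x\<in>Ob C. P x = carrier (fob F x)))"

definition subquotient ::
  "('o, 'a, 'r, 'm) modfun \<Rightarrow> ('o \<Rightarrow> 'm set) \<Rightarrow> ('o \<Rightarrow> 'm set) \<Rightarrow> ('o, 'a, 'r, 'm set) modfun" where
  "subquotient F P Q = \<lparr>fob = (\<lambda>x. quot_module ((fob F x)\<lparr>carrier := P x\<rparr>) (Q x)),
     far = (\<lambda>x y f K. \<Union>k\<in>K. Q y +>\<^bsub>fob F y\<^esub> far F x y f k)\<rparr>"

definition simple_composition_factor ::
  "'r ring \<Rightarrow> ('o, 'a, 'more) category_scheme
    \<Rightarrow> ('o, 'a, 'r, 'm) modfun \<Rightarrow> ('o, 'a, 'r, 'n) modfun \<Rightarrow> bool" where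
  "simple_composition_factor R C F T \<longleftrightarrow> simple_functor R C T \<and>
     (\<exists>P Q. subfunctor R C F P \<and> subfunctor R C F Q \<and> (\<forall>x\<in>Ob C. Q x \<subseteq> P x) \<and>
        modfun_iso R C T (subquotient F P Q))"

definition iso_types ::
  "'r ring \<Rightarrow> ('o, 'a, 'more) category_scheme
    \<Rightarrow> ('o, 'a, 'r, 'm) modfun set \<Rightarrow> ('o, 'a, 'r, 'm) modfun set set" where
  "iso_types R C \<F> = \<F> // {(F, G). F \<in> \<F> \<and> G \<in> \<F> \<and> modfun_iso R C F G}"


section \<open>Biset functors and correspondence functors\<close>

text \<open>
  A type \<open>'u\<close> supplies the elements of the finite sets \<open>X\<close>; the finite categories have objects in
  \<open>'u set\<close> and arrows in \<open>'u set \<times> 'u set\<close>, so that each \<open>2\<^sup>X\<close> is literally one of them.  If \<open>'u\<close>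
  is infinite, every finite set and every finite category is isomorphic to one of these.

  The modules have carriers in a type \<open>'m\<close>.  As arrow modules have countable dimension, all values of a
  simple functor have at most countable dimension; so if \<open>nat \<Rightarrow> 'r\<close> embeds into \<open>'m\<close>, every
  simple functor is isomorphic to one with carriers in \<open>'m\<close>.
\<close>

type_synonym 'u fincat = "('u set, 'u set \<times> 'u set) category"

type_synonym ('u, 'r, 'm) biset_functor =
  "('u fincat, ('u set, 'u set \<times> 'u set, 'r) biset_arrow, 'r, 'm) modfun"

type_synonym ('u, 'r, 'm) corresp_functor = "('u set, ('u \<times> 'u) set, 'r, 'm) modfun"

definition poset_biset_category ::
  "'r ring \<Rightarrow> ('u fincat, ('u set, 'u set \<times> 'u set, 'r) biset_arrow, 'r) linear_category" where
  "poset_biset_category R = full_subcat (biset_category R) (pow_cat ` {X. finite X})"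

definition hat :: "'r ring \<Rightarrow> ('u, 'r, 'm) biset_functor \<Rightarrow> ('u, 'r, 'm) corresp_functor" where
  "hat R S = \<lparr>fob = (\<lambda>X. fob S (pow_cat X)),
     far = (\<lambda>X Y U. far S (pow_cat X) (pow_cat Y)
       (biset_arrow R (pow_cat Y) (pow_cat X) (corresp_biset Y U)))\<rparr>"

definition simple_biset_functor ::
  "'r ring \<Rightarrow> ('u fincat, ('u set, 'u set \<times> 'u set, 'r) biset_arrow, 'r) linear_category
    \<Rightarrow> ('u, 'r, 'm) biset_functor \<Rightarrow> bool" where
  "simple_biset_functor R \<B> S \<longleftrightarrow> linear_module_functor R \<B> S \<and> simple_functor R \<B> S"

definition smallest_set_of_biset_functor :: "('u, 'r, 'm) biset_functor \<Rightarrow> 'u set \<Rightarrow> bool" where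
  "smallest_set_of_biset_functor S X \<longleftrightarrow> finite X \<and> \<not> vanishes_at S (pow_cat X) \<and>
     (\<forall>Y. finite Y \<and> card Y < card X \<longrightarrow> vanishes_at S (pow_cat Y))"

definition smallest_set_of_corresp_functor :: "('u, 'r, 'm) corresp_functor \<Rightarrow> 'u set \<Rightarrow> bool" where
  "smallest_set_of_corresp_functor T X \<longleftrightarrow> finite X \<and> \<not> vanishes_at T X \<and>
     (\<forall>Y. finite Y \<and> card Y < card X \<longrightarrow> vanishes_at T Y)"

definition factor_at ::
  "'r ring \<Rightarrow> 'u set \<Rightarrow> ('u, 'r, 'm) biset_functor \<Rightarrow> ('u, 'r, 'n) corresp_functor \<Rightarrow> bool" where
  "factor_at R X S T \<longleftrightarrow>
     simple_composition_factor R corresp (hat R S) T \<and> smallest_set_of_corresp_functor T X"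

text \<open>
  The mapping \<open>S \<mapsto> T\<close> on isomorphism types: the argument and the value are isomorphism classes.
\<close>

definition corresponding_types ::
  "'r ring \<Rightarrow> ('u, 'r, 'm) biset_functor set \<Rightarrow> ('u, 'r, 'm) corresp_functor set" where
  "corresponding_types R c =
     {T. \<exists>S\<in>c. \<exists>X. smallest_set_of_biset_functor S X \<and> factor_at R X S T}"

end

theory Submission
  imports Defs "HOL-Library.Countable_Set"
begin

text \<open>
  A finite birepresentable \<open>(2\<^sup>Y, 2\<^sup>X)\<close>-biset is a disjoint union of bisets with at most one element in each place,
  one for each element over \<open>(Y, \<emptyset>)\<close>; such a biset is a relation \<open>p\<close> between the subsets of \<open>Y\<close> and of \<open>X\<close>, with
  closure properties (\<open>good\<close>) expressing the two representability conditions.  If \<open>p \<emptyset> \<emptyset>\<close> and \<open>p Y X\<close>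
  (\<open>full\<close>), the biset is \<open>\<Omega>\<^sub>U\<close> for a unique correspondence \<open>U\<close>; otherwise it factors through \<open>2\<^sup>W\<close> with
  \<open>W\<close> a proper subset.  Hence the endomorphisms of \<open>X\<close> in the linearised correspondence category and those of \<open>2\<^sup>X\<close>
  in the biset category act through the same algebra on functors that vanish at all smaller sets.  A simple functor
  is determined by its value at any object where it is not zero, and every simple module over the endomorphisms of an
  object occurs: it is the value of the image of the induced functor in the coinduced one.
\<close>

section \<open>Modules\<close>

text \<open>The delicate point is that non-full relations do not form an ideal. On a one-element
  set, the relation that holds exactly when its second argument is empty is not full; composed with
  the relation that always holds it gives the relation of the empty correspondence, which is full.
  Letting non-full relations act by zero on \<open>T X\<close> is still multiplicative: a full
  composite that has a non-full factor, or that passes through the power set of a smaller set, is a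
  correspondence factoring through a set with fewer elements than \<open>X\<close>, and
  \<open>T\<close> vanishes there by minimality. A second obstacle is the fixed carrier type
  \<open>'m\<close>. The image of the induced functor in the coinduced one consists of functions on
  arrows, so its elements have to be coded in \<open>'m\<close>, as finite lists of generators. A
  generator contains the class of a biset, which is coded by a 0-1 sequence; the injection
  \<open>e\<close> turns such sequences into elements of \<open>'m\<close>. Finally, an action of
  bisets has to respect disjoint unions before it can be extended linearly. Summing over the
  components, indexed by the elements over \<open>(X, {})\<close>, provides this.\<close>

lemma linear_mapsI:
  assumes "\<And>a. a \<in> carrier M \<Longrightarrow> f a \<in> carrier N"
    and "\<And>a b. \<lbrakk>a \<in> carrier M; b \<in> carrier M\<rbrakk> \<Longrightarrow> f (a \<oplus>\<^bsub>M\<^esub> b) = f a \<oplus>\<^bsub>N\<^esub> f b"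
    and "\<And>r a. \<lbrakk>r \<in> carrier R; a \<in> carrier M\<rbrakk> \<Longrightarrow> f (r \<odot>\<^bsub>M\<^esub> a) = r \<odot>\<^bsub>N\<^esub> f a"
  shows "f \<in> linear_maps R M N"
  using assms by (auto simp: linear_maps_def)

lemma linear_mapsD:
  assumes "f \<in> linear_maps R M N"
  shows "a \<in> carrier M \<Longrightarrow> f a \<in> carrier N"
    and "\<lbrakk>a \<in> carrier M; b \<in> carrier M\<rbrakk> \<Longrightarrow> f (a \<oplus>\<^bsub>M\<^esub> b) = f a \<oplus>\<^bsub>N\<^esub> f b"
    and "\<lbrakk>r \<in> carrier R; a \<in> carrier M\<rbrakk> \<Longrightarrow> f (r \<odot>\<^bsub>M\<^esub> a) = r \<odot>\<^bsub>N\<^esub> f a"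
  using assms by (auto simp: linear_maps_def)

lemma linear_maps_comp:
  "\<lbrakk>f \<in> linear_maps R M N; g \<in> linear_maps R N L\<rbrakk> \<Longrightarrow> (\<lambda>a. g (f a)) \<in> linear_maps R M L"
  by (auto simp: linear_maps_def Pi_iff)

lemma module_zero_closed: "module R M \<Longrightarrow> \<zero>\<^bsub>M\<^esub> \<in> carrier M"
  by (simp add: module_def abelian_group_def abelian_monoid.zero_closed)

lemma module_add_closed:
  "\<lbrakk>module R M; a \<in> carrier M; b \<in> carrier M\<rbrakk> \<Longrightarrow> a \<oplus>\<^bsub>M\<^esub> b \<in> carrier M"
  by (simp add: module_def abelian_group_def abelian_monoid.a_closed)

lemma linear_map_zero:
  assumes "f \<in> linear_maps R M N" "module R M" "module R N"
  shows "f \<zero>\<^bsub>M\<^esub> = \<zero>\<^bsub>N\<^esub>"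
proof -
  interpret M: module R M by fact
  interpret N: module R N by fact
  have "f (\<zero>\<^bsub>R\<^esub> \<odot>\<^bsub>M\<^esub> \<zero>\<^bsub>M\<^esub>) = \<zero>\<^bsub>R\<^esub> \<odot>\<^bsub>N\<^esub> f \<zero>\<^bsub>M\<^esub>"
    by (rule linear_mapsD(3)[OF assms(1)]) auto
  then show ?thesis using linear_mapsD(1)[OF assms(1), of "\<zero>\<^bsub>M\<^esub>"] by simp
qed

text \<open>Members of \<open>linear_maps\<close> are unconstrained outside the carrier, so they are
  compared on the carrier only. Closure of \<open>M\<close> under its operations makes the
  replacement legitimate.\<close>

lemma linear_maps_cong:
  assumes "f \<in> linear_maps R M N" "module R M" "\<And>a. a \<in> carrier M \<Longrightarrow> f a = g a"
  shows "g \<in> linear_maps R M N"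
proof -
  interpret M: module R M by fact
  show ?thesis
    by (rule linear_mapsI) (simp_all add: assms(3)[symmetric] linear_mapsD[OF assms(1)])
qed

lemma linear_maps_zero:
  assumes "module R N"
  shows "(\<lambda>_. \<zero>\<^bsub>N\<^esub>) \<in> linear_maps R M N"
proof -
  interpret N: module R N by fact
  show ?thesis by (rule linear_mapsI) simp_all
qed

lemma linear_maps_add:
  assumes "module R N" "f \<in> linear_maps R M N" "g \<in> linear_maps R M N"
  shows "(\<lambda>a. f a \<oplus>\<^bsub>N\<^esub> g a) \<in> linear_maps R M N"
proof -
  interpret N: module R N by fact
  show ?thesis
    by (rule linear_mapsI) (simp_all add: linear_mapsD[OF assms(2)] linear_mapsD[OF assms(3)] N.M.a_ac N.smult_r_distr)
qed

lemma linear_maps_smult: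
  assumes "module R N" "f \<in> linear_maps R M N" "r \<in> carrier R"
  shows "(\<lambda>a. r \<odot>\<^bsub>N\<^esub> f a) \<in> linear_maps R M N"
proof (rule linear_mapsI)
  interpret N: module R N by fact
  fix a s assume "a \<in> carrier M" "s \<in> carrier R"
  then show "r \<odot>\<^bsub>N\<^esub> f (s \<odot>\<^bsub>M\<^esub> a) = s \<odot>\<^bsub>N\<^esub> (r \<odot>\<^bsub>N\<^esub> f a)"
    using assms(3) linear_mapsD[OF assms(2)] N.R.m_comm[of r s] by (simp flip: N.smult_assoc1)
qed (use assms(3) linear_mapsD[OF assms(2)] module.smult_closed[OF assms(1)] module.smult_r_distr[OF assms(1)] in auto)

text \<open>Reduces additive inverses to scalar multiples, so that whatever respects scalars
  respects negation.\<close>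

lemma module_minus_eq:
  assumes "module R M" "a \<in> carrier M"
  shows "\<ominus>\<^bsub>M\<^esub> a = (\<ominus>\<^bsub>R\<^esub> \<one>\<^bsub>R\<^esub>) \<odot>\<^bsub>M\<^esub> a"
proof -
  interpret M: module R M by fact
  show ?thesis using assms(2) by (simp add: M.smult_l_minus)
qed

lemma linear_map_minus:
  assumes "f \<in> linear_maps R M N" "module R M" "module R N" "a \<in> carrier M"
  shows "f (\<ominus>\<^bsub>M\<^esub> a) = \<ominus>\<^bsub>N\<^esub> f a"
proof -
  interpret M: module R M by fact
  have "\<ominus>\<^bsub>R\<^esub> \<one>\<^bsub>R\<^esub> \<in> carrier R" by simp
  then show ?thesis
    using assms linear_mapsD[OF assms(1)] by (simp add: module_minus_eq[of R])
qed

lemma module_eq_iff: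
  assumes "module R M" "a \<in> carrier M" "b \<in> carrier M"
  shows "a \<ominus>\<^bsub>M\<^esub> b = \<zero>\<^bsub>M\<^esub> \<longleftrightarrow> a = b"
proof -
  interpret M: module R M by fact
  have "a = (a \<ominus>\<^bsub>M\<^esub> b) \<oplus>\<^bsub>M\<^esub> b"
    using assms(2,3) by (simp add: M.M.minus_eq M.M.a_assoc M.M.l_neg)
  then show ?thesis using assms(2,3) by (auto simp: M.M.minus_eq M.M.r_neg)
qed

lemma linear_map_inj:
  assumes "f \<in> linear_maps R M N" "module R M" "module R N"
    and "\<And>a. a \<in> carrier M \<Longrightarrow> f a = \<zero>\<^bsub>N\<^esub> \<Longrightarrow> a = \<zero>\<^bsub>M\<^esub>"
  shows "inj_on f (carrier M)"
proof
  interpret M: module R M by fact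
  interpret N: module R N by fact
  fix a b assume ab: "a \<in> carrier M" "b \<in> carrier M" "f a = f b"
  have "f (a \<ominus>\<^bsub>M\<^esub> b) = \<zero>\<^bsub>N\<^esub>"
    using ab linear_mapsD[OF assms(1)] linear_map_minus[OF assms(1-3)]
    by (simp add: M.M.minus_eq N.M.minus_eq N.M.r_neg)
  then have "a \<ominus>\<^bsub>M\<^esub> b = \<zero>\<^bsub>M\<^esub>" using assms(4) ab by simp
  then show "a = b" using module_eq_iff[OF assms(2)] ab by simp
qed

lemma linear_map_inverse:
  assumes "f \<in> linear_maps R M N" "bij_betw f (carrier M) (carrier N)" "module R M"
  shows "inv_into (carrier M) f \<in> linear_maps R N M"
proof -
  let ?g = "inv_into (carrier M) f"
  interpret M: module R M by fact
  have g: "?g b \<in> carrier M" "f (?g b) = b" if "b \<in> carrier N" for b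
    using that assms(2) by (auto simp: bij_betw_def f_inv_into_f inv_into_into)
  have inv: "?g (f a) = a" if "a \<in> carrier M" for a
    using that assms(2) by (simp add: bij_betw_def)
  show ?thesis
  proof (rule linear_mapsI)
    fix a b assume ab: "a \<in> carrier N" "b \<in> carrier N"
    have "f (?g a \<oplus>\<^bsub>M\<^esub> ?g b) = a \<oplus>\<^bsub>N\<^esub> b"
      using ab g linear_mapsD(2)[OF assms(1)] by simp
    then show "?g (a \<oplus>\<^bsub>N\<^esub> b) = ?g a \<oplus>\<^bsub>M\<^esub> ?g b"
      using inv[of "?g a \<oplus>\<^bsub>M\<^esub> ?g b"] ab g by simp
  next
    fix r b assume ab: "r \<in> carrier R" "b \<in> carrier N"
    have "f (r \<odot>\<^bsub>M\<^esub> ?g b) = r \<odot>\<^bsub>N\<^esub> b"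
      using ab g linear_mapsD(3)[OF assms(1)] by simp
    then show "?g (r \<odot>\<^bsub>N\<^esub> b) = r \<odot>\<^bsub>M\<^esub> ?g b"
      using inv[of "r \<odot>\<^bsub>M\<^esub> ?g b"] ab g by simp
  qed (use g in auto)
qed

text \<open>The module axioms are equations, so they pass along any surjection compatible with the
  operations. Quotients and transported modules get their axioms from here.\<close>

lemma module_surj_image:
  assumes M: "module R M"
    and surj: "h ` carrier M = carrier N"
    and add: "\<And>a b. \<lbrakk>a \<in> carrier M; b \<in> carrier M\<rbrakk> \<Longrightarrow> h (a \<oplus>\<^bsub>M\<^esub> b) = h a \<oplus>\<^bsub>N\<^esub> h b"
    and smult: "\<And>r a. \<lbrakk>r \<in> carrier R; a \<in> carrier M\<rbrakk> \<Longrightarrow> h (r \<odot>\<^bsub>M\<^esub> a) = r \<odot>\<^bsub>N\<^esub> h a"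
    and zero: "h \<zero>\<^bsub>M\<^esub> = \<zero>\<^bsub>N\<^esub>"
  shows "module R N"
proof -
  interpret M: module R M by fact
  have ex: "\<exists>a\<in>carrier M. x = h a" if "x \<in> carrier N" for x using that surj by auto
  have cl: "h a \<in> carrier N" if "a \<in> carrier M" for a using that surj by auto
  show ?thesis
  proof (rule moduleI)
    show "cring R" by (rule M.R.is_cring)
    show "abelian_group N"
    proof (rule abelian_groupI)
      fix x y assume "x \<in> carrier N" "y \<in> carrier N"
      then obtain a b where "a \<in> carrier M" "b \<in> carrier M" "x = h a" "y = h b" by (meson ex)
      then show "x \<oplus>\<^bsub>N\<^esub> y \<in> carrier N" "x \<oplus>\<^bsub>N\<^esub> y = y \<oplus>\<^bsub>N\<^esub> x"
        using add[of a b] add[of b a] cl[of "a \<oplus>\<^bsub>M\<^esub> b"] M.M.a_comm[of a b] M.M.a_closed[of a b]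
        by metis+
    next
      fix x y z assume "x \<in> carrier N" "y \<in> carrier N" "z \<in> carrier N"
      then obtain a b c where "a \<in> carrier M" "b \<in> carrier M" "c \<in> carrier M"
        "x = h a" "y = h b" "z = h c" by (meson ex)
      then show "x \<oplus>\<^bsub>N\<^esub> y \<oplus>\<^bsub>N\<^esub> z = x \<oplus>\<^bsub>N\<^esub> (y \<oplus>\<^bsub>N\<^esub> z)" 
        using add[of "a \<oplus>\<^bsub>M\<^esub> b" c] add[of a b] add[of a "b \<oplus>\<^bsub>M\<^esub> c"] add[of b c] M.M.a_assoc[of a b c]
        by simp
    next
      show "\<zero>\<^bsub>N\<^esub> \<in> carrier N" using cl[of "\<zero>\<^bsub>M\<^esub>"] zero by simp
    next
      fix x assume "x \<in> carrier N"
      then obtain a where a: "a \<in> carrier M" "x = h a" by (meson ex)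
      then show "\<zero>\<^bsub>N\<^esub> \<oplus>\<^bsub>N\<^esub> x = x" using add[of "\<zero>\<^bsub>M\<^esub>" a] zero by simp
      have "h (\<ominus>\<^bsub>M\<^esub> a) \<oplus>\<^bsub>N\<^esub> x = \<zero>\<^bsub>N\<^esub>" 
        using a add[of "\<ominus>\<^bsub>M\<^esub> a" a] zero by (simp add: M.M.l_neg)
      then show "\<exists>y\<in>carrier N. y \<oplus>\<^bsub>N\<^esub> x = \<zero>\<^bsub>N\<^esub>" using a cl by blast
    qed
  next
    fix r s x assume rs: "r \<in> carrier R" "s \<in> carrier R" "x \<in> carrier N"
    then obtain a where a: "a \<in> carrier M" "x = h a" by (meson ex)
    show "(r \<oplus>\<^bsub>R\<^esub> s) \<odot>\<^bsub>N\<^esub> x = r \<odot>\<^bsub>N\<^esub> x \<oplus>\<^bsub>N\<^esub> s \<odot>\<^bsub>N\<^esub> x"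
      using rs a add[of "r \<odot>\<^bsub>M\<^esub> a" "s \<odot>\<^bsub>M\<^esub> a"] smult[of r a] smult[of s a] smult[of "r \<oplus>\<^bsub>R\<^esub> s" a]
      by (simp add: M.smult_l_distr)
    show "(r \<otimes>\<^bsub>R\<^esub> s) \<odot>\<^bsub>N\<^esub> x = r \<odot>\<^bsub>N\<^esub> (s \<odot>\<^bsub>N\<^esub> x)"
      using rs a smult[of r "s \<odot>\<^bsub>M\<^esub> a"] smult[of s a] smult[of "r \<otimes>\<^bsub>R\<^esub> s" a]
      by (simp add: M.smult_assoc1)
    show "r \<odot>\<^bsub>N\<^esub> x \<in> carrier N" using rs a cl[of "r \<odot>\<^bsub>M\<^esub> a"] smult[of r a] by simp
  next
    fix x assume "x \<in> carrier N"
    then obtain a where a: "a \<in> carrier M" "x = h a" by (meson ex)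
    show "\<one>\<^bsub>R\<^esub> \<odot>\<^bsub>N\<^esub> x = x" using a smult[of "\<one>\<^bsub>R\<^esub>" a] by simp
  next
    fix r x y assume rs: "r \<in> carrier R" "x \<in> carrier N" "y \<in> carrier N"
    then obtain a b where "a \<in> carrier M" "b \<in> carrier M" "x = h a" "y = h b" by (meson ex)
    then show "r \<odot>\<^bsub>N\<^esub> (x \<oplus>\<^bsub>N\<^esub> y) = r \<odot>\<^bsub>N\<^esub> x \<oplus>\<^bsub>N\<^esub> r \<odot>\<^bsub>N\<^esub> y"
      using rs add[of a b] add[of "r \<odot>\<^bsub>M\<^esub> a" "r \<odot>\<^bsub>M\<^esub> b"] smult[of r a] smult[of r b] smult[of r "a \<oplus>\<^bsub>M\<^esub> b"]
      by (simp add: M.smult_r_distr)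
  qed
qed

subsection \<open>Submodules and spans\<close>

text \<open>Closure under negation comes from the scalar minus one.\<close>

lemma submodule_criterion:
  assumes "module R M" "H \<subseteq> carrier M" "\<zero>\<^bsub>M\<^esub> \<in> H"
    and "\<And>a b. \<lbrakk>a \<in> H; b \<in> H\<rbrakk> \<Longrightarrow> a \<oplus>\<^bsub>M\<^esub> b \<in> H"
    and "\<And>r a. \<lbrakk>r \<in> carrier R; a \<in> H\<rbrakk> \<Longrightarrow> r \<odot>\<^bsub>M\<^esub> a \<in> H"
  shows "submodule H R M"
proof -
  interpret M: module R M by fact
  have "\<ominus>\<^bsub>M\<^esub> a \<in> H" if "a \<in> H" for a
    using that assms(2) assms(5)[of "\<ominus>\<^bsub>R\<^esub> \<one>\<^bsub>R\<^esub>" a] by (auto simp: module_minus_eq[OF assms(1)])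
  then show ?thesis using assms by (intro M.submoduleI) auto
qed

lemma submoduleD:
  assumes "submodule H R M"
  shows "a \<in> H \<Longrightarrow> a \<in> carrier M" "\<zero>\<^bsub>M\<^esub> \<in> H"
    and "\<lbrakk>a \<in> H; b \<in> H\<rbrakk> \<Longrightarrow> a \<oplus>\<^bsub>M\<^esub> b \<in> H"
    and "\<lbrakk>r \<in> carrier R; a \<in> H\<rbrakk> \<Longrightarrow> r \<odot>\<^bsub>M\<^esub> a \<in> H"
proof -
  interpret submodule H R M by fact
  show "a \<in> H \<Longrightarrow> a \<in> carrier M" using subset by auto
  show "\<zero>\<^bsub>M\<^esub> \<in> H" using one_closed by simp
  show "\<lbrakk>a \<in> H; b \<in> H\<rbrakk> \<Longrightarrow> a \<oplus>\<^bsub>M\<^esub> b \<in> H" using m_closed by simp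
  show "\<lbrakk>r \<in> carrier R; a \<in> H\<rbrakk> \<Longrightarrow> r \<odot>\<^bsub>M\<^esub> a \<in> H" using smult_closed by simp
qed

lemma submodule_carrier: "module R M \<Longrightarrow> submodule (carrier M) R M"
  by (rule module.carrier_is_submodule)

lemma submodule_module: "\<lbrakk>module R M; submodule H R M\<rbrakk> \<Longrightarrow> module R (M\<lparr>carrier := H\<rparr>)"
  by (rule submodule.submodule_is_module)

lemma span_submodule:
  assumes "module R M" "A \<subseteq> carrier M"
  shows "submodule (submodule_span R M A) R M"
proof (rule submodule_criterion[OF assms(1)])
  show "submodule_span R M A \<subseteq> carrier M"
    using submodule_carrier[OF assms(1)] assms(2) by (auto simp: submodule_span_def)
qed (auto simp: submodule_span_def dest: submoduleD)

lemma span_superset: "A \<subseteq> submodule_span R M A"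
  by (auto simp: submodule_span_def)

lemma span_least: "\<lbrakk>submodule N R M; A \<subseteq> N\<rbrakk> \<Longrightarrow> submodule_span R M A \<subseteq> N"
  by (auto simp: submodule_span_def)

text \<open>The elements of the span that satisfy \<open>P\<close> form a submodule containing
  \<open>A\<close>, hence are the whole span.\<close>

lemma span_induct [consumes 3, case_names base zero add smult]:
  assumes "module R M" "A \<subseteq> carrier M" "x \<in> submodule_span R M A"
    and "\<And>a. a \<in> A \<Longrightarrow> P a" "P \<zero>\<^bsub>M\<^esub>"
    and "\<And>a b. \<lbrakk>a \<in> submodule_span R M A; b \<in> submodule_span R M A; P a; P b\<rbrakk> \<Longrightarrow> P (a \<oplus>\<^bsub>M\<^esub> b)"
    and "\<And>r a. \<lbrakk>r \<in> carrier R; a \<in> submodule_span R M A; P a\<rbrakk> \<Longrightarrow> P (r \<odot>\<^bsub>M\<^esub> a)"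
  shows "P x"
proof -
  note S = span_submodule[OF assms(1,2)]
  have "submodule {x \<in> submodule_span R M A. P x} R M"
    by (rule submodule_criterion[OF assms(1)]) (use assms(5-) submoduleD[OF S] in auto)
  moreover have "A \<subseteq> {x \<in> submodule_span R M A. P x}"
    using span_superset[of A R M] assms(4) by blast
  ultimately have "submodule_span R M A \<subseteq> {x \<in> submodule_span R M A. P x}" by (rule span_least)
  then show ?thesis using assms(3) by blast
qed

lemma submodule_vimage:
  assumes "f \<in> linear_maps R M N" "module R M" "module R N" "submodule H R N"
  shows "submodule {a \<in> carrier M. f a \<in> H} R M"
proof -
  interpret M: module R M by fact
  show ?thesis
    by (rule submodule_criterion[OF assms(2)])
       (auto simp: linear_map_zero[OF assms(1-3)] linear_mapsD[OF assms(1)] submoduleD[OF assms(4)])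
qed

lemma submodule_image:
  assumes "f \<in> linear_maps R M N" "module R M" "module R N" "submodule H R M"
  shows "submodule (f ` H) R N"
proof -
  have H: "a \<in> carrier M" if "a \<in> H" for a using that submoduleD(1)[OF assms(4)] by simp
  show ?thesis
  proof (rule submodule_criterion[OF assms(3)])
    show "f ` H \<subseteq> carrier N" using linear_mapsD(1)[OF assms(1)] H by auto
    show "\<zero>\<^bsub>N\<^esub> \<in> f ` H" using linear_map_zero[OF assms(1-3)] submoduleD(2)[OF assms(4)] by force
    show "a \<oplus>\<^bsub>N\<^esub> b \<in> f ` H" if ab: "a \<in> f ` H" "b \<in> f ` H" for a b
    proof -
      obtain x y where xy: "x \<in> H" "y \<in> H" "a = f x" "b = f y" using ab by auto
      then have "a \<oplus>\<^bsub>N\<^esub> b = f (x \<oplus>\<^bsub>M\<^esub> y)" using linear_mapsD(2)[OF assms(1)] H by simp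
      then show ?thesis using submoduleD(3)[OF assms(4)] xy by auto
    qed
    show "r \<odot>\<^bsub>N\<^esub> a \<in> f ` H" if ab: "r \<in> carrier R" "a \<in> f ` H" for r a
    proof -
      obtain x where xy: "x \<in> H" "a = f x" using ab by auto
      then have "r \<odot>\<^bsub>N\<^esub> a = f (r \<odot>\<^bsub>M\<^esub> x)" using linear_mapsD(3)[OF assms(1)] H ab by simp
      then show ?thesis using submoduleD(4)[OF assms(4)] xy ab by auto
    qed
  qed
qed

subsection \<open>Quotients\<close>

lemma submodule_abelian_subgroup:
  assumes "module R M" "submodule H R M"
  shows "abelian_subgroup H M"
proof (rule abelian_subgroupI3)
  interpret M: module R M by fact
  show "additive_subgroup H M" using assms(2) by (auto simp: additive_subgroup_def submodule_def)
  show "abelian_group M" by (rule M.M.abelian_group_axioms)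
qed

lemma coset_eq_iff:
  assumes "module R M" "submodule H R M" "a \<in> carrier M" "b \<in> carrier M"
  shows "H +>\<^bsub>M\<^esub> a = H +>\<^bsub>M\<^esub> b \<longleftrightarrow> a \<ominus>\<^bsub>M\<^esub> b \<in> H"
proof -
  interpret H: abelian_subgroup H M using assms(1,2) by (rule submodule_abelian_subgroup)
  have "a \<in> H +>\<^bsub>M\<^esub> b \<longleftrightarrow> a \<ominus>\<^bsub>M\<^esub> b \<in> H"
    using H.a_rcos_module[OF assms(4,3)] by (simp add: H.minus_eq)
  moreover have "H +>\<^bsub>M\<^esub> a = H +>\<^bsub>M\<^esub> b \<longleftrightarrow> a \<in> H +>\<^bsub>M\<^esub> b"
    using H.a_repr_independence'[of a b] H.a_rcos_self[OF assms(3)] assms(4) by auto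
  ultimately show ?thesis by simp
qed

lemma coset_self:
  assumes "module R M" "submodule H R M" "a \<in> carrier M"
  shows "a \<in> H +>\<^bsub>M\<^esub> a"
proof -
  interpret H: abelian_subgroup H M using assms(1,2) by (rule submodule_abelian_subgroup)
  show ?thesis using H.a_rcos_self assms(3) by simp
qed

lemma coset_mem:
  assumes "module R M" "submodule H R M" "a \<in> carrier M" "b \<in> H +>\<^bsub>M\<^esub> a"
  shows "b \<in> carrier M" "H +>\<^bsub>M\<^esub> b = H +>\<^bsub>M\<^esub> a"
proof -
  interpret H: abelian_subgroup H M using assms(1,2) by (rule submodule_abelian_subgroup)
  show "b \<in> carrier M" using H.a_elemrcos_carrier assms(3,4) by simp
  show "H +>\<^bsub>M\<^esub> b = H +>\<^bsub>M\<^esub> a" using H.a_repr_independence'[OF assms(4,3)] by simp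
qed

lemma coset_add:
  assumes "module R M" "submodule H R M" "a \<in> carrier M" "b \<in> carrier M"
  shows "(H +>\<^bsub>M\<^esub> a) <+>\<^bsub>M\<^esub> (H +>\<^bsub>M\<^esub> b) = H +>\<^bsub>M\<^esub> (a \<oplus>\<^bsub>M\<^esub> b)"
proof -
  interpret H: abelian_subgroup H M using assms(1,2) by (rule submodule_abelian_subgroup)
  show ?thesis using H.a_rcos_sum assms(3,4) by simp
qed

lemma coset_zero:
  assumes "module R M" "submodule H R M"
  shows "H +>\<^bsub>M\<^esub> \<zero>\<^bsub>M\<^esub> = H"
proof -
  interpret H: abelian_subgroup H M using assms by (rule submodule_abelian_subgroup)
  show ?thesis using H.a_subset by simp
qed

text \<open>Operations on cosets are defined as unions over all representatives. When the summand
  does not depend on the representative, the union collapses to its common value.\<close>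

lemma coset_UN:
  assumes "module R M" "submodule H R M" "a \<in> carrier M"
    and "\<And>b. b \<in> carrier M \<Longrightarrow> H +>\<^bsub>M\<^esub> b = H +>\<^bsub>M\<^esub> a \<Longrightarrow> F b = F a"
  shows "(\<Union>b\<in>H +>\<^bsub>M\<^esub> a. F b) = F a"
  using coset_self[OF assms(1-3)] coset_mem[OF assms(1-3)] assms(4) by blast

lemma quot_module_simps:
  "zero (quot_module M H) = H" "add (quot_module M H) = set_add M"
  by (simp_all add: quot_module_def)

lemma quot_carrier: "carrier (quot_module M H) = (\<lambda>a. H +>\<^bsub>M\<^esub> a) ` carrier M"
  by (auto simp: quot_module_def A_RCOSETS_def')

lemma coset_smult:
  assumes "module R M" "submodule H R M" "r \<in> carrier R" "a \<in> carrier M"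
  shows "r \<odot>\<^bsub>quot_module M H\<^esub> (H +>\<^bsub>M\<^esub> a) = H +>\<^bsub>M\<^esub> (r \<odot>\<^bsub>M\<^esub> a)"
proof -
  interpret M: module R M by fact
  have "(\<Union>k\<in>H +>\<^bsub>M\<^esub> a. H +>\<^bsub>M\<^esub> (r \<odot>\<^bsub>M\<^esub> k)) = H +>\<^bsub>M\<^esub> (r \<odot>\<^bsub>M\<^esub> a)"
  proof (rule coset_UN[OF assms(1,2,4)])
    fix b assume b: "b \<in> carrier M" "H +>\<^bsub>M\<^esub> b = H +>\<^bsub>M\<^esub> a"
    then have "b \<ominus>\<^bsub>M\<^esub> a \<in> H" using coset_eq_iff[OF assms(1,2) b(1) assms(4)] by simp
    then have "r \<odot>\<^bsub>M\<^esub> (b \<ominus>\<^bsub>M\<^esub> a) \<in> H" using submoduleD(4)[OF assms(2,3)] by simp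
    then have "r \<odot>\<^bsub>M\<^esub> b \<ominus>\<^bsub>M\<^esub> r \<odot>\<^bsub>M\<^esub> a \<in> H"
      using assms b by (simp add: M.M.minus_eq M.smult_r_distr M.smult_r_minus)
    then show "H +>\<^bsub>M\<^esub> (r \<odot>\<^bsub>M\<^esub> b) = H +>\<^bsub>M\<^esub> (r \<odot>\<^bsub>M\<^esub> a)"
      using coset_eq_iff[OF assms(1,2)] assms b by simp
  qed
  then show ?thesis by (simp add: quot_module_def)
qed

lemma quot_module_module:
  assumes "module R M" "submodule H R M"
  shows "module R (quot_module M H)"
  by (rule module_surj_image[OF assms(1), of "\<lambda>a. H +>\<^bsub>M\<^esub> a"])
     (use assms in \<open>auto simp: quot_module_simps quot_carrier coset_add coset_smult coset_zero\<close>)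

lemma coset_linear:
  assumes "module R M" "submodule H R M"
  shows "(\<lambda>a. H +>\<^bsub>M\<^esub> a) \<in> linear_maps R M (quot_module M H)"
  by (rule linear_mapsI)
     (use assms in \<open>auto simp: quot_module_simps quot_carrier coset_add coset_smult coset_zero\<close>)

lemma quot_linear:
  assumes "module R M" "submodule H R M" "(\<lambda>a. h (H +>\<^bsub>M\<^esub> a)) \<in> linear_maps R M N"
  shows "h \<in> linear_maps R (quot_module M H) N"
proof (rule linear_mapsI)
  fix K L assume "K \<in> carrier (quot_module M H)" "L \<in> carrier (quot_module M H)"
  then obtain a b where "a \<in> carrier M" "b \<in> carrier M" "K = H +>\<^bsub>M\<^esub> a" "L = H +>\<^bsub>M\<^esub> b"
    by (auto simp: quot_carrier)
  then show "h (K \<oplus>\<^bsub>quot_module M H\<^esub> L) = h K \<oplus>\<^bsub>N\<^esub> h L"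
    using linear_mapsD(2)[OF assms(3)] by (simp add: quot_module_simps coset_add[OF assms(1,2)])
next
  fix K assume "K \<in> carrier (quot_module M H)"
  then obtain a where a: "a \<in> carrier M" "K = H +>\<^bsub>M\<^esub> a" by (auto simp: quot_carrier)
  then show "h K \<in> carrier N" using linear_mapsD(1)[OF assms(3)] by simp
  fix r assume "r \<in> carrier R"
  then show "h (r \<odot>\<^bsub>quot_module M H\<^esub> K) = r \<odot>\<^bsub>N\<^esub> h K"
    using a linear_mapsD(3)[OF assms(3)] by (simp add: coset_smult[OF assms(1,2)])
qed

lemma linear_coset_const:
  assumes "module R F" "submodule H R F" "module R N" "h \<in> linear_maps R F N"
    and "\<And>a. a \<in> H \<Longrightarrow> h a = \<zero>\<^bsub>N\<^esub>" "a \<in> carrier F" "b \<in> carrier F" "H +>\<^bsub>F\<^esub> b = H +>\<^bsub>F\<^esub> a"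
  shows "h b = h a"
proof -
  interpret F: module R F by fact
  interpret N: module R N by fact
  have "b \<ominus>\<^bsub>F\<^esub> a \<in> H" using coset_eq_iff[OF assms(1,2,7,6)] assms(8) by simp
  from assms(5)[OF this] have "h b \<ominus>\<^bsub>N\<^esub> h a = \<zero>\<^bsub>N\<^esub>"
    using linear_mapsD(2)[OF assms(4,7) F.M.a_inv_closed[OF assms(6)]] linear_map_minus[OF assms(4,1,3,6)]
    by (simp add: F.M.minus_eq N.M.minus_eq)
  then show ?thesis
    using module_eq_iff[OF assms(3) linear_mapsD(1)[OF assms(4,7)] linear_mapsD(1)[OF assms(4,6)]] by simp
qed

text \<open>The induced map evaluates \<open>f\<close> at an arbitrarily chosen member of the coset;
  vanishing on \<open>H\<close> makes the choice immaterial.\<close>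

lemma quot_induced:
  assumes "module R M" "submodule H R M" "module R N" "f \<in> linear_maps R M N"
    and "\<And>a. a \<in> H \<Longrightarrow> f a = \<zero>\<^bsub>N\<^esub>"
  shows "\<exists>h\<in>linear_maps R (quot_module M H) N. \<forall>a\<in>carrier M. h (H +>\<^bsub>M\<^esub> a) = f a"
proof -
  let ?h = "\<lambda>K. f (SOME a. a \<in> K)"
  have h: "f a = ?h (H +>\<^bsub>M\<^esub> a)" if a: "a \<in> carrier M" for a
  proof -
    have "(SOME b. b \<in> H +>\<^bsub>M\<^esub> a) \<in> H +>\<^bsub>M\<^esub> a" by (rule someI) (rule coset_self[OF assms(1,2) a])
    from linear_coset_const[OF assms(1-4) assms(5) a coset_mem[OF assms(1,2) a this]] show ?thesis by simp
  qed
  have "?h \<in> linear_maps R (quot_module M H) N"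
    by (rule quot_linear[OF assms(1,2)], rule linear_maps_cong[OF assms(4,1)]) (rule h)
  then show ?thesis by (rule rev_bexI) (simp flip: h)
qed

subsection \<open>Free modules\<close>

lemma free_module_simps:
  "zero (free_module R I) = (\<lambda>_. \<zero>\<^bsub>R\<^esub>)" "add (free_module R I) = (\<lambda>f g i. f i \<oplus>\<^bsub>R\<^esub> g i)"
  "smult (free_module R I) = (\<lambda>r f i. r \<otimes>\<^bsub>R\<^esub> f i)"
  by (simp_all add: free_module_def)

lemma free_module_carrierI:
  "\<lbrakk>\<And>i. f i \<in> carrier R; finite A; A \<subseteq> I; \<And>i. i \<notin> A \<Longrightarrow> f i = \<zero>\<^bsub>R\<^esub>\<rbrakk> \<Longrightarrow> f \<in> carrier (free_module R I)"
  by (auto simp: free_module_def intro: finite_subset[of _ A])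

lemma free_module_carrierD:
  assumes "f \<in> carrier (free_module R I)"
  shows "f i \<in> carrier R" "finite {i. f i \<noteq> \<zero>\<^bsub>R\<^esub>}" "{i. f i \<noteq> \<zero>\<^bsub>R\<^esub>} \<subseteq> I"
  using assms by (auto simp: free_module_def)

lemma free_module_module:
  assumes "cring R"
  shows "module R (free_module R I)"
proof -
  interpret cring R by fact
  let ?F = "free_module R I"
  note simps = free_module_simps
  have supp: "f \<in> carrier ?F \<Longrightarrow> finite {i. f i \<noteq> \<zero>\<^bsub>R\<^esub>}" "f \<in> carrier ?F \<Longrightarrow> i \<notin> I \<Longrightarrow> f i = \<zero>\<^bsub>R\<^esub>"
    "f \<in> carrier ?F \<Longrightarrow> f i \<in> carrier R" for f i
    by (auto simp: free_module_def)
  show ?thesis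
  proof (rule moduleI)
    show "cring R" by fact
    show "abelian_group ?F"
    proof (rule abelian_groupI)
      fix f g assume fg: "f \<in> carrier ?F" "g \<in> carrier ?F"
      show "f \<oplus>\<^bsub>?F\<^esub> g \<in> carrier ?F" unfolding simps
        using fg free_module_carrierD[OF fg(1)] free_module_carrierD[OF fg(2)]
        by (intro free_module_carrierI[of _ R "{i. f i \<noteq> \<zero>\<^bsub>R\<^esub>} \<union> {i. g i \<noteq> \<zero>\<^bsub>R\<^esub>}"]) auto
      show "f \<oplus>\<^bsub>?F\<^esub> g = g \<oplus>\<^bsub>?F\<^esub> f" using supp(3) fg by (auto simp: simps a_comm)
    next
      fix f assume f: "f \<in> carrier ?F"
      show "\<exists>g\<in>carrier ?F. g \<oplus>\<^bsub>?F\<^esub> f = \<zero>\<^bsub>?F\<^esub>"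
        using f free_module_carrierD[OF f] unfolding simps
        by (intro bexI[of _ "\<lambda>i. \<ominus>\<^bsub>R\<^esub> f i"] free_module_carrierI[of _ R "{i. f i \<noteq> \<zero>\<^bsub>R\<^esub>}"]) (auto simp: l_neg)
    qed (use supp(3) in \<open>auto simp: simps a_assoc intro: free_module_carrierI[of _ R "{}"]\<close>)
  next
    fix r f assume rf: "r \<in> carrier R" "f \<in> carrier ?F"
    show "r \<odot>\<^bsub>?F\<^esub> f \<in> carrier ?F" unfolding simps
      using rf free_module_carrierD[OF rf(2)]
      by (intro free_module_carrierI[of _ R "{i. f i \<noteq> \<zero>\<^bsub>R\<^esub>}"]) auto
  qed (use supp(3) in \<open>auto simp: simps l_distr r_distr m_assoc\<close>)
qed

lemma free_gen_closed: "\<lbrakk>cring R; i \<in> I\<rbrakk> \<Longrightarrow> free_gen R i \<in> carrier (free_module R I)"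
  by (rule free_module_carrierI[of _ R "{i}"])
     (auto simp: free_gen_def cring.cring_simprules)

text \<open>Induction over a finite set containing the support rather than over the support itself:
  deleting one coordinate leaves a vector supported in the smaller set.\<close>

lemma free_module_induct [consumes 2, case_names gen zero add smult]:
  assumes R: "cring R" and f: "f \<in> carrier (free_module R I)"
    and gen: "\<And>i. i \<in> I \<Longrightarrow> P (free_gen R i)" and zero: "P \<zero>\<^bsub>free_module R I\<^esub>"
    and add: "\<And>f g. \<lbrakk>f \<in> carrier (free_module R I); g \<in> carrier (free_module R I); P f; P g\<rbrakk>
       \<Longrightarrow> P (f \<oplus>\<^bsub>free_module R I\<^esub> g)"
    and smult: "\<And>r f. \<lbrakk>r \<in> carrier R; f \<in> carrier (free_module R I); P f\<rbrakk>
       \<Longrightarrow> P (r \<odot>\<^bsub>free_module R I\<^esub> f)"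
  shows "P f"
proof -
  interpret cring R by fact
  let ?F = "free_module R I"
  interpret F: module R ?F by (rule free_module_module[OF R])
  have "\<forall>f \<in> carrier ?F. {i. f i \<noteq> \<zero>\<^bsub>R\<^esub>} \<subseteq> A \<longrightarrow> P f" if "finite A" for A
    using that
  proof induction
    case empty
    have "f = \<zero>\<^bsub>?F\<^esub>" if "{i. f i \<noteq> \<zero>\<^bsub>R\<^esub>} \<subseteq> {}" for f
      using that by (auto simp: free_module_simps)
    then show ?case using zero by blast
  next
    case (insert j A)
    show ?case
    proof (intro ballI impI)
      fix f assume f: "f \<in> carrier ?F" "{i. f i \<noteq> \<zero>\<^bsub>R\<^esub>} \<subseteq> insert j A"
      let ?g = "f(j := \<zero>\<^bsub>R\<^esub>)"
      note fD = free_module_carrierD[OF f(1)]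
      have g: "?g \<in> carrier ?F"
        by (rule free_module_carrierI[of _ R "{i. f i \<noteq> \<zero>\<^bsub>R\<^esub>}"]) (use fD in auto)
      have "{i. ?g i \<noteq> \<zero>\<^bsub>R\<^esub>} \<subseteq> A" using f(2) by auto
      then have Pg: "P ?g" using insert.IH g by blast
      show "P f"
      proof (cases "f j = \<zero>\<^bsub>R\<^esub>")
        case True
        then have "?g = f" by auto
        then show ?thesis using Pg by simp
      next
        case False
        then have j: "j \<in> I" using fD(3) by auto
        have "f = ?g \<oplus>\<^bsub>?F\<^esub> (f j \<odot>\<^bsub>?F\<^esub> free_gen R j)"
          using fD(1) by (auto simp: free_module_simps free_gen_def)
        moreover have "P (f j \<odot>\<^bsub>?F\<^esub> free_gen R j)"
          by (rule smult[OF fD(1) free_gen_closed[OF R j] gen[OF j]])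
        moreover have "f j \<odot>\<^bsub>?F\<^esub> free_gen R j \<in> carrier ?F"
          by (rule F.smult_closed[OF fD(1) free_gen_closed[OF R j]])
        ultimately show ?thesis using add[OF g _ Pg] by metis
      qed
    qed
  qed
  from this[OF free_module_carrierD(2)[OF f]] show ?thesis using f by simp
qed

lemma free_linear_eq:
  assumes R: "cring R" and N: "module R N"
    and f: "f \<in> linear_maps R (free_module R I) N" and g: "g \<in> linear_maps R (free_module R I) N"
    and gen: "\<And>i. i \<in> I \<Longrightarrow> f (free_gen R i) = g (free_gen R i)" and a: "a \<in> carrier (free_module R I)"
  shows "f a = g a"
  using R a
proof (induction rule: free_module_induct)
  case (gen i)
  then show ?case by (rule assms(5))
next
  case zero
  show ?case using linear_map_zero[OF f free_module_module[OF R] N] linear_map_zero[OF g free_module_module[OF R] N] by simp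
next
  case (add a b)
  then show ?case using linear_mapsD(2)[OF f] linear_mapsD(2)[OF g] by simp
next
  case (smult r a)
  then show ?case using linear_mapsD(3)[OF f] linear_mapsD(3)[OF g] by simp
qed

definition free_ext ::
  "('r, 'x) ring_scheme \<Rightarrow> ('r, 'm, 'y) module_scheme \<Rightarrow> ('i \<Rightarrow> 'm) \<Rightarrow> ('i \<Rightarrow> 'r) \<Rightarrow> 'm" where
  "free_ext R N \<phi> f = (\<Oplus>\<^bsub>N\<^esub>i\<in>{i. f i \<noteq> \<zero>\<^bsub>R\<^esub>}. f i \<odot>\<^bsub>N\<^esub> \<phi> i)"

text \<open>Two vectors and their sum have different supports; this allows all three extensions to
  be summed over one common finite set.\<close>

lemma free_ext_eq:
  assumes N: "module R N" and \<phi>: "\<phi> \<in> I \<rightarrow> carrier N" and f: "f \<in> carrier (free_module R I)"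
    and A: "finite A" "{i. f i \<noteq> \<zero>\<^bsub>R\<^esub>} \<subseteq> A" "A \<subseteq> I"
  shows "free_ext R N \<phi> f = (\<Oplus>\<^bsub>N\<^esub>i\<in>A. f i \<odot>\<^bsub>N\<^esub> \<phi> i)"
proof -
  interpret N: module R N by fact
  note fD = free_module_carrierD[OF f]
  show ?thesis unfolding free_ext_def
  proof (rule N.M.add.finprod_mono_neutral_cong_left)
    show "(\<lambda>i. f i \<odot>\<^bsub>N\<^esub> \<phi> i) \<in> A \<rightarrow> carrier N" using A \<phi> fD(1) by (auto simp: Pi_iff subset_iff)
  qed (use A \<phi> in \<open>auto simp: Pi_iff subset_iff\<close>)
qed

lemma free_ext_linear:
  assumes N: "module R N" and \<phi>: "\<phi> \<in> I \<rightarrow> carrier N"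
  shows "free_ext R N \<phi> \<in> linear_maps R (free_module R I) N"
proof -
  interpret N: module R N by fact
  let ?F = "free_module R I"
  interpret F: module R ?F by (rule free_module_module) (rule N.R.is_cring)
  show ?thesis
  proof (rule linear_mapsI)
    fix f assume f: "f \<in> carrier ?F"
    note fD = free_module_carrierD[OF f]
    show "free_ext R N \<phi> f \<in> carrier N" unfolding free_ext_def
      by (rule N.M.finsum_closed) (use fD \<phi> in \<open>auto simp: Pi_iff subset_iff\<close>)
    fix r assume r: "r \<in> carrier R"
    have "free_ext R N \<phi> (r \<odot>\<^bsub>?F\<^esub> f) = (\<Oplus>\<^bsub>N\<^esub>i\<in>{i. f i \<noteq> \<zero>\<^bsub>R\<^esub>}. (r \<odot>\<^bsub>?F\<^esub> f) i \<odot>\<^bsub>N\<^esub> \<phi> i)"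
      by (rule free_ext_eq[OF N \<phi>]) (use fD r f F.smult_closed[OF r f] in \<open>auto simp: free_module_simps\<close>)
    also have "\<dots> = (\<Oplus>\<^bsub>N\<^esub>i\<in>{i. f i \<noteq> \<zero>\<^bsub>R\<^esub>}. r \<odot>\<^bsub>N\<^esub> (f i \<odot>\<^bsub>N\<^esub> \<phi> i))"
      by (rule N.M.finsum_cong') (use fD r \<phi> in \<open>auto simp: free_module_simps N.smult_assoc1 Pi_iff subset_iff\<close>)
    also have "\<dots> = r \<odot>\<^bsub>N\<^esub> free_ext R N \<phi> f" unfolding free_ext_def
      by (rule N.finsum_smult_ldistr[symmetric]) (use fD r \<phi> in \<open>auto simp: Pi_iff subset_iff\<close>)
    finally show "free_ext R N \<phi> (r \<odot>\<^bsub>?F\<^esub> f) = r \<odot>\<^bsub>N\<^esub> free_ext R N \<phi> f" .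
  next
    fix f g assume f: "f \<in> carrier ?F" and g: "g \<in> carrier ?F"
    note fD = free_module_carrierD[OF f]
    note gD = free_module_carrierD[OF g]
    let ?A = "{i. f i \<noteq> \<zero>\<^bsub>R\<^esub>} \<union> {i. g i \<noteq> \<zero>\<^bsub>R\<^esub>}"
    have A: "finite ?A" "?A \<subseteq> I" using fD gD by auto
    have "free_ext R N \<phi> (f \<oplus>\<^bsub>?F\<^esub> g) = (\<Oplus>\<^bsub>N\<^esub>i\<in>?A. (f \<oplus>\<^bsub>?F\<^esub> g) i \<odot>\<^bsub>N\<^esub> \<phi> i)"
      by (rule free_ext_eq[OF N \<phi> _ A(1) _ A(2)]) (use F.M.a_closed[OF f g] in \<open>auto simp: free_module_simps\<close>)
    also have "\<dots> = (\<Oplus>\<^bsub>N\<^esub>i\<in>?A. f i \<odot>\<^bsub>N\<^esub> \<phi> i \<oplus>\<^bsub>N\<^esub> g i \<odot>\<^bsub>N\<^esub> \<phi> i)"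
      by (rule N.M.finsum_cong')
         (use fD gD A \<phi> in \<open>auto simp: free_module_simps N.smult_l_distr Pi_iff subset_iff\<close>)
    also have "\<dots> = (\<Oplus>\<^bsub>N\<^esub>i\<in>?A. f i \<odot>\<^bsub>N\<^esub> \<phi> i) \<oplus>\<^bsub>N\<^esub> (\<Oplus>\<^bsub>N\<^esub>i\<in>?A. g i \<odot>\<^bsub>N\<^esub> \<phi> i)"
      by (rule N.M.finsum_addf) (use fD gD A \<phi> in \<open>auto simp: Pi_iff subset_iff\<close>)
    also have "(\<Oplus>\<^bsub>N\<^esub>i\<in>?A. f i \<odot>\<^bsub>N\<^esub> \<phi> i) = free_ext R N \<phi> f"
      by (rule free_ext_eq[OF N \<phi> f A(1) _ A(2), symmetric]) auto
    also have "(\<Oplus>\<^bsub>N\<^esub>i\<in>?A. g i \<odot>\<^bsub>N\<^esub> \<phi> i) = free_ext R N \<phi> g"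
      by (rule free_ext_eq[OF N \<phi> g A(1) _ A(2), symmetric]) auto
    finally show "free_ext R N \<phi> (f \<oplus>\<^bsub>?F\<^esub> g) = free_ext R N \<phi> f \<oplus>\<^bsub>N\<^esub> free_ext R N \<phi> g" .
  qed
qed

lemma free_ext_gen:
  assumes N: "module R N" and "i \<in> I" "\<phi> \<in> I \<rightarrow> carrier N"
  shows "free_ext R N \<phi> (free_gen R i) = \<phi> i"
proof -
  interpret N: module R N by fact
  have \<phi>: "\<phi> i \<in> carrier N" using assms by auto
  have "free_ext R N \<phi> (free_gen R i) = (\<Oplus>\<^bsub>N\<^esub>j\<in>{i}. free_gen R i j \<odot>\<^bsub>N\<^esub> \<phi> j)"
    by (rule free_ext_eq[OF N assms(3) free_gen_closed[OF N.R.is_cring assms(2)]])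
       (use assms(2) in \<open>auto simp: free_gen_def split: if_splits\<close>)
  also have "\<dots> = free_gen R i i \<odot>\<^bsub>N\<^esub> \<phi> i"
    by (subst N.M.finsum_insert) (use \<phi> in \<open>auto simp: free_gen_def\<close>)
  finally show ?thesis using \<phi> by (simp add: free_gen_def)
qed

section \<open>Functors and their restriction to one object\<close>

lemma full_subcat_simps [simp]:
  "Ob (full_subcat C A) = Ob C \<inter> A" "Arr (full_subcat C A) = Arr C"
  "ident (full_subcat C A) = ident C" "cmp (full_subcat C A) = cmp C"
  by (simp_all add: full_subcat_def)

lemma full_subcat_category: "category C \<Longrightarrow> category (full_subcat C A)"
  by (simp add: category_def)

lemma full_subcat_functor: "module_functor R C F \<Longrightarrow> module_functor R (full_subcat C A) F"
  by (simp add: module_functor_def)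

lemma modfun_isoI:
  assumes "\<And>x. x \<in> Ob C \<Longrightarrow> \<eta> x \<in> linear_maps R (fob F x) (fob G x)"
    and "\<And>x. x \<in> Ob C \<Longrightarrow> bij_betw (\<eta> x) (carrier (fob F x)) (carrier (fob G x))"
    and "\<And>x y f a. \<lbrakk>x \<in> Ob C; y \<in> Ob C; f \<in> Arr C x y; a \<in> carrier (fob F x)\<rbrakk>
       \<Longrightarrow> \<eta> y (far F x y f a) = far G x y f (\<eta> x a)"
  shows "modfun_iso R C F G"
  using assms unfolding modfun_iso_def by blast

text \<open>\<open>modfun_iso\<close> with its witness made explicit, so that the properties of one
  chosen family can be used as rules.\<close>

definition modfun_iso_by ::
  "'r ring \<Rightarrow> ('o, 'a, 'more) category_scheme \<Rightarrow> ('o, 'a, 'r, 'm) modfun \<Rightarrow> ('o, 'a, 'r, 'n) modfun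
    \<Rightarrow> ('o \<Rightarrow> 'm \<Rightarrow> 'n) \<Rightarrow> bool" where
  "modfun_iso_by R C F G \<eta> \<longleftrightarrow>
     (\<forall>x\<in>Ob C. \<eta> x \<in> linear_maps R (fob F x) (fob G x) \<and> bij_betw (\<eta> x) (carrier (fob F x)) (carrier (fob G x))) \<and>
     (\<forall>x\<in>Ob C. \<forall>y\<in>Ob C. \<forall>f\<in>Arr C x y. \<forall>a\<in>carrier (fob F x). \<eta> y (far F x y f a) = far G x y f (\<eta> x a))"

lemma modfun_isoE:
  assumes "modfun_iso R C F G"
  obtains \<eta> where "modfun_iso_by R C F G \<eta>"
  using assms unfolding modfun_iso_def modfun_iso_by_def[symmetric] by (elim exE)

lemma modfun_iso_byD:
  assumes "modfun_iso_by R C F G \<eta>"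
  shows "x \<in> Ob C \<Longrightarrow> \<eta> x \<in> linear_maps R (fob F x) (fob G x)"
    and "x \<in> Ob C \<Longrightarrow> bij_betw (\<eta> x) (carrier (fob F x)) (carrier (fob G x))"
    and "\<lbrakk>x \<in> Ob C; y \<in> Ob C; f \<in> Arr C x y; a \<in> carrier (fob F x)\<rbrakk> \<Longrightarrow> \<eta> y (far F x y f a) = far G x y f (\<eta> x a)"
  using assms by (simp_all add: modfun_iso_by_def)

lemma modfun_iso_subcat: "modfun_iso R C F G \<Longrightarrow> modfun_iso R (full_subcat C A) F G"
  unfolding modfun_iso_def by auto

lemma modfun_iso_refl: "modfun_iso R C F F"
  by (rule modfun_isoI[where \<eta> = "\<lambda>_ a. a"]) (auto simp: linear_maps_def bij_betw_def)

lemma modfun_iso_trans: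
  assumes "modfun_iso R C F G" "modfun_iso R C G H"
  shows "modfun_iso R C F H"
proof -
  from assms(1) obtain \<eta> where "modfun_iso_by R C F G \<eta>" by (rule modfun_isoE)
  note \<eta> = modfun_iso_byD[OF this]
  from assms(2) obtain \<theta> where "modfun_iso_by R C G H \<theta>" by (rule modfun_isoE)
  note \<theta> = modfun_iso_byD[OF this]
  show ?thesis
  proof (rule modfun_isoI[where \<eta> = "\<lambda>x a. \<theta> x (\<eta> x a)"])
    fix x assume x: "x \<in> Ob C"
    show "(\<lambda>a. \<theta> x (\<eta> x a)) \<in> linear_maps R (fob F x) (fob H x)"
      by (rule linear_maps_comp[OF \<eta>(1)[OF x] \<theta>(1)[OF x]])
    show "bij_betw (\<lambda>a. \<theta> x (\<eta> x a)) (carrier (fob F x)) (carrier (fob H x))"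
      using bij_betw_trans[OF \<eta>(2)[OF x] \<theta>(2)[OF x]] by (simp add: o_def)
  next
    fix x y f a assume x: "x \<in> Ob C" "y \<in> Ob C" "f \<in> Arr C x y" "a \<in> carrier (fob F x)"
    show "\<theta> y (\<eta> y (far F x y f a)) = far H x y f (\<theta> x (\<eta> x a))"
      using \<eta>(3)[OF x] \<theta>(3)[OF x(1-3) linear_mapsD(1)[OF \<eta>(1)[OF x(1)] x(4)]] by simp
  qed
qed

lemma modfun_iso_sym:
  assumes "modfun_iso R C F G" "module_functor R C F"
  shows "modfun_iso R C G F"
proof -
  interpret F: module_functor R C F by fact
  from assms(1) obtain \<eta> where "modfun_iso_by R C F G \<eta>" by (rule modfun_isoE)
  note \<eta> = modfun_iso_byD[OF this]
  let ?\<theta> = "\<lambda>x. inv_into (carrier (fob F x)) (\<eta> x)"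
  show ?thesis
  proof (rule modfun_isoI[where \<eta> = ?\<theta>])
    fix x assume x: "x \<in> Ob C"
    show "?\<theta> x \<in> linear_maps R (fob G x) (fob F x)"
      by (rule linear_map_inverse[OF \<eta>(1,2)[OF x] F.fob_module[OF x]])
    show "bij_betw (?\<theta> x) (carrier (fob G x)) (carrier (fob F x))"
      by (rule bij_betw_inv_into[OF \<eta>(2)[OF x]])
  next
    fix x y f b assume x: "x \<in> Ob C" "y \<in> Ob C" "f \<in> Arr C x y" "b \<in> carrier (fob G x)"
    then obtain a where a: "a \<in> carrier (fob F x)" "b = \<eta> x a"
      using \<eta>(2)[OF x(1)] unfolding bij_betw_def by blast
    have "far F x y f a \<in> carrier (fob F y)"
      by (rule linear_mapsD(1)[OF F.far_linear[OF x(1-3)] a(1)])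
    then have "?\<theta> y (\<eta> y (far F x y f a)) = far F x y f a" "?\<theta> x b = a"
      using \<eta>(2) x(1,2) a by (simp_all add: bij_betw_def inv_into_f_f)
    then show "?\<theta> y (far G x y f b) = far F x y f (?\<theta> x b)"
      using \<eta>(3)[OF x(1-3) a(1)] a(2) by simp
  qed
qed

lemma simple_functorD:
  assumes "simple_functor R C F"
  shows "module_functor R C F"
    and "subfunctor R C F P \<Longrightarrow>
      (\<forall>x\<in>Ob C. P x = {\<zero>\<^bsub>fob F x\<^esub>}) \<or> (\<forall>x\<in>Ob C. P x = carrier (fob F x))"
  using assms by (auto simp: simple_functor_def)

lemma vanishes_iso:
  assumes "\<eta> \<in> linear_maps R (fob F x) (fob G y)" "bij_betw \<eta> (carrier (fob F x)) (carrier (fob G y))"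
    "module R (fob F x)" "module R (fob G y)"
  shows "vanishes_at F x \<longleftrightarrow> vanishes_at G y"
proof
  assume "vanishes_at F x"
  then show "vanishes_at G y"
    using assms(2) linear_map_zero[OF assms(1,3,4)] by (auto simp: vanishes_at_def bij_betw_def)
next
  assume G: "vanishes_at G y"
  have "a = \<zero>\<^bsub>fob F x\<^esub>" if "a \<in> carrier (fob F x)" for a
  proof -
    have "\<eta> a = \<zero>\<^bsub>fob G y\<^esub>" using assms(2) that G by (auto simp: vanishes_at_def bij_betw_def)
    then show ?thesis
      using assms(2) that linear_map_zero[OF assms(1,3,4)] module_zero_closed[OF assms(3)]
        inj_onD[of \<eta> "carrier (fob F x)" a "\<zero>\<^bsub>fob F x\<^esub>"] by (simp add: bij_betw_def)
  qed
  then have "carrier (fob F x) \<subseteq> {\<zero>\<^bsub>fob F x\<^esub>}" by blast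
  then show "vanishes_at F x" using module_zero_closed[OF assms(3)] by (auto simp: vanishes_at_def)
qed

lemma modfun_iso_vanishes:
  assumes "modfun_iso R C F G" "module_functor R C F" "module_functor R C G" "x \<in> Ob C"
  shows "vanishes_at F x \<longleftrightarrow> vanishes_at G x"
proof -
  from assms(1) obtain \<eta> where "modfun_iso_by R C F G \<eta>" by (rule modfun_isoE)
  note \<eta> = modfun_iso_byD[OF this]
  show ?thesis
    by (rule vanishes_iso[OF \<eta>(1,2)[OF assms(4)]])
       (rule module_functor.fob_module[OF assms(2,4)] module_functor.fob_module[OF assms(3,4)])+
qed

text \<open>A subfunctor of \<open>G\<close> pulls back along the isomorphism to a subfunctor of
  \<open>F\<close>, and by surjectivity it is the image of its pullback, so the dichotomy for
  \<open>F\<close> transfers.\<close>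

lemma simple_functor_iso:
  assumes "modfun_iso R C F G" "simple_functor R C F" "module_functor R C G"
  shows "simple_functor R C G"
proof -
  interpret F: module_functor R C F using simple_functorD(1)[OF assms(2)] .
  interpret G: module_functor R C G by fact
  from assms(1) obtain \<eta> where "modfun_iso_by R C F G \<eta>" by (rule modfun_isoE)
  note \<eta> = modfun_iso_byD[OF this]
  have img: "\<eta> x ` carrier (fob F x) = carrier (fob G x)" if "x \<in> Ob C" for x
    using \<eta>(2)[OF that] by (simp add: bij_betw_def)
  have "(\<forall>x\<in>Ob C. Q x = {\<zero>\<^bsub>fob G x\<^esub>}) \<or> (\<forall>x\<in>Ob C. Q x = carrier (fob G x))"
    if Q: "subfunctor R C G Q" for Q
  proof -
    let ?P = "\<lambda>x. {a \<in> carrier (fob F x). \<eta> x a \<in> Q x}"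
    have Qsub: "submodule (Q x) R (fob G x)" if "x \<in> Ob C" for x
      using Q that by (simp add: subfunctor_def)
    have eq: "Q x = \<eta> x ` ?P x" if x: "x \<in> Ob C" for x
    proof -
      have "Q x \<subseteq> carrier (fob G x)" using submoduleD(1)[OF Qsub[OF x]] by blast
      then have "Q x \<subseteq> \<eta> x ` carrier (fob F x)" using img[OF x] by simp
      then show ?thesis by auto
    qed
    have "subfunctor R C F ?P" unfolding subfunctor_def
    proof (intro conjI ballI)
      fix x assume x: "x \<in> Ob C"
      show "submodule (?P x) R (fob F x)"
        by (rule submodule_vimage[OF \<eta>(1)[OF x] F.fob_module[OF x] G.fob_module[OF x] Qsub[OF x]])
    next
      fix x y f assume xy: "x \<in> Ob C" "y \<in> Ob C" "f \<in> Arr C x y"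
      show "far F x y f ` ?P x \<subseteq> ?P y"
      proof
        fix b assume "b \<in> far F x y f ` ?P x"
        then obtain a where a: "a \<in> carrier (fob F x)" "\<eta> x a \<in> Q x" "b = far F x y f a" by blast
        have "far G x y f (\<eta> x a) \<in> Q y" using Q xy a(2) unfolding subfunctor_def by blast
        then show "b \<in> ?P y"
          using a \<eta>(3)[OF xy a(1)] linear_mapsD(1)[OF F.far_linear[OF xy] a(1)] by simp
      qed
    qed
    from simple_functorD(2)[OF assms(2) this] show ?thesis
    proof
      assume P: "\<forall>x\<in>Ob C. ?P x = {\<zero>\<^bsub>fob F x\<^esub>}"
      have "Q x = {\<zero>\<^bsub>fob G x\<^esub>}" if x: "x \<in> Ob C" for x
        using eq[OF x] P[rule_format, OF x] linear_map_zero[OF \<eta>(1)[OF x] F.fob_module[OF x] G.fob_module[OF x]]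
        by simp
      then show ?thesis by blast
    next
      assume P: "\<forall>x\<in>Ob C. ?P x = carrier (fob F x)"
      have "Q x = carrier (fob G x)" if x: "x \<in> Ob C" for x
        using eq[OF x] P[rule_format, OF x] img[OF x] by simp
      then show ?thesis by blast
    qed
  qed
  moreover have "\<exists>x\<in>Ob C. \<not> vanishes_at G x"
    using assms modfun_iso_vanishes[OF assms(1) F.module_functor_axioms assms(3)]
    by (simp add: simple_functor_def)
  ultimately show ?thesis using assms(3) by (simp add: simple_functor_def)
qed

section \<open>Subfunctors generated at one object or invisible from it\<close>

definition generated ::
  "'r ring \<Rightarrow> ('o, 'a, 'more) category_scheme \<Rightarrow> ('o, 'a, 'r, 'm) modfun \<Rightarrow> 'o \<Rightarrow> 'm set \<Rightarrow> 'o \<Rightarrow> 'm set" where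
  "generated R C F x W y = submodule_span R (fob F y) {far F x y a w | a w. a \<in> Arr C x y \<and> w \<in> W}"

text \<open>For a functor \<open>F\<close> this is the largest subfunctor that is zero at
  \<open>x\<close>: elements of such a subfunctor are killed by every arrow to \<open>x\<close>, and
  at \<open>x\<close> itself the identity arrow leaves only zero.\<close>

definition annihilated ::
  "('o, 'a, 'more) category_scheme \<Rightarrow> ('o, 'a, 'r, 'm) modfun \<Rightarrow> 'o \<Rightarrow> 'o \<Rightarrow> 'm set" where
  "annihilated C F x y = {w \<in> carrier (fob F y). \<forall>b\<in>Arr C y x. far F y x b w = \<zero>\<^bsub>fob F x\<^esub>}"

locale functor_at = category C + F: module_functor R C F
  for R :: "'r ring" and C :: "('o, 'a, 'more) category_scheme" and F :: "('o, 'a, 'r, 'm) modfun" +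
  fixes X :: 'o
  assumes X: "X \<in> Ob C"
begin

lemma far_closed: "\<lbrakk>x \<in> Ob C; y \<in> Ob C; f \<in> Arr C x y; a \<in> carrier (fob F x)\<rbrakk> \<Longrightarrow> far F x y f a \<in> carrier (fob F y)"
  by (rule linear_mapsD(1)[OF F.far_linear])

lemma far_zero: "\<lbrakk>x \<in> Ob C; y \<in> Ob C; f \<in> Arr C x y\<rbrakk> \<Longrightarrow> far F x y f \<zero>\<^bsub>fob F x\<^esub> = \<zero>\<^bsub>fob F y\<^esub>"
  by (rule linear_map_zero[OF F.far_linear F.fob_module F.fob_module])

context
  fixes W assumes W: "W \<subseteq> carrier (fob F X)"
begin

lemma generators_closed:
  "y \<in> Ob C \<Longrightarrow> {far F X y a w | a w. a \<in> Arr C X y \<and> w \<in> W} \<subseteq> carrier (fob F y)"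
  using far_closed[OF X] W by blast

lemma generated_subfunctor: "subfunctor R C F (generated R C F X W)"
  unfolding subfunctor_def
proof (intro conjI ballI)
  fix x assume x: "x \<in> Ob C"
  show "submodule (generated R C F X W x) R (fob F x)"
    unfolding generated_def by (rule span_submodule[OF F.fob_module[OF x] generators_closed[OF x]])
next
  fix x y f assume x: "x \<in> Ob C" and y: "y \<in> Ob C" and f: "f \<in> Arr C x y"
  \<comment> \<open>The preimage under \<open>f\<close> of the generated submodule at
    \<open>y\<close> is a submodule. It contains the generators at \<open>x\<close> because an arrow
    from \<open>X\<close> followed by \<open>f\<close> is again an arrow from
    \<open>X\<close>.\<close>
  let ?V = "{a \<in> carrier (fob F x). far F x y f a \<in> generated R C F X W y}"
  have "submodule ?V R (fob F x)"
    by (rule submodule_vimage[OF F.far_linear[OF x y f] F.fob_module[OF x] F.fob_module[OF y]])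
       (auto simp: generated_def intro!: span_submodule[OF F.fob_module[OF y] generators_closed[OF y]])
  moreover have "{far F X x a w | a w. a \<in> Arr C X x \<and> w \<in> W} \<subseteq> ?V"
  proof
    fix z assume "z \<in> {far F X x a w | a w. a \<in> Arr C X x \<and> w \<in> W}"
    then obtain a w where aw: "a \<in> Arr C X x" "w \<in> W" "z = far F X x a w" by blast
    then have "far F x y f z = far F X y (cmp C X x y f a) w"
      using F.far_cmp[OF X x y aw(1) f] W by auto
    moreover have "far F X y (cmp C X x y f a) w \<in> generated R C F X W y" unfolding generated_def
      by (rule subsetD[OF span_superset]) (use cmp_in[OF X x y aw(1) f] aw(2) in blast)
    ultimately show "z \<in> ?V" using generators_closed[OF x] aw by auto
  qed
  ultimately have "generated R C F X W x \<subseteq> ?V" unfolding generated_def by (rule span_least)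
  then show "far F x y f ` generated R C F X W x \<subseteq> generated R C F X W y" by blast
qed

lemma generated_self: "W \<subseteq> generated R C F X W X"
proof
  fix w assume w: "w \<in> W"
  then have "far F X X (ident C X) w = w" using F.far_ident[OF X] W by blast
  then have "w \<in> {far F X X a w | a w. a \<in> Arr C X X \<and> w \<in> W}" using ident_in[OF X] w by force
  then show "w \<in> generated R C F X W X" unfolding generated_def by (rule subsetD[OF span_superset])
qed

end

lemma generated_simple:
  assumes "simple_functor R C F" "W \<subseteq> carrier (fob F X)" "w \<in> W" "w \<noteq> \<zero>\<^bsub>fob F X\<^esub>" "y \<in> Ob C"
  shows "generated R C F X W y = carrier (fob F y)"
  using simple_functorD(2)[OF assms(1) generated_subfunctor[OF assms(2)]] generated_self[OF assms(2)]
    assms(3-5) X by blast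

lemma annihilated_subfunctor: "subfunctor R C F (annihilated C F X)"
  unfolding subfunctor_def
proof (intro conjI ballI)
  fix y assume y: "y \<in> Ob C"
  show "submodule (annihilated C F X y) R (fob F y)"
  proof (rule submodule_criterion[OF F.fob_module[OF y]])
    interpret Y: module R "fob F y" by (rule F.fob_module[OF y])
    interpret M: module R "fob F X" by (rule F.fob_module[OF X])
    show "annihilated C F X y \<subseteq> carrier (fob F y)" by (auto simp: annihilated_def)
    show "\<zero>\<^bsub>fob F y\<^esub> \<in> annihilated C F X y" using far_zero[OF y X] by (simp add: annihilated_def)
    fix a b assume ab: "a \<in> annihilated C F X y" "b \<in> annihilated C F X y"
    then show "a \<oplus>\<^bsub>fob F y\<^esub> b \<in> annihilated C F X y"
      by (simp add: annihilated_def linear_mapsD(2)[OF F.far_linear[OF y X]])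
  next
    interpret Y: module R "fob F y" by (rule F.fob_module[OF y])
    interpret M: module R "fob F X" by (rule F.fob_module[OF X])
    fix r a assume "r \<in> carrier R" "a \<in> annihilated C F X y"
    then show "r \<odot>\<^bsub>fob F y\<^esub> a \<in> annihilated C F X y"
      by (simp add: annihilated_def linear_mapsD(3)[OF F.far_linear[OF y X]])
  qed
next
  fix x y f assume x: "x \<in> Ob C" and y: "y \<in> Ob C" and f: "f \<in> Arr C x y"
  show "far F x y f ` annihilated C F X x \<subseteq> annihilated C F X y"
  proof
    fix z assume "z \<in> far F x y f ` annihilated C F X x"
    then obtain w where w: "w \<in> carrier (fob F x)" "z = far F x y f w"
      "\<And>b. b \<in> Arr C x X \<Longrightarrow> far F x X b w = \<zero>\<^bsub>fob F X\<^esub>" by (auto simp: annihilated_def)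
    have "far F y X b z = \<zero>\<^bsub>fob F X\<^esub>" if b: "b \<in> Arr C y X" for b
      using F.far_cmp[OF x y X f b w(1)] w(2) w(3)[OF cmp_in[OF x y X f b]] by simp
    then show "z \<in> annihilated C F X y" using far_closed[OF x y f w(1)] w(2) by (simp add: annihilated_def)
  qed
qed

text \<open>At \<open>X\<close> the identity arrow forces annihilated elements to be zero, so this
  subfunctor is not everything and must vanish.\<close>

lemma annihilated_simple:
  assumes "simple_functor R C F" "\<not> vanishes_at F X" "y \<in> Ob C"
  shows "annihilated C F X y = {\<zero>\<^bsub>fob F y\<^esub>}"
proof -
  have "annihilated C F X X \<subseteq> {\<zero>\<^bsub>fob F X\<^esub>}"
    using F.far_ident[OF X] ident_in[OF X] by (auto simp: annihilated_def)
  moreover have "\<zero>\<^bsub>fob F X\<^esub> \<in> carrier (fob F X)" by (rule module_zero_closed[OF F.fob_module[OF X]])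
  ultimately have "annihilated C F X X \<noteq> carrier (fob F X)"
    using assms(2) by (auto simp: vanishes_at_def)
  then show ?thesis
    using simple_functorD(2)[OF assms(1) annihilated_subfunctor] assms(3) X by blast
qed

text \<open>The difference of \<open>s\<close> and \<open>t\<close> is annihilated. Hence arrows
  into \<open>X\<close> detect all elements of a simple functor; this gives uniqueness in all later
  extensions from \<open>X\<close>.\<close>

lemma separated:
  assumes "simple_functor R C F" "\<not> vanishes_at F X" "y \<in> Ob C"
    and st: "s \<in> carrier (fob F y)" "t \<in> carrier (fob F y)"
    and eq: "\<And>b. b \<in> Arr C y X \<Longrightarrow> far F y X b s = far F y X b t"
  shows "s = t"
proof -
  note Y = F.fob_module[OF assms(3)]
  interpret Y: module R "fob F y" by (rule Y)
  interpret M: module R "fob F X" by (rule F.fob_module[OF X])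
  have "far F y X b (s \<ominus>\<^bsub>fob F y\<^esub> t) = \<zero>\<^bsub>fob F X\<^esub>" if b: "b \<in> Arr C y X" for b
    using st eq[OF b] linear_mapsD(2)[OF F.far_linear[OF assms(3) X b]] far_closed[OF assms(3) X b]
      linear_map_minus[OF F.far_linear[OF assms(3) X b] Y F.fob_module[OF X]]
    by (simp add: Y.M.minus_eq M.M.r_neg)
  then have "s \<ominus>\<^bsub>fob F y\<^esub> t \<in> annihilated C F X y" using st by (simp add: annihilated_def)
  then show ?thesis using annihilated_simple[OF assms(1-3)] module_eq_iff[OF Y st] by simp
qed

text \<open>An invariant submodule \<open>P X\<close> already contains everything it generates at
  \<open>X\<close>. If it is non-zero, it generates the whole functor, so it equals the value at
  \<open>X\<close>.\<close>

lemma simple_restrict: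
  assumes "simple_functor R C F" "\<not> vanishes_at F X"
  shows "simple_functor R (full_subcat C {X}) F"
proof -
  let ?C = "full_subcat C {X}"
  have "(\<forall>x\<in>Ob ?C. P x = {\<zero>\<^bsub>fob F x\<^esub>}) \<or> (\<forall>x\<in>Ob ?C. P x = carrier (fob F x))"
    if P: "subfunctor R ?C F P" for P
  proof -
    have sub: "submodule (P X) R (fob F X)"
      and stable: "\<And>f. f \<in> Arr C X X \<Longrightarrow> far F X X f ` P X \<subseteq> P X"
      using P X by (auto simp: subfunctor_def)
    have PX: "P X \<subseteq> carrier (fob F X)" using submoduleD(1)[OF sub] by blast
    show ?thesis
    proof (cases "P X = {\<zero>\<^bsub>fob F X\<^esub>}")
      case True
      then show ?thesis by simp
    next
      case False
      then obtain w where w: "w \<in> P X" "w \<noteq> \<zero>\<^bsub>fob F X\<^esub>" using submoduleD(2)[OF sub] by blast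
      have "generated R C F X (P X) X \<subseteq> P X" unfolding generated_def
        by (rule span_least[OF sub]) (use stable in blast)
      then have "P X = carrier (fob F X)"
        using generated_simple[OF assms(1) PX w X] PX by blast
      then show ?thesis by simp
    qed
  qed
  moreover have "\<exists>x\<in>Ob ?C. \<not> vanishes_at F x" using X assms(2) by simp
  ultimately show ?thesis
    using full_subcat_functor[OF F.module_functor_axioms] by (simp add: simple_functor_def)
qed

end

subsection \<open>Subquotients\<close>

lemma a_r_coset_carrier_update: "N +>\<^bsub>M\<lparr>carrier := P\<rparr>\<^esub> a = N +>\<^bsub>M\<^esub> a"
  by (simp add: a_r_coset_def r_coset_def)

lemma submodule_restrict:
  assumes "module R M" "submodule P R M" "submodule Q R M" "Q \<subseteq> P"
  shows "submodule Q R (M\<lparr>carrier := P\<rparr>)"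
  by (rule submodule_criterion[OF submodule_module[OF assms(1,2)]])
     (use assms(4) submoduleD[OF assms(3)] in auto)

text \<open>The first isomorphism theorem carried out at each object, together with naturality:
  \<open>T\<close> is the image of \<open>P\<close> under \<open>\<pi>\<close>, whose kernel is
  \<open>Q\<close>.\<close>

lemma subquotient_isoI:
  assumes F: "module_functor R C F" and T: "module_functor R C T"
    and P: "subfunctor R C F P" and Q: "subfunctor R C F Q" and QP: "\<And>x. x \<in> Ob C \<Longrightarrow> Q x \<subseteq> P x"
    and lin: "\<And>x. x \<in> Ob C \<Longrightarrow> \<pi> x \<in> linear_maps R ((fob F x)\<lparr>carrier := P x\<rparr>) (fob T x)"
    and surj: "\<And>x. x \<in> Ob C \<Longrightarrow> \<pi> x ` P x = carrier (fob T x)"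
    and ker: "\<And>x a. \<lbrakk>x \<in> Ob C; a \<in> P x\<rbrakk> \<Longrightarrow> \<pi> x a = \<zero>\<^bsub>fob T x\<^esub> \<longleftrightarrow> a \<in> Q x"
    and nat: "\<And>x y f a. \<lbrakk>x \<in> Ob C; y \<in> Ob C; f \<in> Arr C x y; a \<in> P x\<rbrakk>
       \<Longrightarrow> \<pi> y (far F x y f a) = far T x y f (\<pi> x a)"
  shows "modfun_iso R C T (subquotient F P Q)"
proof -
  let ?M = "\<lambda>x. (fob F x)\<lparr>carrier := P x\<rparr>"
  let ?Q = "\<lambda>x. quot_module (?M x) (Q x)"
  note Fm = module_functor.fob_module[OF F] and Tm = module_functor.fob_module[OF T]
  have Psub: "submodule (P x) R (fob F x)" if "x \<in> Ob C" for x using P that by (simp add: subfunctor_def)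
  have Qsub: "submodule (Q x) R (fob F x)" if "x \<in> Ob C" for x using Q that by (simp add: subfunctor_def)
  have Mm: "module R (?M x)" if "x \<in> Ob C" for x by (rule submodule_module[OF Fm[OF that] Psub[OF that]])
  have Ms: "submodule (Q x) R (?M x)" if "x \<in> Ob C" for x
    by (rule submodule_restrict[OF Fm[OF that] Psub[OF that] Qsub[OF that] QP[OF that]])
  note Qm = quot_module_module[OF Mm Ms]
  have "\<exists>h. h \<in> linear_maps R (?Q x) (fob T x) \<and> bij_betw h (carrier (?Q x)) (carrier (fob T x)) \<and>
      (\<forall>a\<in>P x. h (Q x +>\<^bsub>?M x\<^esub> a) = \<pi> x a)" if x: "x \<in> Ob C" for x
  proof -
    have "\<exists>h\<in>linear_maps R (?Q x) (fob T x). \<forall>a\<in>carrier (?M x). h (Q x +>\<^bsub>?M x\<^esub> a) = \<pi> x a"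
      by (rule quot_induced[OF Mm[OF x] Ms[OF x] Tm[OF x] lin[OF x]]) (rule iffD2[OF ker[OF x subsetD[OF QP[OF x]]]])
    then obtain h where h: "h \<in> linear_maps R (?Q x) (fob T x)" "\<And>a. a \<in> P x \<Longrightarrow> h (Q x +>\<^bsub>?M x\<^esub> a) = \<pi> x a" by auto
    have "inj_on h (carrier (?Q x))"
    proof (rule linear_map_inj[OF h(1) Qm[OF x x] Tm[OF x]])
      fix K assume "K \<in> carrier (?Q x)" "h K = \<zero>\<^bsub>fob T x\<^esub>"
      then obtain a where a: "a \<in> P x" "K = Q x +>\<^bsub>?M x\<^esub> a" "a \<in> Q x" using h(2) ker[OF x] by (auto simp: quot_carrier)
      have "Q x +>\<^bsub>?M x\<^esub> a = Q x +>\<^bsub>?M x\<^esub> \<zero>\<^bsub>?M x\<^esub>"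
        by (rule coset_mem(2)[OF Mm[OF x] Ms[OF x] module_zero_closed[OF Mm[OF x]]])
           (simp only: coset_zero[OF Mm[OF x] Ms[OF x]] a(3))
      then show "K = \<zero>\<^bsub>?Q x\<^esub>" using coset_zero[OF Mm[OF x] Ms[OF x]] a(2) by (simp add: quot_module_simps)
    qed
    moreover have "h ` carrier (?Q x) = carrier (fob T x)"
      unfolding surj[OF x, symmetric] quot_carrier image_image by (rule image_cong) (simp_all add: h(2))
    ultimately show ?thesis using h by (auto simp: bij_betw_def)
  qed
  then have "\<forall>x\<in>Ob C. \<exists>h. h \<in> linear_maps R (?Q x) (fob T x) \<and> bij_betw h (carrier (?Q x)) (carrier (fob T x)) \<and>
      (\<forall>a\<in>P x. h (Q x +>\<^bsub>?M x\<^esub> a) = \<pi> x a)" by (rule ballI)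
  from bchoice[OF this] obtain h where
    h: "\<forall>x\<in>Ob C. h x \<in> linear_maps R (?Q x) (fob T x) \<and> bij_betw (h x) (carrier (?Q x)) (carrier (fob T x)) \<and>
      (\<forall>a\<in>P x. h x (Q x +>\<^bsub>?M x\<^esub> a) = \<pi> x a)" by (rule exE)
  \<comment> \<open>The induced maps \<open>h x\<close> go from the quotient to \<open>T\<close>;
    the isomorphism is wanted in the other direction.\<close>
  define \<eta> where "\<eta> x = inv_into (carrier (?Q x)) (h x)" for x
  have hD: "h x \<in> linear_maps R (?Q x) (fob T x)" "bij_betw (h x) (carrier (?Q x)) (carrier (fob T x))"
    "\<And>a. a \<in> P x \<Longrightarrow> h x (Q x +>\<^bsub>?M x\<^esub> a) = \<pi> x a" if "x \<in> Ob C" for x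
    using bspec[OF h that] by simp_all
  have \<eta>: "\<eta> x (\<pi> x a) = Q x +>\<^bsub>?M x\<^esub> a" if x: "x \<in> Ob C" and a: "a \<in> P x" for x a
    unfolding \<eta>_def hD(3)[OF x a, symmetric]
    by (rule inv_into_f_f[OF bij_betw_imp_inj_on[OF hD(2)[OF x]]]) (use a in \<open>simp add: quot_carrier\<close>)
  have fob: "fob (subquotient F P Q) x = ?Q x" for x by (simp add: subquotient_def)
  show ?thesis
  proof (rule modfun_isoI[where \<eta> = \<eta>], unfold fob)
    fix x assume x: "x \<in> Ob C"
    show "\<eta> x \<in> linear_maps R (fob T x) (?Q x)"
      unfolding \<eta>_def by (rule linear_map_inverse[OF hD(1,2)[OF x] Qm[OF x x]])
    show "bij_betw (\<eta> x) (carrier (fob T x)) (carrier (?Q x))"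
      unfolding \<eta>_def by (rule bij_betw_inv_into[OF hD(2)[OF x]])
  next
    fix x y f t assume x: "x \<in> Ob C" and y: "y \<in> Ob C" and f: "f \<in> Arr C x y" and t: "t \<in> carrier (fob T x)"
    obtain a where a: "a \<in> P x" "t = \<pi> x a" using surj[OF x] t by blast
    have Pf: "far F x y f b \<in> P y" if "b \<in> P x" for b
      using P x y f that unfolding subfunctor_def by blast
    have "far (subquotient F P Q) x y f (\<eta> x t) = (\<Union>k\<in>Q x +>\<^bsub>?M x\<^esub> a. Q y +>\<^bsub>?M y\<^esub> far F x y f k)"
      using a by (simp add: subquotient_def \<eta>[OF x] a_r_coset_carrier_update)
    also have "\<dots> = Q y +>\<^bsub>?M y\<^esub> far F x y f a"
    proof (rule coset_UN[OF Mm[OF x] Ms[OF x]])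
      fix b assume b: "b \<in> carrier (?M x)" "Q x +>\<^bsub>?M x\<^esub> b = Q x +>\<^bsub>?M x\<^esub> a"
      have "\<pi> x b = \<pi> x a" using hD(3)[OF x, of a] hD(3)[OF x, of b] a(1) b by simp
      then show "Q y +>\<^bsub>?M y\<^esub> far F x y f b = Q y +>\<^bsub>?M y\<^esub> far F x y f a"
        using \<eta>[OF y Pf[of b]] \<eta>[OF y Pf[of a]] nat[OF x y f] a b by simp
    qed (use a in simp)
    also have "\<dots> = \<eta> y (\<pi> y (far F x y f a))" by (simp add: \<eta>[OF y Pf[OF a(1)]])
    finally show "\<eta> y (far T x y f t) = far (subquotient F P Q) x y f (\<eta> x t)"
      using nat[OF x y f a(1)] a(2) by simp
  qed
qed

text \<open>Cosets of the zero submodule are singletons, so passing from an element to its singleton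
  identifies \<open>F\<close> with the subquotient at \<open>X\<close>.\<close>

lemma subquotient_whole:
  assumes F: "module_functor R C F" and X: "X \<in> Ob C"
    and P: "P X = carrier (fob F X)" and Q: "Q X = {\<zero>\<^bsub>fob F X\<^esub>}"
  shows "modfun_iso R (full_subcat C {X}) F (subquotient F P Q)"
proof (rule modfun_isoI[where \<eta> = "\<lambda>_ a. {a}"])
  interpret F: module_functor R C F by fact
  interpret M: module R "fob F X" by (rule F.fob_module[OF X])
  have coset: "Q X +>\<^bsub>fob F X\<^esub> a = {a}" if "a \<in> carrier (fob F X)" for a
    using that by (simp add: Q a_r_coset_def')
  have fob: "fob (subquotient F P Q) X = quot_module (fob F X) (Q X)" by (simp add: subquotient_def P)
  fix x assume "x \<in> Ob (full_subcat C {X})"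
  then have [simp]: "x = X" by simp
  have "submodule (Q X) R (fob F X)"
    by (rule submodule_criterion) (auto simp: Q M.module_axioms)
  from coset_linear[OF M.module_axioms this]
  show "(\<lambda>a. {a}) \<in> linear_maps R (fob F x) (fob (subquotient F P Q) x)"
    by (simp add: linear_maps_def fob coset Pi_iff)
  show "bij_betw (\<lambda>a. {a}) (carrier (fob F x)) (carrier (fob (subquotient F P Q) x))"
    by (auto simp: bij_betw_def fob quot_carrier coset cong: image_cong)
next
  interpret F: module_functor R C F by fact
  interpret M: module R "fob F X" by (rule F.fob_module[OF X])
  have coset: "Q X +>\<^bsub>fob F X\<^esub> a = {a}" if "a \<in> carrier (fob F X)" for a
    using that by (simp add: Q a_r_coset_def')
  fix x y f a assume "x \<in> Ob (full_subcat C {X})" "y \<in> Ob (full_subcat C {X})"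
    "f \<in> Arr (full_subcat C {X}) x y" "a \<in> carrier (fob F x)"
  then have "x = X" "y = X" "far F X X f a \<in> carrier (fob F X)"
    using linear_mapsD(1)[OF F.far_linear[OF X X]] by auto
  then show "{far F x y f a} = far (subquotient F P Q) x y f {a}"
    by (simp add: subquotient_def coset)
qed

lemma subquotient_trivial:
  assumes M: "module R M" and P: "submodule P R M"
  shows "carrier (quot_module (M\<lparr>carrier := P\<rparr>) P) = {P}"
proof -
  have "P +>\<^bsub>M\<lparr>carrier := P\<rparr>\<^esub> a = P" if "a \<in> P" for a
  proof -
    have Ms: "module R (M\<lparr>carrier := P\<rparr>)" "submodule P R (M\<lparr>carrier := P\<rparr>)"
      using submodule_module[OF M P] submodule_restrict[OF M P P] by simp_all
    interpret N: module R "M\<lparr>carrier := P\<rparr>" by (rule Ms)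
    have "a \<ominus>\<^bsub>M\<lparr>carrier := P\<rparr>\<^esub> \<zero>\<^bsub>M\<lparr>carrier := P\<rparr>\<^esub> \<in> carrier (M\<lparr>carrier := P\<rparr>)"
      by (rule N.M.minus_closed) (use that N.M.zero_closed in simp_all)
    then show ?thesis
      using coset_eq_iff[OF Ms, of a "\<zero>\<^bsub>M\<lparr>carrier := P\<rparr>\<^esub>"] coset_zero[OF Ms] that N.M.zero_closed by simp
  qed
  then show ?thesis using submoduleD(2)[OF P] by (auto simp: quot_carrier)
qed

text \<open>Simplicity at \<open>X\<close> leaves only zero or everything for \<open>P X\<close> and
  for \<open>Q X\<close>. If they were equal, \<open>T\<close> would vanish at \<open>X\<close>; so
  \<open>P X\<close> is everything, \<open>Q X\<close> is zero, and \<open>T\<close> has the same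
  value at \<open>X\<close> as \<open>F\<close>.\<close>

lemma composition_factor_restrict:
  assumes "module_functor R C F" "simple_composition_factor R C F T" "X \<in> Ob C" "\<not> vanishes_at T X"
    and simple: "simple_functor R (full_subcat C {X}) F"
  shows "modfun_iso R (full_subcat C {X}) F T"
proof -
  obtain P Q where P: "subfunctor R C F P" and Q: "subfunctor R C F Q" and QP: "\<And>x. x \<in> Ob C \<Longrightarrow> Q x \<subseteq> P x"
    and iso: "modfun_iso R C T (subquotient F P Q)" and T: "module_functor R C T"
    using assms(2) by (auto simp: simple_composition_factor_def simple_functor_def)
  interpret T: module_functor R C T by fact
  note M = module_functor.fob_module[OF assms(1,3)]
  have sub: "submodule (P X) R (fob F X)" "submodule (Q X) R (fob F X)"
    using P Q assms(3) by (simp_all add: subfunctor_def)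
  have cases: "N X = {\<zero>\<^bsub>fob F X\<^esub>} \<or> N X = carrier (fob F X)" if "subfunctor R C F N" for N
  proof -
    have "subfunctor R (full_subcat C {X}) F N" using that unfolding subfunctor_def full_subcat_simps by blast
    from simple_functorD(2)[OF simple this] show ?thesis using assms(3) by simp
  qed
  have "P X \<noteq> Q X"
  proof
    assume PQ: "P X = Q X"
    have "carrier (fob (subquotient F P Q) X) = {Q X}"
      using subquotient_trivial[OF M sub(2)] by (simp add: subquotient_def PQ)
    moreover obtain \<eta> where "bij_betw \<eta> (carrier (fob T X)) (carrier (fob (subquotient F P Q) X))"
      using iso assms(3) unfolding modfun_iso_def by blast
    ultimately have inj: "inj_on \<eta> (carrier (fob T X))" and im: "\<eta> ` carrier (fob T X) = {Q X}"
      by (simp_all add: bij_betw_def)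
    have z: "\<zero>\<^bsub>fob T X\<^esub> \<in> carrier (fob T X)" by (rule module_zero_closed[OF T.fob_module[OF assms(3)]])
    have "t = \<zero>\<^bsub>fob T X\<^esub>" if "t \<in> carrier (fob T X)" for t
      by (rule inj_onD[OF inj _ that z]) (use im that z in blast)
    then have "carrier (fob T X) \<subseteq> {\<zero>\<^bsub>fob T X\<^esub>}" by blast
    then show False using assms(4) z by (auto simp: vanishes_at_def)
  qed
  moreover have "Q X \<subseteq> P X" by (rule QP[OF assms(3)])
  moreover have "\<zero>\<^bsub>fob F X\<^esub> \<in> Q X" "P X \<subseteq> carrier (fob F X)" using submoduleD[OF sub(1)] submoduleD[OF sub(2)] by auto
  ultimately have PX: "P X = carrier (fob F X)" "Q X = {\<zero>\<^bsub>fob F X\<^esub>}"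
    using cases[OF P] cases[OF Q] by auto
  show ?thesis
    by (rule modfun_iso_trans[OF subquotient_whole[of R C F X P Q, OF assms(1,3) PX]
          modfun_iso_sym[OF modfun_iso_subcat[OF iso] full_subcat_functor[OF T]]])
qed

subsection \<open>Simple functors are determined by one nonzero value\<close>

text \<open>\<open>\<theta>\<close> is an isomorphism of the values at \<open>X\<close> that
  respects endomorphisms of \<open>X\<close>. Only \<open>T\<close> is simple, so the extension of
  \<open>\<theta>\<close> to other objects starts from a subfunctor of \<open>F\<close> and may have
  a kernel.\<close>

locale match = F: functor_at R C F X + T: functor_at R C T X
  for R :: "'r ring" and C :: "('o, 'a, 'more) category_scheme"
    and F :: "('o, 'a, 'r, 'm) modfun" and T :: "('o, 'a, 'r, 'n) modfun" and X :: 'o +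
  fixes \<theta> :: "'m \<Rightarrow> 'n"
  assumes T_simple: "simple_functor R C T" and T_nonzero: "\<not> vanishes_at T X"
    and \<theta>_linear: "\<theta> \<in> linear_maps R (fob F X) (fob T X)"
    and \<theta>_bij: "bij_betw \<theta> (carrier (fob F X)) (carrier (fob T X))"
    and \<theta>_nat: "\<lbrakk>f \<in> Arr C X X; a \<in> carrier (fob F X)\<rbrakk> \<Longrightarrow> \<theta> (far F X X f a) = far T X X f (\<theta> a)"
begin

text \<open>The graph of the map to be constructed: \<open>w\<close> and \<open>t\<close> look the
  same through every arrow to \<open>X\<close>, once values at \<open>X\<close> are identified by
  \<open>\<theta>\<close>.\<close>

definition corr :: "'o \<Rightarrow> 'm \<Rightarrow> 'n \<Rightarrow> bool" where
  "corr y w t \<longleftrightarrow> w \<in> carrier (fob F y) \<and> t \<in> carrier (fob T y) \<and>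
     (\<forall>b\<in>Arr C y X. far T y X b t = \<theta> (far F y X b w))"

text \<open>\<open>P\<close> is what the value at \<open>X\<close> generates, and \<open>Q\<close>
  below is the part of it that no arrow to \<open>X\<close> detects. The quotient of
  \<open>P\<close> by \<open>Q\<close> will be \<open>T\<close>.\<close>

definition P :: "'o \<Rightarrow> 'm set" where "P = generated R C F X (carrier (fob F X))"

definition Q :: "'o \<Rightarrow> 'm set" where "Q y = P y \<inter> annihilated C F X y"

definition \<pi> :: "'o \<Rightarrow> 'm \<Rightarrow> 'n" where "\<pi> y w = (SOME t. corr y w t)"

lemma \<theta>_closed: "a \<in> carrier (fob F X) \<Longrightarrow> \<theta> a \<in> carrier (fob T X)"
  by (rule linear_mapsD(1)[OF \<theta>_linear])

lemma corr_unique: "\<lbrakk>y \<in> Ob C; corr y w s; corr y w t\<rbrakk> \<Longrightarrow> s = t"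
  by (rule T.separated[OF T_simple T_nonzero]) (auto simp: corr_def)

lemma corr_gen:
  assumes y: "y \<in> Ob C" and a: "a \<in> Arr C X y" and v: "v \<in> carrier (fob F X)"
  shows "corr y (far F X y a v) (far T X y a (\<theta> v))"
  unfolding corr_def
proof (intro conjI ballI)
  show "far F X y a v \<in> carrier (fob F y)" by (rule F.far_closed[OF F.X y a v])
  show "far T X y a (\<theta> v) \<in> carrier (fob T y)" by (rule T.far_closed[OF F.X y a \<theta>_closed[OF v]])
  fix b assume b: "b \<in> Arr C y X"
  show "far T y X b (far T X y a (\<theta> v)) = \<theta> (far F y X b (far F X y a v))"
    using T.F.far_cmp[OF F.X y F.X a b \<theta>_closed[OF v]] F.F.far_cmp[OF F.X y F.X a b v]
      \<theta>_nat[OF F.cmp_in[OF F.X y F.X a b] v] by simp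
qed

lemma corr_add: 
  assumes y: "y \<in> Ob C" and "corr y v s" "corr y w t"
  shows "corr y (v \<oplus>\<^bsub>fob F y\<^esub> w) (s \<oplus>\<^bsub>fob T y\<^esub> t)"
proof -
  interpret FY: module R "fob F y" by (rule F.F.fob_module[OF y])
  interpret TY: module R "fob T y" by (rule T.F.fob_module[OF y])
  show ?thesis
    using assms(2,3) F.far_closed[OF y F.X]
    by (simp add: corr_def linear_mapsD(2)[OF F.F.far_linear[OF y F.X]]
        linear_mapsD(2)[OF T.F.far_linear[OF y F.X]] linear_mapsD(2)[OF \<theta>_linear])
qed

lemma corr_smult: 
  assumes y: "y \<in> Ob C" and "r \<in> carrier R" "corr y w t"
  shows "corr y (r \<odot>\<^bsub>fob F y\<^esub> w) (r \<odot>\<^bsub>fob T y\<^esub> t)"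
proof -
  interpret FY: module R "fob F y" by (rule F.F.fob_module[OF y])
  interpret TY: module R "fob T y" by (rule T.F.fob_module[OF y])
  show ?thesis
    using assms(2,3) F.far_closed[OF y F.X]
    by (simp add: corr_def linear_mapsD(3)[OF F.F.far_linear[OF y F.X]]
        linear_mapsD(3)[OF T.F.far_linear[OF y F.X]] linear_mapsD(3)[OF \<theta>_linear])
qed

lemma corr_zero: "y \<in> Ob C \<Longrightarrow> corr y \<zero>\<^bsub>fob F y\<^esub> \<zero>\<^bsub>fob T y\<^esub>"
  using F.far_zero[OF _ F.X] T.far_zero[OF _ F.X]
    linear_map_zero[OF \<theta>_linear F.F.fob_module[OF F.X] T.F.fob_module[OF F.X]]
  by (simp add: corr_def module_zero_closed[OF F.F.fob_module] module_zero_closed[OF T.F.fob_module])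

lemma corr_far:
  assumes y: "y \<in> Ob C" and z: "z \<in> Ob C" and f: "f \<in> Arr C y z" and c: "corr y w t"
  shows "corr z (far F y z f w) (far T y z f t)"
proof -
  have w: "w \<in> carrier (fob F y)" and t: "t \<in> carrier (fob T y)" using c by (auto simp: corr_def)
  have "far T z X b (far T y z f t) = \<theta> (far F z X b (far F y z f w))" if b: "b \<in> Arr C z X" for b
    using F.F.far_cmp[OF y z F.X f b w] T.F.far_cmp[OF y z F.X f b t]
      c F.cmp_in[OF y z F.X f b] by (simp add: corr_def)
  then show ?thesis using F.far_closed[OF y z f w] T.far_closed[OF y z f t] by (simp add: corr_def)
qed

lemma P_subfunctor: "subfunctor R C F P"
  unfolding P_def by (rule F.generated_subfunctor) simp

lemma P_submodule: "y \<in> Ob C \<Longrightarrow> submodule (P y) R (fob F y)"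
  using P_subfunctor by (simp add: subfunctor_def)

lemma P_far: "\<lbrakk>y \<in> Ob C; z \<in> Ob C; f \<in> Arr C y z; w \<in> P y\<rbrakk> \<Longrightarrow> far F y z f w \<in> P z"
  using P_subfunctor unfolding subfunctor_def by blast

lemma P_carrier: "y \<in> Ob C \<Longrightarrow> P y \<subseteq> carrier (fob F y)"
  using submoduleD(1)[OF P_submodule] by blast

text \<open>Images of elements of \<open>F X\<close> under arrows have a partner, namely the image
  of the corresponding element of \<open>T X\<close>; partners add and scale.\<close>

lemma P_corr:
  assumes y: "y \<in> Ob C" and "w \<in> P y"
  shows "\<exists>t. corr y w t"
  using F.F.fob_module[OF y] F.generators_closed[OF order_refl y] assms(2)[unfolded P_def generated_def]
proof (induction rule: span_induct)
  case (base a)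
  then show ?case using corr_gen[OF y] by blast
next
  case zero
  show ?case using corr_zero[OF y] by blast
next
  case (add a b)
  then show ?case using corr_add[OF y] by blast
next
  case (smult r a)
  then show ?case using corr_smult[OF y] by blast
qed

lemma corr_\<pi>: "\<lbrakk>y \<in> Ob C; w \<in> P y\<rbrakk> \<Longrightarrow> corr y w (\<pi> y w)"
  unfolding \<pi>_def by (rule someI_ex) (rule P_corr)

lemma \<pi>_eqI: "\<lbrakk>y \<in> Ob C; w \<in> P y; corr y w t\<rbrakk> \<Longrightarrow> \<pi> y w = t"
  by (rule corr_unique[OF _ corr_\<pi>])

lemma Q_subfunctor: "subfunctor R C F Q"
  unfolding subfunctor_def
proof (intro conjI ballI)
  fix y assume y: "y \<in> Ob C"
  have A: "submodule (annihilated C F X y) R (fob F y)"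
    using F.annihilated_subfunctor y by (simp add: subfunctor_def)
  show "submodule (Q y) R (fob F y)"
    by (rule submodule_criterion[OF F.F.fob_module[OF y]])
       (use submoduleD[OF A] submoduleD[OF P_submodule[OF y]] in \<open>auto simp: Q_def\<close>)
next
  fix y z f assume yz: "y \<in> Ob C" "z \<in> Ob C" "f \<in> Arr C y z"
  have "far F y z f ` annihilated C F X y \<subseteq> annihilated C F X z"
    using F.annihilated_subfunctor yz unfolding subfunctor_def by blast
  then show "far F y z f ` Q y \<subseteq> Q z" using P_far[OF yz] by (auto simp: Q_def)
qed

lemma \<pi>_linear:
  assumes y: "y \<in> Ob C"
  shows "\<pi> y \<in> linear_maps R ((fob F y)\<lparr>carrier := P y\<rparr>) (fob T y)"
proof (rule linear_mapsI)
  fix a b assume "a \<in> carrier ((fob F y)\<lparr>carrier := P y\<rparr>)" "b \<in> carrier ((fob F y)\<lparr>carrier := P y\<rparr>)"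
  then have ab: "a \<in> P y" "b \<in> P y" by simp_all
  show "\<pi> y (a \<oplus>\<^bsub>(fob F y)\<lparr>carrier := P y\<rparr>\<^esub> b) = \<pi> y a \<oplus>\<^bsub>fob T y\<^esub> \<pi> y b"
    using \<pi>_eqI[OF y submoduleD(3)[OF P_submodule[OF y] ab] corr_add[OF y corr_\<pi>[OF y ab(1)] corr_\<pi>[OF y ab(2)]]]
    by simp
next
  fix a assume "a \<in> carrier ((fob F y)\<lparr>carrier := P y\<rparr>)"
  then have a: "a \<in> P y" by simp
  show "\<pi> y a \<in> carrier (fob T y)" using corr_\<pi>[OF y a] by (simp add: corr_def)
  fix r assume r: "r \<in> carrier R"
  show "\<pi> y (r \<odot>\<^bsub>(fob F y)\<lparr>carrier := P y\<rparr>\<^esub> a) = r \<odot>\<^bsub>fob T y\<^esub> \<pi> y a"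
    using \<pi>_eqI[OF y submoduleD(4)[OF P_submodule[OF y] r a] corr_smult[OF y r corr_\<pi>[OF y a]]]
    by simp
qed

text \<open>The image of \<open>\<pi>\<close> contains all images of elements of \<open>T X\<close>
  under arrows, and these span \<open>T y\<close> because \<open>T\<close> is simple and non-zero at
  \<open>X\<close>.\<close>

lemma \<pi>_surj:
  assumes y: "y \<in> Ob C"
  shows "\<pi> y ` P y = carrier (fob T y)"
proof
  show "\<pi> y ` P y \<subseteq> carrier (fob T y)" using linear_mapsD(1)[OF \<pi>_linear[OF y]] by auto
  obtain t where t: "t \<in> carrier (fob T X)" "t \<noteq> \<zero>\<^bsub>fob T X\<^esub>"
    using T_nonzero module_zero_closed[OF T.F.fob_module[OF F.X]] by (auto simp: vanishes_at_def)
  let ?M = "(fob F y)\<lparr>carrier := P y\<rparr>"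
  note M = submodule_module[OF F.F.fob_module[OF y] P_submodule[OF y]]
  have "submodule (\<pi> y ` carrier ?M) R (fob T y)"
    by (rule submodule_image[OF \<pi>_linear[OF y] M T.F.fob_module[OF y] submodule_carrier[OF M]])
  moreover have "{far T X y a v | a v. a \<in> Arr C X y \<and> v \<in> carrier (fob T X)} \<subseteq> \<pi> y ` carrier ?M"
  proof
    fix z assume "z \<in> {far T X y a v | a v. a \<in> Arr C X y \<and> v \<in> carrier (fob T X)}"
    then obtain a v where a: "a \<in> Arr C X y" "v \<in> carrier (fob T X)" "z = far T X y a v" by blast
    have "v \<in> \<theta> ` carrier (fob F X)" using \<theta>_bij a(2) by (simp add: bij_betw_def)
    then obtain w where w: "w \<in> carrier (fob F X)" "v = \<theta> w" by blast
    have "far F X y a w \<in> P y" unfolding P_def generated_def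
      by (rule subsetD[OF span_superset]) (use a w in blast)
    moreover from this have "\<pi> y (far F X y a w) = z"
      using \<pi>_eqI[OF y _ corr_gen[OF y a(1) w(1)]] a w by simp
    ultimately show "z \<in> \<pi> y ` carrier ?M" by force
  qed
  ultimately have "generated R C T X (carrier (fob T X)) y \<subseteq> \<pi> y ` carrier ?M"
    unfolding generated_def by (rule span_least)
  then show "carrier (fob T y) \<subseteq> \<pi> y ` P y"
    using T.generated_simple[OF T_simple order_refl t y] by simp
qed

text \<open>Being zero in \<open>T y\<close>, being related to zero by \<open>corr\<close>, and
  being invisible from \<open>X\<close> coincide, because \<open>\<theta>\<close> is
  injective.\<close>

lemma \<pi>_kernel:
  assumes y: "y \<in> Ob C" and w: "w \<in> P y"
  shows "\<pi> y w = \<zero>\<^bsub>fob T y\<^esub> \<longleftrightarrow> w \<in> Q y"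
proof -
  have wF: "w \<in> carrier (fob F y)" using P_carrier[OF y] w by blast
  have \<theta>0: "\<theta> a = \<zero>\<^bsub>fob T X\<^esub> \<longleftrightarrow> a = \<zero>\<^bsub>fob F X\<^esub>" if "a \<in> carrier (fob F X)" for a
    using linear_map_zero[OF \<theta>_linear F.F.fob_module[OF F.X] T.F.fob_module[OF F.X]]
      inj_onD[OF bij_betw_imp_inj_on[OF \<theta>_bij] _ that module_zero_closed[OF F.F.fob_module[OF F.X]]]
    by auto
  have "w \<in> Q y \<longleftrightarrow> (\<forall>b\<in>Arr C y X. \<theta> (far F y X b w) = \<zero>\<^bsub>fob T X\<^esub>)"
    using w wF \<theta>0[OF F.far_closed[OF y F.X _ wF]] by (simp add: Q_def annihilated_def)
  also have "\<dots> \<longleftrightarrow> corr y w \<zero>\<^bsub>fob T y\<^esub>"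
  proof -
    have "far T y X b \<zero>\<^bsub>fob T y\<^esub> = \<theta> a \<longleftrightarrow> \<theta> a = \<zero>\<^bsub>fob T X\<^esub>" if "b \<in> Arr C y X" for a b
      using T.far_zero[OF y F.X that] by (simp add: eq_commute)
    then show ?thesis using wF module_zero_closed[OF T.F.fob_module[OF y]] by (simp add: corr_def)
  qed
  also have "\<dots> \<longleftrightarrow> \<pi> y w = \<zero>\<^bsub>fob T y\<^esub>"
  proof
    show "corr y w \<zero>\<^bsub>fob T y\<^esub> \<Longrightarrow> \<pi> y w = \<zero>\<^bsub>fob T y\<^esub>" by (rule \<pi>_eqI[OF y w])
    show "\<pi> y w = \<zero>\<^bsub>fob T y\<^esub> \<Longrightarrow> corr y w \<zero>\<^bsub>fob T y\<^esub>" using corr_\<pi>[OF y w] by simp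
  qed
  finally show ?thesis by simp
qed

lemma \<pi>_nat:
  "\<lbrakk>y \<in> Ob C; z \<in> Ob C; f \<in> Arr C y z; w \<in> P y\<rbrakk> \<Longrightarrow> \<pi> z (far F y z f w) = far T y z f (\<pi> y w)"
  by (rule \<pi>_eqI[OF _ P_far corr_far[OF _ _ _ corr_\<pi>]])

lemma composition_factor: "simple_composition_factor R C F T"
proof -
  have "modfun_iso R C T (subquotient F P Q)"
    by (rule subquotient_isoI[OF F.F.module_functor_axioms T.F.module_functor_axioms P_subfunctor Q_subfunctor
          _ \<pi>_linear \<pi>_surj \<pi>_kernel \<pi>_nat]) (auto simp: Q_def)
  moreover have "\<forall>x\<in>Ob C. Q x \<subseteq> P x" by (simp add: Q_def)
  ultimately show ?thesis using T_simple P_subfunctor Q_subfunctor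
    unfolding simple_composition_factor_def by blast
qed

text \<open>When \<open>F\<close> is simple as well, \<open>P\<close> is all of \<open>F\<close> and
  \<open>Q\<close> is zero, so the subquotient map is itself an isomorphism.\<close>

lemma iso_if_simple:
  assumes simple: "simple_functor R C F"
  shows "modfun_iso R C F T"
proof (rule modfun_isoI[where \<eta> = \<pi>])
  have nz: "\<not> vanishes_at F X"
    using vanishes_iso[OF \<theta>_linear \<theta>_bij F.F.fob_module[OF F.X] T.F.fob_module[OF F.X]] T_nonzero by simp
  obtain v where v: "v \<in> carrier (fob F X)" "v \<noteq> \<zero>\<^bsub>fob F X\<^esub>"
    using nz module_zero_closed[OF F.F.fob_module[OF F.X]] by (auto simp: vanishes_at_def)
  have P: "P y = carrier (fob F y)" if "y \<in> Ob C" for y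
    unfolding P_def by (rule F.generated_simple[OF simple order_refl v that])
  have Q: "Q y = {\<zero>\<^bsub>fob F y\<^esub>}" if "y \<in> Ob C" for y
    using F.annihilated_simple[OF simple nz that] P[OF that] module_zero_closed[OF F.F.fob_module[OF that]]
    by (auto simp: Q_def)
  fix y assume y: "y \<in> Ob C"
  have "(fob F y)\<lparr>carrier := P y\<rparr> = fob F y" by (simp add: P[OF y])
  then show lin: "\<pi> y \<in> linear_maps R (fob F y) (fob T y)" using \<pi>_linear[OF y] by simp
  show "bij_betw (\<pi> y) (carrier (fob F y)) (carrier (fob T y))" unfolding bij_betw_def
  proof
    show "inj_on (\<pi> y) (carrier (fob F y))"
      by (rule linear_map_inj[OF lin F.F.fob_module[OF y] T.F.fob_module[OF y]])
         (use \<pi>_kernel[OF y] P[OF y] Q[OF y] in simp)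
    show "\<pi> y ` carrier (fob F y) = carrier (fob T y)" using \<pi>_surj[OF y] P[OF y] by simp
  qed
  fix z f a assume "z \<in> Ob C" "f \<in> Arr C y z" "a \<in> carrier (fob F y)"
  then show "\<pi> z (far F y z f a) = far T y z f (\<pi> y a)" using \<pi>_nat[OF y] P[OF y] by simp
qed

end

lemma matchE:
  assumes "category C" "module_functor R C F" "simple_functor R C T" "X \<in> Ob C" "\<not> vanishes_at T X"
    and "modfun_iso R (full_subcat C {X}) F T"
  obtains \<theta> where "match R C F T X \<theta>"
proof -
  from assms(6) obtain \<eta> where "modfun_iso_by R (full_subcat C {X}) F T \<eta>" by (rule modfun_isoE)
  note \<eta> = modfun_iso_byD[OF this]
  have "match R C F T X (\<eta> X)"
    using assms \<eta> simple_functorD(1)[OF assms(3)]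
    by (simp add: match_def match_axioms_def functor_at_def functor_at_axioms_def)
  then show thesis by (rule that)
qed

lemma composition_factorI:
  assumes "category C" "module_functor R C F" "simple_functor R C T" "X \<in> Ob C" "\<not> vanishes_at T X"
    and "modfun_iso R (full_subcat C {X}) F T"
  shows "simple_composition_factor R C F T"
proof -
  obtain \<theta> where "match R C F T X \<theta>" by (rule matchE[OF assms])
  then show ?thesis by (rule match.composition_factor)
qed

lemma simple_functor_isoI:
  assumes "category C" "simple_functor R C F" "simple_functor R C T" "X \<in> Ob C" "\<not> vanishes_at T X"
    and "modfun_iso R (full_subcat C {X}) F T"
  shows "modfun_iso R C F T"
proof -
  obtain \<theta> where "match R C F T X \<theta>" by (rule matchE[OF assms(1) simple_functorD(1)[OF assms(2)] assms(3-6)])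
  then show ?thesis by (rule match.iso_if_simple[OF _ assms(2)])
qed

subsection \<open>The simple functor with a prescribed simple value\<close>

text \<open>Extensional functions, so that two elements with the same values on \<open>A\<close> are
  equal. With \<open>A\<close> the arrows from \<open>y\<close> to \<open>X\<close>, this module
  contains the value of the coinduced functor at \<open>y\<close>.\<close>

definition fun_module :: "'a set \<Rightarrow> ('r, 'm) module \<Rightarrow> ('r, 'a \<Rightarrow> 'm) module" where
  "fun_module A M = \<lparr>carrier = A \<rightarrow>\<^sub>E carrier M, mult = undefined, one = undefined,
     zero = (\<lambda>_\<in>A. \<zero>\<^bsub>M\<^esub>), add = (\<lambda>h k. \<lambda>b\<in>A. h b \<oplus>\<^bsub>M\<^esub> k b), smult = (\<lambda>r h. \<lambda>b\<in>A. r \<odot>\<^bsub>M\<^esub> h b)\<rparr>"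

lemma fun_module_simps:
  "carrier (fun_module A M) = A \<rightarrow>\<^sub>E carrier M"
  "zero (fun_module A M) = (\<lambda>_\<in>A. \<zero>\<^bsub>M\<^esub>)" "add (fun_module A M) = (\<lambda>h k. \<lambda>b\<in>A. h b \<oplus>\<^bsub>M\<^esub> k b)"
  "smult (fun_module A M) = (\<lambda>r h. \<lambda>b\<in>A. r \<odot>\<^bsub>M\<^esub> h b)"
  by (simp_all add: fun_module_def)

lemma fun_module_module:
  assumes "module R M"
  shows "module R (fun_module A M)"
proof -
  interpret M: module R M by fact
  let ?F = "fun_module A M"
  have ext: "f = g" if "f \<in> extensional A" "g \<in> extensional A" "\<And>b. b \<in> A \<Longrightarrow> f b = g b" for f g
    using that by (rule extensionalityI)
  have mem: "f b \<in> carrier M" if "f \<in> A \<rightarrow>\<^sub>E carrier M" "b \<in> A" for f b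
    using that by auto
  show ?thesis
  proof (rule moduleI)
    show "cring R" by (rule M.R.is_cring)
    show "abelian_group ?F"
    proof (rule abelian_groupI)
      fix f assume f: "f \<in> carrier ?F"
      have "(\<lambda>b\<in>A. \<ominus>\<^bsub>M\<^esub> f b) \<in> carrier ?F" "(\<lambda>b\<in>A. \<ominus>\<^bsub>M\<^esub> f b) \<oplus>\<^bsub>?F\<^esub> f = \<zero>\<^bsub>?F\<^esub>"
        using f mem[of f] by (auto simp: fun_module_simps M.M.l_neg intro!: restrict_ext)
      then show "\<exists>g\<in>carrier ?F. g \<oplus>\<^bsub>?F\<^esub> f = \<zero>\<^bsub>?F\<^esub>" by blast
      show "\<zero>\<^bsub>?F\<^esub> \<oplus>\<^bsub>?F\<^esub> f = f"
        by (rule ext) (use f mem[of f] in \<open>auto simp: fun_module_simps PiE_iff\<close>)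
    next
      fix f g assume "f \<in> carrier ?F" "g \<in> carrier ?F"
      then show "f \<oplus>\<^bsub>?F\<^esub> g \<in> carrier ?F" "f \<oplus>\<^bsub>?F\<^esub> g = g \<oplus>\<^bsub>?F\<^esub> f"
        using mem[of f] mem[of g] by (auto simp: fun_module_simps M.M.a_comm intro!: restrict_ext)
    next
      fix f g h assume "f \<in> carrier ?F" "g \<in> carrier ?F" "h \<in> carrier ?F"
      then show "f \<oplus>\<^bsub>?F\<^esub> g \<oplus>\<^bsub>?F\<^esub> h = f \<oplus>\<^bsub>?F\<^esub> (g \<oplus>\<^bsub>?F\<^esub> h)"
        using mem[of f] mem[of g] mem[of h] by (auto simp: fun_module_simps M.M.a_assoc intro!: restrict_ext)
    qed (auto simp: fun_module_simps)
  next
    fix r s f assume "r \<in> carrier R" "s \<in> carrier R" "f \<in> carrier ?F"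
    then show "(r \<oplus>\<^bsub>R\<^esub> s) \<odot>\<^bsub>?F\<^esub> f = r \<odot>\<^bsub>?F\<^esub> f \<oplus>\<^bsub>?F\<^esub> s \<odot>\<^bsub>?F\<^esub> f"
      "(r \<otimes>\<^bsub>R\<^esub> s) \<odot>\<^bsub>?F\<^esub> f = r \<odot>\<^bsub>?F\<^esub> (s \<odot>\<^bsub>?F\<^esub> f)" "r \<odot>\<^bsub>?F\<^esub> f \<in> carrier ?F"
      using mem[of f] by (auto simp: fun_module_simps M.smult_l_distr M.smult_assoc1 intro!: restrict_ext)
  next
    fix f assume f: "f \<in> carrier ?F"
    show "\<one>\<^bsub>R\<^esub> \<odot>\<^bsub>?F\<^esub> f = f"
      by (rule ext) (use f mem[of f] in \<open>auto simp: fun_module_simps PiE_iff\<close>)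
  next
    fix r f g assume "r \<in> carrier R" "f \<in> carrier ?F" "g \<in> carrier ?F"
    then show "r \<odot>\<^bsub>?F\<^esub> (f \<oplus>\<^bsub>?F\<^esub> g) = r \<odot>\<^bsub>?F\<^esub> f \<oplus>\<^bsub>?F\<^esub> r \<odot>\<^bsub>?F\<^esub> g"
      using mem[of f] mem[of g] by (auto simp: fun_module_simps M.smult_r_distr intro!: restrict_ext)
  qed
qed

text \<open>The image in the coinduced functor of the tensor \<open>a \<otimes> v\<close> of the
  induced functor: an arrow \<open>b\<close> back to \<open>X\<close> turns it into the action of
  the endomorphism \<open>b a\<close> on \<open>v\<close>.\<close>

definition sim_gen ::
  "('o, 'a, 'more) category_scheme \<Rightarrow> 'o \<Rightarrow> ('o, 'a, 'r, 'm) modfun \<Rightarrow> 'o \<Rightarrow> 'a \<Rightarrow> 'm \<Rightarrow> 'a \<Rightarrow> 'm" where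
  "sim_gen C X V y a v = (\<lambda>b\<in>Arr C y X. far V X X (cmp C X y X b a) v)"

definition sim_set ::
  "'r ring \<Rightarrow> ('o, 'a, 'more) category_scheme \<Rightarrow> 'o \<Rightarrow> ('o, 'a, 'r, 'm) modfun \<Rightarrow> 'o \<Rightarrow> ('a \<Rightarrow> 'm) set" where
  "sim_set R C X V y = submodule_span R (fun_module (Arr C y X) (fob V X))
     {sim_gen C X V y a v | a v. a \<in> Arr C X y \<and> v \<in> carrier (fob V X)}"

text \<open>
  The image of the functor induced from \<open>V\<close> in the functor coinduced from \<open>V\<close>.
\<close>

definition sim ::
  "'r ring \<Rightarrow> ('o, 'a, 'more) category_scheme \<Rightarrow> 'o \<Rightarrow> ('o, 'a, 'r, 'm) modfun \<Rightarrow> ('o, 'a, 'r, 'a \<Rightarrow> 'm) modfun" where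
  "sim R C X V = \<lparr>fob = (\<lambda>y. (fun_module (Arr C y X) (fob V X))\<lparr>carrier := sim_set R C X V y\<rparr>),
     far = (\<lambda>y z f h. \<lambda>c\<in>Arr C z X. h (cmp C y z X c f))\<rparr>"

locale value_at = category C + V: module_functor R "full_subcat C {X}" V
  for R :: "'r ring" and C :: "('o, 'a, 'more) category_scheme" and X :: 'o and V :: "('o, 'a, 'r, 'm) modfun" +
  assumes X: "X \<in> Ob C"
begin

abbreviation M where "M \<equiv> fob V X"
abbreviation \<alpha> where "\<alpha> \<equiv> far V X X"
abbreviation FM where "FM y \<equiv> fun_module (Arr C y X) M"
abbreviation gen where "gen \<equiv> sim_gen C X V"
abbreviation S where "S \<equiv> sim R C X V"
abbreviation SS where "SS \<equiv> sim_set R C X V"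

lemma M: "module R M" using V.fob_module[of X] X by simp
lemma FM: "module R (FM y)" by (rule fun_module_module[OF M])

lemma \<alpha>_linear: "f \<in> Arr C X X \<Longrightarrow> \<alpha> f \<in> linear_maps R M M" using V.far_linear[of X X f] X by simp
lemma \<alpha>_closed: "\<lbrakk>f \<in> Arr C X X; v \<in> carrier M\<rbrakk> \<Longrightarrow> \<alpha> f v \<in> carrier M"
  by (rule linear_mapsD(1)[OF \<alpha>_linear])
lemma \<alpha>_ident: "v \<in> carrier M \<Longrightarrow> \<alpha> (ident C X) v = v" using V.far_ident[of X v] X by simp
lemma \<alpha>_cmp: "\<lbrakk>f \<in> Arr C X X; g \<in> Arr C X X; v \<in> carrier M\<rbrakk> \<Longrightarrow> \<alpha> (cmp C X X X g f) v = \<alpha> g (\<alpha> f v)"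
  using V.far_cmp[of X X X f g v] X by simp

lemma gen_closed:
  assumes "y \<in> Ob C" "a \<in> Arr C X y" "v \<in> carrier M"
  shows "gen y a v \<in> carrier (FM y)"
  using \<alpha>_closed[OF cmp_in[OF X assms(1) X assms(2)] assms(3)] by (auto simp: sim_gen_def fun_module_simps)

lemma gens_closed:
  "y \<in> Ob C \<Longrightarrow> {gen y a v | a v. a \<in> Arr C X y \<and> v \<in> carrier M} \<subseteq> carrier (FM y)"
  using gen_closed by blast

lemma SS_submodule: "y \<in> Ob C \<Longrightarrow> submodule (SS y) R (FM y)"
  unfolding sim_set_def by (rule span_submodule[OF FM gens_closed])

lemma SS_gen: "\<lbrakk>a \<in> Arr C X y; v \<in> carrier M\<rbrakk> \<Longrightarrow> gen y a v \<in> SS y"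
  unfolding sim_set_def by (rule subsetD[OF span_superset]) blast

lemma SS_mem: "\<lbrakk>y \<in> Ob C; h \<in> SS y; b \<in> Arr C y X\<rbrakk> \<Longrightarrow> h b \<in> carrier M"
  using submoduleD(1)[OF SS_submodule, of y h] by (auto simp: fun_module_simps)

lemma SS_ext: "\<lbrakk>y \<in> Ob C; h \<in> SS y; k \<in> SS y; \<And>b. b \<in> Arr C y X \<Longrightarrow> h b = k b\<rbrakk> \<Longrightarrow> h = k"
  using submoduleD(1)[OF SS_submodule, of y h] submoduleD(1)[OF SS_submodule, of y k]
  by (simp add: fun_module_simps) (rule PiE_ext, assumption+)

lemma S_simps:
  "carrier (fob S y) = SS y" "zero (fob S y) = zero (FM y)" "add (fob S y) = add (FM y)"
  "smult (fob S y) = smult (FM y)" "far S y z f = (\<lambda>h. \<lambda>c\<in>Arr C z X. h (cmp C y z X c f))"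
  by (simp_all add: sim_def)

lemma S_fob: "fob S y = (FM y)\<lparr>carrier := SS y\<rparr>" by (simp add: sim_def)

lemma S_module: "y \<in> Ob C \<Longrightarrow> module R (fob S y)"
  unfolding S_fob by (rule submodule_module[OF FM SS_submodule])

lemma pullback_linear:
  assumes "y \<in> Ob C" "z \<in> Ob C" "f \<in> Arr C y z"
  shows "far S y z f \<in> linear_maps R (FM y) (FM z)"
proof -
  have "cmp C y z X c f \<in> Arr C y X" if "c \<in> Arr C z X" for c
    by (rule cmp_in[OF assms(1,2) X assms(3) that])
  then show ?thesis by (intro linear_mapsI) (auto simp: S_simps fun_module_simps PiE_iff intro!: restrict_ext)
qed

lemma pullback_gen:
  assumes "y \<in> Ob C" "z \<in> Ob C" "f \<in> Arr C y z" "a \<in> Arr C X y"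
  shows "far S y z f (gen y a v) = gen z (cmp C X y z f a) v"
  using cmp_in[OF assms(1,2) X assms(3)] cmp_assoc[OF X assms(1,2) X assms(4,3)]
  by (auto simp: S_simps sim_gen_def intro!: restrict_ext)

lemma pullback_closed:
  assumes y: "y \<in> Ob C" and z: "z \<in> Ob C" and f: "f \<in> Arr C y z" and h: "h \<in> SS y"
  shows "far S y z f h \<in> SS z"
proof -
  have "submodule {h \<in> carrier (FM y). far S y z f h \<in> SS z} R (FM y)"
    by (rule submodule_vimage[OF pullback_linear[OF y z f] FM FM SS_submodule[OF z]])
  moreover have "{gen y a v | a v. a \<in> Arr C X y \<and> v \<in> carrier M} \<subseteq> {h \<in> carrier (FM y). far S y z f h \<in> SS z}"
    using gen_closed[OF y] pullback_gen[OF y z f] SS_gen[OF cmp_in[OF X y z _ f]] by auto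
  ultimately have "SS y \<subseteq> {h \<in> carrier (FM y). far S y z f h \<in> SS z}" unfolding sim_set_def by (rule span_least)
  then show ?thesis using h by blast
qed

lemma S_functor: "module_functor R C S"
proof (rule module_functor.intro)
  fix y assume y: "y \<in> Ob C"
  show "module R (fob S y)" by (rule S_module[OF y])
  fix h assume "h \<in> carrier (fob S y)"
  then have h: "h \<in> SS y" by (simp add: S_simps)
  show "far S y y (ident C y) h = h"
    by (rule SS_ext[OF y pullback_closed[OF y y ident_in[OF y] h] h])
       (simp add: S_simps ident_right[OF y X])
next
  fix y z f assume y: "y \<in> Ob C" and z: "z \<in> Ob C" and f: "f \<in> Arr C y z"
  show "far S y z f \<in> linear_maps R (fob S y) (fob S z)"
    using pullback_linear[OF y z f] pullback_closed[OF y z f] submoduleD(1)[OF SS_submodule[OF y]]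
    unfolding S_fob by (auto simp: linear_maps_def)
next
  fix x y z f g h assume x: "x \<in> Ob C" and y: "y \<in> Ob C" and z: "z \<in> Ob C" and f: "f \<in> Arr C x y" and g: "g \<in> Arr C y z"
    and "h \<in> carrier (fob S x)"
  show "far S x z (cmp C x y z g f) h = far S y z g (far S x y f h)"
    using cmp_in[OF y z X g] cmp_assoc[OF x y z X f g] by (auto simp: S_simps intro!: restrict_ext)
qed

text \<open>True for the generators by functoriality of \<open>V\<close>, and linear in
  \<open>h\<close>. Hence evaluation at the identity identifies the new value at \<open>X\<close>
  with \<open>V\<close>.\<close>

lemma SS_at_X:
  assumes "h \<in> SS X" "b \<in> Arr C X X"
  shows "h b = \<alpha> b (h (ident C X))"
  using FM[of X] gens_closed[OF X] assms(1)[unfolded sim_set_def]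
proof (induction rule: span_induct)
  case (base h)
  then obtain a v where a: "h = gen X a v" "a \<in> Arr C X X" "v \<in> carrier M" by blast
  then show ?case using assms(2) ident_in[OF X] by (simp add: sim_gen_def ident_left[OF X X] \<alpha>_cmp)
next
  case zero
  then show ?case using assms(2) ident_in[OF X] linear_map_zero[OF \<alpha>_linear[OF assms(2)] M M]
    by (simp add: fun_module_simps)
next
  case (add h k)
  then show ?case
    using assms(2) ident_in[OF X] linear_mapsD(2)[OF \<alpha>_linear[OF assms(2)]] SS_mem[OF X, of _ "ident C X"]
    by (simp add: fun_module_simps sim_set_def)
next
  case (smult r h)
  then show ?case
    using assms(2) ident_in[OF X] linear_mapsD(3)[OF \<alpha>_linear[OF assms(2)]] SS_mem[OF X, of _ "ident C X"]
    by (simp add: fun_module_simps sim_set_def)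
qed

abbreviation ev where "ev \<equiv> \<lambda>h. h (ident C X)"

lemma ev_linear: "ev \<in> linear_maps R (fob S X) M"
  using SS_mem[OF X] ident_in[OF X] by (intro linear_mapsI) (auto simp: S_simps fun_module_simps)

lemma ev_bij: "bij_betw ev (SS X) (carrier M)"
  unfolding bij_betw_def
proof
  show "inj_on ev (SS X)"
    by (rule inj_onI, rule SS_ext[OF X]) (simp_all add: SS_at_X)
  have "v \<in> ev ` SS X" if v: "v \<in> carrier M" for v
  proof
    show "gen X (ident C X) v \<in> SS X" by (rule SS_gen[OF ident_in[OF X] v])
    show "v = ev (gen X (ident C X) v)"
      using ident_in[OF X] v by (simp add: sim_gen_def ident_left[OF X X] \<alpha>_ident)
  qed
  then show "ev ` SS X = carrier M" using SS_mem[OF X _ ident_in[OF X]] by blast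
qed

lemma ev_nat: "\<lbrakk>f \<in> Arr C X X; h \<in> SS X\<rbrakk> \<Longrightarrow> ev (far S X X f h) = \<alpha> f (ev h)"
  using SS_at_X[of h f] ident_in[OF X] by (simp add: S_simps ident_left[OF X X])

lemma S_restrict: "modfun_iso R (full_subcat C {X}) S V"
  by (rule modfun_isoI[where \<eta> = "\<lambda>_. ev"])
     (use ev_linear ev_bij ev_nat in \<open>auto simp: S_simps(1)\<close>)

text \<open>Evaluated at the identity of \<open>X\<close>, a subfunctor becomes an invariant
  submodule of \<open>V\<close>, so it is zero or everything at \<open>X\<close>. The first case
  spreads to all objects because elements are functions of arrows into \<open>X\<close>, the second
  because the value at \<open>X\<close> generates.\<close>

lemma S_simple:
  assumes simple: "simple_functor R (full_subcat C {X}) V"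
  shows "simple_functor R C S"
proof -
  have nzV: "\<not> vanishes_at V X" using simple X by (simp add: simple_functor_def)
  have "\<not> vanishes_at S X"
    using modfun_iso_vanishes[OF S_restrict full_subcat_functor[OF S_functor] V.module_functor_axioms, of X] X nzV
    by simp
  moreover have "(\<forall>y\<in>Ob C. P y = {\<zero>\<^bsub>fob S y\<^esub>}) \<or> (\<forall>y\<in>Ob C. P y = carrier (fob S y))"
    if P: "subfunctor R C S P" for P
  proof -
    have sub: "submodule (P y) R (fob S y)" if "y \<in> Ob C" for y using P that by (simp add: subfunctor_def)
    have PSS: "P y \<subseteq> SS y" if "y \<in> Ob C" for y using submoduleD(1)[OF sub[OF that]] by (auto simp: S_simps)
    have st: "far S y z f h \<in> P z" if "y \<in> Ob C" "z \<in> Ob C" "f \<in> Arr C y z" "h \<in> P y" for y z f h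
      using P that unfolding subfunctor_def by blast
    have "subfunctor R (full_subcat C {X}) V (\<lambda>_. ev ` P X)"
      unfolding subfunctor_def
    proof (intro conjI ballI)
      fix x assume "x \<in> Ob (full_subcat C {X})"
      then have "x = X" by simp
      then show "submodule (ev ` P X) R (fob V x)"
        using submodule_image[OF ev_linear S_module[OF X] M sub[OF X]] by simp
    next
      fix x y f assume "x \<in> Ob (full_subcat C {X})" "y \<in> Ob (full_subcat C {X})" "f \<in> Arr (full_subcat C {X}) x y"
      then have f: "x = X" "y = X" "f \<in> Arr C X X" by simp_all
      show "far V x y f ` ev ` P X \<subseteq> ev ` P X"
      proof
        fix v assume "v \<in> far V x y f ` ev ` P X"
        then obtain h where h: "h \<in> P X" "v = \<alpha> f (ev h)" using f by blast
        then have "v = ev (far S X X f h)" using ev_nat[OF f(3)] PSS[OF X] by auto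
        then show "v \<in> ev ` P X" using st[OF X X f(3) h(1)] by blast
      qed
    qed
    from simple_functorD(2)[OF simple this] X
    consider "ev ` P X = {\<zero>\<^bsub>M\<^esub>}" | "ev ` P X = carrier M" by auto
    then show ?thesis
    proof cases
      case 1
      have "P y = {\<zero>\<^bsub>fob S y\<^esub>}" if y: "y \<in> Ob C" for y
      proof -
        have "h = \<zero>\<^bsub>fob S y\<^esub>" if h: "h \<in> P y" for h
        proof (rule SS_ext[OF y])
          show hS: "h \<in> SS y" using PSS[OF y] h by blast
          show "\<zero>\<^bsub>fob S y\<^esub> \<in> SS y" using submoduleD(2)[OF SS_submodule[OF y]] by (simp add: S_simps)
          fix b assume b: "b \<in> Arr C y X"
          have "ev (far S y X b h) = \<zero>\<^bsub>M\<^esub>" using 1 st[OF y X b h] by blast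
          then show "h b = \<zero>\<^bsub>fob S y\<^esub> b"
            using b ident_in[OF X] by (simp add: S_simps fun_module_simps ident_left[OF y X])
        qed
        then show ?thesis using submoduleD(2)[OF sub[OF y]] by blast
      qed
      then show ?thesis by blast
    next
      case 2
      have PX: "SS X \<subseteq> P X"
      proof
        fix h assume h: "h \<in> SS X"
        then have "ev h \<in> ev ` P X" using 2 bij_betwE[OF ev_bij] by blast
        then obtain k where k: "k \<in> P X" "ev h = ev k" by blast
        then have "h = k" using inj_onD[OF bij_betw_imp_inj_on[OF ev_bij]] h PSS[OF X] by blast
        then show "h \<in> P X" using k by simp
      qed
      have "P y = carrier (fob S y)" if y: "y \<in> Ob C" for y
      proof
        show "P y \<subseteq> carrier (fob S y)" using PSS[OF y] by (simp add: S_simps)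
        \<comment> \<open>Every generator over \<open>y\<close> is the image under \<open>a\<close>
          of a generator over \<open>X\<close> belonging to the identity.\<close>
        have "gen y a v \<in> P y" if a: "a \<in> Arr C X y" and v: "v \<in> carrier M" for a v
        proof -
          have "far S X y a (gen X (ident C X) v) \<in> P y"
            using st[OF X y a] PX SS_gen[OF ident_in[OF X] v] by blast
          then show ?thesis
            using pullback_gen[OF X y a ident_in[OF X]] ident_right[OF X y a] by simp
        qed
        moreover have "submodule (P y) R (FM y)"
          by (rule submodule_criterion[OF FM])
             (use submoduleD[OF sub[OF y]] PSS[OF y] submoduleD(1)[OF SS_submodule[OF y]] in \<open>auto simp: S_simps\<close>)
        ultimately have "SS y \<subseteq> P y" unfolding sim_set_def by (intro span_least) auto
        then show "carrier (fob S y) \<subseteq> P y" by (simp add: S_simps)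
      qed
      then show ?thesis by blast
    qed
  qed
  ultimately show ?thesis using S_functor X by (auto simp: simple_functor_def)
qed

text \<open>Generators at \<open>y\<close> only record how round trips from \<open>X\<close> through
  \<open>y\<close> act; if all of these act as zero, there is nothing at \<open>y\<close>.\<close>

lemma S_vanishes:
  assumes y: "y \<in> Ob C"
    and 0: "\<And>a b v. \<lbrakk>a \<in> Arr C X y; b \<in> Arr C y X; v \<in> carrier M\<rbrakk> \<Longrightarrow> \<alpha> (cmp C X y X b a) v = \<zero>\<^bsub>M\<^esub>"
  shows "vanishes_at S y"
proof -
  have "gen y a v = \<zero>\<^bsub>FM y\<^esub>" if "a \<in> Arr C X y" "v \<in> carrier M" for a v
    using 0[OF that(1) _ that(2)] by (auto simp: sim_gen_def fun_module_simps intro!: restrict_ext)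
  moreover have "submodule {\<zero>\<^bsub>FM y\<^esub>} R (FM y)"
  proof -
    interpret N: module R "FM y" by (rule FM)
    show ?thesis by (rule submodule_criterion[OF FM]) auto
  qed
  ultimately have "SS y \<subseteq> {\<zero>\<^bsub>FM y\<^esub>}" unfolding sim_set_def by (intro span_least) auto
  then show ?thesis using submoduleD(2)[OF SS_submodule[OF y]] by (auto simp: vanishes_at_def S_simps)
qed

end

subsection \<open>Transport to another carrier type\<close>

text \<open>The functor \<open>sim\<close> has elements of type \<open>'a => 'm\<close>, whereas the
  functors under classification have elements of type \<open>'m\<close>. Modules are moved along
  maps that are injective on carriers.\<close>

definition transport_module :: "('n \<Rightarrow> 'm) \<Rightarrow> ('r, 'n) module \<Rightarrow> ('r, 'm) module" where
  "transport_module c M = (let d = inv_into (carrier M) c in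
     \<lparr>carrier = c ` carrier M, mult = undefined, one = undefined, zero = c \<zero>\<^bsub>M\<^esub>,
      add = (\<lambda>s t. c (d s \<oplus>\<^bsub>M\<^esub> d t)), smult = (\<lambda>r t. c (r \<odot>\<^bsub>M\<^esub> d t))\<rparr>)"

lemma transport_linear:
  assumes "inj_on c (carrier M)"
  shows "c \<in> linear_maps R M (transport_module c M)"
  using assms by (intro linear_mapsI) (auto simp: transport_module_def Let_def)

lemma transport_module_module:
  assumes "module R M" "inj_on c (carrier M)"
  shows "module R (transport_module c M)"
  by (rule module_surj_image[OF assms(1), of c])
     (use linear_mapsD[OF transport_linear[OF assms(2), of R]] in
       \<open>simp_all add: transport_module_def[unfolded Let_def] cong del: image_cong\<close>)

definition transport ::
  "('o \<Rightarrow> 'n \<Rightarrow> 'm) \<Rightarrow> ('o, 'a, 'r, 'n) modfun \<Rightarrow> ('o, 'a, 'r, 'm) modfun" where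
  "transport c F = \<lparr>fob = (\<lambda>y. transport_module (c y) (fob F y)),
     far = (\<lambda>y z f t. c z (far F y z f (inv_into (carrier (fob F y)) (c y) t)))\<rparr>"

lemma transport_functor:
  assumes F: "module_functor R C F" and c: "\<And>y. y \<in> Ob C \<Longrightarrow> inj_on (c y) (carrier (fob F y))" and cat: "category C"
  shows "module_functor R C (transport c F)" "modfun_iso R C F (transport c F)"
proof -
  interpret F: module_functor R C F by fact
  interpret category C by fact
  have far: "far (transport c F) y z f (c y a) = c z (far F y z f a)"
    if "y \<in> Ob C" "a \<in> carrier (fob F y)" for y z f a
    using c[OF that(1)] that(2) by (simp add: transport_def)
  have fob: "fob (transport c F) y = transport_module (c y) (fob F y)" for y by (simp add: transport_def)
  have car: "carrier (fob (transport c F) y) = c y ` carrier (fob F y)" for y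
    by (simp add: fob transport_module_def Let_def)
  have cl: "c y \<in> linear_maps R (fob F y) (fob (transport c F) y)" if "y \<in> Ob C" for y
    unfolding fob by (rule transport_linear[OF c[OF that]])
  show "module_functor R C (transport c F)"
  proof (rule module_functor.intro)
    fix y assume y: "y \<in> Ob C"
    show "module R (fob (transport c F) y)"
      unfolding fob by (rule transport_module_module[OF F.fob_module[OF y] c[OF y]])
    fix t assume "t \<in> carrier (fob (transport c F) y)"
    then show "far (transport c F) y y (ident C y) t = t"
      using y by (auto simp: car far F.far_ident)
  next
    fix y z f assume y: "y \<in> Ob C" and z: "z \<in> Ob C" and f: "f \<in> Arr C y z"
    have "bij_betw (c y) (carrier (fob F y)) (carrier (fob (transport c F) y))"
      using c[OF y] by (simp add: car bij_betw_def)
    from linear_maps_comp[OF linear_maps_comp[OF linear_map_inverse[OF cl[OF y] this F.fob_module[OF y]] F.far_linear[OF y z f]] cl[OF z]]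
    show "far (transport c F) y z f \<in> linear_maps R (fob (transport c F) y) (fob (transport c F) z)"
      by (simp add: transport_def)
  next
    fix x y z f g t assume x: "x \<in> Ob C" and y: "y \<in> Ob C" and z: "z \<in> Ob C" and f: "f \<in> Arr C x y" and g: "g \<in> Arr C y z"
      and "t \<in> carrier (fob (transport c F) x)"
    then obtain a where a: "a \<in> carrier (fob F x)" "t = c x a" by (auto simp: car)
    then show "far (transport c F) x z (cmp C x y z g f) t = far (transport c F) y z g (far (transport c F) x y f t)"
      using linear_mapsD(1)[OF F.far_linear[OF x y f] a(1)] F.far_cmp[OF x y z f g a(1)]
      by (simp add: far[OF x] far[OF y])
  qed
  show "modfun_iso R C F (transport c F)"
    by (rule modfun_isoI[where \<eta> = c]) (use cl c in \<open>auto simp: bij_betw_def car far\<close>)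
qed

text \<open>An infinite type is equinumerous with its square, which gives a pairing
  \<open>p\<close>; folding a list with \<open>p\<close> codes it once its length is known.\<close>

lemma inj_list_code:
  assumes "infinite (UNIV :: 'm set)"
  shows "\<exists>c :: 'm list \<Rightarrow> 'm. inj c"
proof -
  obtain p :: "'m \<times> 'm \<Rightarrow> 'm" where "bij_betw p (UNIV \<times> UNIV) UNIV"
    using card_of_Times_same_infinite[OF assms] card_of_ordIso[of "UNIV \<times> UNIV :: ('m \<times> 'm) set" "UNIV :: 'm set"]
    by blast
  then have p: "inj p" by (simp add: bij_betw_def)
  obtain z :: "nat \<Rightarrow> 'm" where z: "inj z" using assms infinite_countable_subset by blast
  \<comment> \<open>The fold is injective only among lists of equal length, which is why the code
    below also pairs in a value standing for the length.\<close>
  define d where "d xs = foldr (\<lambda>x y. p (x, y)) xs (z 0)" for xs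
  have d: "xs = ys" if "length xs = length ys" "d xs = d ys" for xs ys
    using that by (induction xs ys rule: list_induct2) (auto simp: d_def dest: injD[OF p])
  have "inj (\<lambda>xs. p (z (length xs), d xs))"
  proof (rule injI)
    fix xs ys assume "p (z (length xs), d xs) = p (z (length ys), d ys)"
    then have "z (length xs) = z (length ys)" "d xs = d ys" using injD[OF p] by blast+
    then show "xs = ys" using d injD[OF z] by blast
  qed
  then show ?thesis by blast
qed

section \<open>Embedding the values of the constructed simple functor into the given carrier
  type\<close>

context value_at
begin

lemma gen_smult:
  assumes "y \<in> Ob C" "a \<in> Arr C X y" "v \<in> carrier M" "r \<in> carrier R"
  shows "r \<odot>\<^bsub>FM y\<^esub> gen y a v = gen y a (r \<odot>\<^bsub>M\<^esub> v)"
  using linear_mapsD(3)[OF \<alpha>_linear[OF cmp_in[OF X assms(1) X assms(2)]] assms(4,3)]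
  by (auto simp: sim_gen_def fun_module_simps intro!: restrict_ext)

text \<open>Every element is a finite sum of generators \<open>gen y a v\<close> with
  \<open>a\<close> in \<open>A\<close>, hence is described by a list of pairs from \<open>A\<close>
  and \<open>M\<close>; such lists inject into an infinite type \<open>'m\<close> as soon as
  \<open>A\<close> does.\<close>

lemma S_code:
  fixes \<iota> :: "'a \<Rightarrow> 'm"
  assumes inf: "infinite (UNIV :: 'm set)" and y: "y \<in> Ob C" and A: "A \<subseteq> Arr C X y" "inj_on \<iota> A"
    and span: "\<And>a v. \<lbrakk>a \<in> Arr C X y; v \<in> carrier M\<rbrakk>
      \<Longrightarrow> gen y a v \<in> submodule_span R (FM y) {gen y a v | a v. a \<in> A \<and> v \<in> carrier M}"
  shows "\<exists>c :: ('a \<Rightarrow> 'm) \<Rightarrow> 'm. inj_on c (SS y)"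
proof -
  interpret N: module R "FM y" by (rule FM)
  interpret M': module R M by (rule M)
  let ?G = "{gen y a v | a v. a \<in> A \<and> v \<in> carrier M}"
  have G: "?G \<subseteq> carrier (FM y)" using gens_closed[OF y] A(1) by blast
  have "SS y \<subseteq> submodule_span R (FM y) ?G" unfolding sim_set_def
    by (rule span_least[OF span_submodule[OF FM G]]) (use span in blast)
  define s where "s xs = foldr (\<lambda>(a, v) h. gen y a v \<oplus>\<^bsub>FM y\<^esub> h) xs \<zero>\<^bsub>FM y\<^esub>" for xs :: "('a \<times> 'm) list"
  have s_closed: "s xs \<in> carrier (FM y)" if "set xs \<subseteq> A \<times> carrier M" for xs
    using that
  proof (induction xs)
    case (Cons p xs)
    obtain a v where p: "p = (a, v)" by (cases p)
    then have "gen y a v \<in> carrier (FM y)" using Cons.prems gen_closed[OF y] A(1) by auto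
    then show ?case using Cons p by (simp add: s_def)
  qed (simp add: s_def)
  have s_append: "s (xs @ zs) = s xs \<oplus>\<^bsub>FM y\<^esub> s zs"
    if "set xs \<subseteq> A \<times> carrier M" "set zs \<subseteq> A \<times> carrier M" for xs zs
    using that
  proof (induction xs)
    case Nil
    then show ?case using s_closed[of zs] by (simp add: s_def)
  next
    case (Cons p xs)
    obtain a v where p: "p = (a, v)" by (cases p)
    then have "gen y a v \<in> carrier (FM y)" using Cons.prems gen_closed[OF y] A(1) by auto
    then show ?case using Cons p s_closed[of xs] s_closed[of zs] by (simp add: s_def N.M.a_assoc)
  qed
  \<comment> \<open>Scalars are absorbed into the module entries, so the coded lists need not
    mention coefficients.\<close>
  have s_smult: "\<exists>zs. set zs \<subseteq> A \<times> carrier M \<and> r \<odot>\<^bsub>FM y\<^esub> s xs = s zs"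
    if "set xs \<subseteq> A \<times> carrier M" and r: "r \<in> carrier R" for xs r
    using that(1)
  proof (induction xs)
    case Nil
    then show ?case using r by (intro exI[of _ "[]"]) (simp add: s_def)
  next
    case (Cons p xs)
    obtain a v where p: "p = (a, v)" by (cases p)
    then have av: "a \<in> A" "v \<in> carrier M" "a \<in> Arr C X y" using Cons.prems A(1) by auto
    obtain zs where zs: "set zs \<subseteq> A \<times> carrier M" "r \<odot>\<^bsub>FM y\<^esub> s xs = s zs" using Cons by auto
    have "r \<odot>\<^bsub>FM y\<^esub> s (p # xs) = r \<odot>\<^bsub>FM y\<^esub> gen y a v \<oplus>\<^bsub>FM y\<^esub> r \<odot>\<^bsub>FM y\<^esub> s xs"
      using p s_closed[of xs] Cons.prems gen_closed[OF y av(3,2)] r by (simp add: s_def N.smult_r_distr)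
    also have "\<dots> = s ((a, r \<odot>\<^bsub>M\<^esub> v) # zs)" using gen_smult[OF y av(3,2) r] zs(2) by (simp add: s_def)
    finally show ?case using av zs(1) r by (intro exI[of _ "(a, r \<odot>\<^bsub>M\<^esub> v) # zs"]) simp
  qed
  have list: "\<exists>xs. set xs \<subseteq> A \<times> carrier M \<and> h = s xs" if "h \<in> submodule_span R (FM y) ?G" for h
    using FM G that
  proof (induction rule: span_induct)
    case (base h)
    then obtain a v where "h = gen y a v" "a \<in> A" "v \<in> carrier M" by blast
    then show ?case using gen_closed[OF y] A(1) by (intro exI[of _ "[(a, v)]"]) (auto simp: s_def)
  next
    case zero
    then show ?case by (intro exI[of _ "[]"]) (simp add: s_def)
  next
    case (add h k)
    then obtain xs zs where "set xs \<subseteq> A \<times> carrier M" "h = s xs" "set zs \<subseteq> A \<times> carrier M" "k = s zs" by blast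
    then show ?case by (intro exI[of _ "xs @ zs"]) (simp add: s_append)
  next
    case (smult r h)
    then show ?case using s_smult by blast
  qed
  define enc where "enc h = (SOME xs. set xs \<subseteq> A \<times> carrier M \<and> h = s xs)" for h
  have enc: "set (enc h) \<subseteq> A \<times> carrier M" "s (enc h) = h" if "h \<in> SS y" for h
  proof -
    have "h \<in> submodule_span R (FM y) ?G"
      using \<open>SS y \<subseteq> submodule_span R (FM y) ?G\<close> that by blast
    from someI_ex[OF list[OF this]] show "set (enc h) \<subseteq> A \<times> carrier M" "s (enc h) = h"
      unfolding enc_def by auto
  qed
  \<comment> \<open>The two halves have equal length, so the concatenation determines both.\<close>
  define flat where "flat xs = map \<iota> (map fst xs) @ map snd xs" for xs :: "('a \<times> 'm) list"
  have flat: "xs = zs" if "set xs \<subseteq> A \<times> carrier M" "set zs \<subseteq> A \<times> carrier M" "flat xs = flat zs" for xs zs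
  proof -
    have "length xs = length zs" using arg_cong[OF that(3), of length] by (simp add: flat_def)
    then have eq: "map \<iota> (map fst xs) = map \<iota> (map fst zs)" "map snd xs = map snd zs"
      using that(3) by (simp_all add: flat_def)
    have "set (map fst xs) \<union> set (map fst zs) \<subseteq> A" using that(1,2) by auto
    then have "map fst xs = map fst zs" using map_inj_on[OF eq(1)] inj_on_subset[OF A(2)] by blast
    then show ?thesis using eq(2) by (metis zip_map_fst_snd)
  qed
  obtain c :: "'m list \<Rightarrow> 'm" where c: "inj c" using inj_list_code[OF inf] by blast
  have "inj_on (\<lambda>h. c (flat (enc h))) (SS y)"
  proof (rule inj_onI)
    fix h k assume hk: "h \<in> SS y" "k \<in> SS y" "c (flat (enc h)) = c (flat (enc k))"
    have "enc h = enc k" by (rule flat[OF enc(1)[OF hk(1)] enc(1)[OF hk(2)] injD[OF c hk(3)]])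
    then have "s (enc h) = s (enc k)" by (rule arg_cong)
    then show "h = k" unfolding enc(2)[OF hk(1)] enc(2)[OF hk(2)] .
  qed
  then show ?thesis by (rule exI[where x = "\<lambda>h. c (flat (enc h))"])
qed

text \<open>\<open>A\<close> may be any family of arrows whose generators span, not only the set of
  all arrows; for bisets it will consist of the classes of single bisets instead of linear
  combinations.\<close>

lemma exists_simple:
  assumes inf: "infinite (UNIV :: 'm set)" and simple: "simple_functor R (full_subcat C {X}) V"
    and span: "\<And>y. y \<in> Ob C \<Longrightarrow> \<exists>A \<subseteq> Arr C X y. (\<exists>\<iota> :: 'a \<Rightarrow> 'm. inj_on \<iota> A) \<and>
      (\<forall>a \<in> Arr C X y. \<forall>v \<in> carrier M. gen y a v \<in> submodule_span R (FM y) {gen y a v | a v. a \<in> A \<and> v \<in> carrier M})"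
  shows "\<exists>T :: ('o, 'a, 'r, 'm) modfun. simple_functor R C T \<and> modfun_iso R C S T"
proof -
  have "\<exists>c :: ('a \<Rightarrow> 'm) \<Rightarrow> 'm. inj_on c (SS y)" if y: "y \<in> Ob C" for y
  proof -
    from span[OF y] obtain A and \<iota> :: "'a \<Rightarrow> 'm" where A: "A \<subseteq> Arr C X y" "inj_on \<iota> A"
      "\<forall>a \<in> Arr C X y. \<forall>v \<in> carrier M. gen y a v \<in> submodule_span R (FM y) {gen y a v | a v. a \<in> A \<and> v \<in> carrier M}"
      by (elim exE conjE)
    show ?thesis by (rule S_code[OF inf y A(1,2)]) (use A(3) in blast)
  qed
  then have "\<forall>y. \<exists>c :: ('a \<Rightarrow> 'm) \<Rightarrow> 'm. y \<in> Ob C \<longrightarrow> inj_on c (carrier (fob S y))"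
    unfolding S_simps(1) by blast
  from choice[OF this] obtain c :: "'o \<Rightarrow> ('a \<Rightarrow> 'm) \<Rightarrow> 'm" where
    c: "\<forall>y. y \<in> Ob C \<longrightarrow> inj_on (c y) (carrier (fob S y))" by (rule exE)
  have c': "inj_on (c y) (carrier (fob S y))" if "y \<in> Ob C" for y using c that by simp
  note T = transport_functor[of R C S c, OF S_functor c' category_axioms]
  have "simple_functor R C (transport c S)" by (rule simple_functor_iso[OF T(2) S_simple[OF simple] T(1)])
  then show ?thesis using T(2) by blast
qed

end

section \<open>Bisets\<close>

subsection \<open>Set-valued functors and free generators\<close>

lemma setfun_isoI:
  assumes "\<And>x. x \<in> Ob C \<Longrightarrow> bij_betw (\<eta> x) (elts F x) (elts G x)"
    and "\<And>x y f u. \<lbrakk>x \<in> Ob C; y \<in> Ob C; f \<in> Arr C x y; u \<in> elts F x\<rbrakk>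
      \<Longrightarrow> \<eta> y (act F x y f u) = act G x y f (\<eta> x u)"
  shows "setfun_iso C F G"
  using assms unfolding setfun_iso_def by blast

definition setfun_iso_by ::
  "('o, 'a) category \<Rightarrow> ('o, 'a, 'e) setfun \<Rightarrow> ('o, 'a, 'f) setfun \<Rightarrow> ('o \<Rightarrow> 'e \<Rightarrow> 'f) \<Rightarrow> bool" where
  "setfun_iso_by C F G \<eta> \<longleftrightarrow> (\<forall>x\<in>Ob C. bij_betw (\<eta> x) (elts F x) (elts G x)) \<and>
     (\<forall>x\<in>Ob C. \<forall>y\<in>Ob C. \<forall>f\<in>Arr C x y. \<forall>u\<in>elts F x. \<eta> y (act F x y f u) = act G x y f (\<eta> x u))"

lemma setfun_isoE:
  assumes "setfun_iso C F G"
  obtains \<eta> where "setfun_iso_by C F G \<eta>"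
  using assms unfolding setfun_iso_def setfun_iso_by_def[symmetric] by (elim exE)

lemma setfun_iso_byD:
  assumes "setfun_iso_by C F G \<eta>"
  shows "x \<in> Ob C \<Longrightarrow> bij_betw (\<eta> x) (elts F x) (elts G x)"
    and "\<lbrakk>x \<in> Ob C; y \<in> Ob C; f \<in> Arr C x y; u \<in> elts F x\<rbrakk> \<Longrightarrow> \<eta> y (act F x y f u) = act G x y f (\<eta> x u)"
    and "\<lbrakk>x \<in> Ob C; u \<in> elts F x\<rbrakk> \<Longrightarrow> \<eta> x u \<in> elts G x"
  using assms bij_betw_apply[of "\<eta> x" "elts F x" "elts G x" u] by (simp_all add: setfun_iso_by_def)

lemma setfun_iso_refl: "setfun_iso C F F"
  by (rule setfun_isoI[where \<eta> = "\<lambda>_ u. u"]) (auto simp: bij_betw_def)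

lemma setfun_iso_trans:
  assumes "setfun_iso C F G" "setfun_iso C G H"
  shows "setfun_iso C F H"
proof -
  from assms(1) obtain \<eta> where "setfun_iso_by C F G \<eta>" by (rule setfun_isoE)
  note \<eta> = setfun_iso_byD[OF this]
  from assms(2) obtain \<theta> where "setfun_iso_by C G H \<theta>" by (rule setfun_isoE)
  note \<theta> = setfun_iso_byD[OF this]
  show ?thesis
  proof (rule setfun_isoI[where \<eta> = "\<lambda>x u. \<theta> x (\<eta> x u)"])
    fix x assume x: "x \<in> Ob C"
    show "bij_betw (\<lambda>u. \<theta> x (\<eta> x u)) (elts F x) (elts H x)"
      using bij_betw_trans[OF \<eta>(1)[OF x] \<theta>(1)[OF x]] by (simp add: o_def)
    fix y f u assume y: "y \<in> Ob C" "f \<in> Arr C x y" "u \<in> elts F x"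
    show "\<theta> y (\<eta> y (act F x y f u)) = act H x y f (\<theta> x (\<eta> x u))"
      using \<eta>(2)[OF x y] \<theta>(2)[OF x y(1,2) bij_betwE[OF \<eta>(1)[OF x], rule_format, OF y(3)]] by simp
  qed
qed

lemma setfun_iso_inverseE:
  assumes "setfun_iso C F G" "finite_set_functor C F"
  obtains \<eta> \<theta> where "setfun_iso_by C F G \<eta>" "setfun_iso_by C G F \<theta>"
    and "\<And>x u. \<lbrakk>x \<in> Ob C; u \<in> elts F x\<rbrakk> \<Longrightarrow> \<theta> x (\<eta> x u) = u"
    and "\<And>x v. \<lbrakk>x \<in> Ob C; v \<in> elts G x\<rbrakk> \<Longrightarrow> \<eta> x (\<theta> x v) = v"
proof -
  interpret F: finite_set_functor C F by fact
  from assms(1) obtain \<eta> where iso: "setfun_iso_by C F G \<eta>" by (rule setfun_isoE)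
  note \<eta> = setfun_iso_byD[OF iso]
  let ?\<theta> = "\<lambda>x. inv_into (elts F x) (\<eta> x)"
  have 1: "?\<theta> x (\<eta> x u) = u" if "x \<in> Ob C" "u \<in> elts F x" for x u
    by (rule inv_into_f_f[OF bij_betw_imp_inj_on[OF \<eta>(1)[OF that(1)]] that(2)])
  have 2: "\<eta> x (?\<theta> x v) = v" if "x \<in> Ob C" "v \<in> elts G x" for x v
    by (rule f_inv_into_f) (use bij_betw_imp_surj_on[OF \<eta>(1)[OF that(1)]] that(2) in simp)
  have 3: "?\<theta> x v \<in> elts F x" if "x \<in> Ob C" "v \<in> elts G x" for x v
    using bij_betwE[OF bij_betw_inv_into[OF \<eta>(1)[OF that(1)]]] that(2) by blast
  have "?\<theta> y (act G x y f v) = act F x y f (?\<theta> x v)"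
    if "x \<in> Ob C" "y \<in> Ob C" "f \<in> Arr C x y" "v \<in> elts G x" for x y f v
    using \<eta>(2)[OF that(1-3) 3[OF that(1,4)]] 1[OF that(2) F.act_in[OF that(1-3) 3[OF that(1,4)]]] 2[OF that(1,4)]
    by simp
  then have "setfun_iso_by C G F ?\<theta>" using bij_betw_inv_into[OF \<eta>(1)] by (simp add: setfun_iso_by_def)
  then show thesis by (rule that[OF iso]) (fact 1 2)+
qed

lemma setfun_iso_sym:
  assumes "setfun_iso C F G" "finite_set_functor C F"
  shows "setfun_iso C G F"
proof -
  from assms obtain \<eta> \<theta> where "setfun_iso_by C F G \<eta>" "setfun_iso_by C G F \<theta>" by (rule setfun_iso_inverseE)
  then show ?thesis unfolding setfun_iso_def setfun_iso_by_def by (intro exI[of _ \<theta>]) simp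
qed

lemma finite_set_functor_iso:
  assumes "setfun_iso C F G" "finite_set_functor C F" "category C"
  shows "finite_set_functor C G"
proof -
  interpret F: finite_set_functor C F by fact
  interpret category C by fact
  from assms(1) obtain \<eta> where "setfun_iso_by C F G \<eta>" by (rule setfun_isoE)
  note \<eta> = setfun_iso_byD[OF this]
  have cl: "\<eta> x u \<in> elts G x" if "x \<in> Ob C" "u \<in> elts F x" for x u
    using bij_betwE[OF \<eta>(1)[OF that(1)]] that(2) by blast
  have ex: "\<exists>u\<in>elts F x. v = \<eta> x u" if "x \<in> Ob C" "v \<in> elts G x" for x v
    using bij_betw_imp_surj_on[OF \<eta>(1)[OF that(1)]] that(2) by blast
  show ?thesis
  proof (rule finite_set_functor.intro)
    fix x assume x: "x \<in> Ob C"
    show "finite (elts G x)" using bij_betw_finite[OF \<eta>(1)[OF x]] F.finite_elts[OF x] by simp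
    fix v assume "v \<in> elts G x"
    then obtain u where u: "u \<in> elts F x" "v = \<eta> x u" using ex[OF x] by blast
    show "act G x x (ident C x) v = v"
      using \<eta>(2)[OF x x ident_in[OF x] u(1)] F.act_ident[OF x u(1)] u(2) by simp
  next
    fix x y f v assume x: "x \<in> Ob C" and y: "y \<in> Ob C" and f: "f \<in> Arr C x y" and "v \<in> elts G x"
    then obtain u where u: "u \<in> elts F x" "v = \<eta> x u" using ex[OF x] by blast
    then show "act G x y f v \<in> elts G y"
      using \<eta>(2)[OF x y f u(1)] cl[OF y F.act_in[OF x y f u(1)]] by simp
  next
    fix x y z f g v assume x: "x \<in> Ob C" and y: "y \<in> Ob C" and z: "z \<in> Ob C"
      and f: "f \<in> Arr C x y" and g: "g \<in> Arr C y z" and "v \<in> elts G x"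
    then obtain u where u: "u \<in> elts F x" "v = \<eta> x u" using ex[OF x] by blast
    show "act G x z (cmp C x y z g f) v = act G y z g (act G x y f v)"
      using \<eta>(2)[OF x z cmp_in[OF x y z f g] u(1)] \<eta>(2)[OF y z g F.act_in[OF x y f u(1)]]
        \<eta>(2)[OF x y f u(1)] F.act_cmp[OF x y z f g u(1)] u(2) by simp
  qed
qed

definition transport_setfun :: "('o \<Rightarrow> 'e \<Rightarrow> 'e') \<Rightarrow> ('o, 'a, 'e) setfun \<Rightarrow> ('o, 'a, 'e') setfun" where
  "transport_setfun c F = \<lparr>elts = (\<lambda>x. c x ` elts F x),
     act = (\<lambda>x y f u. c y (act F x y f (inv_into (elts F x) (c x) u)))\<rparr>"

lemma transport_setfun_iso:
  assumes "\<And>x. x \<in> Ob C \<Longrightarrow> inj_on (c x) (elts F x)"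
  shows "setfun_iso C F (transport_setfun c F)"
  by (rule setfun_isoI[where \<eta> = c]) (use assms in \<open>auto simp: transport_setfun_def bij_betw_def\<close>)

text \<open>Isomorphism classes are represented by their members with elements in
  \<open>nat\<close>; finiteness guarantees that such members exist.\<close>

lemma nat_setfun_exists:
  fixes F :: "('o, 'a, 'e) setfun"
  assumes F: "finite_set_functor C F" and C: "category C"
  shows "\<exists>G :: ('o, 'a, nat) setfun. finite_set_functor C G \<and> setfun_iso C F G"
proof -
  have "\<forall>x. \<exists>c :: 'e \<Rightarrow> nat. x \<in> Ob C \<longrightarrow> inj_on c (elts F x)"
    using finite_set_functor.finite_elts[OF F] finite_imp_inj_to_nat_seg by blast
  from choice[OF this] obtain c :: "'o \<Rightarrow> 'e \<Rightarrow> nat" where c: "\<forall>x. x \<in> Ob C \<longrightarrow> inj_on (c x) (elts F x)" by (rule exE)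
  have iso: "setfun_iso C F (transport_setfun c F)" by (rule transport_setfun_iso) (use c in simp)
  show ?thesis using finite_set_functor_iso[OF iso F C] iso by blast
qed

lemma coprod_functor:
  assumes "\<And>i. i \<in> I \<Longrightarrow> finite_set_functor C (F i)" "finite I"
  shows "finite_set_functor C (setfun_coprod I F)"
proof (rule finite_set_functor.intro)
  fix x assume "x \<in> Ob C"
  then show "finite (elts (setfun_coprod I F) x)"
    using assms(2) finite_set_functor.finite_elts[OF assms(1)] by (simp add: setfun_coprod_def)
next
  fix x y f p assume "x \<in> Ob C" "y \<in> Ob C" "f \<in> Arr C x y" "p \<in> elts (setfun_coprod I F) x"
  then show "act (setfun_coprod I F) x y f p \<in> elts (setfun_coprod I F) y"
    using finite_set_functor.act_in[OF assms(1)] by (cases p) (simp add: setfun_coprod_def)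
next
  fix x p assume "x \<in> Ob C" "p \<in> elts (setfun_coprod I F) x"
  then show "act (setfun_coprod I F) x x (ident C x) p = p"
    using finite_set_functor.act_ident[OF assms(1)] by (cases p) (simp add: setfun_coprod_def)
next
  fix x y z f g p assume "x \<in> Ob C" "y \<in> Ob C" "z \<in> Ob C" "f \<in> Arr C x y" "g \<in> Arr C y z"
    "p \<in> elts (setfun_coprod I F) x"
  then show "act (setfun_coprod I F) x z (cmp C x y z g f) p =
      act (setfun_coprod I F) y z g (act (setfun_coprod I F) x y f p)"
    using finite_set_functor.act_cmp[OF assms(1)] by (cases p) (simp add: setfun_coprod_def)
qed

lemma representable_functor:
  assumes "finite_category C" "c \<in> Ob C"
  shows "finite_set_functor C (representable C c)"
proof -
  interpret finite_category C by fact
  show ?thesis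
  proof (rule finite_set_functor.intro)
    fix x y z f g u assume "x \<in> Ob C" "y \<in> Ob C" "z \<in> Ob C" "f \<in> Arr C x y" "g \<in> Arr C y z"
      "u \<in> elts (representable C c) x"
    then show "act (representable C c) x z (cmp C x y z g f) u = act (representable C c) y z g (act (representable C c) x y f u)"
      using cmp_assoc[OF assms(2), of x y z u f g] by (simp add: representable_def)
  qed (use assms(2) finite_Arr cmp_in[OF assms(2)] ident_left[OF assms(2)] in \<open>simp_all add: representable_def\<close>)
qed


text \<open>Free generators in a functor: each element arises from exactly one generator by exactly
  one arrow. This replaces the external coproduct of representables by a condition inside the
  functor, which is easier to produce and to use.\<close>

definition free_on :: "('o, 'a) category \<Rightarrow> ('o, 'a, 'e) setfun \<Rightarrow> ('o \<times> 'e) set \<Rightarrow> bool" where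
  "free_on C F G \<longleftrightarrow> (\<forall>(x, g) \<in> G. x \<in> Ob C \<and> g \<in> elts F x) \<and>
     (\<forall>y\<in>Ob C. \<forall>u\<in>elts F y. \<exists>x g f. (x, g) \<in> G \<and> f \<in> Arr C x y \<and> act F x y f g = u) \<and>
     (\<forall>y\<in>Ob C. \<forall>x g f x' g' f'. (x, g) \<in> G \<longrightarrow> (x', g') \<in> G \<longrightarrow> f \<in> Arr C x y \<longrightarrow> f' \<in> Arr C x' y
        \<longrightarrow> act F x y f g = act F x' y f' g' \<longrightarrow> x = x' \<and> g = g' \<and> f = f')"

lemma free_onI:
  assumes "\<And>x g. (x, g) \<in> G \<Longrightarrow> x \<in> Ob C \<and> g \<in> elts F x"
    and "\<And>y u. \<lbrakk>y \<in> Ob C; u \<in> elts F y\<rbrakk> \<Longrightarrow> \<exists>x g f. (x, g) \<in> G \<and> f \<in> Arr C x y \<and> act F x y f g = u"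
    and "\<And>y x g f x' g' f'. \<lbrakk>y \<in> Ob C; (x, g) \<in> G; (x', g') \<in> G; f \<in> Arr C x y; f' \<in> Arr C x' y;
       act F x y f g = act F x' y f' g'\<rbrakk> \<Longrightarrow> x = x' \<and> g = g' \<and> f = f'"
  shows "free_on C F G"
  using assms unfolding free_on_def by blast

lemma free_onD:
  assumes "free_on C F G"
  shows "(x, g) \<in> G \<Longrightarrow> x \<in> Ob C" "(x, g) \<in> G \<Longrightarrow> g \<in> elts F x"
    and "\<lbrakk>y \<in> Ob C; u \<in> elts F y\<rbrakk> \<Longrightarrow> \<exists>x g f. (x, g) \<in> G \<and> f \<in> Arr C x y \<and> act F x y f g = u"
    and "\<lbrakk>y \<in> Ob C; (x, g) \<in> G; (x', g') \<in> G; f \<in> Arr C x y; f' \<in> Arr C x' y;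
       act F x y f g = act F x' y f' g'\<rbrakk> \<Longrightarrow> x = x' \<and> g = g' \<and> f = f'"
  using assms unfolding free_on_def by blast+

lemma free_on_iso:
  assumes iso: "setfun_iso C F F'" and free: "free_on C F G" and F: "finite_set_functor C F"
  shows "\<exists>G'. free_on C F' G'"
proof -
  interpret F: finite_set_functor C F by fact
  note freeD = free_onD[OF free]
  from iso obtain \<eta> where "setfun_iso_by C F F' \<eta>" by (rule setfun_isoE)
  note \<eta> = setfun_iso_byD[OF this]
  have cl: "\<eta> x u \<in> elts F' x" if "x \<in> Ob C" "u \<in> elts F x" for x u
    using bij_betwE[OF \<eta>(1)[OF that(1)]] that(2) by blast
  have "free_on C F' ((\<lambda>(x, g). (x, \<eta> x g)) ` G)"
  proof (rule free_onI)
    fix x g assume "(x, g) \<in> (\<lambda>(x, g). (x, \<eta> x g)) ` G"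
    then obtain h where "(x, h) \<in> G" "g = \<eta> x h" by auto
    then show "x \<in> Ob C \<and> g \<in> elts F' x" using freeD(1,2)[of x h] cl by simp
  next
    fix y u assume y: "y \<in> Ob C" and "u \<in> elts F' y"
    then obtain v where v: "v \<in> elts F y" "u = \<eta> y v" using bij_betw_imp_surj_on[OF \<eta>(1)[OF y]] by blast
    obtain x g f where g: "(x, g) \<in> G" "f \<in> Arr C x y" "act F x y f g = v" using freeD(3)[OF y v(1)] by blast
    then have "act F' x y f (\<eta> x g) = u" using \<eta>(2)[OF freeD(1)[OF g(1)] y g(2) freeD(2)[OF g(1)]] v(2) by simp
    moreover have "(x, \<eta> x g) \<in> (\<lambda>(x, g). (x, \<eta> x g)) ` G" using g(1) by force
    ultimately show "\<exists>x g f. (x, g) \<in> (\<lambda>(x, g). (x, \<eta> x g)) ` G \<and> f \<in> Arr C x y \<and> act F' x y f g = u"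
      using g(2) by blast
  next
    fix y x g f x' g' f' assume y: "y \<in> Ob C" and "(x, g) \<in> (\<lambda>(x, g). (x, \<eta> x g)) ` G"
      "(x', g') \<in> (\<lambda>(x, g). (x, \<eta> x g)) ` G" and f: "f \<in> Arr C x y" "f' \<in> Arr C x' y"
      and eq: "act F' x y f g = act F' x' y f' g'"
    then obtain h h' where h: "(x, h) \<in> G" "g = \<eta> x h" "(x', h') \<in> G" "g' = \<eta> x' h'" by auto
    have "\<eta> y (act F x y f h) = \<eta> y (act F x' y f' h')"
      using eq h \<eta>(2)[OF freeD(1)[OF h(1)] y f(1) freeD(2)[OF h(1)]]
        \<eta>(2)[OF freeD(1)[OF h(3)] y f(2) freeD(2)[OF h(3)]] by simp
    then have "act F x y f h = act F x' y f' h'"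
      using inj_onD[OF bij_betw_imp_inj_on[OF \<eta>(1)[OF y]] _ F.act_in[OF freeD(1)[OF h(1)] y f(1) freeD(2)[OF h(1)]]
          F.act_in[OF freeD(1)[OF h(3)] y f(2) freeD(2)[OF h(3)]]] by simp
    then show "x = x' \<and> g = g' \<and> f = f'" using freeD(4)[OF y h(1,3) f] h by simp
  qed
  then show ?thesis by blast
qed

text \<open>In a coproduct of representables the identities are free generators, by the Yoneda
  argument. Conversely a finite functor has finitely many generators, which can be numbered by
  naturals to serve as the index set.\<close>

lemma sum_of_representables_iff:
  assumes C: "finite_category C" and F: "finite_set_functor C F"
  shows "sum_of_representables C F \<longleftrightarrow> (\<exists>G. free_on C F G)"
proof
  interpret finite_category C by fact
  interpret F: finite_set_functor C F by fact
  assume "sum_of_representables C F"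
  then obtain I :: "nat set" and c where I: "finite I" "c ` I \<subseteq> Ob C"
    and iso: "setfun_iso C F (setfun_coprod I (\<lambda>i. representable C (c i)))"
    unfolding sum_of_representables_def by blast
  let ?H = "setfun_coprod I (\<lambda>i. representable C (c i))"
  have H: "finite_set_functor C ?H" by (rule finite_set_functor_iso[OF iso F category_axioms])
  have "free_on C ?H ((\<lambda>i. (c i, (i, ident C (c i)))) ` I)"
  proof (rule free_onI)
    fix x g assume "(x, g) \<in> (\<lambda>i. (c i, (i, ident C (c i)))) ` I"
    then show "x \<in> Ob C \<and> g \<in> elts ?H x"
      using I(2) ident_in by (auto simp: setfun_coprod_def representable_def)
  next
    fix y u assume y: "y \<in> Ob C" and "u \<in> elts ?H y"
    then obtain i f where u: "u = (i, f)" "i \<in> I" "f \<in> Arr C (c i) y"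
      by (auto simp: setfun_coprod_def representable_def)
    then have "act ?H (c i) y f (i, ident C (c i)) = u"
      using ident_right[OF _ y u(3)] I(2) by (auto simp: setfun_coprod_def representable_def)
    then show "\<exists>x g f. (x, g) \<in> (\<lambda>i. (c i, (i, ident C (c i)))) ` I \<and> f \<in> Arr C x y \<and> act ?H x y f g = u"
      using u by blast
  next
    fix y x g f x' g' f' assume y: "y \<in> Ob C" and "(x, g) \<in> (\<lambda>i. (c i, (i, ident C (c i)))) ` I"
      "(x', g') \<in> (\<lambda>i. (c i, (i, ident C (c i)))) ` I" and f: "f \<in> Arr C x y" "f' \<in> Arr C x' y"
      and eq: "act ?H x y f g = act ?H x' y f' g'"
    then obtain i j where ij: "i \<in> I" "j \<in> I" "x = c i" "x' = c j" "g = (i, ident C x)" "g' = (j, ident C x')" by auto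
    have "x \<in> Ob C" "x' \<in> Ob C" using I(2) ij by auto
    then show "x = x' \<and> g = g' \<and> f = f'"
      using eq ij ident_right[OF _ y f(1)] ident_right[OF _ y f(2)]
      by (auto simp: setfun_coprod_def representable_def)
  qed
  from free_on_iso[OF setfun_iso_sym[OF iso F] this H] show "\<exists>G. free_on C F G" .
next
  interpret finite_category C by fact
  interpret F: finite_set_functor C F by fact
  assume "\<exists>G. free_on C F G"
  then obtain G where free: "free_on C F G" ..
  note freeD = free_onD[OF free]
  have "G \<subseteq> Sigma (Ob C) (elts F)" using freeD(1,2) by auto
  then have fin: "finite G" by (rule finite_subset) (use finite_Ob F.finite_elts in auto)
  then obtain n :: "'a \<times> 'c \<Rightarrow> nat" where n: "inj_on n G" using finite_imp_inj_to_nat_seg by metis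
  let ?I = "n ` G"
  let ?p = "inv_into G n"
  let ?c = "\<lambda>i. fst (?p i)"
  let ?H = "setfun_coprod ?I (\<lambda>i. representable C (?c i))"
  have p: "?p (n q) = q" if "q \<in> G" for q using n that by simp
  let ?\<theta> = "\<lambda>y (i, f). act F (?c i) y f (snd (?p i))"
  have "setfun_iso C ?H F"
  proof (rule setfun_isoI[where \<eta> = ?\<theta>])
    fix y assume y: "y \<in> Ob C"
    show "bij_betw (?\<theta> y) (elts ?H y) (elts F y)" unfolding bij_betw_def
    proof
      show "inj_on (?\<theta> y) (elts ?H y)"
      proof (rule inj_onI)
        fix a b assume "a \<in> elts ?H y" "b \<in> elts ?H y" and eq: "?\<theta> y a = ?\<theta> y b"
        then obtain x g f x' g' f' where a: "a = (n (x, g), f)" "(x, g) \<in> G" "f \<in> Arr C x y"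
          and b: "b = (n (x', g'), f')" "(x', g') \<in> G" "f' \<in> Arr C x' y"
          by (auto simp: setfun_coprod_def representable_def p)
        then have "act F x y f g = act F x' y f' g'" using eq by (simp add: p)
        then show "a = b" using freeD(4)[OF y a(2) b(2) a(3) b(3)] a b by simp
      qed
      show "?\<theta> y ` elts ?H y = elts F y"
      proof
        show "?\<theta> y ` elts ?H y \<subseteq> elts F y"
          using freeD(1,2) F.act_in[OF _ y] by (auto simp: setfun_coprod_def representable_def p)
        show "elts F y \<subseteq> ?\<theta> y ` elts ?H y"
        proof
          fix u assume "u \<in> elts F y"
          then obtain x g f where g: "(x, g) \<in> G" "f \<in> Arr C x y" "act F x y f g = u" using freeD(3)[OF y] by blast
          have "(n (x, g), f) \<in> elts ?H y" using g by (auto simp: setfun_coprod_def representable_def p)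
          moreover have "?\<theta> y (n (x, g), f) = u" using g by (simp add: p)
          ultimately show "u \<in> ?\<theta> y ` elts ?H y" by (rule rev_image_eqI[OF _ sym])
        qed
      qed
    qed
  next
    fix y z f u assume y: "y \<in> Ob C" and z: "z \<in> Ob C" and f: "f \<in> Arr C y z" and "u \<in> elts ?H y"
    then obtain x g h where u: "u = (n (x, g), h)" "(x, g) \<in> G" "h \<in> Arr C x y"
      by (auto simp: setfun_coprod_def representable_def p)
    then show "?\<theta> z (act ?H y z f u) = act F y z f (?\<theta> y u)"
      using F.act_cmp[OF freeD(1)[OF u(2)] y z u(3) f freeD(2)[OF u(2)]]
      by (simp add: setfun_coprod_def representable_def p)
  qed
  moreover have "finite_set_functor C ?H"
  proof (rule coprod_functor)
    fix i assume "i \<in> ?I"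
    then obtain x g where "i = n (x, g)" "(x, g) \<in> G" by auto
    then show "finite_set_functor C (representable C (?c i))"
      using representable_functor[OF finite_category_axioms freeD(1)] by (simp add: p)
  qed (use fin in simp)
  ultimately have "setfun_iso C F ?H" by (rule setfun_iso_sym)
  moreover have "?c ` ?I \<subseteq> Ob C" using freeD(1) by (auto simp: p)
  ultimately show "sum_of_representables C F" using fin unfolding sum_of_representables_def by blast
qed

text \<open>The action preserves the index of a summand, so generators of a coproduct split
  according to their index, and generators of the summands can be collected.\<close>

lemma free_on_coprod:
  "(\<exists>G. free_on C (setfun_coprod I F) G) \<longleftrightarrow> (\<forall>i\<in>I. \<exists>G. free_on C (F i) G)"
proof (intro iffI ballI)
  fix i assume "\<exists>G. free_on C (setfun_coprod I F) G" and i: "i \<in> I"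
  then obtain G where free: "free_on C (setfun_coprod I F) G" by blast
  note freeD = free_onD[OF free]
  have "free_on C (F i) {(x, g). (x, (i, g)) \<in> G}"
  proof (rule free_onI)
    fix x g assume "(x, g) \<in> {(x, g). (x, (i, g)) \<in> G}"
    then have "(x, (i, g)) \<in> G" by simp
    from freeD(1,2)[OF this] show "x \<in> Ob C \<and> g \<in> elts (F i) x" by (simp add: setfun_coprod_def)
  next
    fix y u assume y: "y \<in> Ob C" and u: "u \<in> elts (F i) y"
    then have "(i, u) \<in> elts (setfun_coprod I F) y" using i by (simp add: setfun_coprod_def)
    from freeD(3)[OF y this] obtain x p f where p: "(x, p) \<in> G" "f \<in> Arr C x y"
      "act (setfun_coprod I F) x y f p = (i, u)" by blast
    obtain j g where "p = (j, g)" by (cases p)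
    then have "p = (i, g)" "act (F i) x y f g = u" using p(3) by (auto simp: setfun_coprod_def)
    then show "\<exists>x g f. (x, g) \<in> {(x, g). (x, (i, g)) \<in> G} \<and> f \<in> Arr C x y \<and> act (F i) x y f g = u"
      using p by blast
  next
    fix y x g f x' g' f' assume y: "y \<in> Ob C" and "(x, g) \<in> {(x, g). (x, (i, g)) \<in> G}"
      "(x', g') \<in> {(x, g). (x, (i, g)) \<in> G}" and f: "f \<in> Arr C x y" "f' \<in> Arr C x' y"
      and eq: "act (F i) x y f g = act (F i) x' y f' g'"
    then have g: "(x, (i, g)) \<in> G" "(x', (i, g')) \<in> G" by simp_all
    show "x = x' \<and> g = g' \<and> f = f'" using freeD(4)[OF y g f] eq by (simp add: setfun_coprod_def)
  qed
  then show "\<exists>G. free_on C (F i) G" by blast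
next
  assume "\<forall>i\<in>I. \<exists>G. free_on C (F i) G"
  then obtain G where "\<forall>i\<in>I. free_on C (F i) (G i)" by (rule bchoice[THEN exE])
  then have G: "free_on C (F i) (G i)" if "i \<in> I" for i using that by blast
  let ?G = "{(x, (i, g)) | x i g. i \<in> I \<and> (x, g) \<in> G i}"
  have "free_on C (setfun_coprod I F) ?G"
  proof (rule free_onI)
    fix x p assume "(x, p) \<in> ?G"
    then obtain i g where p: "p = (i, g)" "i \<in> I" "(x, g) \<in> G i" by blast
    then show "x \<in> Ob C \<and> p \<in> elts (setfun_coprod I F) x"
      using free_onD(1,2)[OF G[OF p(2)] p(3)] by (simp add: setfun_coprod_def)
  next
    fix y p assume y: "y \<in> Ob C" and "p \<in> elts (setfun_coprod I F) y"
    then obtain i u where p: "p = (i, u)" "i \<in> I" "u \<in> elts (F i) y" by (auto simp: setfun_coprod_def)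
    obtain x g f where g: "(x, g) \<in> G i" "f \<in> Arr C x y" "act (F i) x y f g = u"
      using free_onD(3)[OF G[OF p(2)] y p(3)] by blast
    have "(x, (i, g)) \<in> ?G" "act (setfun_coprod I F) x y f (i, g) = p"
      using g p by (simp_all add: setfun_coprod_def)
    then show "\<exists>x g f. (x, g) \<in> ?G \<and> f \<in> Arr C x y \<and> act (setfun_coprod I F) x y f g = p"
      using g(2) by blast
  next
    fix y x p f x' p' f' assume y: "y \<in> Ob C" and "(x, p) \<in> ?G" "(x', p') \<in> ?G"
      and f: "f \<in> Arr C x y" "f' \<in> Arr C x' y"
      and eq: "act (setfun_coprod I F) x y f p = act (setfun_coprod I F) x' y f' p'"
    then obtain i g i' g' where p: "p = (i, g)" "i \<in> I" "(x, g) \<in> G i" "p' = (i', g')" "(x', g') \<in> G i'" by blast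
    then have "i' = i" "act (F i) x y f g = act (F i) x' y f' g'" using eq by (auto simp: setfun_coprod_def)
    then show "x = x' \<and> p = p' \<and> f = f'" using free_onD(4)[OF G[OF p(2)] y p(3) _ f] p by simp
  qed
  then show "\<exists>G. free_on C (setfun_coprod I F) G" by blast
qed

subsection \<open>The two actions on a biset\<close>

lemma op_cat_simps [simp]:
  "Ob (op_cat C) = Ob C" "Arr (op_cat C) x y = Arr C y x" "ident (op_cat C) = ident C"
  "cmp (op_cat C) x y z g f = cmp C z y x f g"
  by (simp_all add: op_cat_def)

lemma op_cat_finite_category: "finite_category C \<Longrightarrow> finite_category (op_cat C)"
  by (simp add: finite_category_def finite_category_axioms_def category_def)

lemma biset_dom_simps [simp]:
  "Ob (biset_dom C D) = Ob C \<times> Ob D" "Arr (biset_dom C D) (x, y) (x', y') = Arr C x x' \<times> Arr D y' y"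
  "ident (biset_dom C D) (x, y) = (ident C x, ident D y)"
  "cmp (biset_dom C D) (x, y) (x', y') (x'', y'') (g, h) (g', h') = (cmp C x x' x'' g g', cmp D y'' y' y h' h)"
  by (simp_all add: biset_dom_def prod_cat_def)

lemma biset_dom_category: "\<lbrakk>category C; category D\<rbrakk> \<Longrightarrow> category (biset_dom C D)"
  by (rule category.intro)
     (auto simp: category.ident_in category.cmp_in category.ident_left category.ident_right category.cmp_assoc)

definition lpart :: "('p, 'b) category \<Rightarrow> ('o \<times> 'p, 'a \<times> 'b, 'e) setfun \<Rightarrow> 'p \<Rightarrow> ('o, 'a, 'e) setfun" where
  "lpart D \<Omega> y = \<lparr>elts = (\<lambda>x. elts \<Omega> (x, y)), act = (\<lambda>x x' \<alpha>. act \<Omega> (x, y) (x', y) (\<alpha>, ident D y))\<rparr>"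

definition rpart :: "('o, 'a) category \<Rightarrow> ('o \<times> 'p, 'a \<times> 'b, 'e) setfun \<Rightarrow> 'o \<Rightarrow> ('p, 'b, 'e) setfun" where
  "rpart C \<Omega> x = \<lparr>elts = (\<lambda>y. elts \<Omega> (x, y)), act = (\<lambda>y y' \<beta>. act \<Omega> (x, y) (x, y') (ident C x, \<beta>))\<rparr>"

locale biset = C: finite_category C + D: finite_category D + F: finite_set_functor "biset_dom C D" \<Omega>
  for C :: "('o, 'a) category" and D :: "('p, 'b) category" and \<Omega> :: "('o \<times> 'p, 'a \<times> 'b, 'e) setfun"
begin

abbreviation el where "el x y \<equiv> elts \<Omega> (x, y)"
abbreviation lact where "lact y x x' \<alpha> u \<equiv> act \<Omega> (x, y) (x', y) (\<alpha>, ident D y) u"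
abbreviation ract where "ract x y y' \<beta> u \<equiv> act \<Omega> (x, y) (x, y') (ident C x, \<beta>) u"

lemma fin: "\<lbrakk>x \<in> Ob C; y \<in> Ob D\<rbrakk> \<Longrightarrow> finite (el x y)"
  using F.finite_elts[of "(x, y)"] by simp

lemma act_closed: "\<lbrakk>x \<in> Ob C; x' \<in> Ob C; y \<in> Ob D; y' \<in> Ob D; \<alpha> \<in> Arr C x x'; \<beta> \<in> Arr D y' y; u \<in> el x y\<rbrakk>
    \<Longrightarrow> act \<Omega> (x, y) (x', y') (\<alpha>, \<beta>) u \<in> el x' y'"
  using F.act_in[of "(x, y)" "(x', y')" "(\<alpha>, \<beta>)"] by simp

lemma act_act: "\<lbrakk>x \<in> Ob C; x' \<in> Ob C; x'' \<in> Ob C; y \<in> Ob D; y' \<in> Ob D; y'' \<in> Ob D; \<alpha> \<in> Arr C x x'; \<alpha>' \<in> Arr C x' x'';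
    \<beta> \<in> Arr D y' y; \<beta>' \<in> Arr D y'' y'; u \<in> el x y\<rbrakk>
    \<Longrightarrow> act \<Omega> (x', y') (x'', y'') (\<alpha>', \<beta>') (act \<Omega> (x, y) (x', y') (\<alpha>, \<beta>) u)
      = act \<Omega> (x, y) (x'', y'') (cmp C x x' x'' \<alpha>' \<alpha>, cmp D y'' y' y \<beta> \<beta>') u"
  using F.act_cmp[of "(x, y)" "(x', y')" "(x'', y'')" "(\<alpha>, \<beta>)" "(\<alpha>', \<beta>')" u] by simp

lemma lact_closed: "\<lbrakk>x \<in> Ob C; x' \<in> Ob C; y \<in> Ob D; \<alpha> \<in> Arr C x x'; u \<in> el x y\<rbrakk> \<Longrightarrow> lact y x x' \<alpha> u \<in> el x' y"
  by (rule act_closed) (auto intro: D.ident_in)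

lemma ract_closed: "\<lbrakk>x \<in> Ob C; y \<in> Ob D; y' \<in> Ob D; \<beta> \<in> Arr D y' y; u \<in> el x y\<rbrakk> \<Longrightarrow> ract x y y' \<beta> u \<in> el x y'"
  by (rule act_closed) (auto intro: C.ident_in)

lemma act_ident: "\<lbrakk>x \<in> Ob C; y \<in> Ob D; u \<in> el x y\<rbrakk> \<Longrightarrow> act \<Omega> (x, y) (x, y) (ident C x, ident D y) u = u"
  using F.act_ident[of "(x, y)" u] by simp

lemma lact_lact: "\<lbrakk>x \<in> Ob C; x' \<in> Ob C; x'' \<in> Ob C; y \<in> Ob D; \<alpha> \<in> Arr C x x'; \<alpha>' \<in> Arr C x' x''; u \<in> el x y\<rbrakk>
    \<Longrightarrow> lact y x' x'' \<alpha>' (lact y x x' \<alpha> u) = lact y x x'' (cmp C x x' x'' \<alpha>' \<alpha>) u"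
  by (simp add: act_act D.ident_in D.ident_left)

lemma ract_ract: "\<lbrakk>x \<in> Ob C; y \<in> Ob D; y' \<in> Ob D; y'' \<in> Ob D; \<beta> \<in> Arr D y' y; \<beta>' \<in> Arr D y'' y'; u \<in> el x y\<rbrakk>
    \<Longrightarrow> ract x y' y'' \<beta>' (ract x y y' \<beta> u) = ract x y y'' (cmp D y'' y' y \<beta> \<beta>') u"
  by (simp add: act_act C.ident_in C.ident_left)

lemma lact_ract: "\<lbrakk>x \<in> Ob C; x' \<in> Ob C; y \<in> Ob D; y' \<in> Ob D; \<alpha> \<in> Arr C x x'; \<beta> \<in> Arr D y' y; u \<in> el x y\<rbrakk>
    \<Longrightarrow> lact y' x x' \<alpha> (ract x y y' \<beta> u) = act \<Omega> (x, y) (x', y') (\<alpha>, \<beta>) u"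
  by (simp add: act_act C.ident_in D.ident_in C.ident_right D.ident_right)

lemma ract_lact: "\<lbrakk>x \<in> Ob C; x' \<in> Ob C; y \<in> Ob D; y' \<in> Ob D; \<alpha> \<in> Arr C x x'; \<beta> \<in> Arr D y' y; u \<in> el x y\<rbrakk>
    \<Longrightarrow> ract x' y y' \<beta> (lact y x x' \<alpha> u) = act \<Omega> (x, y) (x', y') (\<alpha>, \<beta>) u"
  by (simp add: act_act C.ident_in D.ident_in C.ident_left D.ident_left)

lemma lact_ract_commute: "\<lbrakk>x \<in> Ob C; x' \<in> Ob C; y \<in> Ob D; y' \<in> Ob D; \<alpha> \<in> Arr C x x'; \<beta> \<in> Arr D y' y; u \<in> el x y\<rbrakk>
    \<Longrightarrow> lact y' x x' \<alpha> (ract x y y' \<beta> u) = ract x' y y' \<beta> (lact y x x' \<alpha> u)"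
  by (simp add: lact_ract ract_lact)

lemma lpart_functor: "y \<in> Ob D \<Longrightarrow> finite_set_functor C (lpart D \<Omega> y)"
  by (rule finite_set_functor.intro) (auto simp: lpart_def fin lact_closed act_ident lact_lact)

lemma rpart_functor: "x \<in> Ob C \<Longrightarrow> finite_set_functor (op_cat D) (rpart C \<Omega> x)"
  by (rule finite_set_functor.intro) (auto simp: rpart_def fin ract_closed act_ident ract_ract)

end

text \<open>The left set is a coproduct over the objects of \<open>D\<close> and the right set one
  over the objects of \<open>C\<close>, so each condition can be tested with the other variable
  fixed.\<close>

lemma (in biset) birepresentable_iff:
  "birepresentable C D \<Omega> \<longleftrightarrow>
     (\<forall>y\<in>Ob D. \<exists>G. free_on C (lpart D \<Omega> y) G) \<and> (\<forall>x\<in>Ob C. \<exists>G. free_on (op_cat D) (rpart C \<Omega> x) G)"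
proof -
  have l: "left_set D \<Omega> = setfun_coprod (Ob D) (lpart D \<Omega>)"
    by (simp add: left_set_def lpart_def[abs_def])
  have r: "right_set C \<Omega> = setfun_coprod (Ob C) (rpart C \<Omega>)"
    by (simp add: right_set_def rpart_def[abs_def])
  have fl: "finite_set_functor C (setfun_coprod (Ob D) (lpart D \<Omega>))"
    and fr: "finite_set_functor (op_cat D) (setfun_coprod (Ob C) (rpart C \<Omega>))"
    by (rule coprod_functor lpart_functor rpart_functor C.finite_Ob D.finite_Ob | assumption)+
  show ?thesis
    unfolding birepresentable_def l r sum_of_representables_iff[OF C.finite_category_axioms fl]
      sum_of_representables_iff[OF op_cat_finite_category[OF D.finite_category_axioms] fr] free_on_coprod
    using F.finite_set_functor_axioms by simp
qed

lemma birepresentable_biset: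
  "\<lbrakk>finite_category C; finite_category D; birepresentable C D \<Omega>\<rbrakk> \<Longrightarrow> biset C D \<Omega>"
  by (simp add: biset_def birepresentable_def)

lemma biset_iso:
  assumes "biset C D \<Omega>" "setfun_iso (biset_dom C D) \<Omega> \<Omega>'"
  shows "biset C D \<Omega>'"
proof -
  interpret biset C D \<Omega> by fact
  have "finite_set_functor (biset_dom C D) \<Omega>'"
    by (rule finite_set_functor_iso[OF assms(2) F.finite_set_functor_axioms
          biset_dom_category[OF C.category_axioms D.category_axioms]])
  then show ?thesis by (simp add: biset_def C.finite_category_axioms D.finite_category_axioms)
qed

lemma birepresentable_iso:
  assumes \<Omega>: "biset C D \<Omega>" and iso: "setfun_iso (biset_dom C D) \<Omega> \<Omega>'" and bi: "birepresentable C D \<Omega>"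
  shows "birepresentable C D \<Omega>'"
proof -
  interpret biset C D \<Omega> by fact
  interpret B: biset C D \<Omega>' by (rule biset_iso[OF \<Omega> iso])
  from iso obtain \<eta> where "setfun_iso_by (biset_dom C D) \<Omega> \<Omega>' \<eta>" by (rule setfun_isoE)
  note \<eta> = setfun_iso_byD[OF this]
  have l: "setfun_iso C (lpart D \<Omega> y) (lpart D \<Omega>' y)" if y: "y \<in> Ob D" for y
  proof (rule setfun_isoI[where \<eta> = "\<lambda>x. \<eta> (x, y)"])
    fix x assume x: "x \<in> Ob C"
    show "bij_betw (\<eta> (x, y)) (elts (lpart D \<Omega> y) x) (elts (lpart D \<Omega>' y) x)"
      using \<eta>(1)[of "(x, y)"] x y by (simp add: lpart_def)
    fix x' f u assume "x' \<in> Ob C" "f \<in> Arr C x x'" "u \<in> elts (lpart D \<Omega> y) x"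
    then show "\<eta> (x', y) (act (lpart D \<Omega> y) x x' f u) = act (lpart D \<Omega>' y) x x' f (\<eta> (x, y) u)"
      using \<eta>(2)[of "(x, y)" "(x', y)" "(f, ident D y)" u] x y D.ident_in[OF y] by (simp add: lpart_def)
  qed
  have r: "setfun_iso (op_cat D) (rpart C \<Omega> x) (rpart C \<Omega>' x)" if x: "x \<in> Ob C" for x
  proof (rule setfun_isoI[where \<eta> = "\<lambda>y. \<eta> (x, y)"])
    fix y assume "y \<in> Ob (op_cat D)"
    then have y: "y \<in> Ob D" by simp
    show "bij_betw (\<eta> (x, y)) (elts (rpart C \<Omega> x) y) (elts (rpart C \<Omega>' x) y)"
      using \<eta>(1)[of "(x, y)"] x y by (simp add: rpart_def)
    fix y' f u assume "y' \<in> Ob (op_cat D)" "f \<in> Arr (op_cat D) y y'" "u \<in> elts (rpart C \<Omega> x) y"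
    then show "\<eta> (x, y') (act (rpart C \<Omega> x) y y' f u) = act (rpart C \<Omega>' x) y y' f (\<eta> (x, y) u)"
      using \<eta>(2)[of "(x, y)" "(x, y')" "(ident C x, f)" u] x y C.ident_in[OF x] by (simp add: rpart_def)
  qed
  show ?thesis
    unfolding B.birepresentable_iff
  proof (intro conjI ballI)
    fix y assume y: "y \<in> Ob D"
    obtain G where "free_on C (lpart D \<Omega> y) G" using bi y unfolding birepresentable_iff by blast
    then show "\<exists>G. free_on C (lpart D \<Omega>' y) G" by (rule free_on_iso[OF l[OF y] _ lpart_functor[OF y]])
  next
    fix x assume x: "x \<in> Ob C"
    obtain G where "free_on (op_cat D) (rpart C \<Omega> x) G" using bi x unfolding birepresentable_iff by blast
    then show "\<exists>G. free_on (op_cat D) (rpart C \<Omega>' x) G" by (rule free_on_iso[OF r[OF x] _ rpart_functor[OF x]])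
  qed
qed

subsection \<open>Composition of bisets\<close>

text \<open>Evaluates \<open>h\<close> at an arbitrary member of an equivalence class; meaningful
  when \<open>h\<close> is balanced, as in \<open>class_lift_cls\<close>.\<close>

definition class_lift :: "('p \<Rightarrow> 'c) \<Rightarrow> 'p set \<Rightarrow> 'c" where
  "class_lift h K = h (SOME q. q \<in> K)"

locale biset_pair = L: biset C D \<Omega> + R: biset D E \<Psi>
  for C :: "('o, 'a) category" and D :: "('p, 'b) category" and E :: "('q, 'c) category"
    and \<Omega> :: "('o \<times> 'p, 'a \<times> 'b, 'e) setfun" and \<Psi> :: "('p \<times> 'q, 'b \<times> 'c, 'f) setfun"
begin

abbreviation rel where "rel x z \<equiv> biset_rel C D E \<Omega> \<Psi> (x, z)"
abbreviation cls where "cls x z q \<equiv> rel x z `` {q}"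
abbreviation comp where "comp \<equiv> biset_comp C D E \<Omega> \<Psi>"

lemma rel_equiv: "equiv UNIV (rel x z)"
proof (rule equivI)
  show "sym (rel x z)" unfolding biset_rel_def Let_def prod.case by (rule sym_rtrancl) (simp add: sym_Un_converse)
qed (simp_all add: biset_rel_def Let_def refl_rtrancl trans_rtrancl)

lemma cls_eq_iff: "cls x z p = cls x z q \<longleftrightarrow> (p, q) \<in> rel x z"
  by (rule eq_equiv_class_iff[OF rel_equiv]) simp_all

lemma cls_self: "p \<in> cls x z p"
  using equiv_class_self[OF rel_equiv] by simp

lemma cls_balanced:
  assumes "y \<in> Ob D" "y' \<in> Ob D" "\<beta> \<in> Arr D y y'" "u \<in> L.el x y'" "v \<in> R.el y z"
  shows "cls x z (y, L.ract x y' y \<beta> u, v) = cls x z (y', u, R.lact z y y' \<beta> v)"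
proof -
  have "((y, L.ract x y' y \<beta> u, v), (y', u, R.lact z y y' \<beta> v)) \<in> rel x z"
    unfolding biset_rel_def Let_def prod.case
    by (rule r_into_rtrancl, rule UnI1) (use assms in blast)
  then show ?thesis by (simp only: cls_eq_iff)
qed

text \<open>A function that agrees on the generating pairs is constant along every chain of them.
  This is the universal property of the tensor product over the middle category.\<close>

lemma rel_invariant:
  assumes "(p, q) \<in> rel x z"
    and bal: "\<And>y y' \<beta> u v. \<lbrakk>y \<in> Ob D; y' \<in> Ob D; \<beta> \<in> Arr D y y'; u \<in> L.el x y'; v \<in> R.el y z\<rbrakk>
      \<Longrightarrow> h (y, L.ract x y' y \<beta> u, v) = h (y', u, R.lact z y y' \<beta> v)"
  shows "h p = h q"
  using assms(1) unfolding biset_rel_def Let_def prod.case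
proof induction
  case base
  show ?case ..
next
  case (step q r)
  have "h q = h r" using step.hyps(2) bal by (elim UnE converseE CollectE exE conjE Pair_inject) simp_all
  then show ?case using step.IH by simp
qed

lemma class_lift_cls:
  assumes "\<And>y y' \<beta> u v. \<lbrakk>y \<in> Ob D; y' \<in> Ob D; \<beta> \<in> Arr D y y'; u \<in> L.el x y'; v \<in> R.el y z\<rbrakk>
      \<Longrightarrow> h (y, L.ract x y' y \<beta> u, v) = h (y', u, R.lact z y y' \<beta> v)"
  shows "class_lift h (cls x z p) = h p"
proof -
  have "(SOME q. q \<in> cls x z p) \<in> cls x z p" by (rule someI) (rule cls_self)
  then have "(p, SOME q. q \<in> cls x z p) \<in> rel x z" by simp
  from rel_invariant[of _ _ x z h, OF this assms] show ?thesis by (simp add: class_lift_def)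
qed

lemma comp_elts: "elts comp (x, z) = {cls x z (y, u, v) | y u v. y \<in> Ob D \<and> u \<in> L.el x y \<and> v \<in> R.el y z}"
  by (auto simp: biset_comp_def biset_pairs_def quotient_def)

lemma comp_eltsI: "\<lbrakk>y \<in> Ob D; u \<in> L.el x y; v \<in> R.el y z\<rbrakk> \<Longrightarrow> cls x z (y, u, v) \<in> elts comp (x, z)"
  unfolding comp_elts by blast

lemma comp_eltsE:
  assumes "K \<in> elts comp (x, z)"
  obtains y u v where "y \<in> Ob D" "u \<in> L.el x y" "v \<in> R.el y z" "K = cls x z (y, u, v)"
  using assms unfolding comp_elts by blast

text \<open>The action on a class is defined by acting on all its members. Acting on both outer
  sides commutes with moving a middle morphism across, so one member suffices.\<close>

lemma comp_act:
  assumes x: "x \<in> Ob C" "x' \<in> Ob C" and z: "z \<in> Ob E" "z' \<in> Ob E" and \<alpha>: "\<alpha> \<in> Arr C x x'" and \<gamma>: "\<gamma> \<in> Arr E z' z"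
  shows "act comp (x, z) (x', z') (\<alpha>, \<gamma>) (cls x z (y, u, v))
    = cls x' z' (y, L.lact y x x' \<alpha> u, R.ract y z z' \<gamma> v)"
proof -
  let ?f = "\<lambda>(y, u, v). (y, L.lact y x x' \<alpha> u, R.ract y z z' \<gamma> v)"
  have "cls x' z' (?f p) = cls x' z' (?f q)" if "(p, q) \<in> rel x z" for p q
  proof (rule rel_invariant[of p q x z "\<lambda>q. cls x' z' (?f q)", OF that])
    fix y y' \<beta> u v
    assume a: "y \<in> Ob D" "y' \<in> Ob D" "\<beta> \<in> Arr D y y'" "u \<in> L.el x y'" "v \<in> R.el y z"
    have "cls x' z' (?f (y, L.ract x y' y \<beta> u, v)) = cls x' z' (y, L.ract x' y' y \<beta> (L.lact y' x x' \<alpha> u), R.ract y z z' \<gamma> v)"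
      using L.lact_ract_commute[OF x a(2,1) \<alpha> a(3,4)] by simp
    also have "\<dots> = cls x' z' (y', L.lact y' x x' \<alpha> u, R.lact z' y y' \<beta> (R.ract y z z' \<gamma> v))"
      by (rule cls_balanced[OF a(1-3) L.lact_closed[OF x a(2) \<alpha> a(4)] R.ract_closed[OF a(1) z \<gamma> a(5)]])
    also have "\<dots> = cls x' z' (?f (y', u, R.lact z y y' \<beta> v))"
      using R.lact_ract_commute[OF a(1,2) z a(3) \<gamma> a(5)] by simp
    finally show "cls x' z' (?f (y, L.ract x y' y \<beta> u, v)) = cls x' z' (?f (y', u, R.lact z y y' \<beta> v))" .
  qed
  then have "cls x' z' (?f q) = cls x' z' (?f (y, u, v))" if "q \<in> cls x z (y, u, v)" for q
    using that by blast
  then have "(\<Union>q\<in>cls x z (y, u, v). cls x' z' (?f q)) = cls x' z' (?f (y, u, v))"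
    using cls_self[of "(y, u, v)" x z] by blast
  moreover have "act comp (x, z) (x', z') (\<alpha>, \<gamma>) (cls x z (y, u, v)) = rel x' z' `` (?f ` cls x z (y, u, v))"
    by (simp add: biset_comp_def)
  moreover have "rel x' z' `` (?f ` cls x z (y, u, v)) = (\<Union>q\<in>cls x z (y, u, v). cls x' z' (?f q))"
    by blast
  ultimately show ?thesis by simp
qed

lemma comp_finite: "\<lbrakk>x \<in> Ob C; z \<in> Ob E\<rbrakk> \<Longrightarrow> finite (elts comp (x, z))"
proof -
  assume xz: "x \<in> Ob C" "z \<in> Ob E"
  have "elts comp (x, z) = (\<lambda>q. cls x z q) ` (SIGMA y:Ob D. L.el x y \<times> R.el y z)"
    unfolding comp_elts by auto
  moreover have "finite (SIGMA y:Ob D. L.el x y \<times> R.el y z)"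
    using L.fin[OF xz(1)] R.fin[OF _ xz(2)] L.D.finite_Ob by (intro finite_SigmaI finite_cartesian_product)
  ultimately show ?thesis by simp
qed

lemma comp_biset: "biset C E comp"
proof -
  have "finite_set_functor (biset_dom C E) comp"
  proof (rule finite_set_functor.intro)
    fix p assume "p \<in> Ob (biset_dom C E)"
    then obtain x z where p: "p = (x, z)" "x \<in> Ob C" "z \<in> Ob E" by auto
    then show "finite (elts comp p)" using comp_finite by simp
    fix K assume "K \<in> elts comp p"
    then obtain y u v where K: "y \<in> Ob D" "u \<in> L.el x y" "v \<in> R.el y z" "K = cls x z (y, u, v)"
      using comp_eltsE p(1) by blast
    then show "act comp p p (ident (biset_dom C E) p) K = K"
      using p comp_act[OF p(2,2,3,3) L.C.ident_in[OF p(2)] R.D.ident_in[OF p(3)]]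
        L.act_ident[OF p(2) K(1,2)] R.act_ident[OF K(1) p(3) K(3)] by simp
  next
    fix p q f K assume "p \<in> Ob (biset_dom C E)" "q \<in> Ob (biset_dom C E)" "f \<in> Arr (biset_dom C E) p q" "K \<in> elts comp p"
    then obtain x z x' z' \<alpha> \<gamma> where p: "p = (x, z)" "q = (x', z')" "f = (\<alpha>, \<gamma>)" "x \<in> Ob C" "z \<in> Ob E" "x' \<in> Ob C" "z' \<in> Ob E"
      "\<alpha> \<in> Arr C x x'" "\<gamma> \<in> Arr E z' z" and K': "K \<in> elts comp (x, z)" by (cases p, cases q, cases f) auto
    from K' obtain y u v where K: "y \<in> Ob D" "u \<in> L.el x y" "v \<in> R.el y z" "K = cls x z (y, u, v)" by (rule comp_eltsE)
    show "act comp p q f K \<in> elts comp q"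
      using comp_eltsI[OF K(1) L.lact_closed[OF p(4,6) K(1) p(8) K(2)] R.ract_closed[OF K(1) p(5,7,9) K(3)]]
        comp_act[OF p(4,6,5,7,8,9)] K(4) p(1-3) by simp
  next
    fix p q r f g K assume "p \<in> Ob (biset_dom C E)" "q \<in> Ob (biset_dom C E)" "r \<in> Ob (biset_dom C E)"
      "f \<in> Arr (biset_dom C E) p q" "g \<in> Arr (biset_dom C E) q r" "K \<in> elts comp p"
    then obtain x z x' z' x'' z'' \<alpha> \<gamma> \<alpha>' \<gamma>' where p: "p = (x, z)" "q = (x', z')" "r = (x'', z'')" "f = (\<alpha>, \<gamma>)" "g = (\<alpha>', \<gamma>')"
      and o: "x \<in> Ob C" "z \<in> Ob E" "x' \<in> Ob C" "z' \<in> Ob E" "x'' \<in> Ob C" "z'' \<in> Ob E"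
      and a: "\<alpha> \<in> Arr C x x'" "\<gamma> \<in> Arr E z' z" "\<alpha>' \<in> Arr C x' x''" "\<gamma>' \<in> Arr E z'' z'" and K': "K \<in> elts comp (x, z)"
      by (cases p, cases q, cases r, cases f, cases g) auto
    from K' obtain y u v where K: "y \<in> Ob D" "u \<in> L.el x y" "v \<in> R.el y z" "K = cls x z (y, u, v)" by (rule comp_eltsE)
    show "act comp p r (cmp (biset_dom C E) p q r g f) K = act comp q r g (act comp p q f K)"
      using comp_act[OF o(1,3,2,4) a(1,2)] comp_act[OF o(3,5,4,6) a(3,4)]
        comp_act[OF o(1,5,2,6) L.C.cmp_in[OF o(1,3,5) a(1,3)] R.D.cmp_in[OF o(6,4,2) a(4,2)]]
        L.lact_lact[OF o(1,3,5) K(1) a(1,3) K(2)] R.ract_ract[OF K(1) o(2,4,6) a(2,4) K(3)] K(4) p by simp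
  qed
  then show ?thesis by (simp add: biset_def L.C.finite_category_axioms R.D.finite_category_axioms)
qed

text \<open>All isomorphisms out of composites are obtained here. The map \<open>m\<close> is given
  on triples; it has to be balanced, surjective, natural, and injective up to the equivalence
  relation.\<close>

lemma comp_isoI:
  assumes closed: "\<And>x z y u v. \<lbrakk>x \<in> Ob C; z \<in> Ob E; y \<in> Ob D; u \<in> L.el x y; v \<in> R.el y z\<rbrakk> \<Longrightarrow> m x z (y, u, v) \<in> elts K (x, z)"
    and bal: "\<And>x z y y' \<beta> u v. \<lbrakk>x \<in> Ob C; z \<in> Ob E; y \<in> Ob D; y' \<in> Ob D; \<beta> \<in> Arr D y y'; u \<in> L.el x y'; v \<in> R.el y z\<rbrakk>
      \<Longrightarrow> m x z (y, L.ract x y' y \<beta> u, v) = m x z (y', u, R.lact z y y' \<beta> v)"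
    and surj: "\<And>x z k. \<lbrakk>x \<in> Ob C; z \<in> Ob E; k \<in> elts K (x, z)\<rbrakk>
      \<Longrightarrow> \<exists>y u v. y \<in> Ob D \<and> u \<in> L.el x y \<and> v \<in> R.el y z \<and> m x z (y, u, v) = k"
    and inj: "\<And>x z y u v y' u' v'. \<lbrakk>x \<in> Ob C; z \<in> Ob E; y \<in> Ob D; u \<in> L.el x y; v \<in> R.el y z;
      y' \<in> Ob D; u' \<in> L.el x y'; v' \<in> R.el y' z; m x z (y, u, v) = m x z (y', u', v')\<rbrakk>
      \<Longrightarrow> cls x z (y, u, v) = cls x z (y', u', v')"
    and nat: "\<And>x x' z z' \<alpha> \<gamma> y u v. \<lbrakk>x \<in> Ob C; x' \<in> Ob C; z \<in> Ob E; z' \<in> Ob E; \<alpha> \<in> Arr C x x'; \<gamma> \<in> Arr E z' z;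
      y \<in> Ob D; u \<in> L.el x y; v \<in> R.el y z\<rbrakk>
      \<Longrightarrow> m x' z' (y, L.lact y x x' \<alpha> u, R.ract y z z' \<gamma> v) = act K (x, z) (x', z') (\<alpha>, \<gamma>) (m x z (y, u, v))"
  shows "setfun_iso (biset_dom C E) comp K"
proof (rule setfun_isoI[where \<eta> = "\<lambda>(x, z). class_lift (m x z)"])
  have lift: "class_lift (m x z) (cls x z p) = m x z p" if "x \<in> Ob C" "z \<in> Ob E" for x z p
    by (rule class_lift_cls) (rule bal[OF that])
  {
    fix p assume "p \<in> Ob (biset_dom C E)"
    then obtain x z where p: "p = (x, z)" "x \<in> Ob C" "z \<in> Ob E" by auto
    have "bij_betw (class_lift (m x z)) (elts comp (x, z)) (elts K (x, z))"
      unfolding bij_betw_def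
    proof
      show "inj_on (class_lift (m x z)) (elts comp (x, z))"
      proof (rule inj_onI)
        fix k k' assume k: "k \<in> elts comp (x, z)" and k': "k' \<in> elts comp (x, z)"
          and eq: "class_lift (m x z) k = class_lift (m x z) k'"
        from k obtain y u v where q: "y \<in> Ob D" "u \<in> L.el x y" "v \<in> R.el y z" "k = cls x z (y, u, v)" by (rule comp_eltsE)
        from k' obtain y' u' v' where q': "y' \<in> Ob D" "u' \<in> L.el x y'" "v' \<in> R.el y' z" "k' = cls x z (y', u', v')" by (rule comp_eltsE)
        show "k = k'"
          unfolding q(4) q'(4) by (rule inj[OF p(2,3) q(1-3) q'(1-3)]) (use eq q(4) q'(4) lift[OF p(2,3)] in simp)
      qed
      show "class_lift (m x z) ` elts comp (x, z) = elts K (x, z)"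
      proof
        show "class_lift (m x z) ` elts comp (x, z) \<subseteq> elts K (x, z)"
        proof
          fix k assume "k \<in> class_lift (m x z) ` elts comp (x, z)"
          then obtain k' where k': "k = class_lift (m x z) k'" "k' \<in> elts comp (x, z)" by blast
          from k'(2) obtain y u v where q: "y \<in> Ob D" "u \<in> L.el x y" "v \<in> R.el y z" "k' = cls x z (y, u, v)" by (rule comp_eltsE)
          show "k \<in> elts K (x, z)" unfolding k'(1) q(4) lift[OF p(2,3)] by (rule closed[OF p(2,3) q(1-3)])
        qed
        show "elts K (x, z) \<subseteq> class_lift (m x z) ` elts comp (x, z)"
        proof
          fix k assume "k \<in> elts K (x, z)"
          from surj[OF p(2,3) this] obtain y u v where q: "y \<in> Ob D" "u \<in> L.el x y" "v \<in> R.el y z" "m x z (y, u, v) = k"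
            by blast
          show "k \<in> class_lift (m x z) ` elts comp (x, z)"
            by (rule rev_image_eqI[OF comp_eltsI[OF q(1-3)]]) (simp add: lift[OF p(2,3)] q(4))
        qed
      qed
    qed
    then show "bij_betw (case p of (x, z) \<Rightarrow> class_lift (m x z)) (elts comp p) (elts K p)" by (simp add: p(1))
  next
    fix p q f k assume "p \<in> Ob (biset_dom C E)" "q \<in> Ob (biset_dom C E)" "f \<in> Arr (biset_dom C E) p q" "k \<in> elts comp p"
    then obtain x z x' z' \<alpha> \<gamma> where p: "p = (x, z)" "q = (x', z')" "f = (\<alpha>, \<gamma>)" "x \<in> Ob C" "z \<in> Ob E" "x' \<in> Ob C" "z' \<in> Ob E"
      "\<alpha> \<in> Arr C x x'" "\<gamma> \<in> Arr E z' z" and K': "k \<in> elts comp (x, z)" by (cases p, cases q, cases f) auto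
    from K' obtain y u v where k: "y \<in> Ob D" "u \<in> L.el x y" "v \<in> R.el y z" "k = cls x z (y, u, v)" by (rule comp_eltsE)
    show "(case q of (x, z) \<Rightarrow> class_lift (m x z)) (act comp p q f k) = act K p q f ((case p of (x, z) \<Rightarrow> class_lift (m x z)) k)"
      unfolding p(1-3) prod.case k(4) comp_act[OF p(4,6,5,7,8,9)] lift[OF p(4,5)] lift[OF p(6,7)]
      by (rule nat[OF p(4,6,5,7,8,9) k(1-3)])
  }
qed

text \<open>Generators of a composite are the classes built from a generator \<open>g\<close> of the
  right factor over \<open>(y, z)\<close> and a generator \<open>h\<close> of the left factor over
  \<open>(x, y)\<close>. Uniqueness needs an invariant that recovers the triple from its
  class.\<close>

lemma comp_free_left:
  assumes z: "z \<in> Ob E" and fR: "free_on D (lpart E \<Psi> z) G"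
    and fL: "\<And>y. y \<in> Ob D \<Longrightarrow> free_on C (lpart D \<Omega> y) (H y)"
  shows "free_on C (lpart E comp z) {(x, cls x z (y, h, g)) | x y h g. (y, g) \<in> G \<and> (x, h) \<in> H y}"
    (is "free_on _ _ ?G")
proof -
  have G: "y \<in> Ob D" "g \<in> R.el y z" if "(y, g) \<in> G" for y g
    using free_onD(1,2)[OF fR that] by (simp_all add: lpart_def)
  have H: "x \<in> Ob C" "h \<in> L.el x y" if "y \<in> Ob D" "(x, h) \<in> H y" for x y h
    using free_onD(1,2)[OF fL[OF that(1)] that(2)] by (simp_all add: lpart_def)
  have Gex: "\<exists>y0 g f. (y0, g) \<in> G \<and> f \<in> Arr D y0 y \<and> R.lact z y0 y f g = v" if "y \<in> Ob D" "v \<in> R.el y z" for y v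
    using free_onD(3)[OF fR that(1), of v] that(2) by (simp add: lpart_def)
  have Guniq: "y0 = y1 \<and> g = g' \<and> f = f'"
    if "y \<in> Ob D" "(y0, g) \<in> G" "(y1, g') \<in> G" "f \<in> Arr D y0 y" "f' \<in> Arr D y1 y"
      "R.lact z y0 y f g = R.lact z y1 y f' g'" for y y0 g f y1 g' f'
    using free_onD(4)[OF fR that(1-5)] that(6) by (simp add: lpart_def)
  \<comment> \<open>Normal form of a triple: write \<open>v\<close> uniquely as \<open>f g\<close>
    with \<open>g\<close> a generator and move \<open>f\<close> across to \<open>u\<close>. This is
    constant on classes, as \<open>\<phi>_rel\<close> shows.\<close>
  define \<phi> where "\<phi> x = (\<lambda>(y, u, v). SOME t. \<exists>y0 g f. (y0, g) \<in> G \<and> f \<in> Arr D y0 y \<and> R.lact z y0 y f g = v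
     \<and> t = (y0, g, L.ract x y y0 f u))" for x
  have \<phi>: "\<phi> x (y, u, R.lact z y0 y f g) = (y0, g, L.ract x y y0 f u)"
    if "y \<in> Ob D" "(y0, g) \<in> G" "f \<in> Arr D y0 y" for x y u y0 g f
    unfolding \<phi>_def prod.case
  proof (rule some_equality)
    show "\<exists>y0' g' f'. (y0', g') \<in> G \<and> f' \<in> Arr D y0' y \<and> R.lact z y0' y f' g' = R.lact z y0 y f g
        \<and> (y0, g, L.ract x y y0 f u) = (y0', g', L.ract x y y0' f' u)" using that by blast
    fix t assume "\<exists>y0' g' f'. (y0', g') \<in> G \<and> f' \<in> Arr D y0' y \<and> R.lact z y0' y f' g' = R.lact z y0 y f g
        \<and> t = (y0', g', L.ract x y y0' f' u)"
    then obtain y0' g' f' where t: "(y0', g') \<in> G" "f' \<in> Arr D y0' y" "R.lact z y0' y f' g' = R.lact z y0 y f g"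
      "t = (y0', g', L.ract x y y0' f' u)" by blast
    then show "t = (y0, g, L.ract x y y0 f u)" using Guniq[OF that(1) t(1) that(2) t(2) that(3) t(3)] by simp
  qed
  have \<phi>_rel: "\<phi> x p = \<phi> x q" if "(p, q) \<in> rel x z" and x: "x \<in> Ob C" for x p q
  proof (rule rel_invariant[OF that(1)])
    fix y y' \<beta> u v assume a: "y \<in> Ob D" "y' \<in> Ob D" "\<beta> \<in> Arr D y y'" "u \<in> L.el x y'" "v \<in> R.el y z"
    obtain y0 g f where g: "(y0, g) \<in> G" "f \<in> Arr D y0 y" "R.lact z y0 y f g = v" using Gex[OF a(1,5)] by blast
    note G0 = G[OF g(1)]
    have "R.lact z y y' \<beta> v = R.lact z y0 y' (cmp D y0 y y' \<beta> f) g"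
      using R.lact_lact[OF G0(1) a(1,2) z g(2) a(3) G0(2)] g(3) by simp
    then show "\<phi> x (y, L.ract x y' y \<beta> u, v) = \<phi> x (y', u, R.lact z y y' \<beta> v)"
      using \<phi>[OF a(1) g(1,2), of x "L.ract x y' y \<beta> u"] \<phi>[OF a(2) g(1) L.D.cmp_in[OF G0(1) a(1,2) g(2) a(3)], of x u]
        L.ract_ract[OF x a(2,1) G0(1) a(3) g(2) a(4)] g(3) by simp
  qed
  have actG: "act (lpart E comp z) x0 x a (cls x0 z (y, h, g)) = cls x z (y, L.lact y x0 x a h, g)"
    if "x0 \<in> Ob C" "x \<in> Ob C" "a \<in> Arr C x0 x" "y \<in> Ob D" "g \<in> R.el y z" for x0 x a y h g
    using comp_act[OF that(1,2) z z that(3) R.D.ident_in[OF z]] R.act_ident[OF that(4) z that(5)]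
    by (simp add: lpart_def)
  show ?thesis
  proof (rule free_onI)
    fix x k assume "(x, k) \<in> ?G"
    then obtain y h g where k: "k = cls x z (y, h, g)" "(y, g) \<in> G" "(x, h) \<in> H y" by blast
    show "x \<in> Ob C \<and> k \<in> elts (lpart E comp z) x"
      using H[OF G(1)[OF k(2)] k(3)] comp_eltsI[OF G(1)[OF k(2)] _ G(2)[OF k(2)]] k(1) by (simp add: lpart_def)
  next
    fix x k assume x: "x \<in> Ob C" and "k \<in> elts (lpart E comp z) x"
    then have "k \<in> elts comp (x, z)" by (simp add: lpart_def)
    then obtain y u v where k: "y \<in> Ob D" "u \<in> L.el x y" "v \<in> R.el y z" "k = cls x z (y, u, v)" by (rule comp_eltsE)
    obtain y0 g f where g: "(y0, g) \<in> G" "f \<in> Arr D y0 y" "R.lact z y0 y f g = v" using Gex[OF k(1,3)] by blast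
    note G0 = G[OF g(1)]
    have uf: "L.ract x y y0 f u \<in> L.el x y0" by (rule L.ract_closed[OF x k(1) G0(1) g(2) k(2)])
    then obtain x0 h a where h: "(x0, h) \<in> H y0" "a \<in> Arr C x0 x" "L.lact y0 x0 x a h = L.ract x y y0 f u"
      using free_onD(3)[OF fL[OF G0(1)] x, of "L.ract x y y0 f u"] by (auto simp: lpart_def)
    have "k = cls x z (y0, L.ract x y y0 f u, g)"
      using cls_balanced[OF G0(1) k(1) g(2) k(2) G0(2)] k(4) g(3) by simp
    also have "\<dots> = act (lpart E comp z) x0 x a (cls x0 z (y0, h, g))"
      using actG[OF H(1)[OF G0(1) h(1)] x h(2) G0] h(3) by simp
    finally show "\<exists>x0 k0 a. (x0, k0) \<in> ?G \<and> a \<in> Arr C x0 x \<and> act (lpart E comp z) x0 x a k0 = k"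
      using g(1) h(1,2) by blast
  next
    fix x x0 k0 a x1 k1 b assume x: "x \<in> Ob C" and "(x0, k0) \<in> ?G" "(x1, k1) \<in> ?G"
      and a: "a \<in> Arr C x0 x" "b \<in> Arr C x1 x"
      and eq: "act (lpart E comp z) x0 x a k0 = act (lpart E comp z) x1 x b k1"
    then obtain y h g y' h' g' where k: "k0 = cls x0 z (y, h, g)" "(y, g) \<in> G" "(x0, h) \<in> H y"
      and k': "k1 = cls x1 z (y', h', g')" "(y', g') \<in> G" "(x1, h') \<in> H y'" by blast
    note G0 = G[OF k(2)] and G1 = G[OF k'(2)]
    note H0 = H[OF G0(1) k(3)] and H1 = H[OF G1(1) k'(3)]
    have "cls x z (y, L.lact y x0 x a h, g) = cls x z (y', L.lact y' x1 x b h', g')"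
      using eq actG[OF H0(1) x a(1) G0] actG[OF H1(1) x a(2) G1] k(1) k'(1) by simp
    then have "\<phi> x (y, L.lact y x0 x a h, g) = \<phi> x (y', L.lact y' x1 x b h', g')"
      unfolding cls_eq_iff by (rule \<phi>_rel[OF _ x])
    moreover have "\<phi> x (y, w, g) = (y, g, w)" if "w \<in> L.el x y" "(y, g) \<in> G" for w y g
      using \<phi>[OF G(1)[OF that(2)] that(2) L.D.ident_in[OF G(1)[OF that(2)]], of x w]
        R.act_ident[OF G(1)[OF that(2)] z G(2)[OF that(2)]] L.act_ident[OF x G(1)[OF that(2)] that(1)] by simp
    ultimately have e: "y = y'" "g = g'" "L.lact y x0 x a h = L.lact y' x1 x b h'"
      using L.lact_closed[OF H0(1) x G0(1) a(1) H0(2)] L.lact_closed[OF H1(1) x G1(1) a(2) H1(2)] k(2) k'(2) by auto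
    then show "x0 = x1 \<and> k0 = k1 \<and> a = b"
      using free_onD(4)[OF fL[OF G0(1)] x k(3) _ a] k' k(1) by (simp add: lpart_def)
  qed
qed

text \<open>Mirror image of the left case: the normal form writes \<open>u\<close> as a generator
  acted on from the right and moves the arrow to \<open>v\<close>.\<close>

lemma comp_free_right:
  assumes x: "x \<in> Ob C" and fL: "free_on (op_cat D) (rpart C \<Omega> x) G"
    and fR: "\<And>y. y \<in> Ob D \<Longrightarrow> free_on (op_cat E) (rpart D \<Psi> y) (H y)"
  shows "free_on (op_cat E) (rpart C comp x) {(z, cls x z (y, g, h)) | z y h g. (y, g) \<in> G \<and> (z, h) \<in> H y}"
    (is "free_on _ _ ?G")
proof -
  have G: "y \<in> Ob D" "g \<in> L.el x y" if "(y, g) \<in> G" for y g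
    using free_onD(1,2)[OF fL that] by (simp_all add: rpart_def)
  have H: "z \<in> Ob E" "h \<in> R.el y z" if "y \<in> Ob D" "(z, h) \<in> H y" for z y h
    using free_onD(1,2)[OF fR[OF that(1)] that(2)] by (simp_all add: rpart_def)
  have Gex: "\<exists>y0 g f. (y0, g) \<in> G \<and> f \<in> Arr D y y0 \<and> L.ract x y0 y f g = u" if "y \<in> Ob D" "u \<in> L.el x y" for y u
    using free_onD(3)[OF fL, of y u] that by (simp add: rpart_def)
  have Guniq: "y0 = y1 \<and> g = g' \<and> f = f'"
    if "y \<in> Ob D" "(y0, g) \<in> G" "(y1, g') \<in> G" "f \<in> Arr D y y0" "f' \<in> Arr D y y1"
      "L.ract x y0 y f g = L.ract x y1 y f' g'" for y y0 g f y1 g' f'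
    using free_onD(4)[OF fL, of y y0 g y1 g' f f'] that by (simp add: rpart_def)
  define \<phi> where "\<phi> z = (\<lambda>(y, u, v). SOME t. \<exists>y0 g f. (y0, g) \<in> G \<and> f \<in> Arr D y y0 \<and> L.ract x y0 y f g = u
     \<and> t = (y0, g, R.lact z y y0 f v))" for z
  have \<phi>: "\<phi> z (y, L.ract x y0 y f g, v) = (y0, g, R.lact z y y0 f v)"
    if "y \<in> Ob D" "(y0, g) \<in> G" "f \<in> Arr D y y0" for z y v y0 g f
    unfolding \<phi>_def prod.case
  proof (rule some_equality)
    show "\<exists>y0' g' f'. (y0', g') \<in> G \<and> f' \<in> Arr D y y0' \<and> L.ract x y0' y f' g' = L.ract x y0 y f g
        \<and> (y0, g, R.lact z y y0 f v) = (y0', g', R.lact z y y0' f' v)" using that by blast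
    fix t assume "\<exists>y0' g' f'. (y0', g') \<in> G \<and> f' \<in> Arr D y y0' \<and> L.ract x y0' y f' g' = L.ract x y0 y f g
        \<and> t = (y0', g', R.lact z y y0' f' v)"
    then obtain y0' g' f' where t: "(y0', g') \<in> G" "f' \<in> Arr D y y0'" "L.ract x y0' y f' g' = L.ract x y0 y f g"
      "t = (y0', g', R.lact z y y0' f' v)" by blast
    then show "t = (y0, g, R.lact z y y0 f v)" using Guniq[OF that(1) t(1) that(2) t(2) that(3) t(3)] by simp
  qed
  have \<phi>_rel: "\<phi> z p = \<phi> z q" if "(p, q) \<in> rel x z" and z: "z \<in> Ob E" for z p q
  proof (rule rel_invariant[OF that(1)])
    fix y y' \<beta> u v assume a: "y \<in> Ob D" "y' \<in> Ob D" "\<beta> \<in> Arr D y y'" "u \<in> L.el x y'" "v \<in> R.el y z"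
    obtain y0 g f where g: "(y0, g) \<in> G" "f \<in> Arr D y' y0" "L.ract x y0 y' f g = u" using Gex[OF a(2,4)] by blast
    note G0 = G[OF g(1)]
    have "L.ract x y' y \<beta> u = L.ract x y0 y (cmp D y y' y0 f \<beta>) g"
      using L.ract_ract[OF x G0(1) a(2,1) g(2) a(3) G0(2)] g(3) by simp
    then show "\<phi> z (y, L.ract x y' y \<beta> u, v) = \<phi> z (y', u, R.lact z y y' \<beta> v)"
      using \<phi>[OF a(2) g(1,2), of z "R.lact z y y' \<beta> v"] \<phi>[OF a(1) g(1) L.D.cmp_in[OF a(1,2) G0(1) a(3) g(2)], of z v]
        R.lact_lact[OF a(1,2) G0(1) z a(3) g(2) a(5)] g(3) by simp
  qed
  have actG: "act (rpart C comp x) z0 z a (cls x z0 (y, g, h)) = cls x z (y, g, R.ract y z0 z a h)"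
    if "z0 \<in> Ob E" "z \<in> Ob E" "a \<in> Arr E z z0" "y \<in> Ob D" "g \<in> L.el x y" for z0 z a y h g
    using comp_act[OF x x that(1,2) L.C.ident_in[OF x] that(3)] L.act_ident[OF x that(4,5)]
    by (simp add: rpart_def)
  show ?thesis
  proof (rule free_onI)
    fix z k assume "(z, k) \<in> ?G"
    then obtain y h g where k: "k = cls x z (y, g, h)" "(y, g) \<in> G" "(z, h) \<in> H y" by blast
    show "z \<in> Ob (op_cat E) \<and> k \<in> elts (rpart C comp x) z"
      using H[OF G(1)[OF k(2)] k(3)] comp_eltsI[OF G(1)[OF k(2)] G(2)[OF k(2)]] k(1) by (simp add: rpart_def)
  next
    fix z k assume "z \<in> Ob (op_cat E)" and "k \<in> elts (rpart C comp x) z"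
    then have z: "z \<in> Ob E" and "k \<in> elts comp (x, z)" by (simp_all add: rpart_def)
    then obtain y u v where k: "y \<in> Ob D" "u \<in> L.el x y" "v \<in> R.el y z" "k = cls x z (y, u, v)" by (elim comp_eltsE)
    obtain y0 g f where g: "(y0, g) \<in> G" "f \<in> Arr D y y0" "L.ract x y0 y f g = u" using Gex[OF k(1,2)] by blast
    note G0 = G[OF g(1)]
    have uf: "R.lact z y y0 f v \<in> R.el y0 z" by (rule R.lact_closed[OF k(1) G0(1) z g(2) k(3)])
    then obtain z0 h a where h: "(z0, h) \<in> H y0" "a \<in> Arr E z z0" "R.ract y0 z0 z a h = R.lact z y y0 f v"
      using free_onD(3)[OF fR[OF G0(1)], of z "R.lact z y y0 f v"] z by (auto simp: rpart_def)
    have "k = cls x z (y0, g, R.lact z y y0 f v)"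
      using cls_balanced[OF k(1) G0(1) g(2) G0(2) k(3)] k(4) g(3) by simp
    also have "\<dots> = act (rpart C comp x) z0 z a (cls x z0 (y0, g, h))"
      using actG[OF H(1)[OF G0(1) h(1)] z h(2) G0] h(3) by simp
    finally show "\<exists>z0 k0 a. (z0, k0) \<in> ?G \<and> a \<in> Arr (op_cat E) z0 z \<and> act (rpart C comp x) z0 z a k0 = k"
      unfolding op_cat_simps using g(1) h(1,2) by blast
  next
    fix z z0 k0 a z1 k1 b assume "z \<in> Ob (op_cat E)" and "(z0, k0) \<in> ?G" "(z1, k1) \<in> ?G"
      and "a \<in> Arr (op_cat E) z0 z" "b \<in> Arr (op_cat E) z1 z"
      and eq: "act (rpart C comp x) z0 z a k0 = act (rpart C comp x) z1 z b k1"
    then obtain y h g y' h' g' where z: "z \<in> Ob E" and a: "a \<in> Arr E z z0" "b \<in> Arr E z z1"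
      and k: "k0 = cls x z0 (y, g, h)" "(y, g) \<in> G" "(z0, h) \<in> H y"
      and k': "k1 = cls x z1 (y', g', h')" "(y', g') \<in> G" "(z1, h') \<in> H y'" by auto
    note G0 = G[OF k(2)] and G1 = G[OF k'(2)]
    note H0 = H[OF G0(1) k(3)] and H1 = H[OF G1(1) k'(3)]
    have "cls x z (y, g, R.ract y z0 z a h) = cls x z (y', g', R.ract y' z1 z b h')"
      using eq actG[OF H0(1) z a(1) G0] actG[OF H1(1) z a(2) G1] k(1) k'(1) by simp
    then have "\<phi> z (y, g, R.ract y z0 z a h) = \<phi> z (y', g', R.ract y' z1 z b h')"
      unfolding cls_eq_iff by (rule \<phi>_rel[OF _ z])
    moreover have "\<phi> z (y, g, w) = (y, g, w)" if "w \<in> R.el y z" "(y, g) \<in> G" for w y g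
      using \<phi>[OF G(1)[OF that(2)] that(2) L.D.ident_in[OF G(1)[OF that(2)]], of z w]
        L.act_ident[OF x G(1)[OF that(2)] G(2)[OF that(2)]] R.act_ident[OF G(1)[OF that(2)] z that(1)] by simp
    ultimately have e: "y = y'" "g = g'" "R.ract y z0 z a h = R.ract y' z1 z b h'"
      using R.ract_closed[OF G0(1) H0(1) z a(1) H0(2)] R.ract_closed[OF G1(1) H1(1) z a(2) H1(2)] k(2) k'(2) by auto
    then show "z0 = z1 \<and> k0 = k1 \<and> a = b"
      using free_onD(4)[OF fR[OF G0(1)], of z z0 h z1 h' a b] z a k(3) k' k(1) by (simp add: rpart_def)
  qed
qed

lemma comp_birepresentable:
  assumes "birepresentable C D \<Omega>" "birepresentable D E \<Psi>"
  shows "birepresentable C E comp"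
proof -
  interpret K: biset C E comp by (rule comp_biset)
  note l = assms(1)[unfolded L.birepresentable_iff] and r = assms(2)[unfolded R.birepresentable_iff]
  from l have l1: "\<forall>y\<in>Ob D. \<exists>G. free_on C (lpart D \<Omega> y) G" by simp
  from r have r1: "\<forall>y\<in>Ob D. \<exists>G. free_on (op_cat E) (rpart D \<Psi> y) G" by simp
  from bchoice[OF l1] obtain H where H: "\<forall>y\<in>Ob D. free_on C (lpart D \<Omega> y) (H y)" by (rule exE)
  from bchoice[OF r1] obtain H' where H': "\<forall>y\<in>Ob D. free_on (op_cat E) (rpart D \<Psi> y) (H' y)" by (rule exE)
  show ?thesis unfolding K.birepresentable_iff
  proof (intro conjI ballI)
    fix z assume z: "z \<in> Ob E"
    obtain G where "free_on D (lpart E \<Psi> z) G" using r z by blast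
    from comp_free_left[OF z this, of H] H show "\<exists>G. free_on C (lpart E comp z) G" by blast
  next
    fix x assume x: "x \<in> Ob C"
    obtain G where "free_on (op_cat D) (rpart C \<Omega> x) G" using l x by blast
    from comp_free_right[OF x this, of H'] H' show "\<exists>G. free_on (op_cat E) (rpart C comp x) G" by blast
  qed
qed

end

subsection \<open>Isomorphisms between composite bisets\<close>

lemma id_biset_simps:
  "elts (id_biset C) (x, y) = Arr C y x"
  "act (id_biset C) (x, y) (x', y') (\<alpha>, \<beta>) u = cmp C y' y x' (cmp C y x x' \<alpha> u) \<beta>"
  by (simp_all add: id_biset_def functor_biset_def)

lemma id_biset_biset:
  assumes "finite_category C"
  shows "biset C C (id_biset C)"
proof -
  interpret finite_category C by fact
  have "finite_set_functor (biset_dom C C) (id_biset C)"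
  proof (rule finite_set_functor.intro)
    fix p assume "p \<in> Ob (biset_dom C C)"
    then obtain x y where p: "p = (x, y)" "x \<in> Ob C" "y \<in> Ob C" by auto
    then show "finite (elts (id_biset C) p)" using finite_Arr by (simp add: id_biset_simps)
    fix u assume "u \<in> elts (id_biset C) p"
    then show "act (id_biset C) p p (ident (biset_dom C C) p) u = u"
      using p ident_left[OF p(3,2)] ident_right[OF p(3,2)] by (simp add: id_biset_simps)
  next
    fix p q f u assume "p \<in> Ob (biset_dom C C)" "q \<in> Ob (biset_dom C C)" "f \<in> Arr (biset_dom C C) p q" "u \<in> elts (id_biset C) p"
    then obtain x y x' y' \<alpha> \<beta> where p: "p = (x, y)" "q = (x', y')" "f = (\<alpha>, \<beta>)" and o: "x \<in> Ob C" "y \<in> Ob C" "x' \<in> Ob C" "y' \<in> Ob C"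
      and a: "\<alpha> \<in> Arr C x x'" "\<beta> \<in> Arr C y' y" "u \<in> Arr C y x" by (cases p, cases q, cases f) (auto simp: id_biset_simps)
    show "act (id_biset C) p q f u \<in> elts (id_biset C) q"
      using cmp_in[OF o(4,2,3) a(2) cmp_in[OF o(2,1,3) a(3,1)]] p by (simp add: id_biset_simps)
  next
    fix p q r f g u assume "p \<in> Ob (biset_dom C C)" "q \<in> Ob (biset_dom C C)" "r \<in> Ob (biset_dom C C)"
      "f \<in> Arr (biset_dom C C) p q" "g \<in> Arr (biset_dom C C) q r" "u \<in> elts (id_biset C) p"
    then obtain x y x' y' x'' y'' \<alpha> \<beta> \<alpha>' \<beta>' where p: "p = (x, y)" "q = (x', y')" "r = (x'', y'')" "f = (\<alpha>, \<beta>)" "g = (\<alpha>', \<beta>')"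
      and o: "x \<in> Ob C" "y \<in> Ob C" "x' \<in> Ob C" "y' \<in> Ob C" "x'' \<in> Ob C" "y'' \<in> Ob C"
      and a: "\<alpha> \<in> Arr C x x'" "\<beta> \<in> Arr C y' y" "\<alpha>' \<in> Arr C x' x''" "\<beta>' \<in> Arr C y'' y'" "u \<in> Arr C y x"
      by (cases p, cases q, cases r, cases f, cases g) (auto simp: id_biset_simps)
    note au = cmp_in[OF o(2,1,3) a(5,1)]
    have "cmp C y'' y x'' (cmp C y x x'' (cmp C x x' x'' \<alpha>' \<alpha>) u) (cmp C y'' y' y \<beta> \<beta>')
      = cmp C y'' y x'' (cmp C y x' x'' \<alpha>' (cmp C y x x' \<alpha> u)) (cmp C y'' y' y \<beta> \<beta>')"
      using cmp_assoc[OF o(2,1,3,5) a(5,1,3)] by simp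
    also have "\<dots> = cmp C y'' y' x'' (cmp C y' y x'' (cmp C y x' x'' \<alpha>' (cmp C y x x' \<alpha> u)) \<beta>) \<beta>'"
      by (rule cmp_assoc[OF o(6,4,2,5) a(4,2) cmp_in[OF o(2,3,5) au a(3)]])
    also have "\<dots> = cmp C y'' y' x'' (cmp C y' x' x'' \<alpha>' (cmp C y' y x' (cmp C y x x' \<alpha> u) \<beta>)) \<beta>'"
      using cmp_assoc[OF o(4,2,3,5) a(2) au a(3)] by simp
    finally show "act (id_biset C) p r (cmp (biset_dom C C) p q r g f) u = act (id_biset C) q r g (act (id_biset C) p q f u)"
      using p by (simp add: id_biset_simps)
  qed
  then show ?thesis by (simp add: biset_def finite_category_axioms)
qed

text \<open>With the second variable fixed at \<open>y\<close> the identity biset is the functor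
  represented by \<open>y\<close>, generated by the identity arrow; symmetrically on the other
  side.\<close>

lemma id_biset_birepresentable:
  assumes "finite_category C"
  shows "birepresentable C C (id_biset C)"
proof -
  interpret biset C C "id_biset C" by (rule id_biset_biset[OF assms])
  have "free_on C (lpart C (id_biset C) y) {(y, ident C y)}" if y: "y \<in> Ob C" for y
  proof (rule free_onI)
    fix x g assume "(x, g) \<in> {(y, ident C y)}"
    then show "x \<in> Ob C \<and> g \<in> elts (lpart C (id_biset C) y) x"
      using y C.ident_in by (simp add: lpart_def id_biset_simps)
  next
    fix x u assume x: "x \<in> Ob C" "u \<in> elts (lpart C (id_biset C) y) x"
    then have u: "u \<in> Arr C y x" by (simp add: lpart_def id_biset_simps)
    then have "act (lpart C (id_biset C) y) y x u (ident C y) = u"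
      using C.ident_right[OF y x(1) u] by (simp add: lpart_def id_biset_simps)
    then show "\<exists>x' g f. (x', g) \<in> {(y, ident C y)} \<and> f \<in> Arr C x' x \<and> act (lpart C (id_biset C) y) x' x f g = u"
      using u by blast
  next
    fix x x1 g f x2 g' f' assume x: "x \<in> Ob C" "(x1, g) \<in> {(y, ident C y)}" "(x2, g') \<in> {(y, ident C y)}"
      "f \<in> Arr C x1 x" "f' \<in> Arr C x2 x"
      "act (lpart C (id_biset C) y) x1 x f g = act (lpart C (id_biset C) y) x2 x f' g'"
    then show "x1 = x2 \<and> g = g' \<and> f = f'"
      using C.ident_right[OF y x(1)] by (auto simp: lpart_def id_biset_simps)
  qed
  moreover have "free_on (op_cat C) (rpart C (id_biset C) x) {(x, ident C x)}" if x: "x \<in> Ob C" for x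
  proof (rule free_onI)
    fix y g assume "(y, g) \<in> {(x, ident C x)}"
    then show "y \<in> Ob (op_cat C) \<and> g \<in> elts (rpart C (id_biset C) x) y"
      using x C.ident_in by (simp add: rpart_def id_biset_simps)
  next
    fix y u assume y: "y \<in> Ob (op_cat C)" "u \<in> elts (rpart C (id_biset C) x) y"
    then have u: "u \<in> Arr C y x" "y \<in> Ob C" by (simp_all add: rpart_def id_biset_simps)
    then have "act (rpart C (id_biset C) x) x y u (ident C x) = u" "u \<in> Arr (op_cat C) x y"
      using C.ident_left[OF u(2) x u(1)] C.ident_left[OF x x C.ident_in[OF x]] by (simp_all add: rpart_def id_biset_simps)
    then show "\<exists>x' g f. (x', g) \<in> {(x, ident C x)} \<and> f \<in> Arr (op_cat C) x' y \<and> act (rpart C (id_biset C) x) x' y f g = u"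
      by blast
  next
    fix y x1 g f x2 g' f' assume y: "y \<in> Ob (op_cat C)" "(x1, g) \<in> {(x, ident C x)}" "(x2, g') \<in> {(x, ident C x)}"
      "f \<in> Arr (op_cat C) x1 y" "f' \<in> Arr (op_cat C) x2 y"
      "act (rpart C (id_biset C) x) x1 y f g = act (rpart C (id_biset C) x) x2 y f' g'"
    then show "x1 = x2 \<and> g = g' \<and> f = f'"
      using C.ident_left[OF _ x, of y] C.ident_left[OF x x C.ident_in[OF x]] by (auto simp: rpart_def id_biset_simps)
  qed
  ultimately show ?thesis unfolding birepresentable_iff by blast
qed

text \<open>Isomorphisms of the factors induce an isomorphism of composites, applied componentwise
  to triples.\<close>

lemma comp_cong:
  assumes "biset_pair C D E \<Omega> \<Psi>"
    and iso: "setfun_iso (biset_dom C D) \<Omega> \<Omega>'" "setfun_iso (biset_dom D E) \<Psi> \<Psi>'"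
  shows "setfun_iso (biset_dom C E) (biset_comp C D E \<Omega> \<Psi>) (biset_comp C D E \<Omega>' \<Psi>')"
proof -
  interpret A: biset_pair C D E \<Omega> \<Psi> by fact
  interpret B: biset_pair C D E \<Omega>' \<Psi>'
    unfolding biset_pair_def using biset_iso[OF A.L.biset_axioms iso(1)] biset_iso[OF A.R.biset_axioms iso(2)] by simp
  from iso(1) A.L.F.finite_set_functor_axioms obtain \<eta> \<eta>' where
    1: "setfun_iso_by (biset_dom C D) \<Omega> \<Omega>' \<eta>" "setfun_iso_by (biset_dom C D) \<Omega>' \<Omega> \<eta>'"
    and i\<eta>: "\<And>x u. \<lbrakk>x \<in> Ob (biset_dom C D); u \<in> elts \<Omega> x\<rbrakk> \<Longrightarrow> \<eta>' x (\<eta> x u) = u"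
    "\<And>x v. \<lbrakk>x \<in> Ob (biset_dom C D); v \<in> elts \<Omega>' x\<rbrakk> \<Longrightarrow> \<eta> x (\<eta>' x v) = v" by (rule setfun_iso_inverseE) blast
  from iso(2) A.R.F.finite_set_functor_axioms obtain \<theta> \<theta>' where
    2: "setfun_iso_by (biset_dom D E) \<Psi> \<Psi>' \<theta>" "setfun_iso_by (biset_dom D E) \<Psi>' \<Psi> \<theta>'"
    and i\<theta>: "\<And>x u. \<lbrakk>x \<in> Ob (biset_dom D E); u \<in> elts \<Psi> x\<rbrakk> \<Longrightarrow> \<theta>' x (\<theta> x u) = u"
    "\<And>x v. \<lbrakk>x \<in> Ob (biset_dom D E); v \<in> elts \<Psi>' x\<rbrakk> \<Longrightarrow> \<theta> x (\<theta>' x v) = v" by (rule setfun_iso_inverseE) blast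
  note \<eta> = setfun_iso_byD[OF 1(1)] and \<eta>' = setfun_iso_byD[OF 1(2)]
  note \<theta> = setfun_iso_byD[OF 2(1)] and \<theta>' = setfun_iso_byD[OF 2(2)]
  note C = A.L.C.ident_in and D = A.L.D.ident_in and E = A.R.D.ident_in
  show ?thesis
  proof (rule A.comp_isoI[where m = "\<lambda>x z (y, u, v). B.cls x z (y, \<eta> (x, y) u, \<theta> (y, z) v)"], unfold prod.case)
    fix x z y u v assume a: "x \<in> Ob C" "z \<in> Ob E" "y \<in> Ob D" "u \<in> A.L.el x y" "v \<in> A.R.el y z"
    show "B.cls x z (y, \<eta> (x, y) u, \<theta> (y, z) v) \<in> elts B.comp (x, z)"
      by (rule B.comp_eltsI) (use a \<eta>(3)[of "(x, y)"] \<theta>(3)[of "(y, z)"] in simp_all)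
  next
    fix x z y y' \<beta> u v assume a: "x \<in> Ob C" "z \<in> Ob E" "y \<in> Ob D" "y' \<in> Ob D" "\<beta> \<in> Arr D y y'" "u \<in> A.L.el x y'" "v \<in> A.R.el y z"
    have "\<eta> (x, y) (A.L.ract x y' y \<beta> u) = B.L.ract x y' y \<beta> (\<eta> (x, y') u)"
      using \<eta>(2)[of "(x, y')" "(x, y)" "(ident C x, \<beta>)" u] a C[OF a(1)] by simp
    moreover have "\<theta> (y', z) (A.R.lact z y y' \<beta> v) = B.R.lact z y y' \<beta> (\<theta> (y, z) v)"
      using \<theta>(2)[of "(y, z)" "(y', z)" "(\<beta>, ident E z)" v] a E[OF a(2)] by simp
    moreover have "\<eta> (x, y') u \<in> B.L.el x y'" "\<theta> (y, z) v \<in> B.R.el y z"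
      using a \<eta>(3)[of "(x, y')"] \<theta>(3)[of "(y, z)"] by simp_all
    ultimately show "B.cls x z (y, \<eta> (x, y) (A.L.ract x y' y \<beta> u), \<theta> (y, z) v)
      = B.cls x z (y', \<eta> (x, y') u, \<theta> (y', z) (A.R.lact z y y' \<beta> v))"
      using B.cls_balanced[OF a(3-5)] by simp
  next
    fix x z k assume a: "x \<in> Ob C" "z \<in> Ob E" and "k \<in> elts B.comp (x, z)"
    then obtain y u v where k: "y \<in> Ob D" "u \<in> B.L.el x y" "v \<in> B.R.el y z" "k = B.cls x z (y, u, v)" by (elim B.comp_eltsE)
    have "\<eta> (x, y) (\<eta>' (x, y) u) = u" "\<theta> (y, z) (\<theta>' (y, z) v) = v" "\<eta>' (x, y) u \<in> A.L.el x y" "\<theta>' (y, z) v \<in> A.R.el y z"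
      using a k \<eta>'(3)[of "(x, y)"] i\<eta>(2)[of "(x, y)"] \<theta>'(3)[of "(y, z)"] i\<theta>(2)[of "(y, z)"] by simp_all
    then show "\<exists>y u v. y \<in> Ob D \<and> u \<in> A.L.el x y \<and> v \<in> A.R.el y z \<and> B.cls x z (y, \<eta> (x, y) u, \<theta> (y, z) v) = k"
      using k by metis
  next
    fix x z y u v y' u' v' assume a: "x \<in> Ob C" "z \<in> Ob E" "y \<in> Ob D" "u \<in> A.L.el x y" "v \<in> A.R.el y z"
      "y' \<in> Ob D" "u' \<in> A.L.el x y'" "v' \<in> A.R.el y' z"
      and eq: "B.cls x z (y, \<eta> (x, y) u, \<theta> (y, z) v) = B.cls x z (y', \<eta> (x, y') u', \<theta> (y', z) v')"
    \<comment> \<open>The inverse isomorphisms induce a map on classes in the opposite direction;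
      recovering the original class from its image proves injectivity.\<close>
    let ?n = "\<lambda>(y, u, v). A.cls x z (y, \<eta>' (x, y) u, \<theta>' (y, z) v)"
    have "class_lift ?n (B.cls x z p) = ?n p" for p
    proof (rule B.class_lift_cls, unfold prod.case)
      fix y y' \<beta> u v assume b: "y \<in> Ob D" "y' \<in> Ob D" "\<beta> \<in> Arr D y y'" "u \<in> B.L.el x y'" "v \<in> B.R.el y z"
      have "\<eta>' (x, y) (B.L.ract x y' y \<beta> u) = A.L.ract x y' y \<beta> (\<eta>' (x, y') u)"
        using \<eta>'(2)[of "(x, y')" "(x, y)" "(ident C x, \<beta>)" u] a b C[OF a(1)] by simp
      moreover have "\<theta>' (y', z) (B.R.lact z y y' \<beta> v) = A.R.lact z y y' \<beta> (\<theta>' (y, z) v)"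
        using \<theta>'(2)[of "(y, z)" "(y', z)" "(\<beta>, ident E z)" v] a b E[OF a(2)] by simp
      moreover have "\<eta>' (x, y') u \<in> A.L.el x y'" "\<theta>' (y, z) v \<in> A.R.el y z"
        using a b \<eta>'(3)[of "(x, y')"] \<theta>'(3)[of "(y, z)"] by simp_all
      ultimately show "A.cls x z (y, \<eta>' (x, y) (B.L.ract x y' y \<beta> u), \<theta>' (y, z) v)
        = A.cls x z (y', \<eta>' (x, y') u, \<theta>' (y', z) (B.R.lact z y y' \<beta> v))"
        using A.cls_balanced[OF b(1-3)] by simp
    qed
    from this[of "(y, \<eta> (x, y) u, \<theta> (y, z) v)"] this[of "(y', \<eta> (x, y') u', \<theta> (y', z) v')"] eq
    show "A.cls x z (y, u, v) = A.cls x z (y', u', v')"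
      using a i\<eta>(1)[of "(x, y)"] i\<eta>(1)[of "(x, y')"] i\<theta>(1)[of "(y, z)"] i\<theta>(1)[of "(y', z)"] by simp
  next
    fix x x' z z' \<alpha> \<gamma> y u v assume a: "x \<in> Ob C" "x' \<in> Ob C" "z \<in> Ob E" "z' \<in> Ob E" "\<alpha> \<in> Arr C x x'" "\<gamma> \<in> Arr E z' z"
      "y \<in> Ob D" "u \<in> A.L.el x y" "v \<in> A.R.el y z"
    have "\<eta> (x', y) (A.L.lact y x x' \<alpha> u) = B.L.lact y x x' \<alpha> (\<eta> (x, y) u)"
      using \<eta>(2)[of "(x, y)" "(x', y)" "(\<alpha>, ident D y)" u] a D[OF a(7)] by simp
    moreover have "\<theta> (y, z') (A.R.ract y z z' \<gamma> v) = B.R.ract y z z' \<gamma> (\<theta> (y, z) v)"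
      using \<theta>(2)[of "(y, z)" "(y, z')" "(ident D y, \<gamma>)" v] a D[OF a(7)] by simp
    ultimately show "B.cls x' z' (y, \<eta> (x', y) (A.L.lact y x x' \<alpha> u), \<theta> (y, z') (A.R.ract y z z' \<gamma> v))
      = act B.comp (x, z) (x', z') (\<alpha>, \<gamma>) (B.cls x z (y, \<eta> (x, y) u, \<theta> (y, z) v))"
      using B.comp_act[OF a(1-6)] by simp
  qed
qed

text \<open>The isomorphism lets the arrow \<open>f\<close> act on \<open>v\<close>.\<close>

lemma comp_id_left:
  assumes "biset C D \<Omega>"
  shows "setfun_iso (biset_dom C D) (biset_comp C C D (id_biset C) \<Omega>) \<Omega>"
proof -
  interpret O: biset C D \<Omega> by fact
  interpret A: biset_pair C C D "id_biset C" \<Omega>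
    unfolding biset_pair_def using id_biset_biset[OF O.C.finite_category_axioms] assms by simp
  note idl = O.C.ident_left and idr = O.C.ident_right and idn = O.C.ident_in
  have ra: "A.L.ract x y' y \<beta> f = cmp C y y' x f \<beta>"
    if "x \<in> Ob C" "y' \<in> Ob C" "f \<in> Arr C y' x" for x y y' \<beta> f
    using idl[OF that(2,1,3)] by (simp add: id_biset_simps)
  have la: "A.L.lact y x x' \<alpha> f = cmp C y x x' \<alpha> f"
    if "x \<in> Ob C" "x' \<in> Ob C" "y \<in> Ob C" "f \<in> Arr C y x" "\<alpha> \<in> Arr C x x'" for x x' y \<alpha> f
    using idr[OF that(3,2) O.C.cmp_in[OF that(3,1,2,4,5)]] by (simp add: id_biset_simps)
  show ?thesis
  proof (rule A.comp_isoI[where m = "\<lambda>x z (y, f, v). O.lact z y x f v"], unfold prod.case id_biset_simps(1))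
    fix x z y f v assume "x \<in> Ob C" "z \<in> Ob D" "y \<in> Ob C" "f \<in> Arr C y x" "v \<in> O.el y z"
    then show "O.lact z y x f v \<in> O.el x z" by (simp add: O.lact_closed)
  next
    fix x z y y' \<beta> f v assume "x \<in> Ob C" "z \<in> Ob D" "y \<in> Ob C" "y' \<in> Ob C" "\<beta> \<in> Arr C y y'" "f \<in> Arr C y' x" "v \<in> O.el y z"
    then show "O.lact z y x (A.L.ract x y' y \<beta> f) v = O.lact z y' x f (O.lact z y y' \<beta> v)"
      by (simp add: O.lact_lact ra)
  next
    fix x z k assume a: "x \<in> Ob C" "z \<in> Ob D" "k \<in> O.el x z"
    then have "O.lact z x x (ident C x) k = k" by (simp add: O.act_ident)
    then show "\<exists>y f v. y \<in> Ob C \<and> f \<in> Arr C y x \<and> v \<in> O.el y z \<and> O.lact z y x f v = k"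
      using a idn[OF a(1)] by blast
  next
    \<comment> \<open>Each class has a representative with an identity arrow in the first place,
      determined by the value of the map.\<close>
    have *: "A.cls x z (y, f, v) = A.cls x z (x, ident C x, O.lact z y x f v)"
      if a: "x \<in> Ob C" "z \<in> Ob D" "y \<in> Ob C" "f \<in> Arr C y x" "v \<in> O.el y z" for x z y f v
      using A.cls_balanced[OF a(3,1,4) _ a(5), of "ident C x" x] idn[OF a(1)] ra[OF a(1,1) idn[OF a(1)]] idl[OF a(3,1,4)]
      by (simp add: id_biset_simps(1))
    fix x z y f v y' f' v' assume a: "x \<in> Ob C" "z \<in> Ob D" "y \<in> Ob C" "f \<in> Arr C y x" "v \<in> O.el y z"
      "y' \<in> Ob C" "f' \<in> Arr C y' x" "v' \<in> O.el y' z" "O.lact z y x f v = O.lact z y' x f' v'"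
    show "A.cls x z (y, f, v) = A.cls x z (y', f', v')"
      using *[OF a(1-5)] *[OF a(1,2,6-8)] a(9) by simp
  next
    fix x x' z z' \<alpha> \<gamma> y f v assume a: "x \<in> Ob C" "x' \<in> Ob C" "z \<in> Ob D" "z' \<in> Ob D" "\<alpha> \<in> Arr C x x'" "\<gamma> \<in> Arr D z' z"
      "y \<in> Ob C" "f \<in> Arr C y x" "v \<in> O.el y z"
    show "O.lact z' y x' (A.L.lact y x x' \<alpha> f) (O.ract y z z' \<gamma> v) = act \<Omega> (x, z) (x', z') (\<alpha>, \<gamma>) (O.lact z y x f v)"
      using a O.C.cmp_in[OF a(7,1,2,8,5)] O.act_act[OF a(7,1,2,3,3,4,8,5) O.D.ident_in[OF a(3)] a(6,9)]
        O.D.ident_left[OF a(4,3,6)] by (simp add: la O.lact_ract)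
  qed
qed

lemma comp_id_right:
  assumes "biset C D \<Omega>"
  shows "setfun_iso (biset_dom C D) (biset_comp C D D \<Omega> (id_biset D)) \<Omega>"
proof -
  interpret O: biset C D \<Omega> by fact
  interpret A: biset_pair C D D \<Omega> "id_biset D"
    unfolding biset_pair_def using id_biset_biset[OF O.D.finite_category_axioms] assms by simp
  note idl = O.D.ident_left and idr = O.D.ident_right and idn = O.D.ident_in
  have ra: "A.R.ract y z z' \<gamma> f = cmp D z' z y f \<gamma>"
    if "y \<in> Ob D" "z \<in> Ob D" "f \<in> Arr D z y" for y z z' \<gamma> f
    using idl[OF that(2,1,3)] by (simp add: id_biset_simps)
  have la: "A.R.lact z y y' \<beta> f = cmp D z y y' \<beta> f"
    if "y \<in> Ob D" "y' \<in> Ob D" "z \<in> Ob D" "f \<in> Arr D z y" "\<beta> \<in> Arr D y y'" for y y' z \<beta> f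
    using idr[OF that(3,2) O.D.cmp_in[OF that(3,1,2,4,5)]] by (simp add: id_biset_simps)
  show ?thesis
  proof (rule A.comp_isoI[where m = "\<lambda>x z (y, u, f). O.ract x y z f u"], unfold prod.case id_biset_simps(1))
    fix x z y u f assume "x \<in> Ob C" "z \<in> Ob D" "y \<in> Ob D" "u \<in> O.el x y" "f \<in> Arr D z y"
    then show "O.ract x y z f u \<in> O.el x z" by (simp add: O.ract_closed)
  next
    fix x z y y' \<beta> u f assume "x \<in> Ob C" "z \<in> Ob D" "y \<in> Ob D" "y' \<in> Ob D" "\<beta> \<in> Arr D y y'" "u \<in> O.el x y'" "f \<in> Arr D z y"
    then show "O.ract x y z f (O.ract x y' y \<beta> u) = O.ract x y' z (A.R.lact z y y' \<beta> f) u"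
      by (simp add: O.ract_ract la)
  next
    fix x z k assume a: "x \<in> Ob C" "z \<in> Ob D" "k \<in> O.el x z"
    then have "O.ract x z z (ident D z) k = k" by (simp add: O.act_ident)
    then show "\<exists>y u f. y \<in> Ob D \<and> u \<in> O.el x y \<and> f \<in> Arr D z y \<and> O.ract x y z f u = k"
      using a idn[OF a(2)] by blast
  next
    have *: "A.cls x z (y, u, f) = A.cls x z (z, O.ract x y z f u, ident D z)"
      if a: "x \<in> Ob C" "z \<in> Ob D" "y \<in> Ob D" "u \<in> O.el x y" "f \<in> Arr D z y" for x z y f u
      using A.cls_balanced[OF a(2,3,5,4), of "ident D z" z] idn[OF a(2)] la[OF a(2,3,2) idn[OF a(2)] a(5)] idr[OF a(2,3,5)]
      by (simp add: id_biset_simps(1))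
    fix x z y u f y' u' f' assume a: "x \<in> Ob C" "z \<in> Ob D" "y \<in> Ob D" "u \<in> O.el x y" "f \<in> Arr D z y"
      "y' \<in> Ob D" "u' \<in> O.el x y'" "f' \<in> Arr D z y'" "O.ract x y z f u = O.ract x y' z f' u'"
    show "A.cls x z (y, u, f) = A.cls x z (y', u', f')"
      using *[OF a(1-5)] *[OF a(1,2,6-8)] a(9) by simp
  next
    fix x x' z z' \<alpha> \<gamma> y u f assume a: "x \<in> Ob C" "x' \<in> Ob C" "z \<in> Ob D" "z' \<in> Ob D" "\<alpha> \<in> Arr C x x'" "\<gamma> \<in> Arr D z' z"
      "y \<in> Ob D" "u \<in> O.el x y" "f \<in> Arr D z y"
    show "O.ract x' y z' (A.R.ract y z z' \<gamma> f) (O.lact y x x' \<alpha> u) = act \<Omega> (x, z) (x', z') (\<alpha>, \<gamma>) (O.ract x y z f u)"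
      using a O.D.cmp_in[OF a(4,3,7,6,9)] O.act_act[OF a(1,1,2,7,3,4) O.C.ident_in[OF a(1)] a(5,9,6,8)]
        O.C.ident_right[OF a(1,2,5)] by (simp add: ra O.ract_lact)
  qed
qed

text \<open>Both sides consist of classes of four-part data; only the order of forming classes
  differs. Rebracketing is well defined in either direction.\<close>

lemma comp_assoc:
  assumes "biset C D \<Omega>" "biset D E \<Psi>" "biset E G \<Theta>"
  shows "setfun_iso (biset_dom C G) (biset_comp C E G (biset_comp C D E \<Omega> \<Psi>) \<Theta>)
    (biset_comp C D G \<Omega> (biset_comp D E G \<Psi> \<Theta>))"
proof -
  interpret A: biset_pair C D E \<Omega> \<Psi> unfolding biset_pair_def using assms by simp
  interpret B: biset_pair D E G \<Psi> \<Theta> unfolding biset_pair_def using assms by simp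
  interpret AB: biset_pair C E G A.comp \<Theta> unfolding biset_pair_def using assms A.comp_biset by simp
  interpret BA: biset_pair C D G \<Omega> B.comp unfolding biset_pair_def using assms B.comp_biset by simp
  note C = A.L.C.ident_in and D = A.L.D.ident_in and E = A.R.D.ident_in and G = B.R.D.ident_in
  \<comment> \<open>Each rebracketing unpacks the inner class with \<open>class_lift\<close>;
    \<open>g\<close> is the inverse of \<open>f\<close> and is used to prove injectivity.\<close>
  define f where "f x t = (\<lambda>(z, K, w). class_lift (\<lambda>(y, u, v). BA.cls x t (y, u, B.cls y t (z, v, w))) K)" for x t
  define g where "g x t = (\<lambda>(y, u, L). class_lift (\<lambda>(z, v, w). AB.cls x t (z, A.cls x z (y, u, v), w)) L)" for x t
  have f: "f x t (z, A.cls x z (y, u, v), w) = BA.cls x t (y, u, B.cls y t (z, v, w))"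
    if a: "x \<in> Ob C" "t \<in> Ob G" "z \<in> Ob E" "w \<in> B.R.el z t" for x t z y u v w
    unfolding f_def prod.case
  proof (subst A.class_lift_cls, unfold prod.case)
    fix y y' \<beta> u v assume b: "y \<in> Ob D" "y' \<in> Ob D" "\<beta> \<in> Arr D y y'" "u \<in> A.L.el x y'" "v \<in> A.R.el y z"
    show "BA.cls x t (y, A.L.ract x y' y \<beta> u, B.cls y t (z, v, w)) = BA.cls x t (y', u, B.cls y' t (z, A.R.lact z y y' \<beta> v, w))"
      using BA.cls_balanced[OF b(1-4) B.comp_eltsI[OF a(3) b(5) a(4)]]
        B.comp_act[OF b(1,2) a(2,2) b(3) G[OF a(2)]] B.R.act_ident[OF a(3,2,4)] by simp
  qed simp
  have g: "g x t (y, u, B.cls y t (z, v, w)) = AB.cls x t (z, A.cls x z (y, u, v), w)"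
    if a: "x \<in> Ob C" "t \<in> Ob G" "y \<in> Ob D" "u \<in> A.L.el x y" for x t z y u v w
    unfolding g_def prod.case
  proof (subst B.class_lift_cls, unfold prod.case)
    fix z z' \<beta> v w assume b: "z \<in> Ob E" "z' \<in> Ob E" "\<beta> \<in> Arr E z z'" "v \<in> A.R.el y z'" "w \<in> B.R.el z t"
    show "AB.cls x t (z, A.cls x z (y, u, A.R.ract y z' z \<beta> v), w) = AB.cls x t (z', A.cls x z' (y, u, v), B.R.lact t z z' \<beta> w)"
      using AB.cls_balanced[OF b(1-3) A.comp_eltsI[OF a(3,4) b(4)] b(5)]
        A.comp_act[OF a(1,1) b(2,1) C[OF a(1)] b(3)] A.L.act_ident[OF a(1,3,4)] by simp
  qed simp
  show ?thesis
  proof (rule AB.comp_isoI[where m = f])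
    fix x t z K w assume a: "x \<in> Ob C" "t \<in> Ob G" "z \<in> Ob E" "K \<in> elts A.comp (x, z)" "w \<in> B.R.el z t"
    from a(4) obtain y u v where k: "y \<in> Ob D" "u \<in> A.L.el x y" "v \<in> A.R.el y z" "K = A.cls x z (y, u, v)" by (rule A.comp_eltsE)
    show "f x t (z, K, w) \<in> elts BA.comp (x, t)"
      unfolding k(4) f[OF a(1-3,5)] by (intro BA.comp_eltsI B.comp_eltsI k a)
  next
    fix x t z z' \<beta> K w assume a: "x \<in> Ob C" "t \<in> Ob G" "z \<in> Ob E" "z' \<in> Ob E" "\<beta> \<in> Arr E z z'"
      "K \<in> elts A.comp (x, z')" "w \<in> B.R.el z t"
    from a(6) obtain y u v where k: "y \<in> Ob D" "u \<in> A.L.el x y" "v \<in> A.R.el y z'" "K = A.cls x z' (y, u, v)" by (rule A.comp_eltsE)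
    show "f x t (z, AB.L.ract x z' z \<beta> K, w) = f x t (z', K, B.R.lact t z z' \<beta> w)"
      using A.comp_act[OF a(1,1,4,3) C[OF a(1)] a(5)] A.L.act_ident[OF a(1) k(1,2)] k(4) f[OF a(1,2,3,7)]
        f[OF a(1,2,4) B.R.lact_closed[OF a(3,4,2,5,7)]] B.cls_balanced[OF a(3,4,5) k(3) a(7)] by simp
  next
    fix x t K assume a: "x \<in> Ob C" "t \<in> Ob G" "K \<in> elts BA.comp (x, t)"
    from a(3) obtain y u L where k: "y \<in> Ob D" "u \<in> A.L.el x y" "L \<in> elts B.comp (y, t)" "K = BA.cls x t (y, u, L)" by (rule BA.comp_eltsE)
    from k(3) obtain z v w where l: "z \<in> Ob E" "v \<in> A.R.el y z" "w \<in> B.R.el z t" "L = B.cls y t (z, v, w)" by (rule B.comp_eltsE)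
    have "f x t (z, A.cls x z (y, u, v), w) = K" using f[OF a(1,2) l(1,3)] k(4) l(4) by simp
    then show "\<exists>z K' w. z \<in> Ob E \<and> K' \<in> elts A.comp (x, z) \<and> w \<in> B.R.el z t \<and> f x t (z, K', w) = K"
      using l A.comp_eltsI[OF k(1,2) l(2)] by blast
  next
    have gf: "class_lift (g x t) (f x t (z, K, w)) = AB.cls x t (z, K, w)"
      if a: "x \<in> Ob C" "t \<in> Ob G" "z \<in> Ob E" "K \<in> elts A.comp (x, z)" "w \<in> B.R.el z t" for x t z K w
    proof -
      from a(4) obtain y u v where k: "y \<in> Ob D" "u \<in> A.L.el x y" "v \<in> A.R.el y z" "K = A.cls x z (y, u, v)" by (rule A.comp_eltsE)
      have "class_lift (g x t) (BA.cls x t p) = g x t p" for p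
      proof (rule BA.class_lift_cls)
        fix y y' \<beta> u L assume b: "y \<in> Ob D" "y' \<in> Ob D" "\<beta> \<in> Arr D y y'" "u \<in> A.L.el x y'" "L \<in> elts B.comp (y, t)"
        from b(5) obtain z v w where l: "z \<in> Ob E" "v \<in> A.R.el y z" "w \<in> B.R.el z t" "L = B.cls y t (z, v, w)" by (rule B.comp_eltsE)
        show "g x t (y, A.L.ract x y' y \<beta> u, L) = g x t (y', u, BA.R.lact t y y' \<beta> L)"
          using B.comp_act[OF b(1,2) a(2,2) b(3) G[OF a(2)]] B.R.act_ident[OF l(1) a(2) l(3)] l(4)
            g[OF a(1,2) b(1) A.L.ract_closed[OF a(1) b(2,1,3,4)]] g[OF a(1,2) b(2,4)]
            A.cls_balanced[OF b(1-4) l(2)] by simp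
      qed
      then show ?thesis using k(4) f[OF a(1-3,5)] g[OF a(1,2) k(1,2)] by simp
    qed
    fix x t z K w z' K' w' assume a: "x \<in> Ob C" "t \<in> Ob G" "z \<in> Ob E" "K \<in> elts A.comp (x, z)" "w \<in> B.R.el z t"
      "z' \<in> Ob E" "K' \<in> elts A.comp (x, z')" "w' \<in> B.R.el z' t" "f x t (z, K, w) = f x t (z', K', w')"
    show "AB.cls x t (z, K, w) = AB.cls x t (z', K', w')"
      using gf[OF a(1-5)] gf[OF a(1,2,6-8)] a(9) by simp
  next
    fix x x' t t' \<alpha> \<gamma> z K w assume a: "x \<in> Ob C" "x' \<in> Ob C" "t \<in> Ob G" "t' \<in> Ob G" "\<alpha> \<in> Arr C x x'" "\<gamma> \<in> Arr G t' t"
      "z \<in> Ob E" "K \<in> elts A.comp (x, z)" "w \<in> B.R.el z t"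
    from a(8) obtain y u v where k: "y \<in> Ob D" "u \<in> A.L.el x y" "v \<in> A.R.el y z" "K = A.cls x z (y, u, v)" by (rule A.comp_eltsE)
    show "f x' t' (z, AB.L.lact z x x' \<alpha> K, B.R.ract z t t' \<gamma> w) = act BA.comp (x, t) (x', t') (\<alpha>, \<gamma>) (f x t (z, K, w))"
      using A.comp_act[OF a(1,2,7,7,5) E[OF a(7)]] A.R.act_ident[OF k(1) a(7) k(3)] k(4)
        f[OF a(2,4,7) B.R.ract_closed[OF a(7,3,4,6,9)]] f[OF a(1,3,7,9)] BA.comp_act[OF a(1-6)]
        B.comp_act[OF k(1,1) a(3,4) D[OF k(1)] a(6)] A.R.act_ident[OF k(1) a(7) k(3)] by simp
  qed
qed

section \<open>Disjoint unions of bisets and distributivity of composition\<close>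

lemma biset_sum_biset:
  assumes "biset C D \<Omega>" "biset C D \<Psi>"
  shows "biset C D (biset_sum \<Omega> \<Psi>)"
proof -
  interpret A: biset C D \<Omega> by fact
  interpret B: biset C D \<Psi> by fact
  have "finite_set_functor (biset_dom C D) (biset_sum \<Omega> \<Psi>)"
  proof (rule finite_set_functor.intro)
    fix x assume "x \<in> Ob (biset_dom C D)"
    then show "finite (elts (biset_sum \<Omega> \<Psi>) x)"
      using A.F.finite_elts B.F.finite_elts by (simp add: biset_sum_def)
  next
    fix x y f u assume "x \<in> Ob (biset_dom C D)" "y \<in> Ob (biset_dom C D)" "f \<in> Arr (biset_dom C D) x y" "u \<in> elts (biset_sum \<Omega> \<Psi>) x"
    then show "act (biset_sum \<Omega> \<Psi>) x y f u \<in> elts (biset_sum \<Omega> \<Psi>) y"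
      using A.F.act_in B.F.act_in by (cases u) (auto simp: biset_sum_def)
  next
    fix x u assume "x \<in> Ob (biset_dom C D)" "u \<in> elts (biset_sum \<Omega> \<Psi>) x"
    then show "act (biset_sum \<Omega> \<Psi>) x x (ident (biset_dom C D) x) u = u"
      using A.F.act_ident B.F.act_ident by (cases u) (auto simp: biset_sum_def)
  next
    fix x y z f g u assume "x \<in> Ob (biset_dom C D)" "y \<in> Ob (biset_dom C D)" "z \<in> Ob (biset_dom C D)"
      "f \<in> Arr (biset_dom C D) x y" "g \<in> Arr (biset_dom C D) y z" "u \<in> elts (biset_sum \<Omega> \<Psi>) x"
    then show "act (biset_sum \<Omega> \<Psi>) x z (cmp (biset_dom C D) x y z g f) u
        = act (biset_sum \<Omega> \<Psi>) y z g (act (biset_sum \<Omega> \<Psi>) x y f u)"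
      using A.F.act_cmp[of x y z f g] B.F.act_cmp[of x y z f g] by (cases u) (auto simp: biset_sum_def)
  qed
  then show ?thesis by (simp add: biset_def A.C.finite_category_axioms A.D.finite_category_axioms)
qed

lemma free_on_sum:
  assumes "free_on C F G" "free_on C F' G'"
  shows "free_on C (biset_sum F F') ({(x, Inl g) | x g. (x, g) \<in> G} \<union> {(x, Inr g) | x g. (x, g) \<in> G'})"
    (is "free_on _ ?F ?G")
proof (rule free_onI)
  fix x g assume "(x, g) \<in> ?G"
  then show "x \<in> Ob C \<and> g \<in> elts ?F x"
    using free_onD(1,2)[OF assms(1)] free_onD(1,2)[OF assms(2)] by (auto simp: biset_sum_def)
next
  fix y u assume y: "y \<in> Ob C" and "u \<in> elts ?F y"
  then consider (l) v where "u = Inl v" "v \<in> elts F y" | (r) v where "u = Inr v" "v \<in> elts F' y"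
    by (auto simp: biset_sum_def)
  then show "\<exists>x g f. (x, g) \<in> ?G \<and> f \<in> Arr C x y \<and> act ?F x y f g = u"
  proof cases
    case l
    obtain x g f where "(x, g) \<in> G" "f \<in> Arr C x y" "act F x y f g = v" using free_onD(3)[OF assms(1) y l(2)] by blast
    then have "(x, Inl g) \<in> ?G" "f \<in> Arr C x y" "act ?F x y f (Inl g) = u" using l(1) by (auto simp: biset_sum_def)
    then show ?thesis by blast
  next
    case r
    obtain x g f where "(x, g) \<in> G'" "f \<in> Arr C x y" "act F' x y f g = v" using free_onD(3)[OF assms(2) y r(2)] by blast
    then have "(x, Inr g) \<in> ?G" "f \<in> Arr C x y" "act ?F x y f (Inr g) = u" using r(1) by (auto simp: biset_sum_def)
    then show ?thesis by blast
  qed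
next
  fix y x g f x' g' f' assume "y \<in> Ob C" "(x, g) \<in> ?G" "(x', g') \<in> ?G" "f \<in> Arr C x y" "f' \<in> Arr C x' y"
    "act ?F x y f g = act ?F x' y f' g'"
  then show "x = x' \<and> g = g' \<and> f = f'"
    using free_onD(4)[OF assms(1)] free_onD(4)[OF assms(2)] by (auto simp: biset_sum_def)
qed

lemma biset_sum_birepresentable:
  assumes "biset C D \<Omega>" "biset C D \<Psi>" "birepresentable C D \<Omega>" "birepresentable C D \<Psi>"
  shows "birepresentable C D (biset_sum \<Omega> \<Psi>)"
proof -
  interpret A: biset C D \<Omega> by fact
  interpret B: biset C D \<Psi> by fact
  interpret S: biset C D "biset_sum \<Omega> \<Psi>" by (rule biset_sum_biset[OF assms(1,2)])
  have l: "lpart D (biset_sum \<Omega> \<Psi>) y = biset_sum (lpart D \<Omega> y) (lpart D \<Psi> y)" for y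
    by (simp add: lpart_def biset_sum_def)
  have r: "rpart C (biset_sum \<Omega> \<Psi>) x = biset_sum (rpart C \<Omega> x) (rpart C \<Psi> x)" for x
    by (simp add: rpart_def biset_sum_def)
  show ?thesis unfolding S.birepresentable_iff l r
  proof (intro conjI ballI)
    fix y assume y: "y \<in> Ob D"
    obtain G where G: "free_on C (lpart D \<Omega> y) G" using assms(3) y unfolding A.birepresentable_iff by blast
    obtain G' where "free_on C (lpart D \<Psi> y) G'" using assms(4) y unfolding B.birepresentable_iff by blast
    from free_on_sum[OF G this] show "\<exists>G. free_on C (biset_sum (lpart D \<Omega> y) (lpart D \<Psi> y)) G" by blast
  next
    fix x assume x: "x \<in> Ob C"
    obtain G where G: "free_on (op_cat D) (rpart C \<Omega> x) G" using assms(3) x unfolding A.birepresentable_iff by blast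
    obtain G' where "free_on (op_cat D) (rpart C \<Psi> x) G'" using assms(4) x unfolding B.birepresentable_iff by blast
    from free_on_sum[OF G this] show "\<exists>G. free_on (op_cat D) (biset_sum (rpart C \<Omega> x) (rpart C \<Psi> x)) G" by blast
  qed
qed

lemma biset_sum_cong:
  assumes "setfun_iso C \<Omega> \<Omega>'" "setfun_iso C \<Psi> \<Psi>'"
  shows "setfun_iso C (biset_sum \<Omega> \<Psi>) (biset_sum \<Omega>' \<Psi>')"
proof -
  from assms(1) obtain \<eta> where "setfun_iso_by C \<Omega> \<Omega>' \<eta>" by (rule setfun_isoE)
  note \<eta> = setfun_iso_byD[OF this]
  from assms(2) obtain \<theta> where "setfun_iso_by C \<Psi> \<Psi>' \<theta>" by (rule setfun_isoE)
  note \<theta> = setfun_iso_byD[OF this]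
  show ?thesis
  proof (rule setfun_isoI[where \<eta> = "\<lambda>x. map_sum (\<eta> x) (\<theta> x)"])
    fix x assume x: "x \<in> Ob C"
    have "inj_on (map_sum (\<eta> x) (\<theta> x)) (elts (biset_sum \<Omega> \<Psi>) x)"
    proof (rule inj_onI)
      fix a b assume "a \<in> elts (biset_sum \<Omega> \<Psi>) x" "b \<in> elts (biset_sum \<Omega> \<Psi>) x" "map_sum (\<eta> x) (\<theta> x) a = map_sum (\<eta> x) (\<theta> x) b"
      then show "a = b"
        by (cases a; cases b) (auto simp: biset_sum_def inj_on_eq_iff[OF bij_betw_imp_inj_on[OF \<eta>(1)[OF x]]]
            inj_on_eq_iff[OF bij_betw_imp_inj_on[OF \<theta>(1)[OF x]]])
    qed
    moreover have "map_sum (\<eta> x) (\<theta> x) ` elts (biset_sum \<Omega> \<Psi>) x = elts (biset_sum \<Omega>' \<Psi>') x"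
      by (simp add: biset_sum_def image_Un image_image flip: bij_betw_imp_surj_on[OF \<eta>(1)[OF x]] bij_betw_imp_surj_on[OF \<theta>(1)[OF x]])
    ultimately show "bij_betw (map_sum (\<eta> x) (\<theta> x)) (elts (biset_sum \<Omega> \<Psi>) x) (elts (biset_sum \<Omega>' \<Psi>') x)"
      by (simp add: bij_betw_def)
  next
    fix x y f u assume "x \<in> Ob C" "y \<in> Ob C" "f \<in> Arr C x y" "u \<in> elts (biset_sum \<Omega> \<Psi>) x"
    then show "map_sum (\<eta> y) (\<theta> y) (act (biset_sum \<Omega> \<Psi>) x y f u) = act (biset_sum \<Omega>' \<Psi>') x y f (map_sum (\<eta> x) (\<theta> x) u)"
      using \<eta>(2) \<theta>(2) by (auto simp: biset_sum_def)
  qed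
qed

text \<open>Moving a middle morphism across preserves the tag \<open>Inl\<close> or
  \<open>Inr\<close>, so the classes of the composite separate according to the tag.\<close>

lemma comp_sum_left:
  assumes "biset C D \<Omega>" "biset C D \<Omega>'" "biset D E \<Psi>"
  shows "setfun_iso (biset_dom C E) (biset_comp C D E (biset_sum \<Omega> \<Omega>') \<Psi>)
    (biset_sum (biset_comp C D E \<Omega> \<Psi>) (biset_comp C D E \<Omega>' \<Psi>))"
proof -
  interpret A: biset_pair C D E \<Omega> \<Psi> unfolding biset_pair_def using assms by simp
  interpret B: biset_pair C D E \<Omega>' \<Psi> unfolding biset_pair_def using assms by simp
  interpret S: biset_pair C D E "biset_sum \<Omega> \<Omega>'" \<Psi>
    unfolding biset_pair_def using biset_sum_biset[OF assms(1,2)] assms(3) by simp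
  define m where "m x z = (\<lambda>(y, w, v). case w of Inl u \<Rightarrow> Inl (A.cls x z (y, u, v)) | Inr u \<Rightarrow> Inr (B.cls x z (y, u, v)))" for x z
  have el: "S.L.el x y = Inl ` A.L.el x y \<union> Inr ` B.L.el x y" for x y by (simp add: biset_sum_def)
  show ?thesis
  proof (rule S.comp_isoI[where m = m])
    fix x z y w v assume "x \<in> Ob C" "z \<in> Ob E" "y \<in> Ob D" "w \<in> S.L.el x y" "v \<in> A.R.el y z"
    then show "m x z (y, w, v) \<in> elts (biset_sum A.comp B.comp) (x, z)"
      using A.comp_eltsI B.comp_eltsI by (auto simp: m_def el biset_sum_def)
  next
    fix x z y y' \<beta> w v assume "x \<in> Ob C" "z \<in> Ob E" "y \<in> Ob D" "y' \<in> Ob D" "\<beta> \<in> Arr D y y'" "w \<in> S.L.el x y'" "v \<in> A.R.el y z"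
    then show "m x z (y, S.L.ract x y' y \<beta> w, v) = m x z (y', w, A.R.lact z y y' \<beta> v)"
      using A.cls_balanced[of y y' \<beta> _ x v z] B.cls_balanced[of y y' \<beta> _ x v z] by (auto simp: m_def el biset_sum_def)
  next
    fix x z k assume a: "x \<in> Ob C" "z \<in> Ob E" "k \<in> elts (biset_sum A.comp B.comp) (x, z)"
    then consider (l) K where "k = Inl K" "K \<in> elts A.comp (x, z)" | (r) K where "k = Inr K" "K \<in> elts B.comp (x, z)"
      by (auto simp: biset_sum_def)
    then show "\<exists>y w v. y \<in> Ob D \<and> w \<in> S.L.el x y \<and> v \<in> A.R.el y z \<and> m x z (y, w, v) = k"
    proof cases
      case l
      from l(2) obtain y u v where q: "y \<in> Ob D" "u \<in> A.L.el x y" "v \<in> A.R.el y z" "K = A.cls x z (y, u, v)" by (rule A.comp_eltsE)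
      then have "y \<in> Ob D \<and> Inl u \<in> S.L.el x y \<and> v \<in> A.R.el y z \<and> m x z (y, Inl u, v) = k" using l(1) by (auto simp: m_def el)
      then show ?thesis by blast
    next
      case r
      from r(2) obtain y u v where q: "y \<in> Ob D" "u \<in> B.L.el x y" "v \<in> A.R.el y z" "K = B.cls x z (y, u, v)" by (rule B.comp_eltsE)
      then have "y \<in> Ob D \<and> Inr u \<in> S.L.el x y \<and> v \<in> A.R.el y z \<and> m x z (y, Inr u, v) = k" using r(1) by (auto simp: m_def el)
      then show ?thesis by blast
    qed
  next
    \<comment> \<open>Putting the tag back into a representative inverts \<open>m\<close> up to
      equivalence.\<close>
    have *: "(case m x z (y, w, v) of Inl K \<Rightarrow> class_lift (\<lambda>(y, u, v). S.cls x z (y, Inl u, v)) K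
        | Inr K \<Rightarrow> class_lift (\<lambda>(y, u, v). S.cls x z (y, Inr u, v)) K) = S.cls x z (y, w, v)" for x z y w v
    proof -
      have "class_lift (\<lambda>(y, u, v). S.cls x z (y, Inl u, v)) (A.cls x z p) = (\<lambda>(y, u, v). S.cls x z (y, Inl u, v)) p" for p
      proof (rule A.class_lift_cls, unfold prod.case)
        fix y y' \<beta> u v assume b: "y \<in> Ob D" "y' \<in> Ob D" "\<beta> \<in> Arr D y y'" "u \<in> A.L.el x y'" "v \<in> A.R.el y z"
        show "S.cls x z (y, Inl (A.L.ract x y' y \<beta> u), v) = S.cls x z (y', Inl u, A.R.lact z y y' \<beta> v)"
          using S.cls_balanced[OF b(1-3) _ b(5), of "Inl u" x] b(4) by (simp add: biset_sum_def)
      qed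
      moreover have "class_lift (\<lambda>(y, u, v). S.cls x z (y, Inr u, v)) (B.cls x z p) = (\<lambda>(y, u, v). S.cls x z (y, Inr u, v)) p" for p
      proof (rule B.class_lift_cls, unfold prod.case)
        fix y y' \<beta> u v assume b: "y \<in> Ob D" "y' \<in> Ob D" "\<beta> \<in> Arr D y y'" "u \<in> B.L.el x y'" "v \<in> A.R.el y z"
        show "S.cls x z (y, Inr (B.L.ract x y' y \<beta> u), v) = S.cls x z (y', Inr u, A.R.lact z y y' \<beta> v)"
          using S.cls_balanced[OF b(1-3) _ b(5), of "Inr u" x] b(4) by (simp add: biset_sum_def)
      qed
      ultimately show ?thesis by (cases w) (simp_all add: m_def)
    qed
    fix x z y w v y' w' v' assume "m x z (y, w, v) = m x z (y', w', v')"
    then show "S.cls x z (y, w, v) = S.cls x z (y', w', v')" using *[of x z y w v] *[of x z y' w' v'] by simp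
  next
    fix x x' z z' \<alpha> \<gamma> y w v assume a: "x \<in> Ob C" "x' \<in> Ob C" "z \<in> Ob E" "z' \<in> Ob E" "\<alpha> \<in> Arr C x x'" "\<gamma> \<in> Arr E z' z"
      "y \<in> Ob D" "w \<in> S.L.el x y" "v \<in> A.R.el y z"
    show "m x' z' (y, S.L.lact y x x' \<alpha> w, A.R.ract y z z' \<gamma> v) = act (biset_sum A.comp B.comp) (x, z) (x', z') (\<alpha>, \<gamma>) (m x z (y, w, v))"
      using A.comp_act[OF a(1-6)] B.comp_act[OF a(1-6)] by (cases w) (simp_all add: m_def biset_sum_def)
  qed
qed

lemma comp_sum_right:
  assumes "biset C D \<Omega>" "biset D E \<Psi>" "biset D E \<Psi>'"
  shows "setfun_iso (biset_dom C E) (biset_comp C D E \<Omega> (biset_sum \<Psi> \<Psi>'))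
    (biset_sum (biset_comp C D E \<Omega> \<Psi>) (biset_comp C D E \<Omega> \<Psi>'))"
proof -
  interpret A: biset_pair C D E \<Omega> \<Psi> unfolding biset_pair_def using assms by simp
  interpret B: biset_pair C D E \<Omega> \<Psi>' unfolding biset_pair_def using assms by simp
  interpret S: biset_pair C D E \<Omega> "biset_sum \<Psi> \<Psi>'"
    unfolding biset_pair_def using biset_sum_biset[OF assms(2,3)] assms(1) by simp
  define m where "m x z = (\<lambda>(y, u, w). case w of Inl v \<Rightarrow> Inl (A.cls x z (y, u, v)) | Inr v \<Rightarrow> Inr (B.cls x z (y, u, v)))" for x z
  have el: "S.R.el y z = Inl ` A.R.el y z \<union> Inr ` B.R.el y z" for y z by (simp add: biset_sum_def)
  show ?thesis
  proof (rule S.comp_isoI[where m = m])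
    fix x z y u w assume "x \<in> Ob C" "z \<in> Ob E" "y \<in> Ob D" "u \<in> A.L.el x y" "w \<in> S.R.el y z"
    then show "m x z (y, u, w) \<in> elts (biset_sum A.comp B.comp) (x, z)"
      using A.comp_eltsI B.comp_eltsI by (auto simp: m_def el biset_sum_def)
  next
    fix x z y y' \<beta> u w assume "x \<in> Ob C" "z \<in> Ob E" "y \<in> Ob D" "y' \<in> Ob D" "\<beta> \<in> Arr D y y'" "u \<in> A.L.el x y'" "w \<in> S.R.el y z"
    then show "m x z (y, A.L.ract x y' y \<beta> u, w) = m x z (y', u, S.R.lact z y y' \<beta> w)"
      using A.cls_balanced[of y y' \<beta> u x _ z] B.cls_balanced[of y y' \<beta> u x _ z] by (auto simp: m_def el biset_sum_def)
  next
    fix x z k assume a: "x \<in> Ob C" "z \<in> Ob E" "k \<in> elts (biset_sum A.comp B.comp) (x, z)"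
    then consider (l) K where "k = Inl K" "K \<in> elts A.comp (x, z)" | (r) K where "k = Inr K" "K \<in> elts B.comp (x, z)"
      by (auto simp: biset_sum_def)
    then show "\<exists>y u w. y \<in> Ob D \<and> u \<in> A.L.el x y \<and> w \<in> S.R.el y z \<and> m x z (y, u, w) = k"
    proof cases
      case l
      from l(2) obtain y u v where q: "y \<in> Ob D" "u \<in> A.L.el x y" "v \<in> A.R.el y z" "K = A.cls x z (y, u, v)" by (rule A.comp_eltsE)
      then have "y \<in> Ob D \<and> u \<in> A.L.el x y \<and> Inl v \<in> S.R.el y z \<and> m x z (y, u, Inl v) = k" using l(1) by (auto simp: m_def el)
      then show ?thesis by blast
    next
      case r
      from r(2) obtain y u v where q: "y \<in> Ob D" "u \<in> A.L.el x y" "v \<in> B.R.el y z" "K = B.cls x z (y, u, v)" by (rule B.comp_eltsE)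
      then have "y \<in> Ob D \<and> u \<in> A.L.el x y \<and> Inr v \<in> S.R.el y z \<and> m x z (y, u, Inr v) = k" using r(1) by (auto simp: m_def el)
      then show ?thesis by blast
    qed
  next
    have *: "(case m x z (y, u, w) of Inl K \<Rightarrow> class_lift (\<lambda>(y, u, v). S.cls x z (y, u, Inl v)) K
        | Inr K \<Rightarrow> class_lift (\<lambda>(y, u, v). S.cls x z (y, u, Inr v)) K) = S.cls x z (y, u, w)" for x z y u w
    proof -
      have "class_lift (\<lambda>(y, u, v). S.cls x z (y, u, Inl v)) (A.cls x z p) = (\<lambda>(y, u, v). S.cls x z (y, u, Inl v)) p" for p
      proof (rule A.class_lift_cls, unfold prod.case)
        fix y y' \<beta> u v assume b: "y \<in> Ob D" "y' \<in> Ob D" "\<beta> \<in> Arr D y y'" "u \<in> A.L.el x y'" "v \<in> A.R.el y z"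
        show "S.cls x z (y, A.L.ract x y' y \<beta> u, Inl v) = S.cls x z (y', u, Inl (A.R.lact z y y' \<beta> v))"
          using S.cls_balanced[OF b(1-4), of "Inl v" z] b(5) by (simp add: biset_sum_def)
      qed
      moreover have "class_lift (\<lambda>(y, u, v). S.cls x z (y, u, Inr v)) (B.cls x z p) = (\<lambda>(y, u, v). S.cls x z (y, u, Inr v)) p" for p
      proof (rule B.class_lift_cls, unfold prod.case)
        fix y y' \<beta> u v assume b: "y \<in> Ob D" "y' \<in> Ob D" "\<beta> \<in> Arr D y y'" "u \<in> A.L.el x y'" "v \<in> B.R.el y z"
        show "S.cls x z (y, A.L.ract x y' y \<beta> u, Inr v) = S.cls x z (y', u, Inr (B.R.lact z y y' \<beta> v))"
          using S.cls_balanced[OF b(1-4), of "Inr v" z] b(5) by (simp add: biset_sum_def)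
      qed
      ultimately show ?thesis by (cases w) (simp_all add: m_def)
    qed
    fix x z y u w y' u' w' assume "m x z (y, u, w) = m x z (y', u', w')"
    then show "S.cls x z (y, u, w) = S.cls x z (y', u', w')" using *[of x z y u w] *[of x z y' u' w'] by simp
  next
    fix x x' z z' \<alpha> \<gamma> y u w assume a: "x \<in> Ob C" "x' \<in> Ob C" "z \<in> Ob E" "z' \<in> Ob E" "\<alpha> \<in> Arr C x x'" "\<gamma> \<in> Arr E z' z"
      "y \<in> Ob D" "u \<in> A.L.el x y" "w \<in> S.R.el y z"
    show "m x' z' (y, A.L.lact y x x' \<alpha> u, S.R.ract y z z' \<gamma> w) = act (biset_sum A.comp B.comp) (x, z) (x', z') (\<alpha>, \<gamma>) (m x z (y, u, w))"
      using A.comp_act[OF a(1-6)] B.comp_act[OF a(1-6)] by (cases w) (simp_all add: m_def biset_sum_def)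
  qed
qed

section \<open>The biset category\<close>

lemma biset_class_eq:
  assumes "biset C D \<Omega>" "setfun_iso (biset_dom C D) \<Omega> \<Omega>'"
  shows "biset_class C D \<Omega> = biset_class C D \<Omega>'"
proof -
  have s: "setfun_iso (biset_dom C D) \<Omega>' \<Omega>"
    using setfun_iso_sym[OF assms(2)] assms(1) by (simp add: biset_def)
  have "setfun_iso (biset_dom C D) \<Theta> \<Omega> \<longleftrightarrow> setfun_iso (biset_dom C D) \<Theta> \<Omega>'" for \<Theta> :: "('a \<times> 'c, 'b \<times> 'd, nat) setfun"
    using setfun_iso_trans[OF _ s, of \<Theta>] setfun_iso_trans[OF _ assms(2), of \<Theta>] by blast
  then show ?thesis by (simp add: biset_class_def)
qed

type_synonym ('o, 'a, 'p, 'b) nbiset = "('o \<times> 'p, 'a \<times> 'b, nat) setfun"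

lemma nat_biset_exists:
  assumes "biset C D \<Omega>"
  shows "\<exists>\<Omega>' :: ('o, 'a, 'p, 'b) nbiset. biset C D \<Omega>' \<and> setfun_iso (biset_dom C D) \<Omega> \<Omega>'"
proof -
  interpret biset C D \<Omega> by fact
  show ?thesis
    using nat_setfun_exists[OF F.finite_set_functor_axioms biset_dom_category[OF C.category_axioms D.category_axioms]]
    by (simp add: biset_def C.finite_category_axioms D.finite_category_axioms)
qed

lemma biset_class_mem:
  assumes "finite_category C" "finite_category D" "\<Omega> \<in> biset_class C D \<Psi>"
  shows "biset C D \<Omega>" "setfun_iso (biset_dom C D) \<Omega> \<Psi>"
  using assms by (simp_all add: biset_class_def biset_def)

lemma biset_class_nonempty:
  assumes "biset C D \<Omega>"
  shows "\<exists>\<Omega>'. \<Omega>' \<in> biset_class C D \<Omega>"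
proof -
  interpret biset C D \<Omega> by fact
  obtain \<Omega>' :: "('a \<times> 'c, 'b \<times> 'd, nat) setfun" where "biset C D \<Omega>'" "setfun_iso (biset_dom C D) \<Omega> \<Omega>'"
    using nat_biset_exists[OF assms] by blast
  then show ?thesis using setfun_iso_sym[OF _ F.finite_set_functor_axioms]
    by (auto simp: biset_class_def biset_def)
qed

lemma birep_classesI:
  assumes "biset C D \<Omega>" "birepresentable C D \<Omega>"
  shows "biset_class C D \<Omega> \<in> birep_classes C D"
proof -
  obtain \<Omega>' :: "('a \<times> 'c, 'b \<times> 'd, nat) setfun" where *: "biset C D \<Omega>'" "setfun_iso (biset_dom C D) \<Omega> \<Omega>'"
    using nat_biset_exists[OF assms(1)] by blast
  have "birepresentable C D \<Omega>'" by (rule birepresentable_iso[OF assms(1) *(2) assms(2)])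
  then show ?thesis using biset_class_eq[OF assms(1) *(2)] by (auto simp: birep_classes_def)
qed

lemma birep_classesE:
  assumes "finite_category C" "finite_category D" "b \<in> birep_classes C D"
  obtains \<Omega> :: "('o, 'a, 'p, 'b) nbiset" where "biset C D \<Omega>" "birepresentable C D \<Omega>" "b = biset_class C D \<Omega>"
  using assms birepresentable_biset[OF assms(1,2)] by (auto simp: birep_classes_def)

text \<open>\<open>class_comp\<close> is a union over all representatives of the two classes; they
  all contribute the same class because composition respects isomorphism.\<close>

lemma class_comp_eq:
  assumes \<Omega>: "biset C D \<Omega>" and \<Psi>: "biset D E \<Psi>"
  shows "class_comp C D E (biset_class C D \<Omega>) (biset_class D E \<Psi>) = biset_class C E (biset_comp C D E \<Omega> \<Psi>)"
proof -
  interpret A: biset_pair C D E \<Omega> \<Psi> unfolding biset_pair_def using assms by simp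
  have "biset_class C E (biset_comp C D E \<Omega>' \<Psi>') = biset_class C E (biset_comp C D E \<Omega> \<Psi>)"
    if "\<Omega>' \<in> biset_class C D \<Omega>" "\<Psi>' \<in> biset_class D E \<Psi>" for \<Omega>' \<Psi>'
  proof -
    note o = biset_class_mem[OF A.L.C.finite_category_axioms A.L.D.finite_category_axioms that(1)]
    note p = biset_class_mem[OF A.L.D.finite_category_axioms A.R.D.finite_category_axioms that(2)]
    interpret B: biset_pair C D E \<Omega>' \<Psi>' unfolding biset_pair_def using o p by simp
    show ?thesis by (rule biset_class_eq[OF B.comp_biset comp_cong[OF B.biset_pair_axioms o(2) p(2)]])
  qed
  then show ?thesis
    using biset_class_nonempty[OF \<Omega>] biset_class_nonempty[OF \<Psi>] unfolding class_comp_def by blast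
qed

locale biset_module_locale =
  fixes R :: "'r ring" (structure)
  assumes R_field: "field R"
begin

lemma R_cring: "cring R" using R_field by (simp add: field_def domain_def)

abbreviation FF where "FF C D \<equiv> free_module R (birep_classes C D)"
abbreviation NN where "NN C D \<equiv> sum_relations R C D"
abbreviation MM where "MM C D \<equiv> biset_module R C D"
abbreviation arr where "arr C D \<Omega> \<equiv> biset_arrow R C D \<Omega>"
abbreviation PM where "PM Y X \<equiv> MM (pow_cat Y) (pow_cat X)"

lemma FF: "module R (FF C D)" by (rule free_module_module[OF R_cring])

end

locale two_categories = biset_module_locale R for R :: "'r ring" (structure) +
  fixes C :: "('o, 'a) category" and D :: "('p, 'b) category"
  assumes C: "finite_category C" and D: "finite_category D"
begin

lemma gen_closed: "\<lbrakk>biset C D \<Omega>; birepresentable C D \<Omega>\<rbrakk> \<Longrightarrow> free_gen R (biset_class C D \<Omega>) \<in> carrier (FF C D)"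
  by (rule free_gen_closed[OF R_cring birep_classesI])

lemma bisetD: "birepresentable C D \<Omega> \<Longrightarrow> biset C D \<Omega>"
  by (rule birepresentable_biset[OF C D])

lemma sum_rep: "\<lbrakk>birepresentable C D \<Omega>; birepresentable C D \<Psi>\<rbrakk>
    \<Longrightarrow> biset C D (biset_sum \<Omega> \<Psi>) \<and> birepresentable C D (biset_sum \<Omega> \<Psi>)"
  by (simp add: biset_sum_biset bisetD biset_sum_birepresentable)

definition relators where
  "relators = {free_gen R (biset_class C D (biset_sum \<Omega> \<Psi>))
        \<ominus>\<^bsub>FF C D\<^esub> (free_gen R (biset_class C D \<Omega>) \<oplus>\<^bsub>FF C D\<^esub> free_gen R (biset_class C D \<Psi>)) |
      (\<Omega> :: ('o, 'a, 'p, 'b) nbiset) (\<Psi> :: ('o, 'a, 'p, 'b) nbiset). birepresentable C D \<Omega> \<and> birepresentable C D \<Psi>}"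

lemma NN_eq: "NN C D = submodule_span R (FF C D) relators"
  by (simp add: sum_relations_def relators_def)

lemma relators_closed: "relators \<subseteq> carrier (FF C D)"
proof -
  interpret F: module R "FF C D" by (rule FF)
  show ?thesis
  proof
    fix a assume "a \<in> relators"
    then obtain \<Omega> \<Psi> :: "('o, 'a, 'p, 'b) nbiset" where *: "birepresentable C D \<Omega>" "birepresentable C D \<Psi>"
      and a: "a = free_gen R (biset_class C D (biset_sum \<Omega> \<Psi>))
        \<ominus>\<^bsub>FF C D\<^esub> (free_gen R (biset_class C D \<Omega>) \<oplus>\<^bsub>FF C D\<^esub> free_gen R (biset_class C D \<Psi>))"
      unfolding relators_def by blast
    show "a \<in> carrier (FF C D)" unfolding a
      by (intro F.M.minus_closed F.M.a_closed gen_closed bisetD * conjunct1[OF sum_rep[OF *]] conjunct2[OF sum_rep[OF *]])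
  qed
qed

lemma NN: "submodule (NN C D) R (FF C D)"
  unfolding NN_eq by (rule span_submodule[OF FF relators_closed])

lemma MM: "module R (MM C D)"
  unfolding biset_module_def by (rule quot_module_module[OF FF NN])

abbreviation cos where "cos f \<equiv> NN C D +>\<^bsub>FF C D\<^esub> f"

lemma cos_linear: "cos \<in> linear_maps R (FF C D) (MM C D)"
  unfolding biset_module_def by (rule coset_linear[OF FF NN])

lemma MM_carrier: "carrier (MM C D) = cos ` carrier (FF C D)"
  by (simp add: biset_module_def quot_carrier)

lemma arr_closed: "\<lbrakk>biset C D \<Omega>; birepresentable C D \<Omega>\<rbrakk> \<Longrightarrow> arr C D \<Omega> \<in> carrier (MM C D)"
  unfolding biset_arrow_def by (rule linear_mapsD(1)[OF cos_linear gen_closed])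

lemma arr_iso: "\<lbrakk>biset C D \<Omega>; setfun_iso (biset_dom C D) \<Omega> \<Omega>'\<rbrakk> \<Longrightarrow> arr C D \<Omega> = arr C D \<Omega>'"
  unfolding biset_arrow_def using biset_class_eq by metis

lemma arr_sum_nat:
  fixes \<Omega> \<Psi> :: "('o, 'a, 'p, 'b) nbiset"
  assumes "birepresentable C D \<Omega>" "birepresentable C D \<Psi>"
  shows "arr C D (biset_sum \<Omega> \<Psi>) = arr C D \<Omega> \<oplus>\<^bsub>MM C D\<^esub> arr C D \<Psi>"
proof -
  let ?g = "\<lambda>\<Omega> :: ('o, 'a, 'p, 'b) nbiset. free_gen R (biset_class C D \<Omega>)"
  have g: "?g \<Omega> \<in> carrier (FF C D)" "?g \<Psi> \<in> carrier (FF C D)"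
    using gen_closed bisetD assms by blast+
  have s: "free_gen R (biset_class C D (biset_sum \<Omega> \<Psi>)) \<in> carrier (FF C D)" using gen_closed sum_rep[OF assms] by blast
  have "free_gen R (biset_class C D (biset_sum \<Omega> \<Psi>)) \<ominus>\<^bsub>FF C D\<^esub> (?g \<Omega> \<oplus>\<^bsub>FF C D\<^esub> ?g \<Psi>) \<in> relators"
    unfolding relators_def using assms by blast
  then have "free_gen R (biset_class C D (biset_sum \<Omega> \<Psi>)) \<ominus>\<^bsub>FF C D\<^esub> (?g \<Omega> \<oplus>\<^bsub>FF C D\<^esub> ?g \<Psi>) \<in> NN C D"
    unfolding NN_eq by (rule subsetD[OF span_superset])
  then have "cos (free_gen R (biset_class C D (biset_sum \<Omega> \<Psi>))) = cos (?g \<Omega> \<oplus>\<^bsub>FF C D\<^esub> ?g \<Psi>)"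
    using coset_eq_iff[OF FF NN s module_add_closed[OF FF g]] by simp
  then show ?thesis unfolding biset_arrow_def linear_mapsD(2)[OF cos_linear g] .
qed

lemma arr_sum:
  assumes "biset C D \<Omega>" "birepresentable C D \<Omega>" "biset C D \<Psi>" "birepresentable C D \<Psi>"
  shows "arr C D (biset_sum \<Omega> \<Psi>) = arr C D \<Omega> \<oplus>\<^bsub>MM C D\<^esub> arr C D \<Psi>"
proof -
  obtain \<Omega>' :: "('o, 'a, 'p, 'b) nbiset" where o: "biset C D \<Omega>'" "setfun_iso (biset_dom C D) \<Omega> \<Omega>'"
    using nat_biset_exists[OF assms(1)] by blast
  obtain \<Psi>' :: "('o, 'a, 'p, 'b) nbiset" where p: "biset C D \<Psi>'" "setfun_iso (biset_dom C D) \<Psi> \<Psi>'"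
    using nat_biset_exists[OF assms(3)] by blast
  have "arr C D (biset_sum \<Omega> \<Psi>) = arr C D (biset_sum \<Omega>' \<Psi>')"
    by (rule arr_iso[OF biset_sum_biset[OF assms(1,3)] biset_sum_cong[OF o(2) p(2)]])
  also have "\<dots> = arr C D \<Omega>' \<oplus>\<^bsub>MM C D\<^esub> arr C D \<Psi>'"
    by (rule arr_sum_nat[OF birepresentable_iso[OF assms(1) o(2) assms(2)] birepresentable_iso[OF assms(3) p(2) assms(4)]])
  finally show ?thesis using arr_iso[OF assms(1) o(2)] arr_iso[OF assms(3) p(2)] by simp
qed

text \<open>The empty biset is isomorphic to the disjoint union of two copies of itself, so its
  class equals twice itself.\<close>

lemma arr_empty:
  assumes "biset C D \<Omega>" "birepresentable C D \<Omega>" and empty: "\<And>p. p \<in> Ob (biset_dom C D) \<Longrightarrow> elts \<Omega> p = {}"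
  shows "arr C D \<Omega> = \<zero>\<^bsub>MM C D\<^esub>"
proof -
  interpret M: module R "MM C D" by (rule MM)
  have "setfun_iso (biset_dom C D) \<Omega> (biset_sum \<Omega> \<Omega>)"
    by (rule setfun_isoI[where \<eta> = "\<lambda>_. Inl"]) (simp_all add: empty biset_sum_def bij_betw_def)
  from arr_iso[OF assms(1) this] have "arr C D \<Omega> = arr C D \<Omega> \<oplus>\<^bsub>MM C D\<^esub> arr C D \<Omega>"
    using arr_sum[OF assms(1,2,1,2)] by simp
  then show ?thesis using arr_closed[OF assms(1,2)] by (metis M.M.add.l_cancel_one')
qed

lemma MM_induct [consumes 1, case_names arr zero add smult]:
  assumes K: "K \<in> carrier (MM C D)"
    and arr: "\<And>\<Omega> :: ('o, 'a, 'p, 'b) nbiset. \<lbrakk>biset C D \<Omega>; birepresentable C D \<Omega>\<rbrakk> \<Longrightarrow> P (arr C D \<Omega>)"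
    and zero: "P \<zero>\<^bsub>MM C D\<^esub>"
    and add: "\<And>K L. \<lbrakk>K \<in> carrier (MM C D); L \<in> carrier (MM C D); P K; P L\<rbrakk> \<Longrightarrow> P (K \<oplus>\<^bsub>MM C D\<^esub> L)"
    and smult: "\<And>r K. \<lbrakk>r \<in> carrier R; K \<in> carrier (MM C D); P K\<rbrakk> \<Longrightarrow> P (r \<odot>\<^bsub>MM C D\<^esub> K)"
  shows "P K"
proof -
  from K obtain f where f: "f \<in> carrier (FF C D)" "K = cos f" unfolding MM_carrier by blast
  from R_cring f(1) have "P (cos f)"
  proof (induction rule: free_module_induct)
    case (gen b)
    from birep_classesE[OF C D gen] obtain \<Omega> :: "('o, 'a, 'p, 'b) nbiset" where
      "biset C D \<Omega>" "birepresentable C D \<Omega>" "b = biset_class C D \<Omega>" by blast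
    then show ?case using arr[of \<Omega>] by (simp add: biset_arrow_def)
  next
    case zero
    show ?case using assms(3) linear_map_zero[OF cos_linear FF MM] by simp
  next
    case (add f g)
    then show ?case
      using assms(4) linear_mapsD(1)[OF cos_linear] linear_mapsD(2)[OF cos_linear] by simp
  next
    case (smult r f)
    then show ?case
      using assms(5) linear_mapsD(1)[OF cos_linear] linear_mapsD(3)[OF cos_linear] by simp
  qed
  then show ?thesis using f by simp
qed

lemma NN_vanish:
  assumes N: "module R N" and f: "f \<in> linear_maps R (FF C D) N"
    and sum: "\<And>(\<Omega> :: ('o, 'a, 'p, 'b) nbiset) (\<Psi> :: ('o, 'a, 'p, 'b) nbiset). \<lbrakk>birepresentable C D \<Omega>; birepresentable C D \<Psi>\<rbrakk>
      \<Longrightarrow> f (free_gen R (biset_class C D (biset_sum \<Omega> \<Psi>)))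
        = f (free_gen R (biset_class C D \<Omega>)) \<oplus>\<^bsub>N\<^esub> f (free_gen R (biset_class C D \<Psi>))"
    and a: "a \<in> NN C D"
  shows "f a = \<zero>\<^bsub>N\<^esub>"
proof -
  interpret N: module R N by fact
  interpret F: module R "FF C D" by (rule FF)
  have "submodule {\<zero>\<^bsub>N\<^esub>} R N" by (rule submodule_criterion[OF N]) auto
  then have "submodule {a \<in> carrier (FF C D). f a \<in> {\<zero>\<^bsub>N\<^esub>}} R (FF C D)"
    by (rule submodule_vimage[OF f FF N])
  moreover have "relators \<subseteq> {a \<in> carrier (FF C D). f a \<in> {\<zero>\<^bsub>N\<^esub>}}"
  proof
    fix a assume a: "a \<in> relators"
    then obtain \<Omega> \<Psi> :: "('o, 'a, 'p, 'b) nbiset" where *: "birepresentable C D \<Omega>" "birepresentable C D \<Psi>"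
      and a': "a = free_gen R (biset_class C D (biset_sum \<Omega> \<Psi>))
        \<ominus>\<^bsub>FF C D\<^esub> (free_gen R (biset_class C D \<Omega>) \<oplus>\<^bsub>FF C D\<^esub> free_gen R (biset_class C D \<Psi>))"
      unfolding relators_def by blast
    have g: "free_gen R (biset_class C D \<Omega>) \<in> carrier (FF C D)" "free_gen R (biset_class C D \<Psi>) \<in> carrier (FF C D)"
      "free_gen R (biset_class C D (biset_sum \<Omega> \<Psi>)) \<in> carrier (FF C D)"
      using gen_closed bisetD * sum_rep[OF *] by blast+
    have "f a = \<zero>\<^bsub>N\<^esub>"
      unfolding a' F.M.minus_eq linear_mapsD(2)[OF f g(3) F.M.a_inv_closed[OF F.M.a_closed[OF g(1,2)]]]
        linear_map_minus[OF f FF N F.M.a_closed[OF g(1,2)]] linear_mapsD(2)[OF f g(1,2)] sum[OF *]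
      using linear_mapsD(1)[OF f g(1)] linear_mapsD(1)[OF f g(2)] by (simp add: N.M.r_neg)
    then show "a \<in> {a \<in> carrier (FF C D). f a \<in> {\<zero>\<^bsub>N\<^esub>}}" using relators_closed a by blast
  qed
  ultimately have "NN C D \<subseteq> {a \<in> carrier (FF C D). f a \<in> {\<zero>\<^bsub>N\<^esub>}}" unfolding NN_eq by (rule span_least)
  then show ?thesis using a by blast
qed

text \<open>The universal property of the Grothendieck group with coefficients. Additivity is stated
  for a biset \<open>\<Theta>\<close> isomorphic to the sum because \<open>\<phi>\<close> is defined
  on bisets with elements in \<open>nat\<close>, while the sum has elements in
  \<open>nat + nat\<close>.\<close>

lemma MM_linear_map_exists:
  fixes N :: "('r, 'n) module" and \<phi> :: "('o, 'a, 'p, 'b) nbiset \<Rightarrow> 'n"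
  assumes N: "module R N"
    and closed: "\<And>\<Omega>. \<lbrakk>biset C D \<Omega>; birepresentable C D \<Omega>\<rbrakk> \<Longrightarrow> \<phi> \<Omega> \<in> carrier N"
    and iso: "\<And>\<Omega> \<Omega>'. \<lbrakk>biset C D \<Omega>; birepresentable C D \<Omega>; biset C D \<Omega>'; birepresentable C D \<Omega>';
      setfun_iso (biset_dom C D) \<Omega> \<Omega>'\<rbrakk> \<Longrightarrow> \<phi> \<Omega> = \<phi> \<Omega>'"
    and sum: "\<And>\<Omega> \<Psi> \<Theta>. \<lbrakk>biset C D \<Omega>; birepresentable C D \<Omega>; biset C D \<Psi>; birepresentable C D \<Psi>;
      biset C D \<Theta>; birepresentable C D \<Theta>; setfun_iso (biset_dom C D) \<Theta> (biset_sum \<Omega> \<Psi>)\<rbrakk> \<Longrightarrow> \<phi> \<Theta> = \<phi> \<Omega> \<oplus>\<^bsub>N\<^esub> \<phi> \<Psi>"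
  shows "\<exists>h\<in>linear_maps R (MM C D) N. \<forall>\<Omega>. birepresentable C D \<Omega> \<longrightarrow> h (arr C D \<Omega>) = \<phi> \<Omega>"
proof -
  interpret N: module R N by fact
  \<comment> \<open>The value on a class is that of a chosen birepresentable member; invariance
    under isomorphism makes the choice harmless.\<close>
  define \<psi> where "\<psi> b = \<phi> (SOME \<Omega>. birepresentable C D \<Omega> \<and> b = biset_class C D \<Omega>)" for b
  have \<psi>: "\<psi> (biset_class C D \<Omega>) = \<phi> \<Omega>" if \<Omega>: "birepresentable C D \<Omega>" for \<Omega>
  proof -
    define \<Omega>' where "\<Omega>' = (SOME \<Omega>' :: ('o, 'a, 'p, 'b) nbiset. birepresentable C D \<Omega>' \<and> biset_class C D \<Omega> = biset_class C D \<Omega>')"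
    have "\<exists>\<Omega>' :: ('o, 'a, 'p, 'b) nbiset. birepresentable C D \<Omega>' \<and> biset_class C D \<Omega> = biset_class C D \<Omega>'" using \<Omega> by blast
    from someI_ex[OF this] have "birepresentable C D \<Omega>' \<and> biset_class C D \<Omega> = biset_class C D \<Omega>'"
      unfolding \<Omega>'_def .
    then have \<Omega>': "birepresentable C D \<Omega>'" "biset_class C D \<Omega> = biset_class C D \<Omega>'" by simp_all
    have "\<Omega>' \<in> biset_class C D \<Omega>"
      using bisetD[OF \<Omega>'(1)] unfolding \<Omega>'(2) by (simp add: biset_class_def biset_def setfun_iso_refl)
    then have "setfun_iso (biset_dom C D) \<Omega>' \<Omega>" by (simp add: biset_class_def)
    then show ?thesis unfolding \<psi>_def \<Omega>'_def[symmetric] by (rule iso[OF bisetD[OF \<Omega>'(1)] \<Omega>'(1) bisetD[OF \<Omega>] \<Omega>])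
  qed
  have \<psi>_closed: "\<psi> \<in> birep_classes C D \<rightarrow> carrier N"
  proof
    fix b assume "b \<in> birep_classes C D"
    then obtain \<Omega> :: "('o, 'a, 'p, 'b) nbiset" where o: "birepresentable C D \<Omega>" "b = biset_class C D \<Omega>"
      unfolding birep_classes_def by blast
    show "\<psi> b \<in> carrier N" unfolding o(2) \<psi>[OF o(1)] by (rule closed[OF bisetD[OF o(1)] o(1)])
  qed
  let ?f = "free_ext R N \<psi>"
  note lin = free_ext_linear[OF N \<psi>_closed]
  have gen: "?f (free_gen R (biset_class C D \<Omega>)) = \<phi> \<Omega>" if "birepresentable C D \<Omega>" for \<Omega>
    using free_ext_gen[OF N birep_classesI[OF bisetD[OF that] that] \<psi>_closed] \<psi>[OF that] by simp
  have "?f a = \<zero>\<^bsub>N\<^esub>" if "a \<in> NN C D" for a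
  proof (rule NN_vanish[OF N lin _ that])
    fix \<Omega> \<Psi> :: "('o, 'a, 'p, 'b) nbiset" assume *: "birepresentable C D \<Omega>" "birepresentable C D \<Psi>"
    note s = sum_rep[OF *, THEN conjunct1] sum_rep[OF *, THEN conjunct2]
    obtain \<Theta> :: "('o, 'a, 'p, 'b) nbiset" where t: "biset C D \<Theta>" "setfun_iso (biset_dom C D) (biset_sum \<Omega> \<Psi>) \<Theta>"
      using nat_biset_exists[OF s(1)] by blast
    have t': "birepresentable C D \<Theta>" by (rule birepresentable_iso[OF s(1) t(2) s(2)])
    have t'': "setfun_iso (biset_dom C D) \<Theta> (biset_sum \<Omega> \<Psi>)"
      using setfun_iso_sym[OF t(2)] s(1) by (simp add: biset_def)
    show "?f (free_gen R (biset_class C D (biset_sum \<Omega> \<Psi>)))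
        = ?f (free_gen R (biset_class C D \<Omega>)) \<oplus>\<^bsub>N\<^esub> ?f (free_gen R (biset_class C D \<Psi>))"
      unfolding biset_class_eq[OF s(1) t(2)] gen[OF t'] gen[OF *(1)] gen[OF *(2)]
      by (rule sum[OF bisetD[OF *(1)] *(1) bisetD[OF *(2)] *(2) t(1) t' t''])
  qed
  then have "\<exists>h\<in>linear_maps R (quot_module (FF C D) (NN C D)) N. \<forall>a\<in>carrier (FF C D). h (NN C D +>\<^bsub>FF C D\<^esub> a) = ?f a"
    by (rule quot_induced[OF FF NN N lin])
  then obtain h where h: "h \<in> linear_maps R (MM C D) N" "\<forall>a\<in>carrier (FF C D). h (cos a) = ?f a"
    unfolding biset_module_def by blast
  have "h (arr C D \<Omega>) = \<phi> \<Omega>" if "birepresentable C D \<Omega>" for \<Omega>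
    using h(2) gen_closed[OF bisetD[OF that] that] gen[OF that] by (simp add: biset_arrow_def)
  then show ?thesis using h(1) by blast
qed

end

section \<open>Bilinearity of the composition of linear combinations of bisets\<close>

locale three_categories = CD: two_categories R C D + DE: two_categories R D E
  for R :: "'r ring" (structure) and C :: "('o, 'a) category" and D :: "('p, 'b) category" and E :: "('q, 'c) category"
begin

sublocale CE: two_categories R C E
  by (intro two_categories.intro two_categories_axioms.intro CD.biset_module_locale_axioms CD.C DE.D)

text \<open>The image of a pair of vectors under the universal bilinear map into the free module on
  pairs. It turns \<open>free_comp\<close> into a linear extension.\<close>

definition tensor :: "('i \<Rightarrow> 'r) \<Rightarrow> ('j \<Rightarrow> 'r) \<Rightarrow> 'i \<times> 'j \<Rightarrow> 'r" where
  "tensor f g = (\<lambda>p. f (fst p) \<otimes> g (snd p))"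

text \<open>Products of non-zero elements of a field are non-zero, so the support is exactly the
  index set over which \<open>free_comp\<close> sums.\<close>

lemma tensor_supp:
  assumes "\<And>i. f i \<in> carrier R" "\<And>j. g j \<in> carrier R"
  shows "{p. tensor f g p \<noteq> \<zero>} = {i. f i \<noteq> \<zero>} \<times> {j. g j \<noteq> \<zero>}"
proof -
  interpret field R by (rule CD.R_field)
  show ?thesis using assms integral_iff by (auto simp: tensor_def)
qed

lemma tensor_closed:
  assumes "f \<in> carrier (CD.FF C D)" "g \<in> carrier (CD.FF D E)"
  shows "tensor f g \<in> carrier (free_module R (birep_classes C D \<times> birep_classes D E))"
proof -
  interpret field R by (rule CD.R_field)
  note f = free_module_carrierD[OF assms(1)] and g = free_module_carrierD[OF assms(2)]
  have "tensor f g p = \<zero>" if "p \<notin> {i. f i \<noteq> \<zero>} \<times> {j. g j \<noteq> \<zero>}" for p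
    using that tensor_supp[of f g] f(1) g(1) by blast
  then show ?thesis
    using f g by (intro free_module_carrierI[of _ R "{i. f i \<noteq> \<zero>} \<times> {j. g j \<noteq> \<zero>}"]) (auto simp: tensor_def)
qed

abbreviation pgen where "pgen \<equiv> \<lambda>p. free_gen R (class_comp C D E (fst p) (snd p))"

lemma class_comp_closed:
  assumes "b \<in> birep_classes C D" "b' \<in> birep_classes D E"
  shows "class_comp C D E b b' \<in> birep_classes C E"
proof -
  from birep_classesE[OF CD.C CD.D assms(1)] obtain \<Omega> :: "('o, 'a, 'p, 'b) nbiset" where
    o: "biset C D \<Omega>" "birepresentable C D \<Omega>" "b = biset_class C D \<Omega>" by blast
  from birep_classesE[OF CD.D DE.D assms(2)] obtain \<Psi> :: "('p, 'b, 'q, 'c) nbiset" where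
    p: "biset D E \<Psi>" "birepresentable D E \<Psi>" "b' = biset_class D E \<Psi>" by blast
  interpret biset_pair C D E \<Omega> \<Psi> unfolding biset_pair_def using o p by simp
  show ?thesis unfolding o(3) p(3) class_comp_eq[OF o(1) p(1)]
    by (rule birep_classesI[OF comp_biset comp_birepresentable[OF o(2) p(2)]])
qed

lemma pgen_closed: "pgen \<in> birep_classes C D \<times> birep_classes D E \<rightarrow> carrier (CD.FF C E)"
  using class_comp_closed by (auto intro: free_gen_closed[OF CD.R_cring])

lemma free_comp_eq:
  assumes "f \<in> carrier (CD.FF C D)" "g \<in> carrier (CD.FF D E)"
  shows "free_comp R C D E f g = free_ext R (CD.FF C E) pgen (tensor f g)"
  using tensor_supp[of f g] free_module_carrierD(1)[OF assms(1)] free_module_carrierD(1)[OF assms(2)]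
  by (simp add: free_comp_def free_ext_def tensor_def)

lemmas ext_linear = free_ext_linear[OF CD.FF pgen_closed]

definition kap where "kap f g = CE.cos (free_comp R C D E f g)"

abbreviation "TT \<equiv> free_module R (birep_classes C D \<times> birep_classes D E)"

lemma tensor_linear_left:
  assumes g: "g \<in> carrier (CD.FF D E)"
  shows "(\<lambda>f. tensor f g) \<in> linear_maps R (CD.FF C D) TT"
proof (rule linear_mapsI)
  interpret field R by (rule CD.R_field)
  note c = free_module_carrierD(1)
  fix f assume f: "f \<in> carrier (CD.FF C D)"
  show "tensor f g \<in> carrier TT" by (rule tensor_closed[OF f g])
  show "tensor (f \<oplus>\<^bsub>CD.FF C D\<^esub> f') g = tensor f g \<oplus>\<^bsub>TT\<^esub> tensor f' g" if "f' \<in> carrier (CD.FF C D)" for f'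
    using c[OF f] c[OF that] c[OF g] by (simp add: tensor_def free_module_simps l_distr)
  show "tensor (r \<odot>\<^bsub>CD.FF C D\<^esub> f) g = r \<odot>\<^bsub>TT\<^esub> tensor f g" if "r \<in> carrier R" for r
    using c[OF f] c[OF g] that by (simp add: tensor_def free_module_simps m_assoc)
qed

lemma tensor_linear_right:
  assumes f: "f \<in> carrier (CD.FF C D)"
  shows "tensor f \<in> linear_maps R (CD.FF D E) TT"
proof (rule linear_mapsI)
  interpret field R by (rule CD.R_field)
  note c = free_module_carrierD(1)
  fix g assume g: "g \<in> carrier (CD.FF D E)"
  show "tensor f g \<in> carrier TT" by (rule tensor_closed[OF f g])
  show "tensor f (g \<oplus>\<^bsub>CD.FF D E\<^esub> g') = tensor f g \<oplus>\<^bsub>TT\<^esub> tensor f g'" if "g' \<in> carrier (CD.FF D E)" for g'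
    using c[OF f] c[OF that] c[OF g] by (simp add: tensor_def free_module_simps r_distr)
  show "tensor f (r \<odot>\<^bsub>CD.FF D E\<^esub> g) = r \<odot>\<^bsub>TT\<^esub> tensor f g" if "r \<in> carrier R" for r
    using c[OF f] c[OF g] that by (simp add: tensor_def free_module_simps m_lcomm)
qed

lemma kap_linear_left:
  assumes g: "g \<in> carrier (CD.FF D E)"
  shows "(\<lambda>f. kap f g) \<in> linear_maps R (CD.FF C D) (CD.MM C E)"
  by (rule linear_maps_cong[OF linear_maps_comp[OF linear_maps_comp[OF tensor_linear_left[OF g] ext_linear] CE.cos_linear] CD.FF])
     (simp add: kap_def free_comp_eq[OF _ g])

lemma kap_linear_right:
  assumes f: "f \<in> carrier (CD.FF C D)"
  shows "kap f \<in> linear_maps R (CD.FF D E) (CD.MM C E)"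
  by (rule linear_maps_cong[OF linear_maps_comp[OF linear_maps_comp[OF tensor_linear_right[OF f] ext_linear] CE.cos_linear] CD.FF])
     (simp add: kap_def free_comp_eq[OF f])

lemma kap_gen:
  assumes "biset C D \<Omega>" "birepresentable C D \<Omega>" "biset D E \<Psi>" "birepresentable D E \<Psi>"
  shows "kap (free_gen R (biset_class C D \<Omega>)) (free_gen R (biset_class D E \<Psi>)) = CD.arr C E (biset_comp C D E \<Omega> \<Psi>)"
proof -
  interpret field R by (rule CD.R_field)
  let ?b = "biset_class C D \<Omega>" and ?b' = "biset_class D E \<Psi>"
  note g = CD.gen_closed[OF assms(1,2)] DE.gen_closed[OF assms(3,4)]
  have "tensor (free_gen R ?b) (free_gen R ?b') = free_gen R (?b, ?b')"
    by (auto simp: tensor_def free_gen_def)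
  then have "free_comp R C D E (free_gen R ?b) (free_gen R ?b') = pgen (?b, ?b')"
    using free_comp_eq[OF g] free_ext_gen[OF CD.FF _ pgen_closed, of "(?b, ?b')"]
      birep_classesI[OF assms(1,2)] birep_classesI[OF assms(3,4)] by simp
  then show ?thesis by (simp add: kap_def class_comp_eq[OF assms(1,3)] biset_arrow_def)
qed

text \<open>Relations of the left factor go to zero because composition distributes over disjoint
  unions up to isomorphism; by linearity in \<open>g\<close> this is checked on single
  bisets.\<close>

lemma kap_relation_left:
  assumes a: "a \<in> CD.NN C D" and g: "g \<in> carrier (CD.FF D E)"
  shows "kap a g = \<zero>\<^bsub>CD.MM C E\<^esub>"
proof (rule CD.NN_vanish[OF CE.MM kap_linear_left[OF g] _ a])
  fix \<Omega> \<Omega>' :: "('o, 'a, 'p, 'b) nbiset" assume o: "birepresentable C D \<Omega>" "birepresentable C D \<Omega>'"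
  note bo = CD.bisetD[OF o(1)] CD.bisetD[OF o(2)]
  note s = CD.sum_rep[OF o, THEN conjunct1] CD.sum_rep[OF o, THEN conjunct2]
  note lin = kap_linear_right[OF CD.gen_closed]
  show "kap (free_gen R (biset_class C D (biset_sum \<Omega> \<Omega>'))) g
    = kap (free_gen R (biset_class C D \<Omega>)) g \<oplus>\<^bsub>CD.MM C E\<^esub> kap (free_gen R (biset_class C D \<Omega>')) g"
  proof (rule free_linear_eq[OF CD.R_cring CE.MM lin[OF s] linear_maps_add[OF CE.MM lin[OF bo(1) o(1)] lin[OF bo(2) o(2)]] _ g])
    fix b assume "b \<in> birep_classes D E"
    from birep_classesE[OF CD.D DE.D this] obtain \<Psi> :: "('p, 'b, 'q, 'c) nbiset" where
      p: "biset D E \<Psi>" "birepresentable D E \<Psi>" "b = biset_class D E \<Psi>" by blast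
    interpret A: biset_pair C D E \<Omega> \<Psi> unfolding biset_pair_def using bo p by simp
    interpret B: biset_pair C D E \<Omega>' \<Psi> unfolding biset_pair_def using bo p by simp
    interpret S: biset_pair C D E "biset_sum \<Omega> \<Omega>'" \<Psi> unfolding biset_pair_def using s p by simp
    show "kap (free_gen R (biset_class C D (biset_sum \<Omega> \<Omega>'))) (free_gen R b)
      = kap (free_gen R (biset_class C D \<Omega>)) (free_gen R b) \<oplus>\<^bsub>CD.MM C E\<^esub> kap (free_gen R (biset_class C D \<Omega>')) (free_gen R b)"
      unfolding p(3) kap_gen[OF s p(1,2)] kap_gen[OF bo(1) o(1) p(1,2)] kap_gen[OF bo(2) o(2) p(1,2)]
        CE.arr_iso[OF S.comp_biset comp_sum_left[OF bo p(1)]]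
      by (rule CE.arr_sum[OF A.comp_biset A.comp_birepresentable[OF o(1) p(2)] B.comp_biset B.comp_birepresentable[OF o(2) p(2)]])
  qed
qed

lemma kap_relation_right:
  assumes a: "a \<in> CD.NN D E" and f: "f \<in> carrier (CD.FF C D)"
  shows "kap f a = \<zero>\<^bsub>CD.MM C E\<^esub>"
proof (rule DE.NN_vanish[OF CE.MM kap_linear_right[OF f] _ a])
  fix \<Psi> \<Psi>' :: "('p, 'b, 'q, 'c) nbiset" assume o: "birepresentable D E \<Psi>" "birepresentable D E \<Psi>'"
  note bo = DE.bisetD[OF o(1)] DE.bisetD[OF o(2)]
  note s = DE.sum_rep[OF o, THEN conjunct1] DE.sum_rep[OF o, THEN conjunct2]
  note lin = kap_linear_left[OF DE.gen_closed]
  show "kap f (free_gen R (biset_class D E (biset_sum \<Psi> \<Psi>')))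
    = kap f (free_gen R (biset_class D E \<Psi>)) \<oplus>\<^bsub>CD.MM C E\<^esub> kap f (free_gen R (biset_class D E \<Psi>'))"
  proof (rule free_linear_eq[OF CD.R_cring CE.MM lin[OF s] linear_maps_add[OF CE.MM lin[OF bo(1) o(1)] lin[OF bo(2) o(2)]] _ f])
    fix b assume "b \<in> birep_classes C D"
    from birep_classesE[OF CD.C CD.D this] obtain \<Omega> :: "('o, 'a, 'p, 'b) nbiset" where
      p: "biset C D \<Omega>" "birepresentable C D \<Omega>" "b = biset_class C D \<Omega>" by blast
    interpret A: biset_pair C D E \<Omega> \<Psi> unfolding biset_pair_def using bo p by simp
    interpret B: biset_pair C D E \<Omega> \<Psi>' unfolding biset_pair_def using bo p by simp
    interpret S: biset_pair C D E \<Omega> "biset_sum \<Psi> \<Psi>'" unfolding biset_pair_def using s p by simp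
    show "kap (free_gen R b) (free_gen R (biset_class D E (biset_sum \<Psi> \<Psi>')))
      = kap (free_gen R b) (free_gen R (biset_class D E \<Psi>)) \<oplus>\<^bsub>CD.MM C E\<^esub> kap (free_gen R b) (free_gen R (biset_class D E \<Psi>'))"
      unfolding p(3) kap_gen[OF p(1,2) s] kap_gen[OF p(1,2) bo(1) o(1)] kap_gen[OF p(1,2) bo(2) o(2)]
        CE.arr_iso[OF S.comp_biset comp_sum_right[OF p(1) bo]]
      by (rule CE.arr_sum[OF A.comp_biset A.comp_birepresentable[OF p(2) o(1)] B.comp_biset B.comp_birepresentable[OF p(2) o(2)]])
  qed
qed

definition bcomp where
  "bcomp K L = (\<Union>f\<in>K. \<Union>g\<in>L. kap f g)"

text \<open>The double union over representatives collapses one variable at a time, since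
  \<open>kap\<close> kills the relations in each variable.\<close>

lemma bcomp_cos:
  assumes f: "f \<in> carrier (CD.FF C D)" and g: "g \<in> carrier (CD.FF D E)"
  shows "bcomp (CD.cos f) (DE.cos g) = kap f g"
proof -
  have "(\<Union>g'\<in>DE.cos g. kap f' g') = kap f' g" if f': "f' \<in> carrier (CD.FF C D)" for f'
    by (rule coset_UN[OF CD.FF DE.NN g])
       (rule linear_coset_const[OF CD.FF DE.NN CE.MM kap_linear_right[OF f'] kap_relation_right[OF _ f'] g])
  then have "bcomp (CD.cos f) (DE.cos g) = (\<Union>f'\<in>CD.cos f. kap f' g)"
    unfolding bcomp_def using coset_mem(1)[OF CD.FF CD.NN f] by simp
  also have "\<dots> = kap f g"
    by (rule coset_UN[OF CD.FF CD.NN f])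
       (rule linear_coset_const[OF CD.FF CD.NN CE.MM kap_linear_left[OF g] kap_relation_left[OF _ g] f])
  finally show ?thesis .
qed

lemma bcomp_linear_left:
  assumes L: "L \<in> carrier (CD.MM D E)"
  shows "(\<lambda>K. bcomp K L) \<in> linear_maps R (CD.MM C D) (CD.MM C E)"
proof -
  obtain g where g: "g \<in> carrier (CD.FF D E)" "L = DE.cos g" using L unfolding DE.MM_carrier by blast
  have "(\<lambda>K. bcomp K L) \<in> linear_maps R (quot_module (CD.FF C D) (CD.NN C D)) (CD.MM C E)"
    by (rule quot_linear[OF CD.FF CD.NN], rule linear_maps_cong[OF kap_linear_left[OF g(1)] CD.FF])
       (simp add: g(2) bcomp_cos[OF _ g(1)])
  then show ?thesis by (simp only: biset_module_def)
qed

lemma bcomp_linear_right: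
  assumes K: "K \<in> carrier (CD.MM C D)"
  shows "bcomp K \<in> linear_maps R (CD.MM D E) (CD.MM C E)"
proof -
  obtain f where f: "f \<in> carrier (CD.FF C D)" "K = CD.cos f" using K unfolding CD.MM_carrier by blast
  have "bcomp K \<in> linear_maps R (quot_module (CD.FF D E) (CD.NN D E)) (CD.MM C E)"
    by (rule quot_linear[OF CD.FF DE.NN], rule linear_maps_cong[OF kap_linear_right[OF f(1)] CD.FF])
       (simp add: f(2) bcomp_cos[OF f(1)])
  then show ?thesis by (simp only: biset_module_def)
qed

lemma bcomp_arr:
  assumes "biset C D \<Omega>" "birepresentable C D \<Omega>" "biset D E \<Psi>" "birepresentable D E \<Psi>"
  shows "bcomp (CD.arr C D \<Omega>) (CD.arr D E \<Psi>) = CD.arr C E (biset_comp C D E \<Omega> \<Psi>)"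
  using bcomp_cos[OF CD.gen_closed[OF assms(1,2)] DE.gen_closed[OF assms(3,4)]] kap_gen[OF assms]
  by (simp add: biset_arrow_def)

lemma bcomp_closed:
  "\<lbrakk>K \<in> carrier (CD.MM C D); L \<in> carrier (CD.MM D E)\<rbrakk> \<Longrightarrow> bcomp K L \<in> carrier (CD.MM C E)"
  by (rule linear_mapsD(1)[OF bcomp_linear_left])

end

subsection \<open>Linear categories\<close>

locale linear_cat = category C for R :: "'r ring" and C :: "('o, 'a, 'r) linear_category" +
  assumes ArrM_module: "\<lbrakk>x \<in> Ob C; y \<in> Ob C\<rbrakk> \<Longrightarrow> module R (ArrM C x y)"
    and Arr_eq: "Arr C x y = carrier (ArrM C x y)"
    and cmp_linear_left: "\<lbrakk>x \<in> Ob C; y \<in> Ob C; z \<in> Ob C; f \<in> Arr C x y\<rbrakk>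
      \<Longrightarrow> (\<lambda>g. cmp C x y z g f) \<in> linear_maps R (ArrM C y z) (ArrM C x z)"
    and cmp_linear_right: "\<lbrakk>x \<in> Ob C; y \<in> Ob C; z \<in> Ob C; g \<in> Arr C y z\<rbrakk>
      \<Longrightarrow> cmp C x y z g \<in> linear_maps R (ArrM C x y) (ArrM C x z)"

lemma full_subcat_ArrM [simp]: "ArrM (full_subcat C A) = ArrM C"
  by (simp add: full_subcat_def)

lemma linear_cat_subcat: "linear_cat R C \<Longrightarrow> linear_cat R (full_subcat C A)"
  by (simp add: linear_cat_def linear_cat_axioms_def full_subcat_category)

lemma linear_module_functor_iso:
  assumes F: "linear_module_functor R C F" and G: "module_functor R C G" and iso: "modfun_iso R C F G"
    and C: "linear_cat R C"
  shows "linear_module_functor R C G"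
proof -
  interpret F: linear_module_functor R C F by fact
  interpret G: module_functor R C G by fact
  interpret linear_cat R C by fact
  from iso obtain \<eta> where "modfun_iso_by R C F G \<eta>" by (rule modfun_isoE)
  note \<eta> = modfun_iso_byD[OF this]
  show ?thesis
  proof (intro linear_module_functor.intro[OF G] linear_module_functor_axioms.intro)
    fix x y f g b assume x: "x \<in> Ob C" and y: "y \<in> Ob C" and f: "f \<in> Arr C x y" and g: "g \<in> Arr C x y"
      and "b \<in> carrier (fob G x)"
    then obtain a where a: "a \<in> carrier (fob F x)" "b = \<eta> x a"
      using bij_betw_imp_surj_on[OF \<eta>(2)[OF x]] by blast
    have fg: "f \<oplus>\<^bsub>ArrM C x y\<^esub> g \<in> Arr C x y"
      using module_add_closed[OF ArrM_module[OF x y]] f g unfolding Arr_eq by blast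
    show "far G x y (f \<oplus>\<^bsub>ArrM C x y\<^esub> g) b = far G x y f b \<oplus>\<^bsub>fob G y\<^esub> far G x y g b"
      unfolding a(2) \<eta>(3)[OF x y f a(1), symmetric] \<eta>(3)[OF x y g a(1), symmetric] \<eta>(3)[OF x y fg a(1), symmetric]
        F.far_add[OF x y f g a(1)]
      by (rule linear_mapsD(2)[OF \<eta>(1)[OF y] linear_mapsD(1)[OF F.far_linear[OF x y f] a(1)]
            linear_mapsD(1)[OF F.far_linear[OF x y g] a(1)]])
  next
    fix x y r f b assume x: "x \<in> Ob C" and y: "y \<in> Ob C" and r: "r \<in> carrier R" and f: "f \<in> Arr C x y"
      and "b \<in> carrier (fob G x)"
    then obtain a where a: "a \<in> carrier (fob F x)" "b = \<eta> x a"
      using bij_betw_imp_surj_on[OF \<eta>(2)[OF x]] by blast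
    have rf: "r \<odot>\<^bsub>ArrM C x y\<^esub> f \<in> Arr C x y"
      using module.smult_closed[OF ArrM_module[OF x y] r] f unfolding Arr_eq by blast
    show "far G x y (r \<odot>\<^bsub>ArrM C x y\<^esub> f) b = r \<odot>\<^bsub>fob G y\<^esub> far G x y f b"
      unfolding a(2) \<eta>(3)[OF x y f a(1), symmetric] \<eta>(3)[OF x y rf a(1), symmetric] F.far_smult[OF x y r f a(1)]
      by (rule linear_mapsD(3)[OF \<eta>(1)[OF y] r linear_mapsD(1)[OF F.far_linear[OF x y f] a(1)]])
  qed
qed

locale linear_value_at = linear_cat R C + V: linear_module_functor R "full_subcat C {X}" V
  for R :: "'r ring" and C :: "('o, 'a, 'r) linear_category" and X :: 'o and V :: "('o, 'a, 'r, 'm) modfun" +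
  assumes X': "X \<in> Ob C"

sublocale linear_value_at \<subseteq> value_at R C X V
  by (intro value_at.intro value_at_axioms.intro category_axioms V.module_functor_axioms X')

context linear_value_at
begin

lemma \<alpha>_arrow_linear:
  assumes "v \<in> carrier M"
  shows "(\<lambda>f. \<alpha> f v) \<in> linear_maps R (ArrM C X X) M"
  using V.far_add[of X X _ _ v] V.far_smult[of X X _ _ v] \<alpha>_closed[OF _ assms] assms X
  by (intro linear_mapsI) (simp_all add: Arr_eq)

text \<open>The functions making up the constructed functor are linear in the arrow. This is what
  makes the functor itself linear, since its arrows act by precomposition.\<close>

lemma SS_linear:
  assumes y: "y \<in> Ob C" and h: "h \<in> SS y"
  shows "h \<in> linear_maps R (ArrM C y X) M"
proof -
  interpret A: module R "ArrM C y X" by (rule ArrM_module[OF y X])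
  note AE = Arr_eq[of y X]
  note cong = linear_maps_cong[OF _ A.module_axioms]
  show ?thesis
    using FM[of y] gens_closed[OF y] h[unfolded sim_set_def]
  proof (induction rule: span_induct)
    case (base h)
    then obtain a v where a: "h = gen y a v" "a \<in> Arr C X y" "v \<in> carrier M" by blast
    show ?case
      by (rule cong[OF linear_maps_comp[OF cmp_linear_left[OF X y X a(2)] \<alpha>_arrow_linear[OF a(3)]]])
         (simp add: a(1) sim_gen_def AE)
  next
    case zero
    show ?case by (rule cong[OF linear_maps_zero[OF M]]) (simp add: fun_module_simps AE)
  next
    case (add h k)
    show ?case by (rule cong[OF linear_maps_add[OF M add(3,4)]]) (simp add: fun_module_simps AE)
  next
    case (smult r h)
    show ?case by (rule cong[OF linear_maps_smult[OF M smult(3,1)]]) (simp add: fun_module_simps AE)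
  qed
qed

lemma S_linear: "linear_module_functor R C S"
proof (intro linear_module_functor.intro[OF S_functor] linear_module_functor_axioms.intro)
  fix y z f g h assume y: "y \<in> Ob C" and z: "z \<in> Ob C" and f: "f \<in> Arr C y z" and g: "g \<in> Arr C y z"
    and "h \<in> carrier (fob S y)"
  then have h: "h \<in> SS y" by (simp add: S_simps)
  have "h (cmp C y z X c (f \<oplus>\<^bsub>ArrM C y z\<^esub> g)) = h (cmp C y z X c f) \<oplus>\<^bsub>M\<^esub> h (cmp C y z X c g)"
    if c: "c \<in> Arr C z X" for c
    using linear_mapsD(2)[OF linear_maps_comp[OF cmp_linear_right[OF y z X c] SS_linear[OF y h]]] f g by (simp add: Arr_eq)
  then show "far S y z (f \<oplus>\<^bsub>ArrM C y z\<^esub> g) h = far S y z f h \<oplus>\<^bsub>fob S z\<^esub> far S y z g h"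
    by (auto simp: S_simps fun_module_simps intro!: restrict_ext)
next
  fix y z r f h assume y: "y \<in> Ob C" and z: "z \<in> Ob C" and r: "r \<in> carrier R" and f: "f \<in> Arr C y z"
    and "h \<in> carrier (fob S y)"
  then have h: "h \<in> SS y" by (simp add: S_simps)
  have "h (cmp C y z X c (r \<odot>\<^bsub>ArrM C y z\<^esub> f)) = r \<odot>\<^bsub>M\<^esub> h (cmp C y z X c f)"
    if c: "c \<in> Arr C z X" for c
    using linear_mapsD(3)[OF linear_maps_comp[OF cmp_linear_right[OF y z X c] SS_linear[OF y h]] r] f by (simp add: Arr_eq)
  then show "far S y z (r \<odot>\<^bsub>ArrM C y z\<^esub> f) h = r \<odot>\<^bsub>fob S z\<^esub> far S y z f h"
    by (auto simp: S_simps fun_module_simps intro!: restrict_ext)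
qed

text \<open>By linearity in \<open>a\<close>, the generators belonging to a spanning set of arrows
  span all the others.\<close>

lemma gen_arrow_linear:
  assumes y: "y \<in> Ob C" and v: "v \<in> carrier M"
  shows "(\<lambda>a. gen y a v) \<in> linear_maps R (ArrM C X y) (FM y)"
proof -
  have lin: "(\<lambda>a. \<alpha> (cmp C X y X b a) v) \<in> linear_maps R (ArrM C X y) M" if "b \<in> Arr C y X" for b
    by (rule linear_maps_comp[OF cmp_linear_right[OF X y X that] \<alpha>_arrow_linear[OF v]])
  show ?thesis
  proof (rule linear_mapsI)
    fix a assume a: "a \<in> carrier (ArrM C X y)"
    then show "gen y a v \<in> carrier (FM y)" using gen_closed[OF y _ v] by (simp add: Arr_eq)
    show "gen y (a \<oplus>\<^bsub>ArrM C X y\<^esub> b) v = gen y a v \<oplus>\<^bsub>FM y\<^esub> gen y b v" if b: "b \<in> carrier (ArrM C X y)" for b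
      using linear_mapsD(2)[OF lin a b] by (auto simp: sim_gen_def fun_module_simps intro!: restrict_ext)
    show "gen y (r \<odot>\<^bsub>ArrM C X y\<^esub> a) v = r \<odot>\<^bsub>FM y\<^esub> gen y a v" if r: "r \<in> carrier R" for r
      using linear_mapsD(3)[OF lin r a] by (auto simp: sim_gen_def fun_module_simps intro!: restrict_ext)
  qed
qed

end

subsection \<open>The biset category is a linear category\<close>

context biset_module_locale
begin

lemma two: "\<lbrakk>finite_category C; finite_category D\<rbrakk> \<Longrightarrow> two_categories R C D"
  by (intro two_categories.intro two_categories_axioms.intro biset_module_locale_axioms)

lemma three: "\<lbrakk>finite_category C; finite_category D; finite_category E\<rbrakk> \<Longrightarrow> three_categories R C D E"
  by (intro three_categories.intro two)

lemma biset_category_simps: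
  "Ob (biset_category R) = {C. finite_category C}" "Arr (biset_category R) D C = carrier (MM C D)"
  "ident (biset_category R) C = arr C C (id_biset C)" "ArrM (biset_category R) D C = MM C D"
  by (simp_all add: biset_category_def)

lemma biset_category_cmp:
  assumes "finite_category C" "finite_category D" "finite_category E"
  shows "cmp (biset_category R) E D C K L = three_categories.bcomp R C D E K L"
  using three[OF assms] by (simp add: biset_category_def three_categories.bcomp_def three_categories.kap_def)

text \<open>The classes of single bisets span the arrows, so a linear map is determined by its
  values on them.\<close>

lemma linear_maps_agree:
  fixes C :: "('o, 'a) category" and D :: "('p, 'b) category"
  assumes CD: "finite_category C" "finite_category D" and N: "module R N"
    and f: "f \<in> linear_maps R (MM C D) N" and g: "g \<in> linear_maps R (MM C D) N"
    and eq: "\<And>\<Omega> :: ('o, 'a, 'p, 'b) nbiset. \<lbrakk>biset C D \<Omega>; birepresentable C D \<Omega>\<rbrakk> \<Longrightarrow> f (arr C D \<Omega>) = g (arr C D \<Omega>)"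
    and K: "K \<in> carrier (MM C D)"
  shows "f K = g K"
proof -
  interpret CD: two_categories R C D by (rule two[OF CD])
  from K show ?thesis
  proof (induction rule: CD.MM_induct)
    case (arr \<Omega>)
    then show ?case by (rule eq)
  next
    case zero
    show ?case using linear_map_zero[OF f CD.MM N] linear_map_zero[OF g CD.MM N] by simp
  next
    case (add K L)
    then show ?case using linear_mapsD(2)[OF f] linear_mapsD(2)[OF g] by simp
  next
    case (smult r K)
    then show ?case using linear_mapsD(3)[OF f] linear_mapsD(3)[OF g] by simp
  qed
qed

text \<open>Both sides are linear in each argument, so the arguments are reduced to classes of
  single bisets one at a time: the last in \<open>1\<close>, the middle one in \<open>2\<close>, the
  first at the end.\<close>

lemma bcomp_assoc:
  fixes A :: "('o, 'a) category" and B :: "('p, 'b) category" and C :: "('q, 'c) category" and D :: "('s, 'd) category"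
  assumes A: "finite_category A" and B: "finite_category B" and C: "finite_category C" and D: "finite_category D"
    and h: "h \<in> carrier (MM A B)" and g: "g \<in> carrier (MM B C)" and f: "f \<in> carrier (MM C D)"
  shows "three_categories.bcomp R A B D h (three_categories.bcomp R B C D g f)
    = three_categories.bcomp R A C D (three_categories.bcomp R A B C h g) f"
proof -
  interpret ABD: three_categories R A B D by (rule three[OF A B D])
  interpret BCD: three_categories R B C D by (rule three[OF B C D])
  interpret ACD: three_categories R A C D by (rule three[OF A C D])
  interpret ABC: three_categories R A B C by (rule three[OF A B C])
  note MAD = ABD.CE.MM
  have 1: "ABD.bcomp (arr A B \<Omega>) (BCD.bcomp (arr B C \<Psi>) f) = ACD.bcomp (ABC.bcomp (arr A B \<Omega>) (arr B C \<Psi>)) f"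
    if o: "biset A B \<Omega>" "birepresentable A B \<Omega>" and p: "biset B C \<Psi>" "birepresentable B C \<Psi>" and f: "f \<in> carrier (MM C D)"
    for \<Omega> :: "('o, 'a, 'p, 'b) nbiset" and \<Psi> :: "('p, 'b, 'q, 'c) nbiset" and f
  proof (rule linear_maps_agree[OF C D MAD _ _ _ f])
    note oa = ABD.CD.arr_closed[OF o] and pa = BCD.CD.arr_closed[OF p]
    show "(\<lambda>f. ABD.bcomp (arr A B \<Omega>) (BCD.bcomp (arr B C \<Psi>) f)) \<in> linear_maps R (MM C D) (MM A D)"
      by (rule linear_maps_comp[OF BCD.bcomp_linear_right[OF pa] ABD.bcomp_linear_right[OF oa]])
    show "ACD.bcomp (ABC.bcomp (arr A B \<Omega>) (arr B C \<Psi>)) \<in> linear_maps R (MM C D) (MM A D)"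
      by (rule ACD.bcomp_linear_right[OF ABC.bcomp_closed[OF oa pa]])
    fix \<Theta> :: "('q \<times> 's, 'c \<times> 'd, nat) setfun" assume t: "biset C D \<Theta>" "birepresentable C D \<Theta>"
    interpret OP: biset_pair A B C \<Omega> \<Psi> unfolding biset_pair_def using o p by simp
    interpret PT: biset_pair B C D \<Psi> \<Theta> unfolding biset_pair_def using p t by simp
    note op = OP.comp_biset OP.comp_birepresentable[OF o(2) p(2)]
    note pt = PT.comp_biset PT.comp_birepresentable[OF p(2) t(2)]
    interpret OPT: biset_pair A C D OP.comp \<Theta> unfolding biset_pair_def using op t by simp
    show "ABD.bcomp (arr A B \<Omega>) (BCD.bcomp (arr B C \<Psi>) (arr C D \<Theta>))
      = ACD.bcomp (ABC.bcomp (arr A B \<Omega>) (arr B C \<Psi>)) (arr C D \<Theta>)"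
      unfolding BCD.bcomp_arr[OF p t] ABD.bcomp_arr[OF o pt] ABC.bcomp_arr[OF o p] ACD.bcomp_arr[OF op t]
      by (rule ABD.CE.arr_iso[OF OPT.comp_biset comp_assoc[OF o(1) p(1) t(1)], symmetric])
  qed
  have 2: "ABD.bcomp (arr A B \<Omega>) (BCD.bcomp g f) = ACD.bcomp (ABC.bcomp (arr A B \<Omega>) g) f"
    if o: "biset A B \<Omega>" "birepresentable A B \<Omega>" for \<Omega> :: "('o, 'a, 'p, 'b) nbiset"
  proof (rule linear_maps_agree[OF B C MAD _ _ _ g])
    note oa = ABD.CD.arr_closed[OF o]
    show "(\<lambda>g. ABD.bcomp (arr A B \<Omega>) (BCD.bcomp g f)) \<in> linear_maps R (MM B C) (MM A D)"
      by (rule linear_maps_comp[OF BCD.bcomp_linear_left[OF f] ABD.bcomp_linear_right[OF oa]])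
    show "(\<lambda>g. ACD.bcomp (ABC.bcomp (arr A B \<Omega>) g) f) \<in> linear_maps R (MM B C) (MM A D)"
      by (rule linear_maps_comp[OF ABC.bcomp_linear_right[OF oa] ACD.bcomp_linear_left[OF f]])
  qed (rule 1[OF o _ _ f])
  show ?thesis
  proof (rule linear_maps_agree[OF A B MAD _ _ _ h])
    show "(\<lambda>h. ABD.bcomp h (BCD.bcomp g f)) \<in> linear_maps R (MM A B) (MM A D)"
      by (rule ABD.bcomp_linear_left[OF BCD.bcomp_closed[OF g f]])
    show "(\<lambda>h. ACD.bcomp (ABC.bcomp h g) f) \<in> linear_maps R (MM A B) (MM A D)"
      by (rule linear_maps_comp[OF ABC.bcomp_linear_left[OF g] ACD.bcomp_linear_left[OF f]])
  qed (rule 2)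
qed

lemma bcomp_id_left:
  fixes C :: "('o, 'a) category" and D :: "('p, 'b) category"
  assumes C: "finite_category C" and D: "finite_category D" and f: "f \<in> carrier (MM C D)"
  shows "three_categories.bcomp R C C D (arr C C (id_biset C)) f = f"
proof -
  interpret CCD: three_categories R C C D by (rule three[OF C C D])
  note i = id_biset_biset[OF C] id_biset_birepresentable[OF C]
  show ?thesis
  proof (rule linear_maps_agree[OF C D CCD.DE.MM _ _ _ f])
    show "CCD.bcomp (arr C C (id_biset C)) \<in> linear_maps R (MM C D) (MM C D)"
      by (rule CCD.bcomp_linear_right[OF CCD.CD.arr_closed[OF i]])
    show "(\<lambda>f. f) \<in> linear_maps R (MM C D) (MM C D)" by (simp add: linear_maps_def)
    fix \<Omega> :: "('o, 'a, 'p, 'b) nbiset" assume o: "biset C D \<Omega>" "birepresentable C D \<Omega>"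
    interpret P: biset_pair C C D "id_biset C" \<Omega> unfolding biset_pair_def using i o by simp
    show "CCD.bcomp (arr C C (id_biset C)) (arr C D \<Omega>) = arr C D \<Omega>"
      unfolding CCD.bcomp_arr[OF i o] by (rule CCD.DE.arr_iso[OF P.comp_biset comp_id_left[OF o(1)]])
  qed
qed

lemma bcomp_id_right:
  fixes C :: "('o, 'a) category" and D :: "('p, 'b) category"
  assumes C: "finite_category C" and D: "finite_category D" and f: "f \<in> carrier (MM C D)"
  shows "three_categories.bcomp R C D D f (arr D D (id_biset D)) = f"
proof -
  interpret CDD: three_categories R C D D by (rule three[OF C D D])
  note i = id_biset_biset[OF D] id_biset_birepresentable[OF D]
  show ?thesis
  proof (rule linear_maps_agree[OF C D CDD.CD.MM _ _ _ f])
    show "(\<lambda>f. CDD.bcomp f (arr D D (id_biset D))) \<in> linear_maps R (MM C D) (MM C D)"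
      by (rule CDD.bcomp_linear_left[OF CDD.DE.arr_closed[OF i]])
    show "(\<lambda>f. f) \<in> linear_maps R (MM C D) (MM C D)" by (simp add: linear_maps_def)
    fix \<Omega> :: "('o, 'a, 'p, 'b) nbiset" assume o: "biset C D \<Omega>" "birepresentable C D \<Omega>"
    interpret P: biset_pair C D D \<Omega> "id_biset D" unfolding biset_pair_def using i o by simp
    show "CDD.bcomp (arr C D \<Omega>) (arr D D (id_biset D)) = arr C D \<Omega>"
      unfolding CDD.bcomp_arr[OF o i] by (rule CDD.CD.arr_iso[OF P.comp_biset comp_id_right[OF o(1)]])
  qed
qed

lemma biset_category_linear: "linear_cat R (biset_category R :: (('o, 'a) category, ('o, 'a, 'r) biset_arrow, 'r) linear_category)"
proof (intro linear_cat.intro linear_cat_axioms.intro category.intro; (unfold biset_category_simps mem_Collect_eq)?)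
  fix C :: "('o, 'a) category" assume C: "finite_category C"
  interpret CC: two_categories R C C by (rule two[OF C C])
  show "arr C C (id_biset C) \<in> carrier (MM C C)"
    by (rule CC.arr_closed[OF id_biset_biset[OF C] id_biset_birepresentable[OF C]])
next
  fix x y z :: "('o, 'a) category" and f g
  assume fin: "finite_category x" "finite_category y" "finite_category z" and f: "f \<in> carrier (MM y x)" and g: "g \<in> carrier (MM z y)"
  interpret three_categories R z y x by (rule three[OF fin(3,2,1)])
  show "cmp (biset_category R) x y z g f \<in> carrier (MM z x)"
    unfolding biset_category_cmp[OF fin(3,2,1)] by (rule bcomp_closed[OF g f])
next
  fix x y :: "('o, 'a) category" and f assume fin: "finite_category x" "finite_category y" and f: "f \<in> carrier (MM y x)"
  show "cmp (biset_category R) x y y (arr y y (id_biset y)) f = f"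
    unfolding biset_category_cmp[OF fin(2,2,1)] by (rule bcomp_id_left[OF fin(2,1) f])
  show "cmp (biset_category R) x x y f (arr x x (id_biset x)) = f"
    unfolding biset_category_cmp[OF fin(2,1,1)] by (rule bcomp_id_right[OF fin(2,1) f])
next
  fix w x y z :: "('o, 'a) category" and f g h
  assume fin: "finite_category w" "finite_category x" "finite_category y" "finite_category z"
    and a: "f \<in> carrier (MM x w)" "g \<in> carrier (MM y x)" "h \<in> carrier (MM z y)"
  show "cmp (biset_category R) w y z h (cmp (biset_category R) w x y g f) = cmp (biset_category R) w x z (cmp (biset_category R) x y z h g) f"
    unfolding biset_category_cmp[OF fin(4,3,1)] biset_category_cmp[OF fin(3,2,1)] biset_category_cmp[OF fin(4,2,1)]
      biset_category_cmp[OF fin(4,3,2)] by (rule bcomp_assoc[OF fin(4,3,2,1) a(3,2,1)])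
next
  fix x y :: "('o, 'a) category" assume fin: "finite_category x" "finite_category y"
  interpret two_categories R y x by (rule two[OF fin(2,1)])
  show "module R (MM y x)" by (rule MM)
next
  fix x y z :: "('o, 'a) category" and f
  assume fin: "finite_category x" "finite_category y" "finite_category z" and f: "f \<in> carrier (MM y x)"
  interpret three_categories R z y x by (rule three[OF fin(3,2,1)])
  show "(\<lambda>g. cmp (biset_category R) x y z g f) \<in> linear_maps R (MM z y) (MM z x)"
    unfolding biset_category_cmp[OF fin(3,2,1)] by (rule bcomp_linear_left[OF f])
next
  fix x y z :: "('o, 'a) category" and g
  assume fin: "finite_category x" "finite_category y" "finite_category z" and g: "g \<in> carrier (MM z y)"
  interpret three_categories R z y x by (rule three[OF fin(3,2,1)])
  have "cmp (biset_category R) x y z g = bcomp g" by (rule ext) (rule biset_category_cmp[OF fin(3,2,1)])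
  then show "cmp (biset_category R) x y z g \<in> linear_maps R (MM y x) (MM z x)"
    using bcomp_linear_right[OF g] by simp
qed (rule refl)

end

subsection \<open>The number of birepresentable bisets\<close>

text \<open>The indicator sequences of single positions are infinitely many, since one differs from
  zero in a field.\<close>

lemma infinite_if_inj:
  fixes R :: "'r ring" and e :: "(nat \<Rightarrow> 'r) \<Rightarrow> 'm"
  assumes "field R" "inj e"
  shows "infinite (UNIV :: 'm set)"
proof
  interpret field R by fact
  assume "finite (UNIV :: 'm set)"
  have "inj (\<lambda>n. e (\<lambda>k. if k = n then \<one>\<^bsub>R\<^esub> else \<zero>\<^bsub>R\<^esub>))"
  proof (rule injI)
    fix n n' assume "e (\<lambda>k. if k = n then \<one>\<^bsub>R\<^esub> else \<zero>\<^bsub>R\<^esub>) = e (\<lambda>k. if k = n' then \<one>\<^bsub>R\<^esub> else \<zero>\<^bsub>R\<^esub>)"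
    from fun_cong[OF injD[OF assms(2), OF this], of n] show "n = n'" by (simp split: if_splits)
  qed
  from range_inj_infinite[OF this] show False
    using finite_subset[OF subset_UNIV \<open>finite (UNIV :: 'm set)\<close>] by blast
qed

text \<open>Records the action only on genuine objects, arrows and elements, because a record may
  behave arbitrarily elsewhere. Bisets with equal graphs are therefore isomorphic, though not
  necessarily equal.\<close>

definition biset_graph where
  "biset_graph C D \<Omega> = {(p, q, f, n, m) | p q f n m. p \<in> Ob (biset_dom C D) \<and> q \<in> Ob (biset_dom C D) \<and>
     f \<in> Arr (biset_dom C D) p q \<and> n \<in> elts \<Omega> p \<and> m = act \<Omega> p q f n}"

lemma biset_graph_iso:
  assumes "biset C D \<Omega>" "biset C D \<Psi>" and eq: "biset_graph C D \<Omega> = biset_graph C D \<Psi>"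
  shows "setfun_iso (biset_dom C D) \<Omega> \<Psi>"
proof -
  interpret A: biset C D \<Omega> by fact
  interpret B: biset C D \<Psi> by fact
  interpret category "biset_dom C D" by (rule biset_dom_category[OF A.C.category_axioms A.D.category_axioms])
  have mem: "n \<in> elts \<Omega> p \<longleftrightarrow> (\<exists>m. (p, p, ident (biset_dom C D) p, n, m) \<in> biset_graph C D \<Omega>)"
    "n \<in> elts \<Psi> p \<longleftrightarrow> (\<exists>m. (p, p, ident (biset_dom C D) p, n, m) \<in> biset_graph C D \<Psi>)"
    if "p \<in> Ob (biset_dom C D)" for n p
    using that ident_in[OF that] unfolding biset_graph_def by blast+
  have el: "elts \<Omega> p = elts \<Psi> p" if "p \<in> Ob (biset_dom C D)" for p
    using mem[OF that] eq by blast
  show ?thesis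
  proof (rule setfun_isoI[where \<eta> = "\<lambda>_ n. n"])
    fix p assume p: "p \<in> Ob (biset_dom C D)"
    show "bij_betw (\<lambda>n. n) (elts \<Omega> p) (elts \<Psi> p)" using el[OF p] by (simp add: bij_betw_def)
    fix q f n assume "q \<in> Ob (biset_dom C D)" "f \<in> Arr (biset_dom C D) p q" "n \<in> elts \<Omega> p"
    then have "(p, q, f, n, act \<Omega> p q f n) \<in> biset_graph C D \<Omega>" unfolding biset_graph_def using p by blast
    then have "(p, q, f, n, act \<Omega> p q f n) \<in> biset_graph C D \<Psi>" by (simp only: eq)
    then show "act \<Omega> p q f n = act \<Psi> p q f n" unfolding biset_graph_def by blast
  qed
qed

lemma biset_graph_countable:
  fixes C :: "('o, 'a) category" and D :: "('p, 'b) category"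
  assumes "finite_category C" "finite_category D"
  shows "\<exists>Q. countable Q \<and> (\<forall>\<Omega> :: ('o, 'a, 'p, 'b) nbiset. biset_graph C D \<Omega> \<subseteq> Q)"
proof -
  interpret C: finite_category C by fact
  interpret D: finite_category D by fact
  let ?O = "Ob (biset_dom C D)"
  let ?A = "\<Union>p\<in>?O. \<Union>q\<in>?O. Arr (biset_dom C D) p q"
  have O: "finite ?O" using C.finite_Ob D.finite_Ob by simp
  have "finite (Arr (biset_dom C D) p q)" if "p \<in> ?O" "q \<in> ?O" for p q
    using that C.finite_Arr D.finite_Arr by (cases p; cases q) simp
  then have A: "finite ?A" using O by (intro finite_UN_I)
  have "countable (?O \<times> ?O \<times> ?A \<times> (UNIV :: nat set) \<times> (UNIV :: nat set))"
    by (intro countable_SIGMA countable_finite[OF O] countable_finite[OF A]) auto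
  moreover have "biset_graph C D \<Omega> \<subseteq> ?O \<times> ?O \<times> ?A \<times> UNIV \<times> UNIV" for \<Omega> :: "('o, 'a, 'p, 'b) nbiset"
    unfolding biset_graph_def by blast
  ultimately show ?thesis by blast
qed

text \<open>All graphs lie in one countable set, so a biset with elements in \<open>nat\<close> is
  described up to isomorphism by a set of naturals, hence by a 0-1 sequence in \<open>R\<close>, to
  which \<open>e\<close> applies.\<close>

lemma (in two_categories) arrows_code:
  fixes e :: "(nat \<Rightarrow> 'r) \<Rightarrow> 'm"
  assumes e: "inj e"
  shows "\<exists>\<iota> :: (('o, 'a, 'p, 'b) biset_class \<Rightarrow> 'r) set \<Rightarrow> 'm.
    inj_on \<iota> {arr C D \<Omega> | \<Omega> :: ('o, 'a, 'p, 'b) nbiset. birepresentable C D \<Omega>}"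
proof -
  interpret field R by (rule R_field)
  let ?A = "{arr C D \<Omega> | \<Omega> :: ('o, 'a, 'p, 'b) nbiset. birepresentable C D \<Omega>}"
  obtain Q where Q: "countable Q" "\<And>\<Omega> :: ('o, 'a, 'p, 'b) nbiset. biset_graph C D \<Omega> \<subseteq> Q"
    using biset_graph_countable[OF C D] by blast
  define rep where "rep a = (SOME \<Omega> :: ('o, 'a, 'p, 'b) nbiset. birepresentable C D \<Omega> \<and> arr C D \<Omega> = a)" for a
  have rep: "birepresentable C D (rep a)" "arr C D (rep a) = a" if "a \<in> ?A" for a
  proof -
    have "\<exists>\<Omega> :: ('o, 'a, 'p, 'b) nbiset. birepresentable C D \<Omega> \<and> arr C D \<Omega> = a" using that by blast
    from someI_ex[OF this] show "birepresentable C D (rep a)" "arr C D (rep a) = a" unfolding rep_def by blast+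
  qed
  \<comment> \<open>The characteristic sequence of the numbered graph of a chosen
    representative.\<close>
  define \<iota> where "\<iota> a = e (\<lambda>k. if k \<in> to_nat_on Q ` biset_graph C D (rep a) then \<one> else \<zero>)" for a
  have "inj_on \<iota> ?A"
  proof (rule inj_onI)
    fix a b assume ab: "a \<in> ?A" "b \<in> ?A" "\<iota> a = \<iota> b"
    have "(\<lambda>k. if k \<in> to_nat_on Q ` biset_graph C D (rep a) then \<one> else \<zero>)
      = (\<lambda>k. if k \<in> to_nat_on Q ` biset_graph C D (rep b) then \<one> else \<zero>)"
      by (rule injD[OF e, OF ab(3)[unfolded \<iota>_def]])
    from fun_cong[OF this] have "k \<in> to_nat_on Q ` biset_graph C D (rep a) \<longleftrightarrow> k \<in> to_nat_on Q ` biset_graph C D (rep b)" for k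
      by (metis one_not_zero)
    then have "to_nat_on Q ` biset_graph C D (rep a) = to_nat_on Q ` biset_graph C D (rep b)" by blast
    then have "biset_graph C D (rep a) = biset_graph C D (rep b)"
      using inj_on_image_eq_iff[OF inj_on_to_nat_on[OF Q(1)] Q(2) Q(2)] by blast
    then have "setfun_iso (biset_dom C D) (rep a) (rep b)"
      by (rule biset_graph_iso[OF bisetD[OF rep(1)[OF ab(1)]] bisetD[OF rep(1)[OF ab(2)]]])
    from arr_iso[OF bisetD[OF rep(1)[OF ab(1)]] this] show "a = b" using rep(2)[OF ab(1)] rep(2)[OF ab(2)] by simp
  qed
  then show ?thesis by blast
qed

text \<open>The cardinality condition for moving \<open>sim\<close> to \<open>'m\<close> is met with
  the classes of single bisets as the spanning family of arrows.\<close>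

lemma (in biset_module_locale) simple_biset_functor_exists:
  fixes e :: "(nat \<Rightarrow> 'r) \<Rightarrow> 'm" and X :: "('o, 'a) category"
    and V :: "(('o, 'a) category, ('o, 'a, 'r) biset_arrow, 'r, 'm) modfun"
  assumes e: "inj e" and fin: "finite_category X" "X \<in> \<O>"
    and V: "linear_module_functor R (full_subcat (full_subcat (biset_category R) \<O>) {X}) V"
      "simple_functor R (full_subcat (full_subcat (biset_category R) \<O>) {X}) V"
  shows "\<exists>S :: (('o, 'a) category, ('o, 'a, 'r) biset_arrow, 'r, 'm) modfun.
    simple_functor R (full_subcat (biset_category R) \<O>) S \<and>
    linear_module_functor R (full_subcat (biset_category R) \<O>) S \<and>
    modfun_iso R (full_subcat (full_subcat (biset_category R) \<O>) {X}) S V \<and>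
    modfun_iso R (full_subcat (biset_category R) \<O>) (sim R (full_subcat (biset_category R) \<O>) X V) S"
proof -
  let ?B = "full_subcat (biset_category R) \<O>"
  have B: "linear_cat R ?B" by (rule linear_cat_subcat[OF biset_category_linear])
  interpret linear_value_at R ?B X V
    by (intro linear_value_at.intro linear_value_at_axioms.intro B V(1)) (use fin in \<open>simp add: biset_category_simps\<close>)
  have "\<exists>A \<subseteq> Arr ?B X y. (\<exists>\<iota> :: ('o, 'a, 'r) biset_arrow \<Rightarrow> 'm. inj_on \<iota> A) \<and>
      (\<forall>a \<in> Arr ?B X y. \<forall>v \<in> carrier M. gen y a v \<in> submodule_span R (FM y) {gen y a v | a v. a \<in> A \<and> v \<in> carrier M})"
    if y: "y \<in> Ob ?B" for y
  proof -
    have fy: "finite_category y" using y by (simp add: biset_category_simps)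
    interpret T: two_categories R y X by (rule two[OF fy fin(1)])
    let ?A = "{arr y X \<Omega> | \<Omega> :: ('o \<times> 'o, 'a \<times> 'a, nat) setfun. birepresentable y X \<Omega>}"
    have A: "?A \<subseteq> Arr ?B X y"
      using T.arr_closed T.bisetD by (auto simp: biset_category_simps)
    let ?G = "{gen y a v | a v. a \<in> ?A \<and> v \<in> carrier M}"
    have G: "?G \<subseteq> carrier (FM y)" using gens_closed[OF y] A by blast
    have "gen y a v \<in> submodule_span R (FM y) ?G" if a: "a \<in> Arr ?B X y" and v: "v \<in> carrier M" for a v
    proof -
      note lin = gen_arrow_linear[OF y v, unfolded full_subcat_ArrM biset_category_simps]
      note sub = span_submodule[OF FM G]
      have "a \<in> carrier (MM y X)" using a by (simp add: biset_category_simps)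
      then show ?thesis
      proof (induction rule: T.MM_induct)
        case (arr \<Omega>)
        have "gen y (arr y X \<Omega>) v \<in> ?G" using arr v by blast
        then show ?case by (rule subsetD[OF span_superset])
      next
        case zero
        then show ?case using linear_map_zero[OF lin T.MM FM] submoduleD(2)[OF sub] by simp
      next
        case (add K L)
        then show ?case using linear_mapsD(2)[OF lin] submoduleD(3)[OF sub] by simp
      next
        case (smult r K)
        then show ?case using linear_mapsD(3)[OF lin] submoduleD(4)[OF sub] by simp
      qed
    qed
    then show ?thesis using A T.arrows_code[OF e] by blast
  qed
  from exists_simple[OF infinite_if_inj[OF R_field e] V(2) this]
  obtain T :: "(('o, 'a) category, ('o, 'a, 'r) biset_arrow, 'r, 'm) modfun" where
    T: "simple_functor R ?B T" "modfun_iso R ?B S T" by blast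
  have "linear_module_functor R ?B T"
    by (rule linear_module_functor_iso[OF S_linear simple_functorD(1)[OF T(1)] T(2) B])
  moreover have "modfun_iso R (full_subcat ?B {X}) T V"
    by (rule modfun_iso_trans[OF modfun_iso_subcat[OF modfun_iso_sym[OF T(2) S_functor]] S_restrict])
  ultimately show ?thesis using T by blast
qed

section \<open>Bisets for power sets\<close>

lemma pow_cat_simps [simp]:
  "Ob (pow_cat X) = Pow X" "Arr (pow_cat X) A A' = (if A \<subseteq> A' then {(A, A')} else {})"
  "ident (pow_cat X) A = (A, A)" "cmp (pow_cat X) A A' A'' g f = (A, A'')"
  by (simp_all add: pow_cat_def)

abbreviation "pow_dom Y X \<equiv> biset_dom (pow_cat Y) (pow_cat X)"

lemma pow_cat_finite:
  assumes "finite X"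
  shows "finite_category (pow_cat X)"
  by (intro finite_category.intro finite_category_axioms.intro category.intro)
     (use assms in \<open>auto split: if_splits\<close>)

subsection \<open>Relations between power sets\<close>

text \<open>\<open>p B A\<close> says that a biset with at most one element in each place has an
  element at \<open>(B, A)\<close>. Monotonicity is functoriality. Binary intersections give a least
  \<open>B\<close> for each related \<open>A\<close>, and binary unions a greatest \<open>A\<close>
  for each related \<open>B\<close>: these are the generators of the two actions. Empty
  intersections and unions are not included, so a set may be related to nothing.\<close>

definition good :: "'u set \<Rightarrow> 'u set \<Rightarrow> ('u set \<Rightarrow> 'u set \<Rightarrow> bool) \<Rightarrow> bool" where
  "good Y X p \<longleftrightarrow> (\<forall>B A. p B A \<longrightarrow> B \<subseteq> Y \<and> A \<subseteq> X) \<and>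
     (\<forall>B B' A. p B A \<longrightarrow> B \<subseteq> B' \<longrightarrow> B' \<subseteq> Y \<longrightarrow> p B' A) \<and> (\<forall>B A A'. p B A \<longrightarrow> A' \<subseteq> A \<longrightarrow> p B A') \<and>
     (\<forall>B B' A. p B A \<longrightarrow> p B' A \<longrightarrow> p (B \<inter> B') A) \<and> (\<forall>B A A'. p B A \<longrightarrow> p B A' \<longrightarrow> p B (A \<union> A'))"

lemma goodI:
  assumes "\<And>B A. p B A \<Longrightarrow> B \<subseteq> Y \<and> A \<subseteq> X"
    and "\<And>B B' A. \<lbrakk>p B A; B \<subseteq> B'; B' \<subseteq> Y\<rbrakk> \<Longrightarrow> p B' A" and "\<And>B A A'. \<lbrakk>p B A; A' \<subseteq> A\<rbrakk> \<Longrightarrow> p B A'"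
    and "\<And>B B' A. \<lbrakk>p B A; p B' A\<rbrakk> \<Longrightarrow> p (B \<inter> B') A" and "\<And>B A A'. \<lbrakk>p B A; p B A'\<rbrakk> \<Longrightarrow> p B (A \<union> A')"
  shows "good Y X p"
  unfolding good_def
proof (intro conjI allI impI)
  show "B \<subseteq> Y" "A \<subseteq> X" if "p B A" for B A using assms(1)[OF that] by simp_all
  show "p B' A" if "p B A" "B \<subseteq> B'" "B' \<subseteq> Y" for B B' A by (rule assms(2)[OF that])
  show "p B A'" if "p B A" "A' \<subseteq> A" for B A A' by (rule assms(3)[OF that])
  show "p (B \<inter> B') A" if "p B A" "p B' A" for B B' A by (rule assms(4)[OF that])
  show "p B (A \<union> A')" if "p B A" "p B A'" for B A A' by (rule assms(5)[OF that])
qed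

lemma goodD:
  assumes "good Y X p"
  shows "p B A \<Longrightarrow> B \<subseteq> Y" "p B A \<Longrightarrow> A \<subseteq> X"
    and "\<lbrakk>p B A; B \<subseteq> B'; B' \<subseteq> Y\<rbrakk> \<Longrightarrow> p B' A" and "\<lbrakk>p B A; A' \<subseteq> A\<rbrakk> \<Longrightarrow> p B A'"
    and "\<lbrakk>p B A; p B' A\<rbrakk> \<Longrightarrow> p (B \<inter> B') A" and "\<lbrakk>p B A; p B A'\<rbrakk> \<Longrightarrow> p B (A \<union> A')"
proof -
  note d = assms[unfolded good_def]
  note 1 = d[THEN conjunct1] and 2 = d[THEN conjunct2, THEN conjunct1]
    and 3 = d[THEN conjunct2, THEN conjunct2, THEN conjunct1]
    and 4 = d[THEN conjunct2, THEN conjunct2, THEN conjunct2, THEN conjunct1]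
    and 5 = d[THEN conjunct2, THEN conjunct2, THEN conjunct2, THEN conjunct2]
  show "p B A \<Longrightarrow> B \<subseteq> Y" "p B A \<Longrightarrow> A \<subseteq> X" using 1 by simp_all
  show "\<lbrakk>p B A; B \<subseteq> B'; B' \<subseteq> Y\<rbrakk> \<Longrightarrow> p B' A" by (rule 2[rule_format])
  show "\<lbrakk>p B A; A' \<subseteq> A\<rbrakk> \<Longrightarrow> p B A'" by (rule 3[rule_format])
  show "\<lbrakk>p B A; p B' A\<rbrakk> \<Longrightarrow> p (B \<inter> B') A" by (rule 4[rule_format])
  show "\<lbrakk>p B A; p B A'\<rbrakk> \<Longrightarrow> p B (A \<union> A')" by (rule 5[rule_format])
qed

text \<open>A related set of minimal cardinality lies in every other one, since the intersection of
  the two is again related.\<close>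

lemma good_least:
  assumes p: "good Y X p" and Y: "finite Y" and "p B A"
  obtains B0 where "p B0 A" "\<And>B. p B A \<Longrightarrow> B0 \<subseteq> B"
proof -
  define B0 where "B0 = arg_min card (\<lambda>B. p B A)"
  have B0: "p B0 A" "\<And>B. p B A \<Longrightarrow> card B0 \<le> card B"
    using arg_min_nat_lemma[of "\<lambda>B. p B A" B card] assms(3) by (auto simp: B0_def)
  have "B0 \<subseteq> B" if "p B A" for B
  proof -
    have "card B0 \<le> card (B0 \<inter> B)" by (rule B0(2)[OF goodD(5)[OF p B0(1) that]])
    moreover have "finite B0" using finite_subset[OF goodD(1)[OF p B0(1)] Y] .
    ultimately show ?thesis using card_seteq[of B0 "B0 \<inter> B"] by blast
  qed
  then show thesis using that B0(1) by blast
qed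

lemma good_greatest:
  assumes p: "good Y X p" and X: "finite X" and "p B A"
  obtains A0 where "p B A0" "\<And>A. p B A \<Longrightarrow> A \<subseteq> A0"
proof -
  let ?A0 = "\<Union>{A. p B A}"
  have fin: "finite {A. p B A}" by (rule finite_subset[of _ "Pow X"]) (use goodD(2)[OF p] X in auto)
  have "p B (\<Union>F)" if "finite F" "F \<noteq> {}" "F \<subseteq> {A. p B A}" for F
    using that
  proof (induction rule: finite_ne_induct)
    case (insert A F)
    then show ?case using goodD(6)[OF p, of B A "\<Union>F"] by simp
  qed simp
  then have "p B ?A0" using fin assms(3) by blast
  then show thesis by (rule that) blast
qed

lemma good_relcomp:
  assumes p: "good Z Y p" and q: "good Y X q"
  shows "good Z X (p OO q)"
proof (rule goodI)
  fix C A assume "(p OO q) C A"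
  then show "C \<subseteq> Z \<and> A \<subseteq> X" using goodD(1)[OF p] goodD(2)[OF q] by blast
next
  fix C C' A assume a: "(p OO q) C A" "C \<subseteq> C'" "C' \<subseteq> Z"
  then show "(p OO q) C' A" using goodD(3)[OF p _ a(2,3)] by blast
next
  fix C A A' assume a: "(p OO q) C A" "A' \<subseteq> A"
  then show "(p OO q) C A'" using goodD(4)[OF q _ a(2)] by blast
next
  fix C C' A assume "(p OO q) C A" "(p OO q) C' A"
  then obtain B B' where b: "p C B" "q B A" "p C' B'" "q B' A" by blast
  \<comment> \<open>The witness for the intersection is the intersection of the two middle sets,
    which is available because \<open>p\<close> is closed under shrinking its second
    argument.\<close>
  have "p (C \<inter> C') (B \<inter> B')" using goodD(5)[OF p goodD(4)[OF p b(1), of "B \<inter> B'"] goodD(4)[OF p b(3), of "B \<inter> B'"]] by simp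
  then show "(p OO q) (C \<inter> C') A" using goodD(5)[OF q b(2,4)] by blast
next
  fix C A A' assume "(p OO q) C A" "(p OO q) C A'"
  then obtain B B' where b: "p C B" "q B A" "p C B'" "q B' A'" by blast
  have B: "B \<union> B' \<subseteq> Y" using goodD(1)[OF q b(2)] goodD(1)[OF q b(4)] by blast
  have "q (B \<union> B') (A \<union> A')"
    using goodD(6)[OF q goodD(3)[OF q b(2) _ B] goodD(3)[OF q b(4) _ B]] by simp
  then show "(p OO q) C (A \<union> A')" using goodD(6)[OF p b(1,3)] by blast
qed

text \<open>For a good relation, \<open>p Y X\<close> gives every subset of \<open>X\<close> a least
  partner and \<open>p {} {}\<close> gives every subset of \<open>Y\<close> a greatest one. Together
  they make \<open>p\<close> a Galois connection; the lower adjoint preserves all unions, hence is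
  the image map of a correspondence.\<close>

definition full :: "'u set \<Rightarrow> 'u set \<Rightarrow> ('u set \<Rightarrow> 'u set \<Rightarrow> bool) \<Rightarrow> bool" where
  "full Y X p \<longleftrightarrow> p {} {} \<and> p Y X"

definition crel :: "'u set \<Rightarrow> 'u set \<Rightarrow> ('u \<times> 'u) set \<Rightarrow> 'u set \<Rightarrow> 'u set \<Rightarrow> bool" where
  "crel Y X U B A \<longleftrightarrow> B \<subseteq> Y \<and> A \<subseteq> X \<and> corresp_image U A \<subseteq> B"

text \<open>Reads off the correspondence: \<open>y\<close> lies in the image of \<open>{x}\<close>
  exactly when the complement of \<open>{y}\<close> is not above that image.\<close>

definition corr_of :: "'u set \<Rightarrow> 'u set \<Rightarrow> ('u set \<Rightarrow> 'u set \<Rightarrow> bool) \<Rightarrow> ('u \<times> 'u) set" where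
  "corr_of Y X p = {(y, x) | y x. y \<in> Y \<and> x \<in> X \<and> \<not> p (Y - {y}) {x}}"

lemma corr_of_subset: "corr_of Y X p \<subseteq> Y \<times> X"
  by (auto simp: corr_of_def)

lemma corresp_image_mono: "A \<subseteq> A' \<Longrightarrow> corresp_image U A \<subseteq> corresp_image U A'"
  unfolding corresp_image_def by blast

lemma corresp_image_Un: "corresp_image U (A \<union> A') = corresp_image U A \<union> corresp_image U A'"
  unfolding corresp_image_def by blast

lemma corresp_image_relcomp: "corresp_image (V O U) A = corresp_image V (corresp_image U A)"
  unfolding corresp_image_def by blast

lemma good_crel: "good Y X (crel Y X U)"
proof (rule goodI)
  fix B A A' assume a: "crel Y X U B A" "A' \<subseteq> A"
  then show "crel Y X U B A'" using corresp_image_mono[OF a(2), of U] by (simp add: crel_def) blast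
qed (auto simp: crel_def corresp_image_Un)

lemma full_crel: "U \<subseteq> Y \<times> X \<Longrightarrow> full Y X (crel Y X U)"
  by (auto simp: full_def crel_def corresp_image_def)

lemma corr_of_crel: "U \<subseteq> Y \<times> X \<Longrightarrow> corr_of Y X (crel Y X U) = U"
  by (auto simp: corr_of_def crel_def corresp_image_def)

text \<open>The image of \<open>A\<close> under \<open>U\<close> is the least possible middle set,
  so it serves as the witness.\<close>

lemma crel_relcomp:
  assumes "U \<subseteq> Y \<times> X"
  shows "crel Z Y V OO crel Y X U = crel Z X (V O U)"
proof (intro ext iffI)
  fix C A assume "(crel Z Y V OO crel Y X U) C A"
  then obtain B where B: "C \<subseteq> Z" "A \<subseteq> X" "corresp_image V B \<subseteq> C" "corresp_image U A \<subseteq> B" by (auto simp: crel_def)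
  then show "crel Z X (V O U) C A"
    using corresp_image_mono[OF B(4), of V] by (simp add: crel_def corresp_image_relcomp)
next
  fix C A assume "crel Z X (V O U) C A"
  moreover have "corresp_image U A \<subseteq> Y" using assms by (auto simp: corresp_image_def)
  ultimately have "crel Z Y V C (corresp_image U A)" "crel Y X U (corresp_image U A) A"
    by (simp_all add: crel_def corresp_image_relcomp)
  then show "(crel Z Y V OO crel Y X U) C A" by blast
qed

text \<open>\<open>B\<close> is the intersection of the sets \<open>Y - {y}\<close> for
  \<open>y\<close> outside \<open>B\<close>, and \<open>A\<close> is the union of its singletons;
  the closure properties then reduce everything to the pairs tested by \<open>corr_of\<close>.
  Fullness covers the empty intersection and the empty union.\<close>

lemma crel_corr_of:
  assumes p: "good Y X p" and full: "full Y X p" and fin: "finite Y" "finite X"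
  shows "crel Y X (corr_of Y X p) = p"
proof (intro ext iffI)
  fix B A assume pBA: "p B A"
  have "corresp_image (corr_of Y X p) A \<subseteq> B"
  proof
    fix y assume "y \<in> corresp_image (corr_of Y X p) A"
    then obtain x where x: "x \<in> A" "y \<in> Y" "\<not> p (Y - {y}) {x}" by (auto simp: corresp_image_def corr_of_def)
    show "y \<in> B"
    proof (rule ccontr)
      assume "y \<notin> B"
      then have "B \<subseteq> Y - {y}" using goodD(1)[OF p pBA] by blast
      then show False using goodD(3)[OF p goodD(4)[OF p pBA, of "{x}"], of "Y - {y}"] x by blast
    qed
  qed
  then show "crel Y X (corr_of Y X p) B A" using goodD(1,2)[OF p pBA] by (simp add: crel_def)
next
  fix B A assume "crel Y X (corr_of Y X p) B A"
  then have B: "B \<subseteq> Y" and A: "A \<subseteq> X" and *: "p (Y - {y}) {x}" if "x \<in> A" "y \<in> Y - B" for x y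
    using that by (auto simp: crel_def corresp_image_def corr_of_def)
  have BA: "B \<subseteq> Y" "A \<subseteq> X" using \<open>crel Y X (corr_of Y X p) B A\<close> by (auto simp: crel_def)
  have 1: "p B {x}" if x: "x \<in> A" for x
  proof -
    \<comment> \<open>Removes the points of \<open>Y - B\<close> one at a time, so that only binary
      intersections are used.\<close>
    have "p (Y - D) {x}" if "finite D" "D \<subseteq> Y - B" for D
      using that
    proof induction
      case empty
      show ?case using goodD(4)[OF p, of Y X "{x}"] full x BA by (auto simp: full_def)
    next
      case (insert y D)
      have "Y - insert y D = (Y - {y}) \<inter> (Y - D)" by blast
      then show ?case using goodD(5)[OF p *[OF x, of y], of "Y - D"] insert by simp
    qed
    from this[of "Y - B"] fin BA show ?thesis by (simp add: double_diff)
  qed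
  have "p B A'" if "finite A'" "A' \<subseteq> A" for A'
    using that
  proof induction
    case empty
    show ?case using goodD(3)[OF p, of "{}" "{}" B] full BA by (auto simp: full_def)
  next
    case (insert x A')
    then show ?case using goodD(6)[OF p 1[of x], of A'] by simp
  qed
  then show "p B A" using finite_subset[OF BA(2) fin(2)] by blast
qed

text \<open>
  A full composite only sees the interval between the least set \<open>c\<close> with \<open>q c {}\<close> and the greatest
  set \<open>d\<close> with \<open>p Z d\<close>, which is the power set of \<open>d - c\<close>.
\<close>

lemma full_factor:
  assumes p: "good Z Y p" and q: "good Y X q" and fin: "finite Y" and full: "full Z X (p OO q)"
  obtains W p' q' where "W \<subseteq> Y" "good Z W p'" "full Z W p'" "good W X q'" "full W X q'" "p OO q = p' OO q'"
    "W = Y \<Longrightarrow> full Z Y p \<and> full Y X q \<and> p' = p \<and> q' = q"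
proof -
  from full obtain B0 B1 where B0: "p {} B0" "q B0 {}" and B1: "p Z B1" "q B1 X" by (auto simp: full_def)
  obtain c where c: "q c {}" "\<And>B. q B {} \<Longrightarrow> c \<subseteq> B" by (rule good_least[OF q fin B0(2)]) blast
  obtain d where d: "p Z d" "\<And>B. p Z B \<Longrightarrow> B \<subseteq> d" by (rule good_greatest[OF p fin B1(1)]) blast
  have pc: "p {} c" by (rule goodD(4)[OF p B0(1) c(2)[OF B0(2)]])
  have dY: "d \<subseteq> Y" by (rule goodD(2)[OF p d(1)])
  have qd: "q d X" by (rule goodD(3)[OF q B1(2) d(2)[OF B1(1)] dY])
  have cd: "c \<subseteq> d" using d(2) goodD(3)[OF p pc] by simp
  define W where "W = d - c"
  \<comment> \<open>A subset \<open>B\<close> of \<open>W\<close> stands for the middle set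
    \<open>B \<union> c\<close> in the interval from \<open>c\<close> to \<open>d\<close>.\<close>
  define p' where "p' C B \<longleftrightarrow> B \<subseteq> W \<and> p C (B \<union> c)" for C B
  define q' where "q' B A \<longleftrightarrow> B \<subseteq> W \<and> q (B \<union> c) A" for B A
  have Wc: "W \<union> c = d" using cd by (auto simp: W_def)
  have cY: "c \<subseteq> Y" using cd dY by blast
  show thesis
  proof (rule that[of W p' q'])
    show "W \<subseteq> Y" using dY by (auto simp: W_def)
    show "good Z W p'"
    proof (rule goodI)
      fix C B assume "p' C B"
      then show "C \<subseteq> Z \<and> B \<subseteq> W" using goodD(1)[OF p] by (auto simp: p'_def)
    next
      fix C C' B assume "p' C B" "C \<subseteq> C'" "C' \<subseteq> Z"
      then show "p' C' B" using goodD(3)[OF p, of C "B \<union> c" C'] by (simp add: p'_def)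
    next
      fix C B B' assume a: "p' C B" "B' \<subseteq> B"
      then show "p' C B'" using goodD(4)[OF p, of C "B \<union> c" "B' \<union> c"] by (auto simp: p'_def)
    next
      fix C C' B assume "p' C B" "p' C' B"
      then show "p' (C \<inter> C') B" using goodD(5)[OF p, of C "B \<union> c" C'] by (simp add: p'_def)
    next
      fix C B B' assume a: "p' C B" "p' C B'"
      have "(B \<union> c) \<union> (B' \<union> c) = (B \<union> B') \<union> c" by blast
      then show "p' C (B \<union> B')" using a goodD(6)[OF p, of C "B \<union> c" "B' \<union> c"] by (simp add: p'_def)
    qed
    show "good W X q'"
    proof (rule goodI)
      fix B A assume "q' B A"
      then show "B \<subseteq> W \<and> A \<subseteq> X" using goodD(2)[OF q] by (auto simp: q'_def)
    next
      fix B B' A assume a: "q' B A" "B \<subseteq> B'" "B' \<subseteq> W"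
      have "B' \<union> c \<subseteq> Y" using a(3) Wc dY by blast
      then show "q' B' A" using a goodD(3)[OF q, of "B \<union> c" A "B' \<union> c"] by (auto simp: q'_def)
    next
      fix B A A' assume "q' B A" "A' \<subseteq> A"
      then show "q' B A'" using goodD(4)[OF q, of "B \<union> c" A A'] by (simp add: q'_def)
    next
      fix B B' A assume a: "q' B A" "q' B' A"
      have "(B \<union> c) \<inter> (B' \<union> c) = (B \<inter> B') \<union> c" by blast
      then show "q' (B \<inter> B') A" using a goodD(5)[OF q, of "B \<union> c" A "B' \<union> c"] by (auto simp: q'_def)
    next
      fix B A A' assume "q' B A" "q' B A'"
      then show "q' B (A \<union> A')" using goodD(6)[OF q, of "B \<union> c" A A'] by (simp add: q'_def)
    qed
    show "full Z W p'" using pc d(1) Wc by (simp add: full_def p'_def)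
    show "full W X q'" using c(1) qd Wc by (simp add: full_def q'_def)
    show "p OO q = p' OO q'"
    proof (intro ext iffI)
      fix C A assume "(p OO q) C A"
      then obtain B where B: "p C B" "q B A" by blast
      have "c \<subseteq> B" using c(2) goodD(4)[OF q B(2), of "{}"] by simp
      moreover have "B \<subseteq> d" using d(2) goodD(3)[OF p B(1) goodD(1)[OF p B(1)]] by simp
      ultimately have "B - c \<subseteq> W" "(B - c) \<union> c = B" by (auto simp: W_def)
      then have "p' C (B - c)" "q' (B - c) A" using B by (simp_all add: p'_def q'_def)
      then show "(p' OO q') C A" by blast
    next
      fix C A assume "(p' OO q') C A"
      then show "(p OO q) C A" by (auto simp: p'_def q'_def)
    qed
    assume WY: "W = Y"
    then have "c = {}" "d = Y" using cY dY by (auto simp: W_def)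
    moreover have "p' C B \<longleftrightarrow> p C B" for C B
      using WY \<open>c = {}\<close> goodD(2)[OF p, of C B] by (auto simp: p'_def)
    moreover have "q' B A \<longleftrightarrow> q B A" for B A
      using WY \<open>c = {}\<close> goodD(1)[OF q, of B A] by (auto simp: q'_def)
    ultimately have "c = {}" "d = Y" "p' = p" "q' = q" by (simp_all add: fun_eq_iff)
    then show "full Z Y p \<and> full Y X q \<and> p' = p \<and> q' = q" using pc d(1) c(1) qd by (simp add: full_def)
  qed
qed

text \<open>If \<open>p {} {}\<close> fails, every related \<open>B\<close> contains the non-empty
  least set \<open>c\<close> related to \<open>{}\<close>; if \<open>p X X\<close> fails, every
  related \<open>A\<close> lies in a proper subset \<open>d\<close>. In either case one variable
  only sees a smaller power set.\<close>

lemma not_full_factor: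
  assumes p: "good X X p" and fin: "finite X" and nfull: "\<not> full X X p" and ne: "p B A"
  obtains W p1 p2 where "W \<subset> X" "good X W p1" "good W X p2" "p = p1 OO p2"
proof -
  have pX: "p X {}" using goodD(3)[OF p goodD(4)[OF p ne, of "{}"] goodD(1)[OF p ne]] by simp
  consider (a) "\<not> p {} {}" | (b) "\<not> p X X" using nfull by (auto simp: full_def)
  then show thesis
  proof cases
    case a
    obtain c where c: "p c {}" "\<And>B. p B {} \<Longrightarrow> c \<subseteq> B" by (rule good_least[OF p fin pX]) blast
    have cX: "c \<subseteq> X" "c \<noteq> {}" using goodD(1)[OF p c(1)] c(1) a by auto
    \<comment> \<open>\<open>p1\<close> is the relation of adjoining \<open>c\<close>, and
      \<open>p2\<close> is \<open>p\<close> read off on sets containing \<open>c\<close>.\<close>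
    define p1 where "p1 C B \<longleftrightarrow> B \<subseteq> X - c \<and> C \<subseteq> X \<and> B \<union> c \<subseteq> C" for C B
    define p2 where "p2 B A \<longleftrightarrow> B \<subseteq> X - c \<and> p (B \<union> c) A" for B A
    show thesis
    proof (rule that[of "X - c" p1 p2])
      show "X - c \<subset> X" using cX by blast
      show "good X (X - c) p1" by (rule goodI) (auto simp: p1_def)
      show "good (X - c) X p2"
      proof (rule goodI)
        fix B A assume "p2 B A"
        then show "B \<subseteq> X - c \<and> A \<subseteq> X" using goodD(2)[OF p] by (auto simp: p2_def)
      next
        fix B B' A assume a: "p2 B A" "B \<subseteq> B'" "B' \<subseteq> X - c"
        have "B' \<union> c \<subseteq> X" using a(3) cX by blast
        then show "p2 B' A" using a goodD(3)[OF p, of "B \<union> c" A "B' \<union> c"] by (auto simp: p2_def)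
      next
        fix B A A' assume "p2 B A" "A' \<subseteq> A"
        then show "p2 B A'" using goodD(4)[OF p, of "B \<union> c" A A'] by (simp add: p2_def)
      next
        fix B B' A assume a: "p2 B A" "p2 B' A"
        have "(B \<union> c) \<inter> (B' \<union> c) = (B \<inter> B') \<union> c" by blast
        then show "p2 (B \<inter> B') A" using a goodD(5)[OF p, of "B \<union> c" A "B' \<union> c"] by (auto simp: p2_def)
      next
        fix B A A' assume "p2 B A" "p2 B A'"
        then show "p2 B (A \<union> A')" using goodD(6)[OF p, of "B \<union> c" A A'] by (simp add: p2_def)
      qed
      show "p = p1 OO p2"
      proof (intro ext iffI)
        fix C A assume pCA: "p C A"
        have "c \<subseteq> C" using c(2) goodD(4)[OF p pCA, of "{}"] by simp
        then have "(C - c) \<union> c = C" by blast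
        then have "p1 C (C - c)" "p2 (C - c) A" using pCA goodD(1)[OF p pCA] by (auto simp: p1_def p2_def)
        then show "(p1 OO p2) C A" by blast
      next
        fix C A assume "(p1 OO p2) C A"
        then obtain B where "B \<union> c \<subseteq> C" "C \<subseteq> X" "p (B \<union> c) A" by (auto simp: p1_def p2_def)
        then show "p C A" using goodD(3)[OF p] by blast
      qed
    qed
  next
    case b
    obtain d where d: "p X d" "\<And>A. p X A \<Longrightarrow> A \<subseteq> d" by (rule good_greatest[OF p fin pX]) blast
    \<comment> \<open>\<open>p1\<close> is \<open>p\<close> with second variable restricted to
      subsets of \<open>d\<close>, and \<open>p2\<close> is the relation of intersecting nothing
      away: inclusion between subsets of \<open>d\<close>.\<close>
    define p1 where "p1 C B \<longleftrightarrow> B \<subseteq> d \<and> p C B" for C B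
    define p2 where "p2 B A \<longleftrightarrow> A \<subseteq> B \<and> B \<subseteq> d" for B A
    have dX: "d \<subseteq> X" "d \<noteq> X" using goodD(2)[OF p d(1)] d(1) b by auto
    show thesis
    proof (rule that[of d p1 p2])
      show "d \<subset> X" using dX by blast
      show "good X d p1"
      proof (rule goodI)
        fix C B assume "p1 C B"
        then show "C \<subseteq> X \<and> B \<subseteq> d" using goodD(1)[OF p] by (auto simp: p1_def)
      next
        fix C C' B assume "p1 C B" "C \<subseteq> C'" "C' \<subseteq> X"
        then show "p1 C' B" using goodD(3)[OF p, of C B C'] by (simp add: p1_def)
      next
        fix C B B' assume a: "p1 C B" "B' \<subseteq> B"
        then show "p1 C B'" using goodD(4)[OF p, of C B B'] by (auto simp: p1_def)
      next
        fix C C' B assume "p1 C B" "p1 C' B"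
        then show "p1 (C \<inter> C') B" using goodD(5)[OF p, of C B C'] by (simp add: p1_def)
      next
        fix C B B' assume a: "p1 C B" "p1 C B'"
        then show "p1 C (B \<union> B')" using goodD(6)[OF p, of C B B'] by (simp add: p1_def)
      qed
      show "good d X p2" by (rule goodI) (use dX in \<open>auto simp: p2_def\<close>)
      show "p = p1 OO p2"
      proof (intro ext iffI)
        fix C A assume pCA: "p C A"
        have "A \<subseteq> d" using d(2) goodD(3)[OF p pCA goodD(1)[OF p pCA]] by simp
        then have "p1 C A" "p2 A A" using pCA by (auto simp: p1_def p2_def)
        then show "(p1 OO p2) C A" by blast
      next
        fix C A assume "(p1 OO p2) C A"
        then show "p C A" using goodD(4)[OF p] by (auto simp: p1_def p2_def)
      qed
    qed
  qed
qed

subsection \<open>Decomposition into relations\<close>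

type_synonym 'u pow_biset = "('u set \<times> 'u set, ('u set \<times> 'u set) \<times> ('u set \<times> 'u set), nat) setfun"

text \<open>The disjoint union of the thin bisets given by the relations \<open>p j\<close>: the
  label \<open>j\<close> names the component and every action keeps it.\<close>

definition fam :: "nat set \<Rightarrow> (nat \<Rightarrow> 'u set \<Rightarrow> 'u set \<Rightarrow> bool) \<Rightarrow> 'u pow_biset" where
  "fam J p = \<lparr>elts = (\<lambda>(B, A). {j \<in> J. p j B A}), act = (\<lambda>_ _ _ j. j)\<rparr>"

abbreviation thin where "thin p \<equiv> fam {0} (\<lambda>_. p)"

lemma fam_simps: "elts (fam J p) (B, A) = {j \<in> J. p j B A}" "act (fam J p) x y f j = j"
  by (simp_all add: fam_def)

context
  fixes Y X :: "'u set"
  assumes fins: "finite Y" "finite X"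
begin

lemma fam_biset:
  assumes J: "finite J" and p: "\<And>j. j \<in> J \<Longrightarrow> good Y X (p j)"
  shows "biset (pow_cat Y) (pow_cat X) (fam J p)"
proof -
  have "finite_set_functor (pow_dom Y X) (fam J p)"
  proof (rule finite_set_functor.intro)
    fix x assume "x \<in> Ob (pow_dom Y X)"
    then show "finite (elts (fam J p) x)" using J by (cases x) (simp add: fam_simps)
  next
    fix x y f j assume "x \<in> Ob (pow_dom Y X)" "y \<in> Ob (pow_dom Y X)"
      "f \<in> Arr (pow_dom Y X) x y" "j \<in> elts (fam J p) x"
    then obtain B A B' A' where x: "x = (B, A)" "y = (B', A')" "B \<subseteq> B'" "A' \<subseteq> A" "B' \<subseteq> Y" "j \<in> J" "p j B A"
      by (cases x, cases y) (auto simp: fam_simps split: if_splits)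
    then show "act (fam J p) x y f j \<in> elts (fam J p) y"
      using goodD(3)[OF p[OF x(6)] goodD(4)[OF p[OF x(6)] x(7,4)] x(3,5)] by (simp add: fam_simps)
  qed (simp_all add: fam_simps)
  then show ?thesis by (simp add: biset_def pow_cat_finite fins)
qed

text \<open>For fixed \<open>A\<close>, component \<open>j\<close> has one left generator, at the
  least \<open>B\<close> related to \<open>A\<close>, provided it has any element over
  \<open>A\<close>; dually for fixed \<open>B\<close> the right generator sits at the greatest
  \<open>A\<close>.\<close>

lemma fam_birepresentable:
  assumes J: "finite J" and p: "\<And>j. j \<in> J \<Longrightarrow> good Y X (p j)"
  shows "birepresentable (pow_cat Y) (pow_cat X) (fam J p)"
proof -
  interpret biset "pow_cat Y" "pow_cat X" "fam J p" by (rule fam_biset[OF assms])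
  have "\<exists>G. free_on (pow_cat Y) (lpart (pow_cat X) (fam J p) A) G" if A: "A \<in> Ob (pow_cat X)" for A
  proof -
    have "\<forall>j. \<exists>B0. j \<in> J \<and> p j Y A \<longrightarrow> p j B0 A \<and> (\<forall>B. p j B A \<longrightarrow> B0 \<subseteq> B)"
    proof
      fix j
      show "\<exists>B0. j \<in> J \<and> p j Y A \<longrightarrow> p j B0 A \<and> (\<forall>B. p j B A \<longrightarrow> B0 \<subseteq> B)"
      proof (cases "j \<in> J \<and> p j Y A")
        case True
        then obtain B0 where "p j B0 A" "\<And>B. p j B A \<Longrightarrow> B0 \<subseteq> B" using good_least[OF p fins(1), of j Y A] by blast
        then show ?thesis by blast
      qed blast
    qed
    from choice[OF this] obtain b where b: "\<And>j. \<lbrakk>j \<in> J; p j Y A\<rbrakk> \<Longrightarrow> p j (b j) A \<and> (\<forall>B. p j B A \<longrightarrow> b j \<subseteq> B)" by blast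
    have "free_on (pow_cat Y) (lpart (pow_cat X) (fam J p) A) {(b j, j) | j. j \<in> J \<and> p j Y A}" (is "free_on _ ?F ?G")
    proof (rule free_onI)
      fix B j assume "(B, j) \<in> ?G"
      then have j: "j \<in> J" "p j Y A" "B = b j" by auto
      then show "B \<in> Ob (pow_cat Y) \<and> j \<in> elts ?F B"
        using b[OF j(1,2)] goodD(1)[OF p[OF j(1)]] by (auto simp: lpart_def fam_simps)
    next
      fix B j assume B: "B \<in> Ob (pow_cat Y)" and "j \<in> elts ?F B"
      then have j: "j \<in> J" "p j B A" by (auto simp: lpart_def fam_simps)
      have "p j Y A" using goodD(3)[OF p[OF j(1)] j(2)] B by simp
      then have "(b j, j) \<in> ?G" "(b j, B) \<in> Arr (pow_cat Y) (b j) B" using b j by auto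
      then show "\<exists>x g f. (x, g) \<in> ?G \<and> f \<in> Arr (pow_cat Y) x B \<and> act ?F x B f g = j"
        by (intro exI[of _ "b j"] exI[of _ j] exI[of _ "(b j, B)"]) (simp add: lpart_def fam_simps)
    next
      fix B x g f x' g' f' assume "(x, g) \<in> ?G" "(x', g') \<in> ?G" "f \<in> Arr (pow_cat Y) x B" "f' \<in> Arr (pow_cat Y) x' B"
        "act ?F x B f g = act ?F x' B f' g'"
      then show "x = x' \<and> g = g' \<and> f = f'" by (auto simp: lpart_def fam_simps split: if_splits)
    qed
    then show ?thesis by blast
  qed
  moreover have "\<exists>G. free_on (op_cat (pow_cat X)) (rpart (pow_cat Y) (fam J p) B) G" if B: "B \<in> Ob (pow_cat Y)" for B
  proof -
    have "\<forall>j. \<exists>A0. j \<in> J \<and> p j B {} \<longrightarrow> p j B A0 \<and> (\<forall>A. p j B A \<longrightarrow> A \<subseteq> A0)"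
    proof
      fix j
      show "\<exists>A0. j \<in> J \<and> p j B {} \<longrightarrow> p j B A0 \<and> (\<forall>A. p j B A \<longrightarrow> A \<subseteq> A0)"
      proof (cases "j \<in> J \<and> p j B {}")
        case True
        then obtain A0 where "p j B A0" "\<And>A. p j B A \<Longrightarrow> A \<subseteq> A0" using good_greatest[OF p fins(2), of j B "{}"] by blast
        then show ?thesis by blast
      qed blast
    qed
    from choice[OF this] obtain a where a: "\<And>j. \<lbrakk>j \<in> J; p j B {}\<rbrakk> \<Longrightarrow> p j B (a j) \<and> (\<forall>A. p j B A \<longrightarrow> A \<subseteq> a j)" by blast
    have "free_on (op_cat (pow_cat X)) (rpart (pow_cat Y) (fam J p) B) {(a j, j) | j. j \<in> J \<and> p j B {}}" (is "free_on _ ?F ?G")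
    proof (rule free_onI)
      fix A j assume "(A, j) \<in> ?G"
      then have j: "j \<in> J" "p j B {}" "A = a j" by auto
      then show "A \<in> Ob (op_cat (pow_cat X)) \<and> j \<in> elts ?F A"
        using a[OF j(1,2)] goodD(2)[OF p[OF j(1)]] by (auto simp: rpart_def fam_simps)
    next
      fix A j assume A: "A \<in> Ob (op_cat (pow_cat X))" and "j \<in> elts ?F A"
      then have j: "j \<in> J" "p j B A" by (auto simp: rpart_def fam_simps)
      have "p j B {}" using goodD(4)[OF p[OF j(1)] j(2)] by simp
      then have "(a j, j) \<in> ?G" "(A, a j) \<in> Arr (op_cat (pow_cat X)) (a j) A" using a j by auto
      then show "\<exists>x g f. (x, g) \<in> ?G \<and> f \<in> Arr (op_cat (pow_cat X)) x A \<and> act ?F x A f g = j"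
        by (intro exI[of _ "a j"] exI[of _ j] exI[of _ "(A, a j)"]) (simp add: rpart_def fam_simps)
    next
      fix A x g f x' g' f' assume "(x, g) \<in> ?G" "(x', g') \<in> ?G" "f \<in> Arr (op_cat (pow_cat X)) x A" "f' \<in> Arr (op_cat (pow_cat X)) x' A"
        "act ?F x A f g = act ?F x' A f' g'"
      then show "x = x' \<and> g = g' \<and> f = f'" by (auto simp: rpart_def fam_simps split: if_splits)
    qed
    then show ?thesis by blast
  qed
  ultimately show ?thesis unfolding birepresentable_iff by blast
qed

text \<open>Every \<open>(B, A)\<close> has exactly one arrow to \<open>(Y, {})\<close> in the
  domain of the biset. The component of an element is its image there.\<close>

definition piece :: "('u set \<times> 'u set, ('u set \<times> 'u set) \<times> ('u set \<times> 'u set), 'e) setfun \<Rightarrow> 'e \<Rightarrow> 'u set \<Rightarrow> 'u set \<Rightarrow> bool" where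
  "piece \<Omega> j B A \<longleftrightarrow> B \<subseteq> Y \<and> A \<subseteq> X \<and> (\<exists>u\<in>elts \<Omega> (B, A). act \<Omega> (B, A) (Y, {}) ((B, Y), ({}, A)) u = j)"

text \<open>Freeness over a poset makes all transition maps injective, so an element is determined
  by its place and its image over \<open>(Y, {})\<close>. The closure properties of the components
  come from common generators of elements with the same image.\<close>

lemma birepresentable_pieces:
  fixes \<Omega> :: "'u pow_biset"
  assumes \<Omega>: "biset (pow_cat Y) (pow_cat X) \<Omega>" and bi: "birepresentable (pow_cat Y) (pow_cat X) \<Omega>"
  shows "\<And>j. j \<in> elts \<Omega> (Y, {}) \<Longrightarrow> good Y X (piece \<Omega> j)"
    and "finite (elts \<Omega> (Y, {}))"
    and "setfun_iso (pow_dom Y X) \<Omega> (fam (elts \<Omega> (Y, {})) (piece \<Omega>))"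
proof -
  interpret biset "pow_cat Y" "pow_cat X" \<Omega> by fact
  define t where "t B A B' A' u = act \<Omega> (B, A) (B', A') ((B, B'), (A', A)) u" for B A B' A' u
  have t_closed: "t B A B' A' u \<in> el B' A'" if "B \<subseteq> B'" "B' \<subseteq> Y" "A' \<subseteq> A" "A \<subseteq> X" "u \<in> el B A" for B A B' A' u
    unfolding t_def by (rule act_closed) (use that in auto)
  have t_t: "t B' A' B'' A'' (t B A B' A' u) = t B A B'' A'' u"
    if "B \<subseteq> B'" "B' \<subseteq> B''" "B'' \<subseteq> Y" "A'' \<subseteq> A'" "A' \<subseteq> A" "A \<subseteq> X" "u \<in> el B A" for B A B' A' B'' A'' u
    unfolding t_def by (subst act_act) (use that in auto)
  have left: "\<exists>G. free_on (pow_cat Y) (lpart (pow_cat X) \<Omega> A) G" if "A \<subseteq> X" for A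
    using bi that unfolding birepresentable_iff by simp
  have right: "\<exists>G. free_on (op_cat (pow_cat X)) (rpart (pow_cat Y) \<Omega> B) G" if "B \<subseteq> Y" for B
    using bi that unfolding birepresentable_iff by simp
  \<comment> \<open>Two elements over \<open>B\<close> and \<open>B'\<close> that agree over
    \<open>Y\<close> have the same generator by uniqueness over \<open>Y\<close>, and this generator
    lives below both sets.\<close>
  have merge_left: "\<exists>x g. x \<subseteq> B \<inter> B' \<and> g \<in> el x A \<and> u = t x A B A g \<and> u' = t x A B' A g"
    if A: "A \<subseteq> X" and B: "B \<subseteq> Y" "B' \<subseteq> Y" and u: "u \<in> el B A" "u' \<in> el B' A" and eq: "t B A Y A u = t B' A Y A u'"
    for A B B' u u'
  proof -
    obtain G where G: "free_on (pow_cat Y) (lpart (pow_cat X) \<Omega> A) G" using left[OF A] by blast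
    obtain x g f where g: "(x, g) \<in> G" "f \<in> Arr (pow_cat Y) x B" "act (lpart (pow_cat X) \<Omega> A) x B f g = u"
      using free_onD(3)[OF G, of B u] B u by (auto simp: lpart_def)
    obtain x' g' f' where g': "(x', g') \<in> G" "f' \<in> Arr (pow_cat Y) x' B'" "act (lpart (pow_cat X) \<Omega> A) x' B' f' g' = u'"
      using free_onD(3)[OF G, of B' u'] B u by (auto simp: lpart_def)
    have x: "x \<subseteq> B" "f = (x, B)" "x' \<subseteq> B'" "f' = (x', B')" using g(2) g'(2) by (auto split: if_splits)
    have gel: "g \<in> el x A" "g' \<in> el x' A" using free_onD(2)[OF G g(1)] free_onD(2)[OF G g'(1)] by (simp_all add: lpart_def)
    have uu: "u = t x A B A g" "u' = t x' A B' A g'" using g(3) g'(3) x by (simp_all add: lpart_def t_def)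
    have "t x A Y A g = t x' A Y A g'"
      using eq t_t[OF x(1) B(1) order_refl order_refl order_refl A gel(1)] t_t[OF x(3) B(2) order_refl order_refl order_refl A gel(2)] uu by simp
    then have "act (lpart (pow_cat X) \<Omega> A) x Y (x, Y) g = act (lpart (pow_cat X) \<Omega> A) x' Y (x', Y) g'"
      by (simp add: lpart_def t_def)
    then have "x = x' \<and> g = g' \<and> (x, Y) = (x', Y)"
      by (rule free_onD(4)[OF G _ g(1) g'(1), rotated -1]) (use x B in auto)
    then show ?thesis using x gel uu by (intro exI[of _ x] exI[of _ g]) auto
  qed
  \<comment> \<open>Dually, elements that agree over the empty set come from one generator placed
    above both \<open>A\<close> and \<open>A'\<close>.\<close>
  have merge_right: "\<exists>x g. A \<union> A' \<subseteq> x \<and> x \<subseteq> X \<and> g \<in> el B x \<and> u = t B x B A g \<and> u' = t B x B A' g"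
    if B: "B \<subseteq> Y" and A: "A \<subseteq> X" "A' \<subseteq> X" and u: "u \<in> el B A" "u' \<in> el B A'" and eq: "t B A B {} u = t B A' B {} u'"
    for B A A' u u'
  proof -
    obtain G where G: "free_on (op_cat (pow_cat X)) (rpart (pow_cat Y) \<Omega> B) G" using right[OF B] by blast
    obtain x g f where g: "(x, g) \<in> G" "f \<in> Arr (pow_cat X) A x" "act (rpart (pow_cat Y) \<Omega> B) x A f g = u"
      using free_onD(3)[OF G, of A u] A u by (auto simp: rpart_def)
    obtain x' g' f' where g': "(x', g') \<in> G" "f' \<in> Arr (pow_cat X) A' x'" "act (rpart (pow_cat Y) \<Omega> B) x' A' f' g' = u'"
      using free_onD(3)[OF G, of A' u'] A u by (auto simp: rpart_def)
    have x: "A \<subseteq> x" "f = (A, x)" "A' \<subseteq> x'" "f' = (A', x')" using g(2) g'(2) by (auto split: if_splits)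
    have xX: "x \<subseteq> X" "x' \<subseteq> X" using free_onD(1)[OF G g(1)] free_onD(1)[OF G g'(1)] by simp_all
    have gel: "g \<in> el B x" "g' \<in> el B x'" using free_onD(2)[OF G g(1)] free_onD(2)[OF G g'(1)] by (simp_all add: rpart_def)
    have uu: "u = t B x B A g" "u' = t B x' B A' g'" using g(3) g'(3) x by (simp_all add: rpart_def t_def)
    have "t B x B {} g = t B x' B {} g'"
      using eq t_t[OF order_refl order_refl B empty_subsetI x(1) xX(1) gel(1)] t_t[OF order_refl order_refl B empty_subsetI x(3) xX(2) gel(2)] uu by simp
    then have "act (rpart (pow_cat Y) \<Omega> B) x {} ({}, x) g = act (rpart (pow_cat Y) \<Omega> B) x' {} ({}, x') g'"
      by (simp add: rpart_def t_def)
    then have "x = x' \<and> g = g' \<and> ({} :: 'u set, x) = ({}, x')"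
      by (rule free_onD(4)[OF G _ g(1) g'(1), rotated -1]) auto
    then show ?thesis using x xX gel uu by (intro exI[of _ x] exI[of _ g]) auto
  qed
  have inj_left: "u = u'" if "A \<subseteq> X" "B \<subseteq> Y" "u \<in> el B A" "u' \<in> el B A" "t B A Y A u = t B A Y A u'" for A B u u'
    using merge_left[OF that(1,2,2,3,4,5)] by auto
  have inj_right: "u = u'" if "B \<subseteq> Y" "A \<subseteq> X" "u \<in> el B A" "u' \<in> el B A" "t B A B {} u = t B A B {} u'" for A B u u'
    using merge_right[OF that(1,2,2,3,4,5)] by auto
  have piece: "piece \<Omega> j B A \<longleftrightarrow> B \<subseteq> Y \<and> A \<subseteq> X \<and> (\<exists>u\<in>el B A. t B A Y {} u = j)" for j B A
    by (simp add: piece_def t_def)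
  show "good Y X (piece \<Omega> j)" if "j \<in> el Y {}" for j
  proof (rule goodI)
    fix B A assume "piece \<Omega> j B A"
    then show "B \<subseteq> Y \<and> A \<subseteq> X" by (simp add: piece)
  next
    fix B B' A assume a: "piece \<Omega> j B A" "B \<subseteq> B'" "B' \<subseteq> Y"
    then obtain u where u: "A \<subseteq> X" "u \<in> el B A" "t B A Y {} u = j" by (auto simp: piece)
    have "t B A B' A u \<in> el B' A" "t B' A Y {} (t B A B' A u) = j"
      using t_closed[OF a(2,3) order_refl u(1,2)] t_t[OF a(2,3) order_refl empty_subsetI order_refl u(1,2)] u(3) by simp_all
    then show "piece \<Omega> j B' A" using a(3) u(1) by (auto simp: piece)
  next
    fix B A A' assume a: "piece \<Omega> j B A" "A' \<subseteq> A"
    then obtain u where u: "B \<subseteq> Y" "A \<subseteq> X" "u \<in> el B A" "t B A Y {} u = j" by (auto simp: piece)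
    have "t B A B A' u \<in> el B A'" "t B A' Y {} (t B A B A' u) = j"
      using t_closed[OF order_refl u(1) a(2) u(2,3)] t_t[OF order_refl u(1) order_refl empty_subsetI a(2) u(2,3)] u(4) by simp_all
    then show "piece \<Omega> j B A'" using a(2) u by (auto simp: piece)
  next
    fix B B' A assume a: "piece \<Omega> j B A" "piece \<Omega> j B' A"
    then obtain u u' where A: "A \<subseteq> X" and B: "B \<subseteq> Y" "B' \<subseteq> Y" and u: "u \<in> el B A" "t B A Y {} u = j" "u' \<in> el B' A" "t B' A Y {} u' = j"
      by (auto simp: piece)
    \<comment> \<open>Equality is known only over \<open>(Y, {})\<close>; injectivity of the right
      action lifts it to \<open>(Y, A)\<close>, where the left generators can be compared.\<close>
    have "t B A Y A u = t B' A Y A u'"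
      by (rule inj_right[OF order_refl A t_closed[OF B(1) order_refl order_refl A u(1)] t_closed[OF B(2) order_refl order_refl A u(3)]])
         (simp add: t_t[OF B(1) order_refl order_refl empty_subsetI order_refl A u(1)]
          t_t[OF B(2) order_refl order_refl empty_subsetI order_refl A u(3)] u)
    from merge_left[OF A B u(1,3) this] obtain x g where g: "x \<subseteq> B \<inter> B'" "g \<in> el x A" "u = t x A B A g" by blast
    have BB: "B \<inter> B' \<subseteq> Y" "x \<subseteq> B" using B g(1) by blast+
    have "t x A (B \<inter> B') A g \<in> el (B \<inter> B') A" by (rule t_closed[OF g(1) BB(1) order_refl A g(2)])
    moreover have "t (B \<inter> B') A Y {} (t x A (B \<inter> B') A g) = j"
      using t_t[OF g(1) BB(1) order_refl empty_subsetI order_refl A g(2)]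
        t_t[OF BB(2) B(1) order_refl empty_subsetI order_refl A g(2)] g(3) u(2) by simp
    ultimately show "piece \<Omega> j (B \<inter> B') A" using BB(1) A by (auto simp: piece)
  next
    fix B A A' assume a: "piece \<Omega> j B A" "piece \<Omega> j B A'"
    then obtain u u' where B: "B \<subseteq> Y" and A: "A \<subseteq> X" "A' \<subseteq> X" and u: "u \<in> el B A" "t B A Y {} u = j" "u' \<in> el B A'" "t B A' Y {} u' = j"
      by (auto simp: piece)
    have "t B A B {} u = t B A' B {} u'"
      by (rule inj_left[OF empty_subsetI B t_closed[OF order_refl B empty_subsetI A(1) u(1)] t_closed[OF order_refl B empty_subsetI A(2) u(3)]])
         (simp add: t_t[OF order_refl B order_refl empty_subsetI empty_subsetI A(1) u(1)]
          t_t[OF order_refl B order_refl empty_subsetI empty_subsetI A(2) u(3)] u)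
    from merge_right[OF B A u(1,3) this] obtain x g where g: "A \<union> A' \<subseteq> x" "x \<subseteq> X" "g \<in> el B x" "u = t B x B A g" by blast
    have AA: "A \<union> A' \<subseteq> X" "A \<subseteq> x" using A g(1) by blast+
    have "t B x B (A \<union> A') g \<in> el B (A \<union> A')" by (rule t_closed[OF order_refl B g(1,2,3)])
    moreover have "t B (A \<union> A') Y {} (t B x B (A \<union> A') g) = j"
      using t_t[OF order_refl B order_refl empty_subsetI g(1,2,3)]
        t_t[OF order_refl B order_refl empty_subsetI AA(2) g(2,3)] g(4) u(2) by simp
    ultimately show "piece \<Omega> j B (A \<union> A')" using AA(1) B unfolding piece by blast
  qed
  show "finite (el Y {})" using fin[of Y "{}"] by simp
  show "setfun_iso (pow_dom Y X) \<Omega> (fam (el Y {}) (piece \<Omega>))"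
  proof (rule setfun_isoI[where \<eta> = "\<lambda>(B, A). t B A Y {}"])
    fix q assume "q \<in> Ob (pow_dom Y X)"
    then obtain B A where q: "q = (B, A)" "B \<subseteq> Y" "A \<subseteq> X" by auto
    have "inj_on (t B A Y {}) (el B A)"
    proof (rule inj_onI)
      fix u u' assume u: "u \<in> el B A" "u' \<in> el B A" "t B A Y {} u = t B A Y {} u'"
      have "t B A Y A u = t B A Y A u'"
        by (rule inj_right[OF order_refl q(3) t_closed[OF q(2) order_refl order_refl q(3) u(1)] t_closed[OF q(2) order_refl order_refl q(3) u(2)]])
           (simp add: t_t[OF q(2) order_refl order_refl empty_subsetI order_refl q(3) u(1)]
            t_t[OF q(2) order_refl order_refl empty_subsetI order_refl q(3) u(2)] u(3))
      then show "u = u'" by (rule inj_left[OF q(3,2) u(1,2)])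
    qed
    moreover have "t B A Y {} ` el B A = elts (fam (el Y {}) (piece \<Omega>)) (B, A)"
      using t_closed[OF q(2) order_refl empty_subsetI q(3)] q by (auto simp: fam_simps piece)
    ultimately show "bij_betw (case q of (B, A) \<Rightarrow> t B A Y {}) (elts \<Omega> q) (elts (fam (el Y {}) (piece \<Omega>)) q)"
      by (simp add: q(1) bij_betw_def)
  next
    fix q r f u assume "q \<in> Ob (pow_dom Y X)" "r \<in> Ob (pow_dom Y X)"
      "f \<in> Arr (pow_dom Y X) q r" "u \<in> elts \<Omega> q"
    then obtain B A B' A' where q: "q = (B, A)" "r = (B', A')" "f = ((B, B'), (A', A))" "B \<subseteq> B'" "B' \<subseteq> Y" "A' \<subseteq> A" "A \<subseteq> X" "u \<in> el B A"
      by (cases q, cases r) (auto split: if_splits)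
    have "act \<Omega> q r f u = t B A B' A' u" by (simp add: q t_def)
    then show "(case r of (B, A) \<Rightarrow> t B A Y {}) (act \<Omega> q r f u)
      = act (fam (el Y {}) (piece \<Omega>)) q r f ((case q of (B, A) \<Rightarrow> t B A Y {}) u)"
      using t_t[OF q(4,5) order_refl empty_subsetI q(6-8)] by (simp add: q(1,2) fam_simps)
  qed
qed

end

text \<open>The composite has an element over \<open>(C, A)\<close> exactly when some middle set
  links them; the point is that different middle sets give the same class.\<close>

lemma thin_comp:
  assumes fin: "finite Z" "finite Y" "finite X" and p: "good Z Y p" and q: "good Y X q"
  shows "setfun_iso (pow_dom Z X) (biset_comp (pow_cat Z) (pow_cat Y) (pow_cat X) (thin p) (thin q)) (thin (p OO q))"
proof -
  interpret A: biset_pair "pow_cat Z" "pow_cat Y" "pow_cat X" "thin p" "thin q"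
    unfolding biset_pair_def using fam_biset[OF fin(1,2)] fam_biset[OF fin(2,3)] p q by simp
  show ?thesis
  proof (rule A.comp_isoI[where m = "\<lambda>_ _ _. 0"])
    fix C A k assume "k \<in> elts (thin (p OO q)) (C, A)"
    then obtain B where "p C B" "q B A" "k = 0" by (auto simp: fam_simps)
    then show "\<exists>B u v. B \<in> Ob (pow_cat Y) \<and> u \<in> A.L.el C B \<and> v \<in> A.R.el B A \<and> 0 = k"
      using goodD(2)[OF p] by (intro exI[of _ B] exI[of _ 0]) (auto simp: fam_simps)
  next
    \<comment> \<open>Any two middle sets are identified through their intersection, to which
      \<open>q\<close> still relates \<open>A\<close>.\<close>
    have *: "A.cls C A (B \<inter> B', 0, 0) = A.cls C A (B, 0, 0)" if "p C B" "q B A" "q B' A" for C A B B'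
    proof -
      have B: "B \<subseteq> Y" using goodD(2)[OF p that(1)] .
      then show ?thesis
        using A.cls_balanced[of "B \<inter> B'" B "(B \<inter> B', B)" 0 C 0 A] that goodD(5)[OF q that(2,3)]
        by (auto simp: fam_simps)
    qed
    fix C A B u v B' u' v' assume "u \<in> A.L.el C B" "v \<in> A.R.el B A" "u' \<in> A.L.el C B'" "v' \<in> A.R.el B' A"
    then show "A.cls C A (B, u, v) = A.cls C A (B', u', v')"
      using *[of C B A B'] *[of C B' A B] by (auto simp: fam_simps Int_commute)
  qed (auto simp: fam_simps)
qed

lemma corresp_biset_iso:
  shows "setfun_iso (pow_dom Y X) (thin (crel Y X U)) (corresp_biset Y U)"
proof (rule setfun_isoI[where \<eta> = "\<lambda>(B, A) _. (corresp_image U A, B)"])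
  fix q assume "q \<in> Ob (pow_dom Y X)"
  then show "bij_betw (case q of (B, A) \<Rightarrow> \<lambda>_. (corresp_image U A, B)) (elts (thin (crel Y X U)) q) (elts (corresp_biset Y U) q)"
    by (cases q) (auto simp: fam_simps corresp_biset_def functor_biset_def crel_def bij_betw_def inj_on_def)
next
  fix q r f u assume "q \<in> Ob (pow_dom Y X)" "r \<in> Ob (pow_dom Y X)"
    "f \<in> Arr (pow_dom Y X) q r"
  then show "(case r of (B, A) \<Rightarrow> \<lambda>_. (corresp_image U A, B)) (act (thin (crel Y X U)) q r f u)
    = act (corresp_biset Y U) q r f ((case q of (B, A) \<Rightarrow> \<lambda>_. (corresp_image U A, B)) u)"
    by (cases q, cases r, cases f) (auto simp: fam_simps corresp_biset_def functor_biset_def)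
qed

lemma id_biset_iso:
  shows "setfun_iso (pow_dom X X) (thin (crel X X (Id_on X))) (id_biset (pow_cat X))"
proof -
  have im: "corresp_image (Id_on X) A = A" if "A \<subseteq> X" for A using that by (auto simp: corresp_image_def)
  show ?thesis
  proof (rule setfun_isoI[where \<eta> = "\<lambda>(B, A) _. (A, B)"])
    fix q assume "q \<in> Ob (pow_dom X X)"
    then show "bij_betw (case q of (B, A) \<Rightarrow> \<lambda>_. (A, B)) (elts (thin (crel X X (Id_on X))) q) (elts (id_biset (pow_cat X)) q)"
      by (cases q) (auto simp: fam_simps id_biset_simps crel_def bij_betw_def inj_on_def im)
  next
    fix q r f u assume "q \<in> Ob (pow_dom X X)" "r \<in> Ob (pow_dom X X)"
      "f \<in> Arr (pow_dom X X) q r"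
    then show "(case r of (B, A) \<Rightarrow> \<lambda>_. (A, B)) (act (thin (crel X X (Id_on X))) q r f u)
      = act (id_biset (pow_cat X)) q r f ((case q of (B, A) \<Rightarrow> \<lambda>_. (A, B)) u)"
      by (cases q, cases r, cases f) (auto simp: fam_simps id_biset_simps)
  qed
qed

subsection \<open>Arrows between power sets\<close>

context biset_module_locale
begin

abbreviation ta :: "'u set \<Rightarrow> 'u set \<Rightarrow> ('u set \<Rightarrow> 'u set \<Rightarrow> bool) \<Rightarrow> ('u set, 'u set \<times> 'u set, 'r) biset_arrow" where
  "ta Y X p \<equiv> biset_arrow R (pow_cat Y) (pow_cat X) (thin p)"

lemma thin_ok:
  assumes "finite Y" "finite X" "good Y X p"
  shows "biset (pow_cat Y) (pow_cat X) (thin p)" "birepresentable (pow_cat Y) (pow_cat X) (thin p)"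
  using fam_biset[OF assms(1,2), of "{0}"] fam_birepresentable[OF assms(1,2), of "{0}"] assms(3) by simp_all

lemma two_pow: "\<lbrakk>finite Y; finite X\<rbrakk> \<Longrightarrow> two_categories R (pow_cat Y) (pow_cat X)"
  by (rule two[OF pow_cat_finite pow_cat_finite])

lemma ta_closed:
  assumes "finite Y" "finite X" "good Y X p"
  shows "ta Y X p \<in> carrier (PM Y X)"
  by (rule two_categories.arr_closed[OF two_pow[OF assms(1,2)] thin_ok[OF assms]])

lemma ta_comp:
  assumes fin: "finite Z" "finite Y" "finite X" and p: "good Z Y p" and q: "good Y X q"
  shows "cmp (biset_category R) (pow_cat X) (pow_cat Y) (pow_cat Z) (ta Z Y p) (ta Y X q) = ta Z X (p OO q)"
proof -
  note P = thin_ok[OF fin(1,2) p] and Q = thin_ok[OF fin(2,3) q]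
  interpret T: three_categories R "pow_cat Z" "pow_cat Y" "pow_cat X" by (rule three) (simp_all add: pow_cat_finite fin)
  interpret A: biset_pair "pow_cat Z" "pow_cat Y" "pow_cat X" "thin p" "thin q" unfolding biset_pair_def using P Q by simp
  show ?thesis
    unfolding biset_category_cmp[OF pow_cat_finite[OF fin(1)] pow_cat_finite[OF fin(2)] pow_cat_finite[OF fin(3)]] T.bcomp_arr[OF P Q]
    by (rule T.CE.arr_iso[OF A.comp_biset thin_comp[OF fin p q]])
qed

lemma ta_empty:
  assumes "finite Y" "finite X" "\<And>B A. \<not> p B A"
  shows "ta Y X p = \<zero>\<^bsub>PM Y X\<^esub>"
proof -
  have "good Y X p" using assms(3) by (simp add: good_def)
  then show ?thesis
    by (intro two_categories.arr_empty[OF two_pow[OF assms(1,2)] thin_ok[OF assms(1,2)]]) (auto simp: fam_simps assms(3))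
qed

lemma corresp_arrow:
  assumes "finite Y" "finite X"
  shows "biset_arrow R (pow_cat Y) (pow_cat X) (corresp_biset Y U) = ta Y X (crel Y X U)"
  by (rule two_categories.arr_iso[OF two_pow[OF assms] thin_ok(1)[OF assms good_crel] corresp_biset_iso, symmetric])

lemma id_arrow:
  assumes "finite X"
  shows "ident (biset_category R) (pow_cat X) = ta X X (crel X X (Id_on X))"
  unfolding biset_category_simps
  by (rule two_categories.arr_iso[OF two_pow[OF assms assms] thin_ok(1)[OF assms assms good_crel] id_biset_iso, symmetric])

text \<open>Splits off one component at a time; a disjoint union becomes a sum of classes and the
  empty family becomes zero.\<close>

lemma fam_arrow_induct:
  assumes fin: "finite Y" "finite X" and J: "finite J" and good: "\<And>j. j \<in> J \<Longrightarrow> good Y X (p j)"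
    and ta: "\<And>p. good Y X p \<Longrightarrow> P (ta Y X p)"
    and zero: "P \<zero>\<^bsub>PM Y X\<^esub>"
    and add: "\<And>K L. \<lbrakk>K \<in> carrier (PM Y X); L \<in> carrier (PM Y X); P K; P L\<rbrakk>
      \<Longrightarrow> P (K \<oplus>\<^bsub>PM Y X\<^esub> L)"
  shows "P (arr (pow_cat Y) (pow_cat X) (fam J p))"
  using J good
proof (induction J)
  interpret T: two_categories R "pow_cat Y" "pow_cat X" by (rule two_pow[OF fin])
  case empty
  have "arr (pow_cat Y) (pow_cat X) (fam {} p) = \<zero>\<^bsub>PM Y X\<^esub>"
    by (rule T.arr_empty) (auto intro: fam_biset[OF fin] fam_birepresentable[OF fin] simp: fam_simps)
  then show ?case using zero by simp
next
  interpret T: two_categories R "pow_cat Y" "pow_cat X" by (rule two_pow[OF fin])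
  case (insert j J)
  have b: "biset (pow_cat Y) (pow_cat X) (fam (insert j J) p)" "biset (pow_cat Y) (pow_cat X) (fam J p)"
    "birepresentable (pow_cat Y) (pow_cat X) (fam J p)"
    by (rule fam_biset[OF fin] fam_birepresentable[OF fin]; use insert in simp)+
  have j: "good Y X (p j)" using insert by simp
  note t = thin_ok[OF fin j]
  have "setfun_iso (pow_dom Y X) (fam (insert j J) p) (biset_sum (thin (p j)) (fam J p))"
  proof (rule setfun_isoI[where \<eta> = "\<lambda>_ i. if i = j then Inl 0 else Inr i"])
    fix x assume "x \<in> Ob (pow_dom Y X)"
    show "bij_betw (\<lambda>i. if i = j then Inl 0 else Inr i) (elts (fam (insert j J) p) x) (elts (biset_sum (thin (p j)) (fam J p)) x)"
      using insert(2) by (cases x) (auto simp: fam_simps biset_sum_def bij_betw_def inj_on_def image_iff split: if_splits)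
  qed (auto simp: fam_simps biset_sum_def)
  from T.arr_iso[OF b(1) this] have "arr (pow_cat Y) (pow_cat X) (fam (insert j J) p)
    = ta Y X (p j) \<oplus>\<^bsub>PM Y X\<^esub> arr (pow_cat Y) (pow_cat X) (fam J p)"
    using T.arr_sum[OF t b(2,3)] by simp
  then show ?case using add[OF T.arr_closed[OF t] T.arr_closed[OF b(2,3)] ta[OF j]] insert by simp
qed

text \<open>The classes of good relations span the arrows between power sets, because every
  birepresentable biset decomposes into components.\<close>

lemma pow_induct [consumes 3, case_names ta zero add smult]:
  assumes fin: "finite Y" "finite X" and K: "K \<in> carrier (PM Y X)"
    and ta: "\<And>p. good Y X p \<Longrightarrow> P (ta Y X p)"
    and zero: "P \<zero>\<^bsub>PM Y X\<^esub>"
    and add: "\<And>K L. \<lbrakk>K \<in> carrier (PM Y X); L \<in> carrier (PM Y X); P K; P L\<rbrakk>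
      \<Longrightarrow> P (K \<oplus>\<^bsub>PM Y X\<^esub> L)"
    and smult: "\<And>r K. \<lbrakk>r \<in> carrier R; K \<in> carrier (PM Y X); P K\<rbrakk> \<Longrightarrow> P (r \<odot>\<^bsub>PM Y X\<^esub> K)"
  shows "P K"
proof -
  interpret T: two_categories R "pow_cat Y" "pow_cat X" by (rule two_pow[OF fin])
  from K show ?thesis
  proof (induction rule: T.MM_induct)
    case (arr \<Omega>)
    note pc = birepresentable_pieces[OF fin arr]
    show ?case unfolding T.arr_iso[OF arr(1) pc(3)]
      by (rule fam_arrow_induct[OF fin pc(2) pc(1) ta zero add])
  qed (fact zero add smult)+
qed

end

section \<open>Biset functors and correspondence functors\<close>

lemma corresp_simps [simp]:
  "Ob corresp = {X. finite X}" "Arr corresp X Y = {U. U \<subseteq> Y \<times> X}" "ident corresp = Id_on"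
  "cmp corresp X Y Z U V = U O V"
  by (simp_all add: corresp_def)

lemma corresp_category: "category corresp"
  by (rule category.intro) auto

text \<open>The graph of a bijection is an invertible correspondence, so every element over
  \<open>X'\<close> is recovered from its image over \<open>X\<close>, which is zero.\<close>

lemma corresp_vanishes_card:
  assumes F: "module_functor R corresp F" and X: "finite X" "finite X'" "card X = card X'" and v: "vanishes_at F X"
  shows "vanishes_at F X'"
proof -
  interpret F: module_functor R corresp F by fact
  obtain f where f: "bij_betw f X X'" using finite_same_card_bij[OF X] by blast
  define U where "U = {(f x, x) | x. x \<in> X}"
  have U: "U \<subseteq> X' \<times> X" "U\<inverse> \<subseteq> X \<times> X'" using f by (auto simp: U_def bij_betw_def)
  have UU: "U O U\<inverse> = Id_on X'" using f by (auto simp: U_def bij_betw_def)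
  have X1: "X \<in> Ob corresp" "X' \<in> Ob corresp" and A1: "U \<in> Arr corresp X X'" "U\<inverse> \<in> Arr corresp X' X" using X U by simp_all
  have "a = \<zero>\<^bsub>fob F X'\<^esub>" if a: "a \<in> carrier (fob F X')" for a
  proof -
    have "far F X' X (U\<inverse>) a \<in> carrier (fob F X)" by (rule linear_mapsD(1)[OF F.far_linear[OF X1(2,1) A1(2)] a])
    then have "far F X' X (U\<inverse>) a = \<zero>\<^bsub>fob F X\<^esub>" using v by (simp add: vanishes_at_def)
    then have "far F X X' U (far F X' X (U\<inverse>) a) = \<zero>\<^bsub>fob F X'\<^esub>"
      using linear_map_zero[OF F.far_linear[OF X1 A1(1)] F.fob_module[OF X1(1)] F.fob_module[OF X1(2)]] by simp
    moreover have "far F X X' U (far F X' X (U\<inverse>) a) = a"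
      using F.far_cmp[OF X1(2,1,2) A1(2,1) a] F.far_ident[OF X1(2) a] by (simp add: UU)
    ultimately show ?thesis by simp
  qed
  then have "carrier (fob F X') \<subseteq> {\<zero>\<^bsub>fob F X'\<^esub>}" by blast
  then show ?thesis using module_zero_closed[OF F.fob_module[OF X1(2)]] by (auto simp: vanishes_at_def)
qed

lemma smallest_set_card:
  assumes F: "module_functor R corresp F" and s: "smallest_set_of_corresp_functor F X" and X': "finite X'" "card X' = card X"
  shows "smallest_set_of_corresp_functor F X'"
proof -
  have X: "finite X" "\<not> vanishes_at F X" using s by (simp_all add: smallest_set_of_corresp_functor_def)
  have "\<not> vanishes_at F X'" using corresp_vanishes_card[OF F X'(1) X(1) X'(2)] X(2) by blast
  then show ?thesis using s X' by (simp add: smallest_set_of_corresp_functor_def)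
qed

lemma smallest_sets_card:
  assumes "smallest_set_of_corresp_functor F X" "smallest_set_of_corresp_functor F X'"
  shows "card X = card X'"
  using assms unfolding smallest_set_of_corresp_functor_def by (metis linorder_neqE_nat)

lemma smallest_set_exists:
  assumes "finite Y" "\<not> vanishes_at F Y"
  shows "\<exists>X. smallest_set_of_corresp_functor F X"
proof -
  obtain X where X: "finite X \<and> \<not> vanishes_at F X" "\<And>Z. finite Z \<and> \<not> vanishes_at F Z \<Longrightarrow> card X \<le> card Z"
    using exists_least_iff[of "\<lambda>n. \<exists>Z. (finite Z \<and> \<not> vanishes_at F Z) \<and> card Z = n"] assms
    by (metis (no_types, lifting) linorder_not_less)
  then show ?thesis unfolding smallest_set_of_corresp_functor_def by (metis linorder_not_less)
qed

lemma smallest_set_iso: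
  assumes "modfun_iso R corresp F G" "module_functor R corresp F" "module_functor R corresp G"
    and s: "smallest_set_of_corresp_functor F X"
  shows "smallest_set_of_corresp_functor G X"
proof -
  have "vanishes_at F Y \<longleftrightarrow> vanishes_at G Y" if "finite Y" for Y
    by (rule modfun_iso_vanishes[OF assms(1-3)]) (use that in simp)
  then show ?thesis using s by (auto simp: smallest_set_of_corresp_functor_def)
qed

lemma smallest_set_hat: "smallest_set_of_biset_functor S X \<longleftrightarrow> smallest_set_of_corresp_functor (hat R S) X"
  by (simp add: smallest_set_of_biset_functor_def smallest_set_of_corresp_functor_def vanishes_at_def hat_def)

text \<open>Treats at once every full subcategory that contains the power sets, in particular the
  whole biset category and the category of power sets alone.\<close>

locale biset_subcat = biset_module_locale R for R :: "'r ring" (structure) +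
  fixes \<O> :: "'u fincat set"
  assumes pows: "finite X \<Longrightarrow> pow_cat X \<in> \<O>"
begin

abbreviation BB where "BB \<equiv> full_subcat (biset_category R) \<O>"

lemma BB_linear: "linear_cat R BB"
  by (rule linear_cat_subcat[OF biset_category_linear])

lemma BB_category: "category BB"
  using BB_linear by (simp add: linear_cat_def)

lemma pow_Ob: "finite X \<Longrightarrow> pow_cat X \<in> Ob BB"
  using pows by (simp add: biset_category_simps pow_cat_finite)

lemma BB_Arr: "Arr BB D C = carrier (MM C D)"
  by (simp add: biset_category_simps)

lemma ta_Arr: "\<lbrakk>finite Y; finite X; good Y X p\<rbrakk> \<Longrightarrow> ta Y X p \<in> Arr BB (pow_cat X) (pow_cat Y)"
  unfolding BB_Arr by (rule ta_closed)

section \<open>Pulling biset functors back to correspondences\<close>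

lemma hat_fob: "fob (hat R S) X = fob S (pow_cat X)"
  by (simp add: hat_def)

lemma hat_far: "\<lbrakk>finite X; finite Y\<rbrakk> \<Longrightarrow> far (hat R S) X Y U = far S (pow_cat X) (pow_cat Y) (ta Y X (crel Y X U))"
  by (simp add: hat_def corresp_arrow)

lemma hat_functor:
  assumes "module_functor R BB S"
  shows "module_functor R corresp (hat R S)"
proof -
  interpret S: module_functor R BB S by fact
  show ?thesis
  proof (rule module_functor.intro)
    fix X :: "'u set" assume "X \<in> Ob corresp"
    then have X: "finite X" by simp
    show "module R (fob (hat R S) X)" unfolding hat_fob by (rule S.fob_module[OF pow_Ob[OF X]])
    fix a assume "a \<in> carrier (fob (hat R S) X)"
    then show "far (hat R S) X X (ident corresp X) a = a"
      using S.far_ident[OF pow_Ob[OF X]] by (simp add: hat_far[OF X X] hat_fob id_arrow[OF X])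
  next
    fix X Y :: "'u set" and U assume "X \<in> Ob corresp" "Y \<in> Ob corresp"
    then have X: "finite X" "finite Y" by simp_all
    show "far (hat R S) X Y U \<in> linear_maps R (fob (hat R S) X) (fob (hat R S) Y)"
      unfolding hat_fob hat_far[OF X] by (rule S.far_linear[OF pow_Ob[OF X(1)] pow_Ob[OF X(2)] ta_Arr[OF X(2,1) good_crel]])
  next
    fix X Y Z :: "'u set" and U V a assume "X \<in> Ob corresp" "Y \<in> Ob corresp" "Z \<in> Ob corresp"
      "U \<in> Arr corresp X Y" "V \<in> Arr corresp Y Z" "a \<in> carrier (fob (hat R S) X)"
    then have X: "finite X" "finite Y" "finite Z" and U: "U \<subseteq> Y \<times> X" and a: "a \<in> carrier (fob S (pow_cat X))"
      by (simp_all add: hat_fob)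
    show "far (hat R S) X Z (cmp corresp X Y Z V U) a = far (hat R S) Y Z V (far (hat R S) X Y U a)"
      unfolding hat_far[OF X(1,3)] hat_far[OF X(2,3)] hat_far[OF X(1,2)] corresp_simps crel_relcomp[OF U, symmetric]
        ta_comp[OF X(3,2,1) good_crel good_crel, symmetric]
      using S.far_cmp[OF pow_Ob[OF X(1)] pow_Ob[OF X(2)] pow_Ob[OF X(3)] ta_Arr[OF X(2,1) good_crel] ta_Arr[OF X(3,2) good_crel] a]
      by simp
  qed
qed

lemma arrow_linear:
  assumes "linear_module_functor R BB S" "finite X" "finite Y" and a: "a \<in> carrier (fob S (pow_cat X))"
  shows "(\<lambda>f. far S (pow_cat X) (pow_cat Y) f a) \<in> linear_maps R (PM Y X) (fob S (pow_cat Y))"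
proof -
  interpret S: linear_module_functor R BB S by fact
  note o = pow_Ob[OF assms(2)] pow_Ob[OF assms(3)]
  show ?thesis
    using S.far_add[OF o _ _ a] S.far_smult[OF o _ _ a] linear_mapsD(1)[OF S.far_linear[OF o] a]
    by (intro linear_mapsI) (simp_all add: biset_category_simps)
qed

lemma MM_pow: "\<lbrakk>finite Y; finite X\<rbrakk> \<Longrightarrow> module R (PM Y X)"
  by (rule two_categories.MM[OF two_pow])

lemma pow_agree:
  assumes fin: "finite Y" "finite X" and N: "module R N"
    and f: "f \<in> linear_maps R (PM Y X) N" and g: "g \<in> linear_maps R (PM Y X) N"
    and eq: "\<And>p. good Y X p \<Longrightarrow> f (ta Y X p) = g (ta Y X p)" and K: "K \<in> carrier (PM Y X)"
  shows "f K = g K"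
  using fin K
proof (induction rule: pow_induct)
  case (ta p)
  then show ?case by (rule eq)
next
  case zero
  show ?case using linear_map_zero[OF f MM_pow[OF fin] N] linear_map_zero[OF g MM_pow[OF fin] N] by simp
next
  case (add K L)
  then show ?case using linear_mapsD(2)[OF f] linear_mapsD(2)[OF g] by simp
next
  case (smult r K)
  then show ?case using linear_mapsD(3)[OF f] linear_mapsD(3)[OF g] by simp
qed

text \<open>A non-full relation is empty, hence zero as an arrow, or factors through the power set
  of a proper subset, where \<open>S\<close> vanishes. So on the smallest value only correspondences
  act non-trivially.\<close>

lemma far_ta_smallest:
  assumes S: "linear_module_functor R BB S" and s: "smallest_set_of_biset_functor S X"
    and p: "good X X p" and a: "a \<in> carrier (fob S (pow_cat X))"
  shows "far S (pow_cat X) (pow_cat X) (ta X X p) a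
    = (if full X X p then far (hat R S) X X (corr_of X X p) a else \<zero>\<^bsub>fob S (pow_cat X)\<^esub>)"
proof -
  interpret S: linear_module_functor R BB S by fact
  have X: "finite X" using s by (simp add: smallest_set_of_biset_functor_def)
  note o = pow_Ob[OF X]
  consider (full) "full X X p" | (empty) "\<not> full X X p" "\<And>B A. \<not> p B A" | (other) B A where "\<not> full X X p" "p B A" by blast
  then show ?thesis
  proof cases
    case full
    then show ?thesis by (simp add: hat_far[OF X X] crel_corr_of[OF p full X X])
  next
    case empty
    then show ?thesis
      using linear_map_zero[OF arrow_linear[OF S X X a] MM_pow[OF X X] S.fob_module[OF o]] by (simp add: ta_empty[OF X X])
  next
    case other
    obtain W p1 p2 where W: "W \<subset> X" and g: "good X W p1" "good W X p2" and eq: "p = p1 OO p2"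
      by (rule not_full_factor[OF p X other])
    have fW: "finite W" using W X finite_subset by blast
    have "card W < card X" using W X by (rule psubset_card_mono[rotated])
    then have 0: "carrier (fob S (pow_cat W)) = {\<zero>\<^bsub>fob S (pow_cat W)\<^esub>}"
      using s fW by (simp add: smallest_set_of_biset_functor_def vanishes_at_def)
    note t = ta_Arr[OF X fW g(1)] ta_Arr[OF fW X g(2)] and oW = pow_Ob[OF fW]
    have "far S (pow_cat X) (pow_cat W) (ta W X p2) a = \<zero>\<^bsub>fob S (pow_cat W)\<^esub>"
      using linear_mapsD(1)[OF S.far_linear[OF o oW t(2)] a] 0 by simp
    then have "far S (pow_cat X) (pow_cat X) (ta X X p) a = \<zero>\<^bsub>fob S (pow_cat X)\<^esub>"
      using S.far_cmp[OF o oW o t(2,1) a] linear_map_zero[OF S.far_linear[OF oW o t(1)] S.fob_module[OF oW] S.fob_module[OF o]]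
      by (simp add: ta_comp[OF X fW X g] eq)
    then show ?thesis using other(1) by simp
  qed
qed

text \<open>A submodule stable under correspondences is stable under all arrows by
  \<open>far_ta_smallest\<close> and linearity, so simplicity over the biset category gives
  simplicity over correspondences.\<close>

lemma hat_simple_at:
  assumes S: "linear_module_functor R BB S" "simple_functor R BB S" and s: "smallest_set_of_biset_functor S X"
  shows "simple_functor R (full_subcat corresp {X}) (hat R S)"
proof -
  interpret S: linear_module_functor R BB S by fact
  have X: "finite X" and nz: "\<not> vanishes_at S (pow_cat X)" using s by (simp_all add: smallest_set_of_biset_functor_def)
  note o = pow_Ob[OF X]
  interpret SA: functor_at R BB S "pow_cat X"
    by (intro functor_at.intro functor_at_axioms.intro BB_category S.module_functor_axioms o)
  note simple = SA.simple_restrict[OF S(2) nz]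
  have "(\<forall>x\<in>Ob (full_subcat corresp {X}). P x = {\<zero>\<^bsub>fob (hat R S) x\<^esub>}) \<or>
      (\<forall>x\<in>Ob (full_subcat corresp {X}). P x = carrier (fob (hat R S) x))"
    if P: "subfunctor R (full_subcat corresp {X}) (hat R S) P" for P
  proof -
    have sub: "submodule (P X) R (fob S (pow_cat X))"
      and st: "\<And>U. U \<subseteq> X \<times> X \<Longrightarrow> far (hat R S) X X U ` P X \<subseteq> P X"
      using P X by (auto simp: subfunctor_def hat_fob)
    have "far S (pow_cat X) (pow_cat X) K a \<in> P X" if K: "K \<in> carrier (PM X X)" and a: "a \<in> P X" for K a
      using X X K
    proof (induction rule: pow_induct)
      case (ta p)
      then show ?case
        using far_ta_smallest[OF S(1) s ta submoduleD(1)[OF sub a]] st[OF corr_of_subset[of X X p]] a submoduleD(2)[OF sub] by auto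
    next
      case zero
      show ?case
        using linear_map_zero[OF arrow_linear[OF S(1) X X submoduleD(1)[OF sub a]] MM_pow[OF X X] S.fob_module[OF o]]
          submoduleD(2)[OF sub] by simp
    next
      case (add K L)
      then show ?case
        using linear_mapsD(2)[OF arrow_linear[OF S(1) X X submoduleD(1)[OF sub a]]] submoduleD(3)[OF sub] by simp
    next
      case (smult r K)
      then show ?case
        using linear_mapsD(3)[OF arrow_linear[OF S(1) X X submoduleD(1)[OF sub a]]] submoduleD(4)[OF sub] by simp
    qed
    then have "subfunctor R (full_subcat BB {pow_cat X}) S (\<lambda>_. P X)"
      using sub by (auto simp: subfunctor_def biset_category_simps)
    from simple_functorD(2)[OF simple this] show ?thesis using o by (auto simp: hat_fob)
  qed
  moreover have "\<exists>x\<in>Ob (full_subcat corresp {X}). \<not> vanishes_at (hat R S) x"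
    using nz X by (simp add: vanishes_at_def hat_fob)
  ultimately show ?thesis
    using full_subcat_functor[OF hat_functor[OF S.module_functor_axioms]] by (simp add: simple_functor_def)
qed

lemma hat_iso:
  assumes "modfun_iso R (full_subcat BB {pow_cat X}) S S'" and X: "finite X"
  shows "modfun_iso R (full_subcat corresp {X}) (hat R S) (hat R S')"
proof -
  note o = pow_Ob[OF X]
  from assms(1) obtain \<eta> where "modfun_iso_by R (full_subcat BB {pow_cat X}) S S' \<eta>" by (rule modfun_isoE)
  note \<eta> = modfun_iso_byD[OF this]
  show ?thesis
  proof (rule modfun_isoI[where \<eta> = "\<lambda>_. \<eta> (pow_cat X)"])
    fix x assume "x \<in> Ob (full_subcat corresp {X})"
    then have x: "x = X" by simp
    show "\<eta> (pow_cat X) \<in> linear_maps R (fob (hat R S) x) (fob (hat R S') x)"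
      "bij_betw (\<eta> (pow_cat X)) (carrier (fob (hat R S) x)) (carrier (fob (hat R S') x))"
      using \<eta>(1,2)[of "pow_cat X"] o by (simp_all add: x hat_fob)
  next
    fix x y f a assume "x \<in> Ob (full_subcat corresp {X})" "y \<in> Ob (full_subcat corresp {X})" "a \<in> carrier (fob (hat R S) x)"
    then have x: "x = X" "y = X" "a \<in> carrier (fob S (pow_cat X))" by (simp_all add: hat_fob)
    show "\<eta> (pow_cat X) (far (hat R S) x y f a) = far (hat R S') x y f (\<eta> (pow_cat X) a)"
      unfolding x(1,2) hat_far[OF X X]
      using \<eta>(3)[of "pow_cat X" "pow_cat X" "ta X X (crel X X f)" a] o x(3) ta_Arr[OF X X good_crel] by simp
  qed
qed

text \<open>A map commuting with correspondences commutes with all biset arrows: on the spanning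
  relations these act through a correspondence or as zero, on both sides alike.\<close>

lemma hat_iso_D:
  assumes iso: "modfun_iso R (full_subcat corresp {X}) (hat R S) (hat R S')"
    and S: "linear_module_functor R BB S" "smallest_set_of_biset_functor S X"
    and S': "linear_module_functor R BB S'" "smallest_set_of_biset_functor S' X"
  shows "modfun_iso R (full_subcat BB {pow_cat X}) S S'"
proof -
  interpret S: linear_module_functor R BB S by fact
  interpret S': linear_module_functor R BB S' by fact
  have X: "finite X" using S(2) by (simp add: smallest_set_of_biset_functor_def)
  note o = pow_Ob[OF X]
  from iso obtain \<eta> where "modfun_iso_by R (full_subcat corresp {X}) (hat R S) (hat R S') \<eta>" by (rule modfun_isoE)
  note \<eta> = modfun_iso_byD[OF this]
  have lin: "\<eta> X \<in> linear_maps R (fob S (pow_cat X)) (fob S' (pow_cat X))" using \<eta>(1)[of X] X by (simp add: hat_fob)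
  have bij: "bij_betw (\<eta> X) (carrier (fob S (pow_cat X))) (carrier (fob S' (pow_cat X)))" using \<eta>(2)[of X] X by (simp add: hat_fob)
  have nat: "\<eta> X (far (hat R S) X X U a) = far (hat R S') X X U (\<eta> X a)" if "U \<subseteq> X \<times> X" "a \<in> carrier (fob S (pow_cat X))" for U a
    using \<eta>(3)[of X X U a] X that by (simp add: hat_fob)
  show ?thesis
  proof (rule modfun_isoI[where \<eta> = "\<lambda>_. \<eta> X"])
    fix x assume "x \<in> Ob (full_subcat BB {pow_cat X})"
    then have "x = pow_cat X" by simp
    then show "\<eta> X \<in> linear_maps R (fob S x) (fob S' x)" "bij_betw (\<eta> X) (carrier (fob S x)) (carrier (fob S' x))"
      using lin bij by simp_all
  next
    fix x y K a assume "x \<in> Ob (full_subcat BB {pow_cat X})" "y \<in> Ob (full_subcat BB {pow_cat X})"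
      "K \<in> Arr (full_subcat BB {pow_cat X}) x y" "a \<in> carrier (fob S x)"
    then have x: "x = pow_cat X" "y = pow_cat X" and K: "K \<in> carrier (PM X X)" and a: "a \<in> carrier (fob S (pow_cat X))"
      by (simp_all add: biset_category_simps)
    note a' = linear_mapsD(1)[OF lin a]
    show "\<eta> X (far S x y K a) = far S' x y K (\<eta> X a)" unfolding x
    proof (rule pow_agree[OF X X S'.fob_module[OF o] _ _ _ K])
      show "(\<lambda>K. \<eta> X (far S (pow_cat X) (pow_cat X) K a)) \<in> linear_maps R (PM X X) (fob S' (pow_cat X))"
        by (rule linear_maps_comp[OF arrow_linear[OF S(1) X X a] lin])
      show "(\<lambda>K. far S' (pow_cat X) (pow_cat X) K (\<eta> X a)) \<in> linear_maps R (PM X X) (fob S' (pow_cat X))"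
        by (rule arrow_linear[OF S'(1) X X a'])
      fix p assume p: "good X X p"
      show "\<eta> X (far S (pow_cat X) (pow_cat X) (ta X X p) a) = far S' (pow_cat X) (pow_cat X) (ta X X p) (\<eta> X a)"
        unfolding far_ta_smallest[OF S p a] far_ta_smallest[OF S' p a']
        using nat[OF corr_of_subset a] linear_map_zero[OF lin S.fob_module[OF o] S'.fob_module[OF o]] by simp
    qed
  qed
qed

text \<open>Replaces subquotients by values at \<open>X\<close>: the value of the pulled-back
  functor at \<open>X\<close> is simple, so a factor that is non-zero there must take all of it, and
  conversely any simple functor with this value is such a factor.\<close>

lemma factor_at_iff:
  assumes S: "linear_module_functor R BB S" "simple_functor R BB S" and s: "smallest_set_of_biset_functor S X"
  shows "factor_at R X S T \<longleftrightarrow> simple_functor R corresp T \<and> smallest_set_of_corresp_functor T X \<and>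
    modfun_iso R (full_subcat corresp {X}) (hat R S) T"
proof -
  have X: "X \<in> Ob corresp" using s by (simp add: smallest_set_of_biset_functor_def)
  note H = hat_functor[OF simple_functorD(1)[OF S(2)]]
  show ?thesis
  proof
    assume f: "factor_at R X S T"
    then have "\<not> vanishes_at T X" by (simp add: factor_at_def smallest_set_of_corresp_functor_def)
    then show "simple_functor R corresp T \<and> smallest_set_of_corresp_functor T X \<and>
        modfun_iso R (full_subcat corresp {X}) (hat R S) T"
      using f composition_factor_restrict[OF H _ X _ hat_simple_at[OF S s], of T]
      by (simp add: factor_at_def simple_composition_factor_def)
  next
    assume T: "simple_functor R corresp T \<and> smallest_set_of_corresp_functor T X \<and>
        modfun_iso R (full_subcat corresp {X}) (hat R S) T"
    then have "\<not> vanishes_at T X" by (simp add: smallest_set_of_corresp_functor_def)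
    then show "factor_at R X S T"
      using composition_factorI[OF corresp_category H _ X, of T] T by (simp add: factor_at_def)
  qed
qed

text \<open>The factor is the simple functor extending the value of the pulled-back functor at
  \<open>X\<close>, recoded in \<open>'m\<close>.\<close>

lemma factor_exists:
  fixes S :: "('u, 'r, 'm) biset_functor" and e :: "(nat \<Rightarrow> 'r) \<Rightarrow> 'm"
  assumes e: "inj e"
    and S: "linear_module_functor R BB S" "simple_functor R BB S" and s: "smallest_set_of_biset_functor S X"
  shows "\<exists>T :: ('u, 'r, 'm) corresp_functor. factor_at R X S T"
proof -
  have X: "finite X" using s by (simp add: smallest_set_of_biset_functor_def)
  note H = hat_functor[OF simple_functorD(1)[OF S(2)]]
  interpret H: functor_at R corresp "hat R S" X
    by (intro functor_at.intro functor_at_axioms.intro corresp_category H) (simp add: X)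
  interpret V: value_at R corresp X "hat R S"
    by (intro value_at.intro value_at_axioms.intro corresp_category full_subcat_functor[OF H]) (simp add: X)
  have inf: "infinite (UNIV :: 'm set)" by (rule infinite_if_inj[OF R_field e])
  have "\<exists>A \<subseteq> Arr corresp X Y. (\<exists>\<iota> :: ('u \<times> 'u) set \<Rightarrow> 'm. inj_on \<iota> A) \<and>
      (\<forall>a \<in> Arr corresp X Y. \<forall>v \<in> carrier V.M. V.gen Y a v \<in> submodule_span R (V.FM Y) {V.gen Y a v | a v. a \<in> A \<and> v \<in> carrier V.M})"
    if Y: "Y \<in> Ob corresp" for Y
  proof -
    \<comment> \<open>There are only finitely many correspondences between two finite sets, so any
      infinite carrier type can code them.\<close>
    have "finite (Pow (Y \<times> X))" using X Y by simp
    then obtain \<iota> :: "('u \<times> 'u) set \<Rightarrow> 'm" where "inj_on \<iota> (Pow (Y \<times> X))"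
      using infinite_arbitrarily_large[OF inf, of "card (Pow (Y \<times> X))"] finite_same_card_bij[of "Pow (Y \<times> X)"]
      by (metis bij_betw_imp_inj_on)
    moreover have "Arr corresp X Y = Pow (Y \<times> X)" by auto
    ultimately show ?thesis
      using span_superset[of "{V.gen Y a v | a v. a \<in> Arr corresp X Y \<and> v \<in> carrier V.M}" R "V.FM Y"]
      by (intro exI[of _ "Arr corresp X Y"]) (simp del: corresp_simps, blast)
  qed
  from V.exists_simple[OF inf hat_simple_at[OF S s] this]
  obtain T :: "('u, 'r, 'm) corresp_functor" where T: "simple_functor R corresp T" "modfun_iso R corresp V.S T" by blast
  note Tf = simple_functorD(1)[OF T(1)]
  have iso: "modfun_iso R (full_subcat corresp {X}) (hat R S) T"
    by (rule modfun_iso_trans[OF modfun_iso_sym[OF V.S_restrict full_subcat_functor[OF V.S_functor]] modfun_iso_subcat[OF T(2)]])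
  have "vanishes_at T Y" if Y: "finite Y" "card Y < card X" for Y
  proof -
    have 0: "carrier (fob (hat R S) Y) = {\<zero>\<^bsub>fob (hat R S) Y\<^esub>}"
      using s Y by (simp add: smallest_set_of_biset_functor_def vanishes_at_def hat_fob)
    have oY: "Y \<in> Ob corresp" using Y by simp
    \<comment> \<open>A round trip from \<open>X\<close> through a smaller \<open>Y\<close> acts
      through the value at \<open>Y\<close>, which is zero.\<close>
    have "vanishes_at V.S Y"
    proof (rule V.S_vanishes[OF oY])
      fix U V v assume U: "U \<in> Arr corresp X Y" "V \<in> Arr corresp Y X" and v: "v \<in> carrier (fob (hat R S) X)"
      have "far (hat R S) X Y U v = \<zero>\<^bsub>fob (hat R S) Y\<^esub>" using H.far_closed[OF H.X oY U(1) v] 0 by simp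
      then show "far (hat R S) X X (cmp corresp X Y X V U) v = \<zero>\<^bsub>fob (hat R S) X\<^esub>"
        using H.F.far_cmp[OF H.X oY H.X U v] H.far_zero[OF oY H.X U(2)] by simp
    qed
    then show ?thesis using modfun_iso_vanishes[OF T(2) V.S_functor Tf oY] by simp
  qed
  moreover have "\<not> vanishes_at T X"
  proof -
    have "\<not> vanishes_at (hat R S) X" using s by (simp add: smallest_set_of_biset_functor_def vanishes_at_def hat_fob)
    then show ?thesis
      using modfun_iso_vanishes[OF iso full_subcat_functor[OF H] full_subcat_functor[OF Tf], of X] X by simp
  qed
  ultimately have "smallest_set_of_corresp_functor T X" using X by (simp add: smallest_set_of_corresp_functor_def)
  then show ?thesis using T(1) iso factor_at_iff[OF S s] by blast
qed

end

subsection \<open>The biset functor attached to a simple correspondence functor\<close>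

locale biset_action = biset_module_locale R for R :: "'r ring" (structure) +
  fixes T :: "('u, 'r, 'm) corresp_functor" and X :: "'u set"
  assumes T: "simple_functor R corresp T" and s: "smallest_set_of_corresp_functor T X"
begin

lemma X: "finite X" and T_nonzero: "\<not> vanishes_at T X"
  using s by (simp_all add: smallest_set_of_corresp_functor_def)

sublocale T: functor_at R corresp T X
  by (intro functor_at.intro functor_at_axioms.intro corresp_category simple_functorD(1)[OF T]) (simp add: X)

abbreviation N where "N \<equiv> fob T X"

lemma N: "module R N" by (rule T.F.fob_module[OF T.X])

text \<open>The only action compatible with \<open>far_ta_smallest\<close>: full relations act as
  their correspondences, the others as zero.\<close>

definition \<tau> :: "('u set \<Rightarrow> 'u set \<Rightarrow> bool) \<Rightarrow> 'm \<Rightarrow> 'm" where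
  "\<tau> p v = (if full X X p then far T X X (corr_of X X p) v else \<zero>\<^bsub>N\<^esub>)"

lemma corr_Arr: "corr_of X X p \<in> Arr corresp X X"
  using corr_of_subset by simp

lemma \<tau>_linear: "\<tau> p \<in> linear_maps R N N"
proof -
  interpret N: module R N by (rule N)
  show ?thesis
    using T.F.far_linear[OF T.X T.X corr_Arr, of p] by (auto simp: \<tau>_def linear_maps_def Pi_iff)
qed

lemma \<tau>_closed: "v \<in> carrier N \<Longrightarrow> \<tau> p v \<in> carrier N"
  by (rule linear_mapsD(1)[OF \<tau>_linear])

lemma \<tau>_crel: "U \<subseteq> X \<times> X \<Longrightarrow> \<tau> (crel X X U) v = far T X X U v"
  by (simp add: \<tau>_def full_crel corr_of_crel)

text \<open>If the composite is not full, \<open>\<tau>\<close> is zero by definition. If it is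
  full, \<open>full_factor\<close> writes it as a composite of correspondences through some
  \<open>W\<close>, and \<open>not\<close> makes \<open>W\<close> smaller than \<open>X\<close>, so
  the action passes through a zero module.\<close>

lemma full_comp_small:
  assumes Y: "finite Y" and p: "good X Y p" and q: "good Y X q" and v: "v \<in> carrier N"
    and not: "Y \<noteq> X \<and> card Y \<le> card X \<and> card Y < card X \<or> Y = X \<and> \<not> (full X X p \<and> full X X q)"
  shows "\<tau> (p OO q) v = \<zero>\<^bsub>N\<^esub>"
proof (cases "full X X (p OO q)")
  case True
  obtain W p' q' where W: "W \<subseteq> Y" "good X W p'" "full X W p'" "good W X q'" "full W X q'" "p OO q = p' OO q'"
    "W = Y \<Longrightarrow> full X Y p \<and> full Y X q \<and> p' = p \<and> q' = q" by (fact full_factor[OF p q Y True])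
  have fW: "finite W" using W(1) Y finite_subset by blast
  \<comment> \<open>When \<open>W\<close> is all of \<open>Y\<close>, both factors are full, so
    \<open>not\<close> leaves only the case that \<open>Y\<close> itself has fewer elements than
    \<open>X\<close>.\<close>
  have "card W < card X"
  proof (cases "W = Y")
    case True
    then show ?thesis using W(7) not by auto
  next
    case False
    then have "card W < card Y" using W(1) Y psubset_card_mono by blast
    then show ?thesis using not by auto
  qed
  then have 0: "carrier (fob T W) = {\<zero>\<^bsub>fob T W\<^esub>}"
    using s fW by (simp add: smallest_set_of_corresp_functor_def vanishes_at_def)
  let ?U = "corr_of W X q'" and ?V = "corr_of X W p'"
  have oW: "W \<in> Ob corresp" and U: "?U \<in> Arr corresp X W" "?V \<in> Arr corresp W X" using fW corr_of_subset by simp_all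
  have "p OO q = crel X X (?V O ?U)"
    unfolding W(6) crel_relcomp[OF corr_of_subset, symmetric] crel_corr_of[OF W(2,3) X fW] crel_corr_of[OF W(4,5) fW X] ..
  then have "\<tau> (p OO q) v = far T X X (?V O ?U) v" using corr_of_subset[of W X q'] corr_of_subset[of X W p'] by (simp add: \<tau>_crel relcomp_subset_Sigma)
  also have "\<dots> = far T W X ?V (far T X W ?U v)" using T.F.far_cmp[OF T.X oW T.X U v] by simp
  also have "far T X W ?U v = \<zero>\<^bsub>fob T W\<^esub>" using T.far_closed[OF T.X oW U(1) v] 0 by simp
  finally show ?thesis using T.far_zero[OF oW T.X U(2)] by simp
qed (simp add: \<tau>_def)

text \<open>With both factors full this is functoriality of \<open>T\<close>; otherwise the right
  side is zero by definition and the left side by \<open>full_comp_small\<close>, even if the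
  composite is full.\<close>

lemma \<tau>_comp:
  assumes p: "good X X p" and q: "good X X q" and v: "v \<in> carrier N"
  shows "\<tau> (p OO q) v = \<tau> p (\<tau> q v)"
proof (cases "full X X p \<and> full X X q")
  case True
  let ?U = "corr_of X X q" and ?V = "corr_of X X p"
  have "p OO q = crel X X (?V O ?U)"
    unfolding crel_relcomp[OF corr_of_subset, symmetric] using True crel_corr_of[OF p _ X X] crel_corr_of[OF q _ X X] by simp
  then have "\<tau> (p OO q) v = far T X X (?V O ?U) v"
    using corr_of_subset[of X X q] corr_of_subset[of X X p] by (simp add: \<tau>_crel relcomp_subset_Sigma)
  also have "\<dots> = far T X X ?V (far T X X ?U v)" using T.F.far_cmp[OF T.X T.X T.X corr_Arr corr_Arr v] by simp
  finally show ?thesis using True by (simp add: \<tau>_def)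
next
  case False
  interpret N: module R N by (rule N)
  have "\<tau> p \<zero>\<^bsub>N\<^esub> = \<zero>\<^bsub>N\<^esub>" by (rule linear_map_zero[OF \<tau>_linear N N])
  then have "\<tau> p (\<tau> q v) = \<zero>\<^bsub>N\<^esub>" using False by (auto simp: \<tau>_def)
  then show ?thesis using full_comp_small[OF X p q v] False by simp
qed

text \<open>Sums the action over the components of a biset. The element type is left general because
  the disjoint union of bisets over \<open>nat\<close> has elements in a sum type.\<close>

definition \<phi> :: "'m \<Rightarrow> ('u set \<times> 'u set, ('u set \<times> 'u set) \<times> ('u set \<times> 'u set), 'e) setfun \<Rightarrow> 'm" where
  "\<phi> v \<Omega> = (\<Oplus>\<^bsub>N\<^esub>j\<in>elts \<Omega> (X, {}). \<tau> (piece X X \<Omega> j) v)"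

text \<open>An isomorphism carries components to components and preserves the places where they have
  elements, so the sum is only reindexed.\<close>

lemma \<phi>_iso:
  assumes v: "v \<in> carrier N" and \<Omega>: "biset (pow_cat X) (pow_cat X) \<Omega>"
    and iso: "setfun_iso (pow_dom X X) \<Omega> \<Omega>'"
  shows "\<phi> v \<Omega> = \<phi> v \<Omega>'"
proof -
  interpret N: module R N by (rule N)
  interpret biset "pow_cat X" "pow_cat X" \<Omega> by fact
  from iso obtain \<eta> where "setfun_iso_by (pow_dom X X) \<Omega> \<Omega>' \<eta>" by (rule setfun_isoE)
  note \<eta> = setfun_iso_byD[OF this]
  have b: "bij_betw (\<eta> (X, {})) (elts \<Omega> (X, {})) (elts \<Omega>' (X, {}))" by (rule \<eta>(1)) simp
  have "piece X X \<Omega> j = piece X X \<Omega>' (\<eta> (X, {}) j)" if j: "j \<in> elts \<Omega> (X, {})" for j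
  proof (intro ext)
    fix B A
    show "piece X X \<Omega> j B A = piece X X \<Omega>' (\<eta> (X, {}) j) B A"
    proof (cases "B \<subseteq> X \<and> A \<subseteq> X")
      case True
      then have o: "(B, A) \<in> Ob (pow_dom X X)" by simp
      have eq: "act \<Omega>' (B, A) (X, {}) ((B, X), ({}, A)) (\<eta> (B, A) u) = \<eta> (X, {}) j
          \<longleftrightarrow> act \<Omega> (B, A) (X, {}) ((B, X), ({}, A)) u = j" if u: "u \<in> elts \<Omega> (B, A)" for u
      proof -
        have a: "act \<Omega> (B, A) (X, {}) ((B, X), ({}, A)) u \<in> elts \<Omega> (X, {})"
          by (rule act_closed) (use True u in auto)
        have "act \<Omega>' (B, A) (X, {}) ((B, X), ({}, A)) (\<eta> (B, A) u) = \<eta> (X, {}) (act \<Omega> (B, A) (X, {}) ((B, X), ({}, A)) u)"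
          using \<eta>(2)[OF o _ _ u, of "(X, {})" "((B, X), ({}, A))"] True by simp
        then show ?thesis using inj_on_eq_iff[OF bij_betw_imp_inj_on[OF b] a j] by simp
      qed
      have "elts \<Omega>' (B, A) = \<eta> (B, A) ` elts \<Omega> (B, A)" using bij_betw_imp_surj_on[OF \<eta>(1)[OF o]] by simp
      then show ?thesis using True eq by (auto simp: piece_def[OF X X])
    next
      case False
      then show ?thesis by (auto simp: piece_def[OF X X])
    qed
  qed
  then have "\<phi> v \<Omega> = (\<Oplus>\<^bsub>N\<^esub>j\<in>elts \<Omega> (X, {}). \<tau> (piece X X \<Omega>' (\<eta> (X, {}) j)) v)"
    unfolding \<phi>_def by (intro N.M.finsum_cong') (auto intro: \<tau>_closed[OF v])
  also have "\<dots> = (\<Oplus>\<^bsub>N\<^esub>j\<in>\<eta> (X, {}) ` elts \<Omega> (X, {}). \<tau> (piece X X \<Omega>' j) v)"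
    by (rule N.M.finsum_reindex[symmetric]) (auto intro: \<tau>_closed[OF v] bij_betw_imp_inj_on[OF b])
  finally show ?thesis unfolding \<phi>_def bij_betw_imp_surj_on[OF b] .
qed

lemma \<phi>_sum:
  assumes v: "v \<in> carrier N" and fin: "finite (elts \<Omega> (X, {}))" "finite (elts \<Psi> (X, {}))"
  shows "\<phi> v (biset_sum \<Omega> \<Psi>) = \<phi> v \<Omega> \<oplus>\<^bsub>N\<^esub> \<phi> v \<Psi>"
proof -
  interpret N: module R N by (rule N)
  have l: "piece X X (biset_sum \<Omega> \<Psi>) (Inl j) = piece X X \<Omega> j" for j
    by (intro ext) (auto simp: piece_def[OF X X] biset_sum_def bex_Un)
  have r: "piece X X (biset_sum \<Omega> \<Psi>) (Inr j) = piece X X \<Psi> j" for j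
    by (intro ext) (auto simp: piece_def[OF X X] biset_sum_def bex_Un)
  have "\<phi> v (biset_sum \<Omega> \<Psi>) = (\<Oplus>\<^bsub>N\<^esub>j\<in>Inl ` elts \<Omega> (X, {}) \<union> Inr ` elts \<Psi> (X, {}). \<tau> (piece X X (biset_sum \<Omega> \<Psi>) j) v)"
    by (simp add: \<phi>_def biset_sum_def)
  also have "\<dots> = (\<Oplus>\<^bsub>N\<^esub>j\<in>Inl ` elts \<Omega> (X, {}). \<tau> (piece X X (biset_sum \<Omega> \<Psi>) j) v)
      \<oplus>\<^bsub>N\<^esub> (\<Oplus>\<^bsub>N\<^esub>j\<in>Inr ` elts \<Psi> (X, {}). \<tau> (piece X X (biset_sum \<Omega> \<Psi>) j) v)"
    by (rule N.M.finsum_Un_disjoint) (use fin \<tau>_closed[OF v] in auto)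
  also have "(\<Oplus>\<^bsub>N\<^esub>j\<in>Inl ` elts \<Omega> (X, {}). \<tau> (piece X X (biset_sum \<Omega> \<Psi>) j) v) = \<phi> v \<Omega>"
    by (subst N.M.finsum_reindex) (auto simp: \<phi>_def l intro: \<tau>_closed[OF v])
  also have "(\<Oplus>\<^bsub>N\<^esub>j\<in>Inr ` elts \<Psi> (X, {}). \<tau> (piece X X (biset_sum \<Omega> \<Psi>) j) v) = \<phi> v \<Psi>"
    by (subst N.M.finsum_reindex) (auto simp: \<phi>_def r intro: \<tau>_closed[OF v])
  finally show ?thesis .
qed

text \<open>A thin biset has at most one component. It has none exactly when \<open>p X {}\<close>
  fails; then \<open>p\<close> is not full, so both sides are zero.\<close>

lemma \<phi>_thin:
  assumes v: "v \<in> carrier N" and p: "good X X p"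
  shows "\<phi> v (thin p) = \<tau> p v"
proof -
  interpret N: module R N by (rule N)
  have pc: "piece X X (thin p) 0 = p"
    by (intro ext) (auto simp: piece_def[OF X X] fam_simps dest: goodD(1,2)[OF p, THEN subsetD])
  show ?thesis
  proof (cases "p X {}")
    case True
    then have "elts (thin p) (X, {}) = {0}" by (auto simp: fam_simps)
    then show ?thesis unfolding \<phi>_def by (simp add: pc \<tau>_closed[OF v])
  next
    case False
    then have "\<not> full X X p" using goodD(4)[OF p, of X X "{}"] by (auto simp: full_def)
    moreover have "elts (thin p) (X, {}) = {}" using False by (auto simp: fam_simps)
    ultimately show ?thesis by (simp add: \<phi>_def \<tau>_def)
  qed
qed

abbreviation E where "E \<equiv> PM X X"

text \<open>For fixed \<open>v\<close>, the sum over components is an additive invariant of bisets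
  and therefore extends linearly to all endomorphisms of the power set.\<close>

lemma action_exists:
  assumes v: "v \<in> carrier N"
  shows "\<exists>h\<in>linear_maps R E N. \<forall>p. good X X p \<longrightarrow> h (ta X X p) = \<tau> p v"
proof -
  interpret N: module R N by (rule N)
  interpret TC: two_categories R "pow_cat X" "pow_cat X" by (rule two_pow[OF X X])
  have fin: "finite (elts \<Omega> (X, {}))" if "biset (pow_cat X) (pow_cat X) \<Omega>" for \<Omega> :: "'u pow_biset"
    using biset.fin[OF that, of X "{}"] by simp
  have "\<exists>h\<in>linear_maps R E N. \<forall>\<Omega> :: 'u pow_biset. birepresentable (pow_cat X) (pow_cat X) \<Omega> \<longrightarrow> h (arr (pow_cat X) (pow_cat X) \<Omega>) = \<phi> v \<Omega>"
  proof (rule TC.MM_linear_map_exists[OF N])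
    fix \<Omega> :: "'u pow_biset"
    show "\<phi> v \<Omega> \<in> carrier N" unfolding \<phi>_def by (rule N.M.finsum_closed) (use \<tau>_closed[OF v] in auto)
  next
    fix \<Omega> \<Omega>' :: "'u pow_biset" assume "biset (pow_cat X) (pow_cat X) \<Omega>" "setfun_iso (pow_dom X X) \<Omega> \<Omega>'"
    then show "\<phi> v \<Omega> = \<phi> v \<Omega>'" by (rule \<phi>_iso[OF v])
  next
    fix \<Omega> \<Psi> \<Theta> :: "'u pow_biset" assume b: "biset (pow_cat X) (pow_cat X) \<Omega>" "biset (pow_cat X) (pow_cat X) \<Psi>"
      "biset (pow_cat X) (pow_cat X) \<Theta>" "setfun_iso (pow_dom X X) \<Theta> (biset_sum \<Omega> \<Psi>)"
    show "\<phi> v \<Theta> = \<phi> v \<Omega> \<oplus>\<^bsub>N\<^esub> \<phi> v \<Psi>"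
      using \<phi>_iso[OF v b(3,4)] \<phi>_sum[OF v fin[OF b(1)] fin[OF b(2)]] by simp
  qed
  then obtain h where h: "h \<in> linear_maps R E N"
    "\<And>\<Omega> :: 'u pow_biset. birepresentable (pow_cat X) (pow_cat X) \<Omega> \<Longrightarrow> h (arr (pow_cat X) (pow_cat X) \<Omega>) = \<phi> v \<Omega>" by blast
  have "h (ta X X p) = \<tau> p v" if "good X X p" for p
    using h(2)[OF thin_ok(2)[OF X X that]] \<phi>_thin[OF v that] by simp
  then show ?thesis using h(1) by blast
qed

definition h where "h v = (SOME h. h \<in> linear_maps R E N \<and> (\<forall>p. good X X p \<longrightarrow> h (ta X X p) = \<tau> p v))"

lemma h_props:
  assumes v: "v \<in> carrier N"
  shows "h v \<in> linear_maps R E N" "good X X p \<Longrightarrow> h v (ta X X p) = \<tau> p v"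
proof -
  have "\<exists>h. h \<in> linear_maps R E N \<and> (\<forall>p. good X X p \<longrightarrow> h (ta X X p) = \<tau> p v)"
    using action_exists[OF v] by blast
  from someI_ex[OF this] show "h v \<in> linear_maps R E N" "good X X p \<Longrightarrow> h v (ta X X p) = \<tau> p v"
    unfolding h_def by blast+
qed

lemma h_closed: "\<lbrakk>v \<in> carrier N; K \<in> carrier E\<rbrakk> \<Longrightarrow> h v K \<in> carrier N"
  by (rule linear_mapsD(1)[OF h_props(1)])

text \<open>The map \<open>h v\<close> is chosen separately for each \<open>v\<close>, so linearity
  in \<open>v\<close> has to be proved: it holds on the spanning relations through
  \<open>\<tau>\<close> and is preserved by linear combinations.\<close>

lemma h_linear:
  assumes K: "K \<in> carrier E"
  shows "(\<lambda>v. h v K) \<in> linear_maps R N N"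
proof -
  note ME = two_categories.MM[OF two_pow[OF X X]]
  note cong = linear_maps_cong[OF _ N]
  from X X K show ?thesis
  proof (induction rule: pow_induct)
    case (ta p)
    show ?case by (rule cong[OF \<tau>_linear[of p]]) (simp add: h_props(2)[OF _ ta])
  next
    case zero
    show ?case by (rule cong[OF linear_maps_zero[OF N]]) (simp add: linear_map_zero[OF h_props(1) ME N])
  next
    case (add K L)
    show ?case by (rule cong[OF linear_maps_add[OF N add(3,4)]]) (simp add: linear_mapsD(2)[OF h_props(1) add(1,2)])
  next
    case (smult s K)
    show ?case by (rule cong[OF linear_maps_smult[OF N smult(3,1)]]) (simp add: linear_mapsD(3)[OF h_props(1) smult(1,2)])
  qed
qed

end

locale biset_action_subcat = biset_action R T X + biset_subcat R \<O>
  for R :: "'r ring" (structure) and T :: "('u, 'r, 'm) corresp_functor" and X :: "'u set" and \<O> :: "'u fincat set"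
begin

abbreviation "P \<equiv> pow_cat X"
abbreviation "BP \<equiv> full_subcat BB {P}"

text \<open>By linearity in \<open>L\<close> and in \<open>K\<close> the claim reduces to two
  relations, where it is multiplicativity of \<open>\<tau>\<close>.\<close>

lemma h_comp:
  assumes v: "v \<in> carrier N" and K: "K \<in> carrier E" and L: "L \<in> carrier E"
  shows "h v (cmp (biset_category R) P P P K L) = h (h v L) K"
proof -
  interpret B: linear_cat R BB by (rule BB_linear)
  note o = pow_Ob[OF X]
  have left: "(\<lambda>K. cmp (biset_category R) P P P K L) \<in> linear_maps R E E" if "L \<in> carrier E" for L
    using B.cmp_linear_left[OF o o o, of L] that by (simp add: biset_category_simps)
  have right: "cmp (biset_category R) P P P K \<in> linear_maps R E E" if "K \<in> carrier E" for K
    using B.cmp_linear_right[OF o o o, of K] that by (simp add: biset_category_simps)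
  have 1: "h v (cmp (biset_category R) P P P (ta X X p) L) = h (h v L) (ta X X p)" if p: "good X X p" for p
  proof (rule pow_agree[OF X X N _ _ _ L])
    note pE = ta_closed[OF X X p]
    show "(\<lambda>L. h v (cmp (biset_category R) P P P (ta X X p) L)) \<in> linear_maps R E N"
      by (rule linear_maps_comp[OF right[OF pE] h_props(1)[OF v]])
    show "(\<lambda>L. h (h v L) (ta X X p)) \<in> linear_maps R E N"
      by (rule linear_maps_comp[OF h_props(1)[OF v] h_linear[OF pE]])
    fix q assume q: "good X X q"
    show "h v (cmp (biset_category R) P P P (ta X X p) (ta X X q)) = h (h v (ta X X q)) (ta X X p)"
      unfolding ta_comp[OF X X X p q] h_props(2)[OF v good_relcomp[OF p q]] h_props(2)[OF v q]
        h_props(2)[OF \<tau>_closed[OF v] p] by (rule \<tau>_comp[OF p q v])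
  qed
  show ?thesis
    by (rule pow_agree[OF X X N linear_maps_comp[OF left[OF L] h_props(1)[OF v]] h_props(1)[OF h_closed[OF v L]] 1 K])
qed

text \<open>The value \<open>T X\<close> as a functor on the one-object category of endomorphisms of
  the power set of \<open>X\<close>.\<close>

definition V :: "('u fincat, ('u set, 'u set \<times> 'u set, 'r) biset_arrow, 'r, 'm) modfun" where
  "V = \<lparr>fob = (\<lambda>_. N), far = (\<lambda>_ _ K v. h v K)\<rparr>"

lemma V_simps: "fob V x = N" "far V x y K v = h v K"
  by (simp_all add: V_def)

lemma V_functor: "linear_module_functor R BP V"
proof (intro linear_module_functor.intro linear_module_functor_axioms.intro module_functor.intro; unfold V_simps)
  show "module R N" by (rule N)
next
  fix x y f assume "x \<in> Ob BP" "y \<in> Ob BP" "f \<in> Arr BP x y"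
  then have f: "f \<in> carrier E" by (auto simp: biset_category_simps)
  show "(\<lambda>v. h v f) \<in> linear_maps R N N" by (rule h_linear[OF f])
next
  fix x v assume x: "x \<in> Ob BP" and v: "v \<in> carrier N"
  then have "ident BP x = ta X X (crel X X (Id_on X))" using id_arrow[OF X] by simp
  moreover have "\<tau> (crel X X (Id_on X)) v = v"
    using T.F.far_ident[OF T.X v] by (subst \<tau>_crel) auto
  ultimately show "h v (ident BP x) = v" by (simp add: h_props(2)[OF v good_crel])
next
  fix x y z f g v assume "x \<in> Ob BP" "y \<in> Ob BP" "z \<in> Ob BP"
    "f \<in> Arr BP x y" "g \<in> Arr BP y z" and v: "v \<in> carrier N"
  then show "h v (cmp BP x y z g f) = h (h v f) g"
    using h_comp[OF v, of g f] by (simp add: biset_category_simps)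
next
  fix x y f g v assume "x \<in> Ob BP" "y \<in> Ob BP"
    "f \<in> Arr BP x y" "g \<in> Arr BP x y" and v: "v \<in> carrier N"
  then show "h v (f \<oplus>\<^bsub>ArrM BP x y\<^esub> g) = h v f \<oplus>\<^bsub>N\<^esub> h v g"
    using linear_mapsD(2)[OF h_props(1)[OF v], of f g] by (simp add: biset_category_simps)
next
  fix x y r f v assume "x \<in> Ob BP" "y \<in> Ob BP" "r \<in> carrier R"
    "f \<in> Arr BP x y" and v: "v \<in> carrier N"
  then show "h v (r \<odot>\<^bsub>ArrM BP x y\<^esub> f) = r \<odot>\<^bsub>N\<^esub> h v f"
    using linear_mapsD(3)[OF h_props(1)[OF v], of r f] by (simp add: biset_category_simps)
qed

text \<open>Correspondences are among the acting arrows, so an invariant submodule is invariant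
  under correspondences, and \<open>T\<close> restricted to \<open>X\<close> is simple.\<close>

lemma V_simple: "simple_functor R BP V"
proof -
  note simple = T.simple_restrict[OF T T_nonzero]
  have "(\<forall>x\<in>Ob BP. Q x = {\<zero>\<^bsub>fob V x\<^esub>}) \<or> (\<forall>x\<in>Ob BP. Q x = carrier (fob V x))"
    if Q: "subfunctor R BP V Q" for Q
  proof -
    have sub: "submodule (Q P) R N" using Q pow_Ob[OF X] by (simp add: subfunctor_def V_simps)
    have st: "h v K \<in> Q P" if "K \<in> carrier E" "v \<in> Q P" for K v
    proof -
      have "far V P P K ` Q P \<subseteq> Q P" using Q pow_Ob[OF X] that(1) by (simp add: subfunctor_def biset_category_simps)
      then show ?thesis using that(2) by (auto simp: V_simps)
    qed
    have "far T X X U v \<in> Q P" if U: "U \<subseteq> X \<times> X" and v: "v \<in> Q P" for U v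
      using st[OF ta_closed[OF X X good_crel] v] h_props(2)[OF submoduleD(1)[OF sub v] good_crel] \<tau>_crel[OF U] by metis
    then have "subfunctor R (full_subcat corresp {X}) T (\<lambda>_. Q P)"
      using sub by (auto simp: subfunctor_def)
    from simple_functorD(2)[OF simple this] X show ?thesis by (auto simp: V_simps)
  qed
  moreover have "\<exists>x\<in>Ob BP. \<not> vanishes_at V x"
    using T_nonzero pow_Ob[OF X] by (simp add: vanishes_at_def V_simps)
  ultimately show ?thesis using V_functor by (simp add: simple_functor_def linear_module_functor_def)
qed

text \<open>Surjectivity of the mapping: the simple biset functor extending \<open>V\<close> has
  \<open>T X\<close> as its value at the power set of \<open>X\<close> and vanishes at power sets of
  smaller sets, so its factor at \<open>X\<close> is \<open>T\<close>.\<close>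

lemma exists_biset_functor:
  fixes e :: "(nat \<Rightarrow> 'r) \<Rightarrow> 'm"
  assumes e: "inj e"
  shows "\<exists>S :: ('u, 'r, 'm) biset_functor. linear_module_functor R BB S \<and> simple_functor R BB S \<and>
    smallest_set_of_biset_functor S X \<and> factor_at R X S T"
proof -
  from simple_biset_functor_exists[OF e pow_cat_finite[OF X] pows[OF X] V_functor V_simple]
  obtain S :: "('u, 'r, 'm) biset_functor" where S: "simple_functor R BB S" "linear_module_functor R BB S"
    and iso: "modfun_iso R BP S V" and sim: "modfun_iso R BB (sim R BB P V) S" by blast
  note Sf = simple_functorD(1)[OF S(1)]
  note o = pow_Ob[OF X]
  interpret B: linear_cat R BB by (rule BB_linear)
  interpret VV: linear_value_at R BB P V
    by (intro linear_value_at.intro linear_value_at_axioms.intro BB_linear V_functor o)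
  have nz: "\<not> vanishes_at S P"
    using modfun_iso_vanishes[OF iso full_subcat_functor[OF Sf] simple_functorD(1)[OF V_simple], of P] o T_nonzero
    by (simp add: vanishes_at_def V_simps)
  have "vanishes_at S (pow_cat Y)" if Y: "finite Y" "card Y < card X" for Y
  proof -
    note oY = pow_Ob[OF Y(1)]
    have "vanishes_at VV.S (pow_cat Y)"
    proof (rule VV.S_vanishes[OF oY])
      fix a b v assume "a \<in> Arr BB P (pow_cat Y)" "b \<in> Arr BB (pow_cat Y) P" and "v \<in> carrier (fob V P)"
      then have a: "a \<in> carrier (MM (pow_cat Y) P)" and b: "b \<in> carrier (MM P (pow_cat Y))" and v: "v \<in> carrier N"
        by (simp_all add: BB_Arr V_simps biset_category_simps)
      interpret N: module R N by (rule N)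
      let ?c = "cmp (biset_category R) P (pow_cat Y) P"
      have left: "(\<lambda>b. ?c b a) \<in> linear_maps R (MM P (pow_cat Y)) E" if "a \<in> carrier (MM (pow_cat Y) P)" for a
        using B.cmp_linear_left[OF o oY o, of a] that by (simp add: biset_category_simps)
      have right: "?c b \<in> linear_maps R (MM (pow_cat Y) P) E" if "b \<in> carrier (MM P (pow_cat Y))" for b
        using B.cmp_linear_right[OF o oY o, of b] that by (simp add: biset_category_simps)
      have 0: "(\<lambda>_. \<zero>\<^bsub>N\<^esub>) \<in> linear_maps R M' N" for M' :: "('r, 'x) module" by (rule linear_mapsI) simp_all
      \<comment> \<open>A round trip through the power set of a smaller \<open>Y\<close> is a
        combination of composites of relations through \<open>Y\<close>, and each of these acts as
        zero.\<close>
      have 1: "h v (?c (ta X Y p) a) = \<zero>\<^bsub>N\<^esub>" if p: "good X Y p" for p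
      proof (rule pow_agree[OF Y(1) X N linear_maps_comp[OF right[OF ta_closed[OF X Y(1) p]] h_props(1)[OF v]] 0 _ a])
        fix q assume q: "good Y X q"
        have "Y \<noteq> X" "card Y \<le> card X" using Y(2) by auto
        then show "h v (?c (ta X Y p) (ta Y X q)) = \<zero>\<^bsub>N\<^esub>"
          unfolding ta_comp[OF X Y(1) X p q] h_props(2)[OF v good_relcomp[OF p q]]
          using full_comp_small[OF Y(1) p q v] Y(2) by simp
      qed
      have "h v (?c b a) = \<zero>\<^bsub>N\<^esub>"
        by (rule pow_agree[OF X Y(1) N linear_maps_comp[OF left[OF a] h_props(1)[OF v]] 0 1 b])
      then show "far V P P (cmp BB P (pow_cat Y) P b a) v = \<zero>\<^bsub>fob V P\<^esub>" by (simp add: V_simps)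
    qed
    then show ?thesis using modfun_iso_vanishes[OF sim VV.S_functor Sf oY] by simp
  qed
  then have sm: "smallest_set_of_biset_functor S X" using X nz by (simp add: smallest_set_of_biset_functor_def)
  from iso obtain \<eta> where "modfun_iso_by R BP S V \<eta>" by (rule modfun_isoE)
  note \<eta> = modfun_iso_byD[OF this]
  have oP: "P \<in> Ob BP" using o by simp
  have "modfun_iso R (full_subcat corresp {X}) (hat R S) T"
  proof (rule modfun_isoI[where \<eta> = "\<lambda>_. \<eta> P"])
    fix x assume "x \<in> Ob (full_subcat corresp {X})"
    then have x: "x = X" by simp
    show "\<eta> P \<in> linear_maps R (fob (hat R S) x) (fob T x)" "bij_betw (\<eta> P) (carrier (fob (hat R S) x)) (carrier (fob T x))"
      using \<eta>(1,2)[OF oP] by (simp_all add: x hat_fob V_simps)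
  next
    fix x y U a assume "x \<in> Ob (full_subcat corresp {X})" "y \<in> Ob (full_subcat corresp {X})"
      "U \<in> Arr (full_subcat corresp {X}) x y" "a \<in> carrier (fob (hat R S) x)"
    then have x: "x = X" "y = X" and U: "U \<subseteq> X \<times> X" and a: "a \<in> carrier (fob S P)" by (auto simp: hat_fob)
    have a': "\<eta> P a \<in> carrier N" using linear_mapsD(1)[OF \<eta>(1)[OF oP] a] by (simp add: V_simps)
    have "ta X X (crel X X U) \<in> Arr BP P P" using ta_Arr[OF X X good_crel] by simp
    from \<eta>(3)[OF oP oP this a] show "\<eta> P (far (hat R S) x y U a) = far T x y U (\<eta> P a)"
      by (simp add: x hat_far[OF X X] V_simps h_props(2)[OF a' good_crel] \<tau>_crel[OF U])
  qed
  then have "factor_at R X S T" using factor_at_iff[OF S(2,1) sm] T s by blast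
  then show ?thesis using S sm by blast
qed

end

subsection \<open>The bijection\<close>

text \<open>\<open>rel\<close> need not be single-valued; \<open>compat\<close> says it is so up to
  equivalence and reflects equivalence, and \<open>closed\<close> makes the set of partners of a
  class a whole class.\<close>

lemma quotient_bij:
  assumes r: "equiv A r" and s: "equiv B s"
    and dom: "\<And>x y. \<lbrakk>x \<in> A; rel x y\<rbrakk> \<Longrightarrow> y \<in> B" and total: "\<And>x. x \<in> A \<Longrightarrow> \<exists>y. rel x y"
    and surj: "\<And>y. y \<in> B \<Longrightarrow> \<exists>x\<in>A. rel x y"
    and compat: "\<And>x x' y y'. \<lbrakk>x \<in> A; x' \<in> A; rel x y; rel x' y'\<rbrakk> \<Longrightarrow> (x, x') \<in> r \<longleftrightarrow> (y, y') \<in> s"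
    and closed: "\<And>x y y'. \<lbrakk>x \<in> A; rel x y; (y, y') \<in> s\<rbrakk> \<Longrightarrow> rel x y'"
  shows "bij_betw (\<lambda>c. {y. \<exists>x\<in>c. rel x y}) (A // r) (B // s)"
proof -
  have eq: "{y. \<exists>x\<in>r `` {x0}. rel x y} = s `` {y0}" if x0: "x0 \<in> A" "rel x0 y0" for x0 y0
  proof (intro equalityI subsetI)
    fix y assume "y \<in> {y. \<exists>x\<in>r `` {x0}. rel x y}"
    then obtain x where x: "(x0, x) \<in> r" "rel x y" by blast
    then have "x \<in> A" using r by (auto simp: equiv_def)
    then show "y \<in> s `` {y0}" using compat[OF x0(1) _ x0(2) x(2)] x(1) by blast
  next
    fix y assume "y \<in> s `` {y0}"
    then have "rel x0 y" using closed[OF x0] by blast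
    moreover have "x0 \<in> r `` {x0}" using equiv_class_self[OF r x0(1)] .
    ultimately show "y \<in> {y. \<exists>x\<in>r `` {x0}. rel x y}" by blast
  qed
  show ?thesis unfolding bij_betw_def
  proof
    show "inj_on (\<lambda>c. {y. \<exists>x\<in>c. rel x y}) (A // r)"
    proof (rule inj_onI)
      fix c c' assume "c \<in> A // r" "c' \<in> A // r" and e: "{y. \<exists>x\<in>c. rel x y} = {y. \<exists>x\<in>c'. rel x y}"
      then obtain x x' where x: "x \<in> A" "c = r `` {x}" "x' \<in> A" "c' = r `` {x'}" by (auto elim!: quotientE)
      obtain y where y: "rel x y" using total[OF x(1)] by blast
      obtain y' where y': "rel x' y'" using total[OF x(3)] by blast
      have "s `` {y} = s `` {y'}" using e eq[OF x(1) y] eq[OF x(3) y'] x by simp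
      then have "(y, y') \<in> s" using eq_equiv_class_iff[OF s dom[OF x(1) y] dom[OF x(3) y']] by simp
      then have "(x, x') \<in> r" using compat[OF x(1,3) y y'] by simp
      then show "c = c'" using equiv_class_eq[OF r] x by simp
    qed
    show "(\<lambda>c. {y. \<exists>x\<in>c. rel x y}) ` (A // r) = B // s"
    proof (intro equalityI subsetI)
      fix d assume "d \<in> (\<lambda>c. {y. \<exists>x\<in>c. rel x y}) ` (A // r)"
      then obtain x where x: "x \<in> A" "d = {y. \<exists>x\<in>r `` {x}. rel x y}" by (auto elim!: quotientE)
      obtain y where y: "rel x y" using total[OF x(1)] by blast
      show "d \<in> B // s" using eq[OF x(1) y] x(2) quotientI[OF dom[OF x(1) y], of s] by simp
    next
      fix d assume "d \<in> B // s"
      then obtain y where y: "y \<in> B" "d = s `` {y}" by (auto elim!: quotientE)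
      obtain x where x: "x \<in> A" "rel x y" using surj[OF y(1)] by blast
      show "d \<in> (\<lambda>c. {y. \<exists>x\<in>c. rel x y}) ` (A // r)"
        by (rule rev_image_eqI[OF quotientI[OF x(1)]]) (simp only: eq[OF x] y(2))
    qed
  qed
qed

lemma iso_types_equiv:
  assumes "\<And>F. F \<in> \<F> \<Longrightarrow> module_functor R C F"
  shows "equiv \<F> {(F, G). F \<in> \<F> \<and> G \<in> \<F> \<and> modfun_iso R C F G}"
proof (rule equivI)
  show "sym {(F, G). F \<in> \<F> \<and> G \<in> \<F> \<and> modfun_iso R C F G}"
    using assms modfun_iso_sym by (intro symI) blast
  show "trans {(F, G). F \<in> \<F> \<and> G \<in> \<F> \<and> modfun_iso R C F G}"
  proof (rule transI)
    fix F G H assume "(F, G) \<in> {(F, G). F \<in> \<F> \<and> G \<in> \<F> \<and> modfun_iso R C F G}"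
      "(G, H) \<in> {(F, G). F \<in> \<F> \<and> G \<in> \<F> \<and> modfun_iso R C F G}"
    then show "(F, H) \<in> {(F, G). F \<in> \<F> \<and> G \<in> \<F> \<and> modfun_iso R C F G}"
      using modfun_iso_trans[of R C F G H] by simp
  qed
qed (auto simp: refl_on_def modfun_iso_refl)

context biset_subcat
begin

context
  fixes e :: "(nat \<Rightarrow> 'r) \<Rightarrow> 'm"
  assumes e: "inj e"
begin

abbreviation simple_S :: "('u, 'r, 'm) biset_functor \<Rightarrow> bool" where
  "simple_S S \<equiv> simple_biset_functor R BB S"

section \<open>The correspondence between simple functors and its invariance under
  isomorphism\<close>

lemma factor_unique:
  fixes T T' :: "('u, 'r, 'm) corresp_functor"
  assumes S: "simple_S S" "smallest_set_of_biset_functor S X" and T: "factor_at R X S T" "factor_at R X S T'"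
  shows "modfun_iso R corresp T T'"
proof -
  have S': "linear_module_functor R BB S" "simple_functor R BB S" using S(1) by (simp_all add: simple_biset_functor_def)
  note f = factor_at_iff[OF S' S(2)]
  have t: "simple_functor R corresp T" "modfun_iso R (full_subcat corresp {X}) (hat R S) T" using T(1) f by blast+
  have t': "simple_functor R corresp T'" "smallest_set_of_corresp_functor T' X"
    "modfun_iso R (full_subcat corresp {X}) (hat R S) T'" using T(2) f by blast+
  have X: "X \<in> Ob corresp" "\<not> vanishes_at T' X" using t'(2) by (simp_all add: smallest_set_of_corresp_functor_def)
  note H = full_subcat_functor[OF hat_functor[OF simple_functorD(1)[OF S'(2)]]]
  show ?thesis
    by (rule simple_functor_isoI[OF corresp_category t(1) t'(1) X modfun_iso_trans[OF modfun_iso_sym[OF t(2) H] t'(3)]])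
qed

text \<open>A smallest set is determined only up to its cardinality, so the choices made for two
  functors must be aligned before their values are compared.\<close>

lemma smallest_transfer:
  assumes S: "simple_S S" "smallest_set_of_biset_functor S X" and X': "finite X'" "card X' = card X"
  shows "smallest_set_of_biset_functor S X'"
proof -
  have "module_functor R BB S" using S(1) by (simp add: simple_biset_functor_def simple_functorD(1))
  from smallest_set_card[OF hat_functor[OF this] _ X'] S(2) show ?thesis by (simp only: smallest_set_hat[of S _ R])
qed

lemma factor_transfer:
  assumes S: "simple_S S" and sm: "smallest_set_of_biset_functor S X" "smallest_set_of_biset_functor S X'"
    and f: "factor_at R X S T"
  shows "factor_at R X' S T"
proof -
  have T: "smallest_set_of_corresp_functor T X" "module_functor R corresp T" using f
    by (simp_all add: factor_at_def simple_composition_factor_def simple_functor_def)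
  have "card X = card X'" using smallest_sets_card sm by (simp add: smallest_set_hat[of S _ R])
  moreover have "finite X'" using sm(2) by (simp add: smallest_set_of_biset_functor_def)
  ultimately show ?thesis using f smallest_set_card[OF T(2,1)] by (simp add: factor_at_def)
qed

definition corresponds :: "('u, 'r, 'm) biset_functor \<Rightarrow> ('u, 'r, 'm) corresp_functor \<Rightarrow> bool" where
  "corresponds S T \<longleftrightarrow> (\<exists>X. smallest_set_of_biset_functor S X \<and> factor_at R X S T)"

text \<open>Through \<open>factor_at_iff\<close> both isomorphism questions reduce to comparing
  values at one common smallest set; a simple functor is then recovered from that value.\<close>

lemma corresponds_compat:
  assumes S: "simple_S S" "simple_S S'" and c: "corresponds S T" "corresponds S' T'"
  shows "modfun_iso R BB S S' \<longleftrightarrow> modfun_iso R corresp T T'"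
proof -
  have SS: "linear_module_functor R BB S" "simple_functor R BB S" using S(1) by (simp_all add: simple_biset_functor_def)
  have SS': "linear_module_functor R BB S'" "simple_functor R BB S'" using S(2) by (simp_all add: simple_biset_functor_def)
  note Sf = simple_functorD(1)[OF SS(2)] and Sf' = simple_functorD(1)[OF SS'(2)]
  obtain X where X: "smallest_set_of_biset_functor S X" "factor_at R X S T" using c(1) by (auto simp: corresponds_def)
  obtain X' where X': "smallest_set_of_biset_functor S' X'" "factor_at R X' S' T'" using c(2) by (auto simp: corresponds_def)
  have fX: "finite X" "finite X'" using X(1) X'(1) by (simp_all add: smallest_set_of_biset_functor_def)
  note f = factor_at_iff[OF SS X(1), THEN iffD1, OF X(2)] and f' = factor_at_iff[OF SS' X'(1), THEN iffD1, OF X'(2)]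
  note Tf = simple_functorD(1)[OF f[THEN conjunct1]] and Tf' = simple_functorD(1)[OF f'[THEN conjunct1]]
  show ?thesis
  proof
    assume iso: "modfun_iso R BB S S'"
    have van: "vanishes_at S (pow_cat Y) \<longleftrightarrow> vanishes_at S' (pow_cat Y)" if "finite Y" for Y
      by (rule modfun_iso_vanishes[OF iso Sf Sf' pow_Ob[OF that]])
    \<comment> \<open>Isomorphic functors vanish at the same power sets, so the set chosen for
      \<open>S\<close> also works for \<open>S'\<close>.\<close>
    then have sm: "smallest_set_of_biset_functor S' X" using X(1) by (auto simp: smallest_set_of_biset_functor_def)
    note g = factor_at_iff[OF SS' sm, THEN iffD1, OF factor_transfer[OF S(2) X'(1) sm X'(2)]]
    have "modfun_iso R (full_subcat corresp {X}) T (hat R S)"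
      by (rule modfun_iso_sym[OF _ full_subcat_functor[OF hat_functor[OF Sf]]]) (use f in blast)
    moreover have "modfun_iso R (full_subcat corresp {X}) (hat R S) (hat R S')"
      by (rule hat_iso[OF modfun_iso_subcat[OF iso] fX(1)])
    ultimately have "modfun_iso R (full_subcat corresp {X}) T (hat R S')" by (rule modfun_iso_trans)
    moreover have "modfun_iso R (full_subcat corresp {X}) (hat R S') T'" using g by blast
    ultimately have "modfun_iso R (full_subcat corresp {X}) T T'" by (rule modfun_iso_trans)
    moreover have "X \<in> Ob corresp" "\<not> vanishes_at T' X" using g fX by (auto simp: smallest_set_of_corresp_functor_def)
    ultimately show "modfun_iso R corresp T T'"
      using simple_functor_isoI[OF corresp_category f[THEN conjunct1] f'[THEN conjunct1]] by blast
  next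
    assume iso: "modfun_iso R corresp T T'"
    \<comment> \<open>Here alignment goes through the factors: \<open>T\<close> and
      \<open>T'\<close> have smallest sets of the same cardinality, so \<open>X'\<close> can be used
      for \<open>S\<close> as well.\<close>
    have "smallest_set_of_corresp_functor T' X" using smallest_set_iso[OF iso Tf Tf'] f by blast
    then have card: "card X' = card X" using smallest_sets_card f' by blast
    have sm: "smallest_set_of_biset_functor S X'" by (rule smallest_transfer[OF S(1) X(1) fX(2) card])
    note g = factor_at_iff[OF SS sm, THEN iffD1, OF factor_transfer[OF S(1) X(1) sm X(2)]]
    have "modfun_iso R (full_subcat corresp {X'}) (hat R S) T" using g by blast
    moreover have "modfun_iso R (full_subcat corresp {X'}) T T'" by (rule modfun_iso_subcat[OF iso])
    ultimately have "modfun_iso R (full_subcat corresp {X'}) (hat R S) T'" by (rule modfun_iso_trans)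
    moreover have "modfun_iso R (full_subcat corresp {X'}) T' (hat R S')"
      by (rule modfun_iso_sym[OF _ full_subcat_functor[OF hat_functor[OF Sf']]]) (use f' in blast)
    ultimately have "modfun_iso R (full_subcat corresp {X'}) (hat R S) (hat R S')" by (rule modfun_iso_trans)
    from hat_iso_D[OF this SS(1) sm SS'(1) X'(1)]
    have "modfun_iso R (full_subcat BB {pow_cat X'}) S S'" .
    moreover have "\<not> vanishes_at S' (pow_cat X')" using X'(1) by (simp add: smallest_set_of_biset_functor_def)
    ultimately show "modfun_iso R BB S S'"
      using simple_functor_isoI[OF BB_category SS(2) SS'(2) pow_Ob[OF fX(2)]] by blast
  qed
qed

lemma corresponds_closed:
  assumes S: "simple_S S" and c: "corresponds S T" and iso: "modfun_iso R corresp T T'" and T': "simple_functor R corresp T'"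
  shows "corresponds S T'"
proof -
  have SS: "linear_module_functor R BB S" "simple_functor R BB S" using S by (simp_all add: simple_biset_functor_def)
  obtain X where X: "smallest_set_of_biset_functor S X" "factor_at R X S T" using c by (auto simp: corresponds_def)
  note f = factor_at_iff[OF SS X(1), THEN iffD1, OF X(2)]
  have "smallest_set_of_corresp_functor T' X"
    by (rule smallest_set_iso[OF iso simple_functorD(1) simple_functorD(1)[OF T']]) (use f in blast)+
  moreover have "modfun_iso R (full_subcat corresp {X}) (hat R S) T'"
    by (rule modfun_iso_trans[OF _ modfun_iso_subcat[OF iso]]) (use f in blast)
  ultimately have "factor_at R X S T'" using factor_at_iff[OF SS X(1)] T' by blast
  then show ?thesis using X(1) by (auto simp: corresponds_def)
qed

text \<open>Totality is \<open>factor_exists\<close>, surjectivity is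
  \<open>exists_biset_functor\<close>, and \<open>corresponds_compat\<close> gives both
  well-definedness and injectivity.\<close>

lemma corresponding_types_bij:
  "bij_betw (corresponding_types R)
     (iso_types R BB {S :: ('u, 'r, 'm) biset_functor. simple_S S \<and> (\<exists>X. finite X \<and> \<not> vanishes_at S (pow_cat X))})
     (iso_types R corresp {T :: ('u, 'r, 'm) corresp_functor. simple_functor R corresp T})"
proof -
  let ?A = "{S :: ('u, 'r, 'm) biset_functor. simple_S S \<and> (\<exists>X. finite X \<and> \<not> vanishes_at S (pow_cat X))}"
  let ?B = "{T :: ('u, 'r, 'm) corresp_functor. simple_functor R corresp T}"
  have SS: "linear_module_functor R BB S" "simple_functor R BB S" if "simple_S S" for S
    using that by (simp_all add: simple_biset_functor_def)
  have ct: "corresponding_types R = (\<lambda>c. {T. \<exists>S\<in>c. corresponds S T})"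
    by (intro ext) (simp add: corresponding_types_def corresponds_def)
  show ?thesis unfolding iso_types_def ct
  proof (rule quotient_bij)
    show "equiv ?A {(F, G). F \<in> ?A \<and> G \<in> ?A \<and> modfun_iso R BB F G}"
      by (rule iso_types_equiv) (use simple_functorD(1)[OF SS(2)] in blast)
    show "equiv ?B {(F, G). F \<in> ?B \<and> G \<in> ?B \<and> modfun_iso R corresp F G}"
      by (rule iso_types_equiv) (use simple_functorD(1) in blast)
  next
    fix S T assume "corresponds S T"
    then show "T \<in> ?B" by (auto simp: corresponds_def factor_at_def simple_composition_factor_def)
  next
    fix S assume "S \<in> ?A"
    then obtain Y where S: "simple_S S" and Y: "finite Y" "\<not> vanishes_at S (pow_cat Y)" by blast
    have "\<not> vanishes_at (hat R S) Y" using Y(2) by (simp add: vanishes_at_def hat_fob)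
    then obtain X where "smallest_set_of_corresp_functor (hat R S) X" using smallest_set_exists[OF Y(1)] by blast
    then have X: "smallest_set_of_biset_functor S X" by (simp add: smallest_set_hat[of S X R])
    then show "\<exists>T. corresponds S T" using factor_exists[OF e SS[OF S] X] unfolding corresponds_def by blast
  next
    fix T :: "('u, 'r, 'm) corresp_functor" assume "T \<in> ?B"
    then have T: "simple_functor R corresp T" by simp
    then obtain Y where "finite Y" "\<not> vanishes_at T Y" by (auto simp: simple_functor_def)
    then obtain X where X: "smallest_set_of_corresp_functor T X" using smallest_set_exists by blast
    interpret A: biset_action_subcat R T X \<O>
      by (intro biset_action_subcat.intro biset_action.intro biset_action_axioms.intro biset_module_locale_axioms
          biset_subcat_axioms T X)
    from A.exists_biset_functor[OF e] obtain S :: "('u, 'r, 'm) biset_functor" where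
      S: "linear_module_functor R BB S" "simple_functor R BB S" "smallest_set_of_biset_functor S X" "factor_at R X S T" by blast
    have "S \<in> ?A" using S(1-3) by (auto simp: simple_biset_functor_def smallest_set_of_biset_functor_def)
    moreover have "corresponds S T" using S(3,4) by (auto simp: corresponds_def)
    ultimately show "\<exists>S\<in>?A. corresponds S T" by blast
  next
    fix S S' T T' assume a: "S \<in> ?A" "S' \<in> ?A" "corresponds S T" "corresponds S' T'"
    have "T \<in> ?B" "T' \<in> ?B" using a(3,4) by (auto simp: corresponds_def factor_at_def simple_composition_factor_def)
    then show "(S, S') \<in> {(F, G). F \<in> ?A \<and> G \<in> ?A \<and> modfun_iso R BB F G} \<longleftrightarrow>
        (T, T') \<in> {(F, G). F \<in> ?B \<and> G \<in> ?B \<and> modfun_iso R corresp F G}"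
      using a corresponds_compat[of S S' T T'] by simp
  next
    fix S T T' assume "S \<in> ?A" "corresponds S T" "(T, T') \<in> {(F, G). F \<in> ?B \<and> G \<in> ?B \<and> modfun_iso R corresp F G}"
    then show "corresponds S T'" using corresponds_closed[of S T T'] by simp
  qed
qed

lemma subcat_statement:
  "(\<forall>(S :: ('u, 'r, 'm) biset_functor) X. simple_biset_functor R BB S \<and> smallest_set_of_biset_functor S X \<longrightarrow>
      (\<exists>T :: ('u, 'r, 'm) corresp_functor. factor_at R X S T \<and>
         (\<forall>T' :: ('u, 'r, 'm) corresp_functor. factor_at R X S T' \<longrightarrow> modfun_iso R corresp T' T))) \<and>
   bij_betw (corresponding_types R)
     (iso_types R BB {S :: ('u, 'r, 'm) biset_functor. simple_biset_functor R BB S \<and> (\<exists>X. finite X \<and> \<not> vanishes_at S (pow_cat X))})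
     (iso_types R corresp {T :: ('u, 'r, 'm) corresp_functor. simple_functor R corresp T})"
proof (intro conjI allI impI corresponding_types_bij)
  fix S :: "('u, 'r, 'm) biset_functor" and X
  assume a: "simple_biset_functor R BB S \<and> smallest_set_of_biset_functor S X"
  then obtain T :: "('u, 'r, 'm) corresp_functor" where T: "factor_at R X S T"
    using factor_exists[OF e, of S X] by (auto simp: simple_biset_functor_def)
  have "modfun_iso R corresp T' T" if "factor_at R X S T'" for T' :: "('u, 'r, 'm) corresp_functor"
    using factor_unique[of S X T' T] a that T by simp
  then show "\<exists>T :: ('u, 'r, 'm) corresp_functor. factor_at R X S T \<and>
      (\<forall>T' :: ('u, 'r, 'm) corresp_functor. factor_at R X S T' \<longrightarrow> modfun_iso R corresp T' T)" using T by blast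
qed

end

end

theorem corollary8p16:
  fixes R :: "'r ring" and e :: "(nat \<Rightarrow> 'r) \<Rightarrow> 'm"
  assumes "field R"
    and "infinite (UNIV :: 'u set)"
    and "inj e"
  shows "\<forall>\<B> \<in> {biset_category R, poset_biset_category R}.
     (\<forall>(S :: ('u, 'r, 'm) biset_functor) X.
        simple_biset_functor R \<B> S \<and> smallest_set_of_biset_functor S X \<longrightarrow>
        (\<exists>T :: ('u, 'r, 'm) corresp_functor. factor_at R X S T \<and>
           (\<forall>T' :: ('u, 'r, 'm) corresp_functor. factor_at R X S T' \<longrightarrow> modfun_iso R corresp T' T))) \<and>
     bij_betw (corresponding_types R)
       (iso_types R \<B> {S :: ('u, 'r, 'm) biset_functor. simple_biset_functor R \<B> S \<and>
          (\<exists>X. finite X \<and> \<not> vanishes_at S (pow_cat X))})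
       (iso_types R corresp {T :: ('u, 'r, 'm) corresp_functor. simple_functor R corresp T})"
proof -
  \<comment> \<open>Restricting to all objects changes nothing, so the whole biset category is an
    instance of the same statement.\<close>
  have UN: "full_subcat (biset_category R) UNIV = (biset_category R :: ('u fincat, _, _) linear_category)"
    by (simp add: full_subcat_def)
  have "biset_subcat R (UNIV :: 'u fincat set)" "biset_subcat R (pow_cat ` {X :: 'u set. finite X})"
    by (intro biset_subcat.intro biset_module_locale.intro biset_subcat_axioms.intro assms(1); simp)+
  from this[THEN biset_subcat.subcat_statement, OF assms(3)] show ?thesis
    unfolding UN poset_biset_category_def[symmetric] by simp
qed

end
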